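(* Let $\mathcal V$ be a lextensive category such that $-\cdot 1\colon\mathsf{Set}\to\mathcal V$ is fully faithful, and let $T=(T,m,e)$ be a cartesian monad on $\mathcal V$ such that the natural transformation $\hat\varepsilon_{T(-\cdot 1)}\colon\mathcal V(1,T(-\cdot1))\cdot 1\to T(-\cdot 1)$ of functors $\mathsf{Set}\to\mathcal V$ is cartesian. If $\hat\varepsilon_{T1}\colon\mathcal V(1,T1)\cdot1\to T1$ is a monomorphism, then the functor $-\cdot1\colon(\overline T,\mathcal V)\text{-}\mathsf{Cat}\to\mathsf{Cat}(T,\mathcal V)$ reflects effective descent morphisms: if $(f,\phi)\cdot 1$ is an effective descent morphism in $\mathsf{Cat}(T,\mathcal V)$, then $(f,\phi)$ is an effective descent morphism in $(\overline T,\mathcal V)\text{-}\mathsf{Cat}$.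
   Context: Lextensive: finite limits, and (small) coproducts which are disjoint and universal. $X\cdot1$ is the coproduct of $X$ copies of the terminal object $1$; $-\cdot1$ is left adjoint to $\mathcal V(1,-)$ with counit $\hat\varepsilon_Z\colon\mathcal V(1,Z)\cdot1\to Z$. A natural transformation is cartesian if its naturality squares are pullbacks; a monad is cartesian if $T$ preserves pullbacks and $m,e$ are cartesian. Internal $T$-categories: a $T$-category $x$ has objects $x_0,x_1$ and morphisms $d_1\colon x_1\to Tx_0$, $d_0\colon x_1\to x_0$, $s_0\colon x_0\to x_1$, $c\colon x_2\to x_1$, where $x_2$ is the pullback of $d_1$ and $Td_0\colon Tx_1\to Tx_0$ (projections $\pi_0\colon x_2\to x_1$, $\pi_2\colon x_2\to Tx_1$) and $x_3$ is the pullback of $\pi_2$ and $T\pi_0\colon Tx_2\to Tx_1$ (projections $\rho_0\colon x_3\to x_2$, $\rho_3\colon x_3\to Tx_2$), such that $d_0s_0=\mathrm{id}$, $d_1s_0=e$, $d_0c=d_0\pi_0$, $d_1c=m\circ Td_1\circ\pi_2$, $c(s_0d_0,e_{x_1})=\mathrm{id}=c(\mathrm{id},Ts_0\circ d_1)$, $c(\pi_0\rho_0,Tc\circ\rho_3)=c(c\rho_0,m\circ T\pi_2\circ\rho_3)$. Functors are pairs $(p_0,p_1)$ commuting with this structure. They form $\mathsf{Cat}(T,\mathcal V)$. $\mathcal V$-matrices: a $\mathcal V$-matrix $r\colon X\to Y$ between sets is a family $(r(x,y))_{x\in X,y\in Y}$ of objects of $\mathcal V$; $(s\cdot r)(x,z)=\sum_y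 s(y,z)\times r(x,y)$; $1_X(x,x')$ is terminal if $x=x'$ and initial otherwise. Put $M_r=\sum_{x,y}r(x,y)$, with its canonical maps to $X\cdot1$ and $Y\cdot1$. The monad $\overline T$: on sets, $\overline TX=\mathcal V(1,T(X\cdot1))$, with $\overline e(x)=e_{X\cdot 1}\circ x$ and $\overline m(\mathfrak x)=m_{X\cdot1}\circ T\hat\varepsilon_{T(X\cdot1)}\circ\mathfrak x$. On matrices, $(\overline Tr)(\mathfrak x,\mathfrak y)$ is the pullback of $TM_r\to T(X\cdot1)\times T(Y\cdot1)$ along $(\mathfrak x,\mathfrak y)\colon1\to T(X\cdot1)\times T(Y\cdot1)$. A family $\theta_{x,y}\colon r(x,y)\to r'(gx,hy)$ induces $M_r\to M_{r'}$, hence by applying $T$ and restricting to fibres a family $\overline T\theta$. Structure maps: $\mathsf e\colon1\to(\overline T1_X)(\mathfrak x,\mathfrak x)$ given by $\mathfrak x$ (as $M_{1_X}\cong X\cdot1$); $\mathsf m\colon(\overline Ts)(\mathfrak y,\mathfrak z)\times(\overline Tr)(\mathfrak x,\mathfrak y)\to(\overline T(s\cdot r))(\mathfrak x,\mathfrak z)$ induced by $TM_s\times_{T(Y\cdot1)}TM_r\cong T(M_s\times_{Y\cdot1}M_r)\cong TM_{s\cdot r}$; $\overline e_r\colon r(x,y)\to(\overline Tr)(\overline ex,\overline ey)$ induced by $e_{M_r}$; $\overline m_r\colon(\overline T\,\overline Tr)(\mathfrak x,\mathfrak y)\to(\overline Tr)(\overline m\mathfrak x,\overline m\mathfrak y)$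 induced by $TM_{\overline Tr}\to TTM_r\to TM_r$, i.e. $T$ of the canonical map $M_{\overline Tr}\to TM_r$ followed by $m_{M_r}$. Enriched $(\overline T,\mathcal V)$-categories: a quadruple $(X,a,\upsilon,\mu)$ with $X$ a set, $a\colon\overline TX\to X$ a $\mathcal V$-matrix, morphisms $\upsilon_x\colon1\to a(\overline e(x),x)$, and morphisms $\mu\colon a(x_1,x_0)\times(\overline Ta)(x_2,x_1)\to a(\overline m(x_2),x_0)$ for $x_i\in\overline T^iX$, such that $\mu\circ(\mathrm{id}\times(\overline T\upsilon\circ\mathsf e))=\mathrm{id}$ and $\mu\circ(\upsilon_{x_0}\times\overline e_a)=\mathrm{id}$ on $a(x_1,x_0)$, and $\mu\circ(\mathrm{id}\times(\overline T\mu\circ\mathsf m))=\mu\circ(\mu\times\overline m_a)$ on $a(x_1,x_0)\times(\overline Ta)(x_2,x_1)\times(\overline T\,\overline Ta)(x_3,x_2)$. A functor $(f,\phi)\colon(X,a,\upsilon,\mu)\to(Y,b,\upsilon,\mu)$ is a function $f\colon X\to Y$ with morphisms $\phi\colon a(x_1,x_0)\to b((\overline Tf)x_1,fx_0)$ compatible with $\upsilon$ and $\mu$. These form $(\overline T,\mathcal V)\text{-}\mathsf{Cat}$. The functor $-\cdot1$: $(X,a,\upsilon,\mu)\cdot1$ is the internal $T$-category with object of objects $X\cdot1$, object of arrows $M_a=\sum a(x_1,x_0)$, $d_0\colon M_a\to X\cdot1$ the projection, $d_1$ the composite $M_a\to\overline TX\cdot1\xrightarrow{\hat\varepsilon_{T(X\cdot1)}}T(X\cdot1)$,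 identities and composition induced on coproducts by $\upsilon$ and $\mu$ (under the cartesianness hypothesis, the object of 2-chains is $\sum_{x_i\in\overline T^iX}a(x_1,x_0)\times(\overline Ta)(x_2,x_1)$). $(f,\phi)\cdot1$ is $f\cdot1$ on objects and is induced by $\phi$ on arrows. Under the stated hypotheses this is a fully faithful functor. Effective descent: for a category $\mathcal A$ with pullbacks and $q\colon e\to b$, let $q^*\colon\mathcal A/b\to\mathcal A/e$ be the pullback functor, $q_!\dashv q^*$, $T^q$ the induced monad; $q$ is an effective descent morphism if the Eilenberg–Moore comparison $\mathcal A/b\to T^q\text{-}\mathsf{Alg}$ is an equivalence. *)

theory Defs
  imports Main "HOL-Library.FuncSet"
begin

section \<open>Categories, functors and natural transformations\<close>

record ('o, 'a) cat =
  Obj :: "'o set"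
  Arr :: "'a set"
  Dom :: "'a \<Rightarrow> 'o"
  Cod :: "'a \<Rightarrow> 'o"
  Ident :: "'o \<Rightarrow> 'a"
  Comp :: "'a \<Rightarrow> 'a \<Rightarrow> 'a" (infixl "\<cdot>\<index>" 70)

definition hom :: "('o, 'a) cat \<Rightarrow> 'o \<Rightarrow> 'o \<Rightarrow> 'a set" where
  "hom C A B = {f \<in> Arr C. Dom C f = A \<and> Cod C f = B}"

locale category =
  fixes C :: "('o, 'a) cat" (structure)
  assumes Dom_in_Obj: "f \<in> Arr C \<Longrightarrow> Dom C f \<in> Obj C"
    and Cod_in_Obj: "f \<in> Arr C \<Longrightarrow> Cod C f \<in> Obj C"
    and Ident_in_hom: "A \<in> Obj C \<Longrightarrow> Ident C A \<in> hom C A A"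
    and Comp_in_hom: "\<lbrakk>f \<in> hom C A B; g \<in> hom C B D\<rbrakk> \<Longrightarrow> g \<cdot> f \<in> hom C A D"
    and Comp_Ident: "f \<in> hom C A B \<Longrightarrow> f \<cdot> Ident C A = f"
    and Ident_Comp: "f \<in> hom C A B \<Longrightarrow> Ident C B \<cdot> f = f"
    and Comp_assoc: "\<lbrakk>f \<in> hom C A B; g \<in> hom C B D; h \<in> hom C D E\<rbrakk>
      \<Longrightarrow> h \<cdot> (g \<cdot> f) = (h \<cdot> g) \<cdot> f"

definition is_mono :: "('o, 'a) cat \<Rightarrow> 'a \<Rightarrow> bool" where
  "is_mono C f \<longleftrightarrow> f \<in> Arr C \<and>
    (\<forall>Z\<in>Obj C. \<forall>g\<in>hom C Z (Dom C f). \<forall>h\<in>hom C Z (Dom C f).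
      f \<cdot>\<^bsub>C\<^esub> g = f \<cdot>\<^bsub>C\<^esub> h \<longrightarrow> g = h)"

definition inverse_arrows :: "('o, 'a) cat \<Rightarrow> 'a \<Rightarrow> 'a \<Rightarrow> bool" where
  "inverse_arrows C f g \<longleftrightarrow> f \<in> Arr C \<and> g \<in> hom C (Cod C f) (Dom C f) \<and>
    g \<cdot>\<^bsub>C\<^esub> f = Ident C (Dom C f) \<and> f \<cdot>\<^bsub>C\<^esub> g = Ident C (Cod C f)"

definition is_iso :: "('o, 'a) cat \<Rightarrow> 'a \<Rightarrow> bool" where
  "is_iso C f \<longleftrightarrow> (\<exists>g. inverse_arrows C f g)"

definition inv_arrow :: "('o, 'a) cat \<Rightarrow> 'a \<Rightarrow> 'a" where
  "inv_arrow C f = (THE g. inverse_arrows C f g)"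

record ('o, 'a, 'p, 'b) ftor =
  FO :: "'o \<Rightarrow> 'p"
  FA :: "'a \<Rightarrow> 'b"

definition is_functor ::
  "('o, 'a) cat \<Rightarrow> ('p, 'b) cat \<Rightarrow> ('o, 'a, 'p, 'b, 'm) ftor_scheme \<Rightarrow> bool" where
  "is_functor C D F \<longleftrightarrow>
    (\<forall>A\<in>Obj C. FO F A \<in> Obj D) \<and>
    (\<forall>f\<in>Arr C. FA F f \<in> hom D (FO F (Dom C f)) (FO F (Cod C f))) \<and>
    (\<forall>A\<in>Obj C. FA F (Ident C A) = Ident D (FO F A)) \<and>
    (\<forall>f\<in>Arr C. \<forall>g\<in>Arr C. Cod C f = Dom C g \<longrightarrow>
      FA F (g \<cdot>\<^bsub>C\<^esub> f) = FA F g \<cdot>\<^bsub>D\<^esub> FA F f)"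

definition id_functor :: "('o, 'a, 'o, 'a) ftor" where
  "id_functor = \<lparr>FO = (\<lambda>A. A), FA = (\<lambda>f. f)\<rparr>"

definition comp_functor ::
  "('p, 'b, 'q, 'c, 'm) ftor_scheme \<Rightarrow> ('o, 'a, 'p, 'b, 'n) ftor_scheme \<Rightarrow> ('o, 'a, 'q, 'c) ftor"
  where
  "comp_functor G F = \<lparr>FO = (\<lambda>A. FO G (FO F A)), FA = (\<lambda>f. FA G (FA F f))\<rparr>"

definition fully_faithful ::
  "('o, 'a) cat \<Rightarrow> ('p, 'b) cat \<Rightarrow> ('o, 'a, 'p, 'b, 'm) ftor_scheme \<Rightarrow> bool" where
  "fully_faithful C D F \<longleftrightarrow> is_functor C D F \<and>
    (\<forall>A\<in>Obj C. \<forall>B\<in>Obj C. bij_betw (FA F) (hom C A B) (hom D (FO F A) (FO F B)))"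

definition is_nat_trans ::
  "('o, 'a) cat \<Rightarrow> ('p, 'b) cat \<Rightarrow> ('o, 'a, 'p, 'b, 'm) ftor_scheme \<Rightarrow>
    ('o, 'a, 'p, 'b, 'n) ftor_scheme \<Rightarrow> ('o \<Rightarrow> 'b) \<Rightarrow> bool" where
  "is_nat_trans C D F G \<alpha> \<longleftrightarrow>
    (\<forall>A\<in>Obj C. \<alpha> A \<in> hom D (FO F A) (FO G A)) \<and>
    (\<forall>f\<in>Arr C. \<alpha> (Cod C f) \<cdot>\<^bsub>D\<^esub> FA F f = FA G f \<cdot>\<^bsub>D\<^esub> \<alpha> (Dom C f))"

definition is_nat_iso ::
  "('o, 'a) cat \<Rightarrow> ('p, 'b) cat \<Rightarrow> ('o, 'a, 'p, 'b, 'm) ftor_scheme \<Rightarrow>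
    ('o, 'a, 'p, 'b, 'n) ftor_scheme \<Rightarrow> ('o \<Rightarrow> 'b) \<Rightarrow> bool" where
  "is_nat_iso C D F G \<alpha> \<longleftrightarrow> is_nat_trans C D F G \<alpha> \<and> (\<forall>A\<in>Obj C. is_iso D (\<alpha> A))"

definition is_equivalence ::
  "('o, 'a) cat \<Rightarrow> ('p, 'b) cat \<Rightarrow> ('o, 'a, 'p, 'b) ftor \<Rightarrow> bool" where
  "is_equivalence C D F \<longleftrightarrow> is_functor C D F \<and>
    (\<exists>G :: ('p, 'b, 'o, 'a) ftor. \<exists>\<alpha> \<beta>. is_functor D C G \<and>
      is_nat_iso C C id_functor (comp_functor G F) \<alpha> \<and>
      is_nat_iso D D (comp_functor F G) id_functor \<beta>)"


section \<open>Limits and coproducts\<close>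

definition is_terminal :: "('o, 'a) cat \<Rightarrow> 'o \<Rightarrow> bool" where
  "is_terminal C t \<longleftrightarrow> t \<in> Obj C \<and> (\<forall>A\<in>Obj C. \<exists>!u. u \<in> hom C A t)"

definition is_initial :: "('o, 'a) cat \<Rightarrow> 'o \<Rightarrow> bool" where
  "is_initial C z \<longleftrightarrow> z \<in> Obj C \<and> (\<forall>A\<in>Obj C. \<exists>!u. u \<in> hom C z A)"

definition is_product :: "('o, 'a) cat \<Rightarrow> 'o \<Rightarrow> 'o \<Rightarrow> 'a \<Rightarrow> 'a \<Rightarrow> bool" where
  "is_product C A B p q \<longleftrightarrow>
    p \<in> Arr C \<and> q \<in> Arr C \<and> Dom C p = Dom C q \<and> Cod C p = A \<and> Cod C q = B \<and>
    (\<forall>Z\<in>Obj C. \<forall>f\<in>hom C Z A. \<forall>g\<in>hom C Z B.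
      \<exists>!u. u \<in> hom C Z (Dom C p) \<and> p \<cdot>\<^bsub>C\<^esub> u = f \<and> q \<cdot>\<^bsub>C\<^esub> u = g)"

text \<open>\<open>p\<close> and \<open>q\<close> are the projections onto the domains of \<open>f\<close> and \<open>g\<close>, respectively.\<close>

definition is_pullback :: "('o, 'a) cat \<Rightarrow> 'a \<Rightarrow> 'a \<Rightarrow> 'a \<Rightarrow> 'a \<Rightarrow> bool" where
  "is_pullback C f g p q \<longleftrightarrow>
    f \<in> Arr C \<and> g \<in> Arr C \<and> Cod C f = Cod C g \<and>
    p \<in> Arr C \<and> q \<in> Arr C \<and> Dom C p = Dom C q \<and> Cod C p = Dom C f \<and> Cod C q = Dom C g \<and>
    f \<cdot>\<^bsub>C\<^esub> p = g \<cdot>\<^bsub>C\<^esub> q \<and>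
    (\<forall>Z\<in>Obj C. \<forall>h\<in>hom C Z (Dom C f). \<forall>k\<in>hom C Z (Dom C g). f \<cdot>\<^bsub>C\<^esub> h = g \<cdot>\<^bsub>C\<^esub> k \<longrightarrow>
      (\<exists>!u. u \<in> hom C Z (Dom C p) \<and> p \<cdot>\<^bsub>C\<^esub> u = h \<and> q \<cdot>\<^bsub>C\<^esub> u = k))"

definition has_pullbacks :: "('o, 'a) cat \<Rightarrow> bool" where
  "has_pullbacks C \<longleftrightarrow>
    (\<forall>f\<in>Arr C. \<forall>g\<in>Arr C. Cod C f = Cod C g \<longrightarrow> (\<exists>p q. is_pullback C f g p q))"

text \<open>A diagram is given by a set \<open>I\<close> of nodes labelled by objects \<open>D i\<close> and a set \<open>E\<close> of edges
  \<open>(i, f, j)\<close> labelled by arrows \<open>f : D i \<rightarrow> D j\<close>.\<close>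

definition is_diagram ::
  "('o, 'a) cat \<Rightarrow> 'i set \<Rightarrow> ('i \<Rightarrow> 'o) \<Rightarrow> ('i \<times> 'a \<times> 'i) set \<Rightarrow> bool" where
  "is_diagram C I D E \<longleftrightarrow> (\<forall>i\<in>I. D i \<in> Obj C) \<and>
    (\<forall>(i, f, j)\<in>E. i \<in> I \<and> j \<in> I \<and> f \<in> hom C (D i) (D j))"

definition is_cone ::
  "('o, 'a) cat \<Rightarrow> 'i set \<Rightarrow> ('i \<Rightarrow> 'o) \<Rightarrow> ('i \<times> 'a \<times> 'i) set \<Rightarrow> 'o \<Rightarrow> ('i \<Rightarrow> 'a) \<Rightarrow> bool" where
  "is_cone C I D E L p \<longleftrightarrow> L \<in> Obj C \<and> (\<forall>i\<in>I. p i \<in> hom C L (D i)) \<and>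
    (\<forall>(i, f, j)\<in>E. f \<cdot>\<^bsub>C\<^esub> p i = p j)"

definition is_limit ::
  "('o, 'a) cat \<Rightarrow> 'i set \<Rightarrow> ('i \<Rightarrow> 'o) \<Rightarrow> ('i \<times> 'a \<times> 'i) set \<Rightarrow> 'o \<Rightarrow> ('i \<Rightarrow> 'a) \<Rightarrow> bool" where
  "is_limit C I D E L p \<longleftrightarrow> is_cone C I D E L p \<and>
    (\<forall>Z q. is_cone C I D E Z q \<longrightarrow> (\<exists>!u. u \<in> hom C Z L \<and> (\<forall>i\<in>I. p i \<cdot>\<^bsub>C\<^esub> u = q i)))"

definition has_finite_limits :: "('o, 'a) cat \<Rightarrow> bool" where
  "has_finite_limits C \<longleftrightarrow>
    (\<forall>(I :: nat set) D E. finite I \<and> finite E \<and> is_diagram C I D E \<longrightarrow>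
      (\<exists>L p. is_limit C I D E L p))"

definition is_coproduct ::
  "('o, 'a) cat \<Rightarrow> 'i set \<Rightarrow> ('i \<Rightarrow> 'o) \<Rightarrow> 'o \<Rightarrow> ('i \<Rightarrow> 'a) \<Rightarrow> bool" where
  "is_coproduct C I A P \<iota> \<longleftrightarrow> P \<in> Obj C \<and> (\<forall>i\<in>I. \<iota> i \<in> hom C (A i) P) \<and>
    (\<forall>Z\<in>Obj C. \<forall>g. (\<forall>i\<in>I. g i \<in> hom C (A i) Z) \<longrightarrow>
      (\<exists>!u. u \<in> hom C P Z \<and> (\<forall>i\<in>I. u \<cdot>\<^bsub>C\<^esub> \<iota> i = g i)))"

text \<open>Chosen limits and coproducts, and the arrows induced by their universal properties.\<close>

definition one :: "('o, 'a) cat \<Rightarrow> 'o" where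
  "one C = (SOME t. is_terminal C t)"

definition bang :: "('o, 'a) cat \<Rightarrow> 'o \<Rightarrow> 'a" where
  "bang C A = (THE u. u \<in> hom C A (one C))"

definition zero :: "('o, 'a) cat \<Rightarrow> 'o" where
  "zero C = (SOME z. is_initial C z)"

definition cobang :: "('o, 'a) cat \<Rightarrow> 'o \<Rightarrow> 'a" where
  "cobang C A = (THE u. u \<in> hom C (zero C) A)"

definition prod_cone :: "('o, 'a) cat \<Rightarrow> 'o \<Rightarrow> 'o \<Rightarrow> 'a \<times> 'a" where
  "prod_cone C A B = (SOME (p, q). is_product C A B p q)"

definition prod_fst :: "('o, 'a) cat \<Rightarrow> 'o \<Rightarrow> 'o \<Rightarrow> 'a" where
  "prod_fst C A B = fst (prod_cone C A B)"

definition prod_snd :: "('o, 'a) cat \<Rightarrow> 'o \<Rightarrow> 'o \<Rightarrow> 'a" where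
  "prod_snd C A B = snd (prod_cone C A B)"

definition prod_ob :: "('o, 'a) cat \<Rightarrow> 'o \<Rightarrow> 'o \<Rightarrow> 'o" where
  "prod_ob C A B = Dom C (prod_fst C A B)"

definition pairing :: "('o, 'a) cat \<Rightarrow> 'a \<Rightarrow> 'a \<Rightarrow> 'a" where
  "pairing C f g = (THE u. u \<in> hom C (Dom C f) (prod_ob C (Cod C f) (Cod C g)) \<and>
    prod_fst C (Cod C f) (Cod C g) \<cdot>\<^bsub>C\<^esub> u = f \<and> prod_snd C (Cod C f) (Cod C g) \<cdot>\<^bsub>C\<^esub> u = g)"

definition pb_cone :: "('o, 'a) cat \<Rightarrow> 'a \<Rightarrow> 'a \<Rightarrow> 'a \<times> 'a" where
  "pb_cone C f g = (SOME (p, q). is_pullback C f g p q)"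

definition pb_fst :: "('o, 'a) cat \<Rightarrow> 'a \<Rightarrow> 'a \<Rightarrow> 'a" where
  "pb_fst C f g = fst (pb_cone C f g)"

definition pb_snd :: "('o, 'a) cat \<Rightarrow> 'a \<Rightarrow> 'a \<Rightarrow> 'a" where
  "pb_snd C f g = snd (pb_cone C f g)"

definition pb_ob :: "('o, 'a) cat \<Rightarrow> 'a \<Rightarrow> 'a \<Rightarrow> 'o" where
  "pb_ob C f g = Dom C (pb_fst C f g)"

definition pb_lift :: "('o, 'a) cat \<Rightarrow> 'a \<Rightarrow> 'a \<Rightarrow> 'a \<Rightarrow> 'a \<Rightarrow> 'a" where
  "pb_lift C f g h k = (THE u. u \<in> hom C (Dom C h) (pb_ob C f g) \<and>
    pb_fst C f g \<cdot>\<^bsub>C\<^esub> u = h \<and> pb_snd C f g \<cdot>\<^bsub>C\<^esub> u = k)"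

definition coprod_cocone :: "('o, 'a) cat \<Rightarrow> 'i set \<Rightarrow> ('i \<Rightarrow> 'o) \<Rightarrow> 'o \<times> ('i \<Rightarrow> 'a)" where
  "coprod_cocone C I A = (SOME (P, \<iota>). is_coproduct C I A P \<iota>)"

definition coprod_ob :: "('o, 'a) cat \<Rightarrow> 'i set \<Rightarrow> ('i \<Rightarrow> 'o) \<Rightarrow> 'o" where
  "coprod_ob C I A = fst (coprod_cocone C I A)"

definition coprod_in :: "('o, 'a) cat \<Rightarrow> 'i set \<Rightarrow> ('i \<Rightarrow> 'o) \<Rightarrow> 'i \<Rightarrow> 'a" where
  "coprod_in C I A = snd (coprod_cocone C I A)"

definition copair :: "('o, 'a) cat \<Rightarrow> 'i set \<Rightarrow> ('i \<Rightarrow> 'o) \<Rightarrow> 'o \<Rightarrow> ('i \<Rightarrow> 'a) \<Rightarrow> 'a" where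
  "copair C I A Z g = (THE u. u \<in> hom C (coprod_ob C I A) Z \<and>
    (\<forall>i\<in>I. u \<cdot>\<^bsub>C\<^esub> coprod_in C I A i = g i))"


section \<open>Monads, algebras and effective descent\<close>

record ('o, 'a) monad = "('o, 'a, 'o, 'a) ftor" +
  Unit :: "'o \<Rightarrow> 'a"
  Mult :: "'o \<Rightarrow> 'a"

definition is_monad :: "('o, 'a) cat \<Rightarrow> ('o, 'a) monad \<Rightarrow> bool" where
  "is_monad C T \<longleftrightarrow> is_functor C C T \<and>
    is_nat_trans C C id_functor (comp_functor T id_functor) (Unit T) \<and>
    is_nat_trans C C (comp_functor T T) (comp_functor T id_functor) (Mult T) \<and>
    (\<forall>A\<in>Obj C.
      Mult T A \<cdot>\<^bsub>C\<^esub> Unit T (FO T A) = Ident C (FO T A) \<and>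
      Mult T A \<cdot>\<^bsub>C\<^esub> FA T (Unit T A) = Ident C (FO T A) \<and>
      Mult T A \<cdot>\<^bsub>C\<^esub> Mult T (FO T A) = Mult T A \<cdot>\<^bsub>C\<^esub> FA T (Mult T A))"

definition preserves_pullbacks ::
  "('o, 'a) cat \<Rightarrow> ('p, 'b) cat \<Rightarrow> ('o, 'a, 'p, 'b, 'm) ftor_scheme \<Rightarrow> bool" where
  "preserves_pullbacks C D F \<longleftrightarrow>
    (\<forall>f g p q. is_pullback C f g p q \<longrightarrow> is_pullback D (FA F f) (FA F g) (FA F p) (FA F q))"

definition is_cartesian_trans ::
  "('o, 'a) cat \<Rightarrow> ('p, 'b) cat \<Rightarrow> ('o, 'a, 'p, 'b, 'm) ftor_scheme \<Rightarrow>
    ('o, 'a, 'p, 'b, 'n) ftor_scheme \<Rightarrow> ('o \<Rightarrow> 'b) \<Rightarrow> bool" where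
  "is_cartesian_trans C D F G \<alpha> \<longleftrightarrow> is_nat_trans C D F G \<alpha> \<and>
    (\<forall>f\<in>Arr C. is_pullback D (\<alpha> (Cod C f)) (FA G f) (FA F f) (\<alpha> (Dom C f)))"

definition is_cartesian_monad :: "('o, 'a) cat \<Rightarrow> ('o, 'a) monad \<Rightarrow> bool" where
  "is_cartesian_monad C T \<longleftrightarrow> is_monad C T \<and> preserves_pullbacks C C T \<and>
    is_cartesian_trans C C id_functor (comp_functor T id_functor) (Unit T) \<and>
    is_cartesian_trans C C (comp_functor T T) (comp_functor T id_functor) (Mult T)"

definition EM_algebras :: "('o, 'a) cat \<Rightarrow> ('o, 'a) monad \<Rightarrow> ('o \<times> 'a) set" where
  "EM_algebras C T = {(A, h). A \<in> Obj C \<and> h \<in> hom C (FO T A) A \<and>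
    h \<cdot>\<^bsub>C\<^esub> Unit T A = Ident C A \<and> h \<cdot>\<^bsub>C\<^esub> FA T h = h \<cdot>\<^bsub>C\<^esub> Mult T A}"

definition EM :: "('o, 'a) cat \<Rightarrow> ('o, 'a) monad \<Rightarrow> ('o \<times> 'a, ('o \<times> 'a) \<times> 'a \<times> ('o \<times> 'a)) cat"
  where
  "EM C T = \<lparr>
    Obj = EM_algebras C T,
    Arr = {((A, h), f, (B, k)). (A, h) \<in> EM_algebras C T \<and> (B, k) \<in> EM_algebras C T \<and>
      f \<in> hom C A B \<and> f \<cdot>\<^bsub>C\<^esub> h = k \<cdot>\<^bsub>C\<^esub> FA T f},
    Dom = (\<lambda>(x, f, y). x),
    Cod = (\<lambda>(x, f, y). y),
    Ident = (\<lambda>(A, h). ((A, h), Ident C A, (A, h))),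
    Comp = (\<lambda>(y', g, z) (x, f, y). (x, g \<cdot>\<^bsub>C\<^esub> f, z))\<rparr>"

text \<open>The monad on \<open>A\<close> induced by an adjunction \<open>F \<stileturn> G\<close>, where \<open>F\<close> goes from \<open>A\<close> to \<open>B\<close>,
  with unit \<open>\<eta>\<close> and counit \<open>\<epsilon>\<close>, and the comparison functor from \<open>B\<close> to its algebras.\<close>

definition adj_monad ::
  "('o, 'a, 'p, 'b) ftor \<Rightarrow> ('p, 'b, 'o, 'a) ftor \<Rightarrow> ('o \<Rightarrow> 'a) \<Rightarrow> ('p \<Rightarrow> 'b) \<Rightarrow> ('o, 'a) monad"
  where
  "adj_monad F G \<eta> \<epsilon> = \<lparr>
    FO = (\<lambda>A. FO G (FO F A)),
    FA = (\<lambda>f. FA G (FA F f)),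
    Unit = \<eta>,
    Mult = (\<lambda>A. FA G (\<epsilon> (FO F A)))\<rparr>"

definition EM_comparison ::
  "('p, 'b) cat \<Rightarrow> ('p, 'b, 'o, 'a) ftor \<Rightarrow> ('p \<Rightarrow> 'b) \<Rightarrow>
    ('p, 'b, 'o \<times> 'a, ('o \<times> 'a) \<times> 'a \<times> ('o \<times> 'a)) ftor" where
  "EM_comparison B G \<epsilon> = \<lparr>
    FO = (\<lambda>X. (FO G X, FA G (\<epsilon> X))),
    FA = (\<lambda>f. ((FO G (Dom B f), FA G (\<epsilon> (Dom B f))), FA G f,
               (FO G (Cod B f), FA G (\<epsilon> (Cod B f)))))\<rparr>"

definition slice :: "('o, 'a) cat \<Rightarrow> 'o \<Rightarrow> ('a, 'a \<times> 'a \<times> 'a) cat" where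
  "slice C b = \<lparr>
    Obj = {f \<in> Arr C. Cod C f = b},
    Arr = {(f, h, g). f \<in> Arr C \<and> Cod C f = b \<and> g \<in> Arr C \<and> Cod C g = b \<and>
      h \<in> hom C (Dom C f) (Dom C g) \<and> g \<cdot>\<^bsub>C\<^esub> h = f},
    Dom = (\<lambda>(f, h, g). f),
    Cod = (\<lambda>(f, h, g). g),
    Ident = (\<lambda>f. (f, Ident C (Dom C f), f)),
    Comp = (\<lambda>(g', k, l) (f, h, g). (f, k \<cdot>\<^bsub>C\<^esub> h, l))\<rparr>"

definition push_functor :: "('o, 'a) cat \<Rightarrow> 'a \<Rightarrow> ('a, 'a \<times> 'a \<times> 'a, 'a, 'a \<times> 'a \<times> 'a) ftor" where
  "push_functor C q = \<lparr>
    FO = (\<lambda>f. q \<cdot>\<^bsub>C\<^esub> f),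
    FA = (\<lambda>(f, h, g). (q \<cdot>\<^bsub>C\<^esub> f, h, q \<cdot>\<^bsub>C\<^esub> g))\<rparr>"

definition pull_functor :: "('o, 'a) cat \<Rightarrow> 'a \<Rightarrow> ('a, 'a \<times> 'a \<times> 'a, 'a, 'a \<times> 'a \<times> 'a) ftor" where
  "pull_functor C q = \<lparr>
    FO = (\<lambda>f. pb_fst C q f),
    FA = (\<lambda>(f, h, g).
      (pb_fst C q f, pb_lift C q g (pb_fst C q f) (h \<cdot>\<^bsub>C\<^esub> pb_snd C q f), pb_fst C q g))\<rparr>"

definition pull_unit :: "('o, 'a) cat \<Rightarrow> 'a \<Rightarrow> 'a \<Rightarrow> 'a \<times> 'a \<times> 'a" where
  "pull_unit C q f =
    (f, pb_lift C q (q \<cdot>\<^bsub>C\<^esub> f) f (Ident C (Dom C f)), pb_fst C q (q \<cdot>\<^bsub>C\<^esub> f))"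

definition pull_counit :: "('o, 'a) cat \<Rightarrow> 'a \<Rightarrow> 'a \<Rightarrow> 'a \<times> 'a \<times> 'a" where
  "pull_counit C q f = (q \<cdot>\<^bsub>C\<^esub> pb_fst C q f, pb_snd C q f, f)"

definition descent_monad :: "('o, 'a) cat \<Rightarrow> 'a \<Rightarrow> ('a, 'a \<times> 'a \<times> 'a) monad" where
  "descent_monad C q =
    adj_monad (push_functor C q) (pull_functor C q) (pull_unit C q) (pull_counit C q)"

definition effective_descent :: "('o, 'a) cat \<Rightarrow> 'a \<Rightarrow> bool" where
  "effective_descent C q \<longleftrightarrow> has_pullbacks C \<and> q \<in> Arr C \<and>
    is_equivalence (slice C (Cod C q)) (EM (slice C (Dom C q)) (descent_monad C q))
      (EM_comparison (slice C (Cod C q)) (pull_functor C q) (pull_counit C q))"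


section \<open>Sets, smallness and lextensive categories\<close>

text \<open>The type \<open>'u\<close> plays the role of the universe of all individuals, its sets are the classes,
  and \<open>small\<close> singles out those classes that are sets. The power set axiom has to be stated up to
  a bijection. Infinity is not imposed, so the finite sets are also admitted.\<close>

locale set_universe =
  fixes small :: "'u set \<Rightarrow> bool"
  assumes small_empty: "small {}"
    and small_subset: "\<lbrakk>small A; B \<subseteq> A\<rbrakk> \<Longrightarrow> small B"
    and small_image: "small A \<Longrightarrow> small (f ` A)"
    and small_UN: "\<lbrakk>small I; \<And>i. i \<in> I \<Longrightarrow> small (F i)\<rbrakk> \<Longrightarrow> small (\<Union>i\<in>I. F i)"
    and small_Pow: "small A \<Longrightarrow> \<exists>g. inj_on g (Pow A) \<and> small (g ` Pow A)"

definition Sets :: "('u set \<Rightarrow> bool) \<Rightarrow> ('u set, 'u set \<times> ('u \<Rightarrow> 'u) \<times> 'u set) cat" where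
  "Sets small = \<lparr>
    Obj = {X. small X},
    Arr = {(X, f, Y). small X \<and> small Y \<and> f \<in> X \<rightarrow>\<^sub>E Y},
    Dom = (\<lambda>(X, f, Y). X),
    Cod = (\<lambda>(X, f, Y). Y),
    Ident = (\<lambda>X. (X, \<lambda>x\<in>X. x, X)),
    Comp = (\<lambda>(Y', g, Z) (X, f, Y). (X, compose X g f, Z))\<rparr>"

text \<open>Arrows of the category are individuals of the universe, so its hom-sets are literally
  objects of \<open>Sets small\<close>.\<close>

definition locally_small :: "('u set \<Rightarrow> bool) \<Rightarrow> ('o, 'u) cat \<Rightarrow> bool" where
  "locally_small small C \<longleftrightarrow> (\<forall>A\<in>Obj C. \<forall>B\<in>Obj C. small (hom C A B))"

definition disjoint_coproduct :: "('o, 'a) cat \<Rightarrow> 'i set \<Rightarrow> ('i \<Rightarrow> 'a) \<Rightarrow> bool" where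
  "disjoint_coproduct C I \<iota> \<longleftrightarrow> (\<forall>i\<in>I. is_mono C (\<iota> i)) \<and>
    (\<forall>i\<in>I. \<forall>j\<in>I. i \<noteq> j \<longrightarrow>
      (\<forall>p q. is_pullback C (\<iota> i) (\<iota> j) p q \<longrightarrow> is_initial C (Dom C p)))"

definition universal_coproduct :: "('o, 'a) cat \<Rightarrow> 'i set \<Rightarrow> 'o \<Rightarrow> ('i \<Rightarrow> 'a) \<Rightarrow> bool" where
  "universal_coproduct C I P \<iota> \<longleftrightarrow>
    (\<forall>f\<in>Arr C. Cod C f = P \<longrightarrow>
      (\<forall>p q. (\<forall>i\<in>I. is_pullback C f (\<iota> i) (p i) (q i)) \<longrightarrow>
        is_coproduct C I (\<lambda>i. Dom C (p i)) (Dom C f) p))"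

definition lextensive :: "('u set \<Rightarrow> bool) \<Rightarrow> ('o, 'a) cat \<Rightarrow> bool" where
  "lextensive small C \<longleftrightarrow> has_finite_limits C \<and>
    (\<forall>(I :: 'u set) A. small I \<and> (\<forall>i\<in>I. A i \<in> Obj C) \<longrightarrow>
      (\<exists>P \<iota>. is_coproduct C I A P \<iota>) \<and>
      (\<forall>P \<iota>. is_coproduct C I A P \<iota> \<longrightarrow>
        disjoint_coproduct C I \<iota> \<and> universal_coproduct C I P \<iota>))"

text \<open>The copower \<open>X \<cdot> 1\<close>, its points, its action on functions, and the counit
  \<open>V(1, Z) \<cdot> 1 \<rightarrow> Z\<close>.\<close>

definition copow :: "('o, 'a) cat \<Rightarrow> 'i set \<Rightarrow> 'o" where
  "copow C X = coprod_ob C X (\<lambda>_. one C)"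

definition pt :: "('o, 'a) cat \<Rightarrow> 'i set \<Rightarrow> 'i \<Rightarrow> 'a" where
  "pt C X x = coprod_in C X (\<lambda>_. one C) x"

definition copow_map :: "('o, 'a) cat \<Rightarrow> 'i set \<Rightarrow> ('i \<Rightarrow> 'j) \<Rightarrow> 'j set \<Rightarrow> 'a" where
  "copow_map C X f Y = copair C X (\<lambda>_. one C) (copow C Y) (\<lambda>x. pt C Y (f x))"

definition copow_functor ::
  "('o, 'a) cat \<Rightarrow> ('u set, 'u set \<times> ('u \<Rightarrow> 'u) \<times> 'u set, 'o, 'a) ftor" where
  "copow_functor C = \<lparr>FO = copow C, FA = (\<lambda>(X, f, Y). copow_map C X f Y)\<rparr>"

definition eps_hat :: "('o, 'a) cat \<Rightarrow> 'o \<Rightarrow> 'a" where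
  "eps_hat C Z = copair C (hom C (one C) Z) (\<lambda>_. one C) Z (\<lambda>z. z)"


section \<open>Data of internal categories, matrices and enriched categories\<close>

record ('o, 'a) icat =
  I0 :: 'o
  I1 :: 'o
  D1 :: 'a
  D0 :: 'a
  S0 :: 'a
  Cm :: 'a

text \<open>An arrow of \<open>Cat(T, V)\<close> is a quadruple of its domain, the two components, and its codomain.\<close>

type_synonym ('o, 'a) ifun = "('o, 'a) icat \<times> 'a \<times> 'a \<times> ('o, 'a) icat"

record ('o, 'u) vmat =
  src :: "'u set"
  tgt :: "'u set"
  ent :: "'u \<times> 'u \<Rightarrow> 'o"

text \<open>In \<open>Mu\<close>, the index is the triple \<open>(x\<^sub>2, x\<^sub>1, x\<^sub>0)\<close>.\<close>

record ('o, 'u) tvcat =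
  Car :: "'u set"
  Mat :: "('o, 'u) vmat"
  Ups :: "'u \<Rightarrow> 'u"
  Mu :: "'u \<times> 'u \<times> 'u \<Rightarrow> 'u"

type_synonym ('o, 'u) tvfun =
  "('o, 'u) tvcat \<times> ('u \<Rightarrow> 'u) \<times> ('u \<times> 'u \<Rightarrow> 'u) \<times> ('o, 'u) tvcat"

locale monad_setting =
  fixes V :: "('o, 'u) cat" (structure)
    and T :: "('o, 'u) monad"
begin

section \<open>Internal T-categories\<close>

definition chain_fst :: "('o, 'u) icat \<Rightarrow> 'u" where
  "chain_fst x = pb_fst V (D1 x) (FA T (D0 x))"

definition chain_snd :: "('o, 'u) icat \<Rightarrow> 'u" where
  "chain_snd x = pb_snd V (D1 x) (FA T (D0 x))"

definition chain_ob :: "('o, 'u) icat \<Rightarrow> 'o" where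
  "chain_ob x = pb_ob V (D1 x) (FA T (D0 x))"

definition chain_lift :: "('o, 'u) icat \<Rightarrow> 'u \<Rightarrow> 'u \<Rightarrow> 'u" where
  "chain_lift x f g = pb_lift V (D1 x) (FA T (D0 x)) f g"

definition chain3_fst :: "('o, 'u) icat \<Rightarrow> 'u" where
  "chain3_fst x = pb_fst V (chain_snd x) (FA T (chain_fst x))"

definition chain3_snd :: "('o, 'u) icat \<Rightarrow> 'u" where
  "chain3_snd x = pb_snd V (chain_snd x) (FA T (chain_fst x))"

definition is_icat :: "('o, 'u) icat \<Rightarrow> bool" where
  "is_icat x \<longleftrightarrow>
    I0 x \<in> Obj V \<and> I1 x \<in> Obj V \<and>
    D1 x \<in> hom V (I1 x) (FO T (I0 x)) \<and>
    D0 x \<in> hom V (I1 x) (I0 x) \<and>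
    S0 x \<in> hom V (I0 x) (I1 x) \<and>
    Cm x \<in> hom V (chain_ob x) (I1 x) \<and>
    D0 x \<cdot> S0 x = Ident V (I0 x) \<and>
    D1 x \<cdot> S0 x = Unit T (I0 x) \<and>
    D0 x \<cdot> Cm x = D0 x \<cdot> chain_fst x \<and>
    D1 x \<cdot> Cm x = Mult T (I0 x) \<cdot> (FA T (D1 x) \<cdot> chain_snd x) \<and>
    Cm x \<cdot> chain_lift x (S0 x \<cdot> D0 x) (Unit T (I1 x)) = Ident V (I1 x) \<and>
    Cm x \<cdot> chain_lift x (Ident V (I1 x)) (FA T (S0 x) \<cdot> D1 x) = Ident V (I1 x) \<and>
    Cm x \<cdot> chain_lift x (chain_fst x \<cdot> chain3_fst x) (FA T (Cm x) \<cdot> chain3_snd x) =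
    Cm x \<cdot> chain_lift x (Cm x \<cdot> chain3_fst x)
      (Mult T (I1 x) \<cdot> (FA T (chain_snd x) \<cdot> chain3_snd x))"

definition is_ifun :: "('o, 'u) ifun \<Rightarrow> bool" where
  "is_ifun = (\<lambda>(x, p0, p1, y). is_icat x \<and> is_icat y \<and>
    p0 \<in> hom V (I0 x) (I0 y) \<and> p1 \<in> hom V (I1 x) (I1 y) \<and>
    D1 y \<cdot> p1 = FA T p0 \<cdot> D1 x \<and>
    D0 y \<cdot> p1 = p0 \<cdot> D0 x \<and>
    p1 \<cdot> S0 x = S0 y \<cdot> p0 \<and>
    p1 \<cdot> Cm x = Cm y \<cdot> chain_lift y (p1 \<cdot> chain_fst x) (FA T p1 \<cdot> chain_snd x))"

definition ICat :: "(('o, 'u) icat, ('o, 'u) ifun) cat" where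
  "ICat = \<lparr>
    Obj = {x. is_icat x},
    Arr = {p. is_ifun p},
    Dom = (\<lambda>(x, p0, p1, y). x),
    Cod = (\<lambda>(x, p0, p1, y). y),
    Ident = (\<lambda>x. (x, Ident V (I0 x), Ident V (I1 x), x)),
    Comp = (\<lambda>(y', q0, q1, z) (x, p0, p1, y). (x, q0 \<cdot> p0, q1 \<cdot> p1, z))\<rparr>"


section \<open>The induced monad on sets and matrices\<close>

definition Tset :: "'u set \<Rightarrow> 'u set" where
  "Tset X = hom V (one V) (FO T (copow V X))"

definition Tfun :: "'u set \<Rightarrow> ('u \<Rightarrow> 'u) \<Rightarrow> 'u set \<Rightarrow> 'u \<Rightarrow> 'u" where
  "Tfun X f Y = (\<lambda>\<xi>\<in>Tset X. FA T (copow_map V X f Y) \<cdot> \<xi>)"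

definition Tset_functor ::
  "('u set, 'u set \<times> ('u \<Rightarrow> 'u) \<times> 'u set, 'u set, 'u set \<times> ('u \<Rightarrow> 'u) \<times> 'u set) ftor" where
  "Tset_functor = \<lparr>FO = Tset, FA = (\<lambda>(X, f, Y). (Tset X, Tfun X f Y, Tset Y))\<rparr>"

definition ebar :: "'u set \<Rightarrow> 'u \<Rightarrow> 'u" where
  "ebar X x = Unit T (copow V X) \<cdot> pt V X x"

definition mbar :: "'u set \<Rightarrow> 'u \<Rightarrow> 'u" where
  "mbar X \<xi> = Mult T (copow V X) \<cdot> (FA T (eps_hat V (FO T (copow V X))) \<cdot> \<xi>)"

text \<open>\<open>tot r\<close> is the coproduct of all entries of \<open>r\<close>.\<close>

definition tot :: "('o, 'u) vmat \<Rightarrow> 'o" where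
  "tot r = coprod_ob V (src r \<times> tgt r) (ent r)"

definition tot_in :: "('o, 'u) vmat \<Rightarrow> 'u \<times> 'u \<Rightarrow> 'u" where
  "tot_in r xy = coprod_in V (src r \<times> tgt r) (ent r) xy"

definition tot_copair :: "('o, 'u) vmat \<Rightarrow> 'o \<Rightarrow> ('u \<times> 'u \<Rightarrow> 'u) \<Rightarrow> 'u" where
  "tot_copair r Z g = copair V (src r \<times> tgt r) (ent r) Z g"

definition tot_src :: "('o, 'u) vmat \<Rightarrow> 'u" where
  "tot_src r = tot_copair r (copow V (src r)) (\<lambda>(x, y). pt V (src r) x \<cdot> bang V (ent r (x, y)))"

definition tot_tgt :: "('o, 'u) vmat \<Rightarrow> 'u" where
  "tot_tgt r = tot_copair r (copow V (tgt r)) (\<lambda>(x, y). pt V (tgt r) y \<cdot> bang V (ent r (x, y)))"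

definition Tspan :: "('o, 'u) vmat \<Rightarrow> 'u" where
  "Tspan r = pairing V (FA T (tot_src r)) (FA T (tot_tgt r))"

definition Tbar :: "('o, 'u) vmat \<Rightarrow> ('o, 'u) vmat" where
  "Tbar r = \<lparr>src = Tset (src r), tgt = Tset (tgt r),
    ent = (\<lambda>(\<xi>, \<zeta>) \<in> Tset (src r) \<times> Tset (tgt r). pb_ob V (Tspan r) (pairing V \<xi> \<zeta>))\<rparr>"

text \<open>The canonical arrow \<open>Tbar r (\<xi>, \<zeta>) \<rightarrow> T (tot r)\<close>, and the factorization through it of an
  arrow \<open>g\<close> into \<open>T (tot r)\<close> lying over \<open>(\<xi>, \<zeta>)\<close>.\<close>

definition fib_in :: "('o, 'u) vmat \<Rightarrow> 'u \<times> 'u \<Rightarrow> 'u" where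
  "fib_in r = (\<lambda>(\<xi>, \<zeta>). pb_fst V (Tspan r) (pairing V \<xi> \<zeta>))"

definition fib_lift :: "('o, 'u) vmat \<Rightarrow> 'u \<times> 'u \<Rightarrow> 'u \<Rightarrow> 'u" where
  "fib_lift r = (\<lambda>(\<xi>, \<zeta>) g. pb_lift V (Tspan r) (pairing V \<xi> \<zeta>) g (bang V (Dom V g)))"

text \<open>The arrows induced by a family \<open>\<theta> (x, y) : r (x, y) \<rightarrow> r' (g x, h y)\<close>.\<close>

definition tot_map ::
  "('o, 'u) vmat \<Rightarrow> ('o, 'u) vmat \<Rightarrow> ('u \<Rightarrow> 'u) \<Rightarrow> ('u \<Rightarrow> 'u) \<Rightarrow> ('u \<times> 'u \<Rightarrow> 'u) \<Rightarrow> 'u" where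
  "tot_map r r' g h \<theta> = tot_copair r (tot r') (\<lambda>(x, y). tot_in r' (g x, h y) \<cdot> \<theta> (x, y))"

definition Tbar_map ::
  "('o, 'u) vmat \<Rightarrow> ('o, 'u) vmat \<Rightarrow> ('u \<Rightarrow> 'u) \<Rightarrow> ('u \<Rightarrow> 'u) \<Rightarrow> ('u \<times> 'u \<Rightarrow> 'u) \<Rightarrow>
    'u \<times> 'u \<Rightarrow> 'u" where
  "Tbar_map r r' g h \<theta> = (\<lambda>(\<xi>, \<zeta>).
    fib_lift r' (Tfun (src r) g (src r') \<xi>, Tfun (tgt r) h (tgt r') \<zeta>)
      (FA T (tot_map r r' g h \<theta>) \<cdot> fib_in r (\<xi>, \<zeta>)))"

definition idmat :: "'u set \<Rightarrow> ('o, 'u) vmat" where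
  "idmat X = \<lparr>src = X, tgt = X,
    ent = (\<lambda>(x, y) \<in> X \<times> X. if x = y then one V else zero V)\<rparr>"

definition mat_comp :: "('o, 'u) vmat \<Rightarrow> ('o, 'u) vmat \<Rightarrow> ('o, 'u) vmat" where
  "mat_comp s r = \<lparr>src = src r, tgt = tgt s,
    ent = (\<lambda>(x, z) \<in> src r \<times> tgt s.
      coprod_ob V (tgt r) (\<lambda>y. prod_ob V (ent s (y, z)) (ent r (x, y))))\<rparr>"

definition comp_copair ::
  "('o, 'u) vmat \<Rightarrow> ('o, 'u) vmat \<Rightarrow> 'u \<times> 'u \<Rightarrow> 'o \<Rightarrow> ('u \<Rightarrow> 'u) \<Rightarrow> 'u" where
  "comp_copair s r = (\<lambda>(x, z).
    copair V (tgt r) (\<lambda>y. prod_ob V (ent s (y, z)) (ent r (x, y))))"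

text \<open>The copairing below is the canonical isomorphism from \<open>X \<cdot> 1\<close> to
  \<open>tot (idmat X)\<close>.\<close>

definition e_str :: "'u set \<Rightarrow> 'u \<Rightarrow> 'u" where
  "e_str X \<xi> = fib_lift (idmat X) (\<xi>, \<xi>)
    (FA T (copair V X (\<lambda>_. one V) (tot (idmat X)) (\<lambda>x. tot_in (idmat X) (x, x))) \<cdot> \<xi>)"

text \<open>The canonical isomorphisms from \<open>tot (mat_comp s r)\<close> to the pullback of \<open>tot s\<close> and \<open>tot r\<close>
  over the copower of the middle set, and from \<open>T\<close> of this pullback to the pullback of the images.\<close>

definition tot_comp_iso :: "('o, 'u) vmat \<Rightarrow> ('o, 'u) vmat \<Rightarrow> 'u" where
  "tot_comp_iso s r = pb_lift V (tot_src s) (tot_tgt r)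
    (tot_copair (mat_comp s r) (tot s) (\<lambda>(x, z). comp_copair s r (x, z) (tot s)
      (\<lambda>y. tot_in s (y, z) \<cdot> prod_fst V (ent s (y, z)) (ent r (x, y)))))
    (tot_copair (mat_comp s r) (tot r) (\<lambda>(x, z). comp_copair s r (x, z) (tot r)
      (\<lambda>y. tot_in r (x, y) \<cdot> prod_snd V (ent s (y, z)) (ent r (x, y)))))"

definition T_pb_iso :: "('o, 'u) vmat \<Rightarrow> ('o, 'u) vmat \<Rightarrow> 'u" where
  "T_pb_iso s r = pb_lift V (FA T (tot_src s)) (FA T (tot_tgt r))
    (FA T (pb_fst V (tot_src s) (tot_tgt r))) (FA T (pb_snd V (tot_src s) (tot_tgt r)))"

definition m_str :: "('o, 'u) vmat \<Rightarrow> ('o, 'u) vmat \<Rightarrow> 'u \<times> 'u \<times> 'u \<Rightarrow> 'u" where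
  "m_str s r = (\<lambda>(\<xi>, \<zeta>, \<omega>). fib_lift (mat_comp s r) (\<xi>, \<omega>)
    (FA T (inv_arrow V (tot_comp_iso s r)) \<cdot> (inv_arrow V (T_pb_iso s r) \<cdot>
      pb_lift V (FA T (tot_src s)) (FA T (tot_tgt r))
        (fib_in s (\<zeta>, \<omega>) \<cdot> prod_fst V (ent (Tbar s) (\<zeta>, \<omega>)) (ent (Tbar r) (\<xi>, \<zeta>)))
        (fib_in r (\<xi>, \<zeta>) \<cdot> prod_snd V (ent (Tbar s) (\<zeta>, \<omega>)) (ent (Tbar r) (\<xi>, \<zeta>))))))"

definition e_mat :: "('o, 'u) vmat \<Rightarrow> 'u \<times> 'u \<Rightarrow> 'u" where
  "e_mat r = (\<lambda>(x, y). fib_lift r (ebar (src r) x, ebar (tgt r) y)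
    (Unit T (tot r) \<cdot> tot_in r (x, y)))"

definition m_mat :: "('o, 'u) vmat \<Rightarrow> 'u \<times> 'u \<Rightarrow> 'u" where
  "m_mat r = (\<lambda>(\<xi>, \<zeta>). fib_lift r (mbar (src r) \<xi>, mbar (tgt r) \<zeta>)
    (Mult T (tot r) \<cdot>
      (FA T (tot_copair (Tbar r) (FO T (tot r)) (fib_in r)) \<cdot> fib_in (Tbar r) (\<xi>, \<zeta>))))"


section \<open>Enriched categories\<close>

text \<open>\<open>\<upsilon>\<close> and \<open>\<mu>\<close> regarded as families on the entries of \<open>idmat X\<close> and of \<open>a \<cdot> Tbar a\<close>.\<close>

definition Ups_family :: "('o, 'u) tvcat \<Rightarrow> 'u \<times> 'u \<Rightarrow> 'u" where
  "Ups_family A = (\<lambda>(x, y).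
    if x = y then Ups A x else cobang V (ent (Mat A) (ebar (Car A) x, y)))"

definition Mu_family :: "('o, 'u) tvcat \<Rightarrow> 'u \<times> 'u \<Rightarrow> 'u" where
  "Mu_family A = (\<lambda>(x2, x0).
    comp_copair (Mat A) (Tbar (Mat A)) (x2, x0) (ent (Mat A) (mbar (Car A) x2, x0))
      (\<lambda>x1. Mu A (x2, x1, x0)))"

definition T_Ups :: "('o, 'u) tvcat \<Rightarrow> 'u \<times> 'u \<Rightarrow> 'u" where
  "T_Ups A = Tbar_map (idmat (Car A)) (Mat A) (ebar (Car A)) (\<lambda>x. x) (Ups_family A)"

definition T_Mu :: "('o, 'u) tvcat \<Rightarrow> 'u \<times> 'u \<Rightarrow> 'u" where
  "T_Mu A = Tbar_map (mat_comp (Mat A) (Tbar (Mat A))) (Mat A) (mbar (Car A)) (\<lambda>x. x)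
    (Mu_family A)"

definition tv_unit_laws :: "('o, 'u) tvcat \<Rightarrow> bool" where
  "tv_unit_laws A \<longleftrightarrow> (\<forall>x1\<in>Tset (Car A). \<forall>x0\<in>Car A.
    let X = Car A; a = ent (Mat A) (x1, x0) in
    Mu A (Tfun X (ebar X) (Tset X) x1, x1, x0) \<cdot>
      pairing V (Ident V a) ((T_Ups A (x1, x1) \<cdot> e_str X x1) \<cdot> bang V a) = Ident V a \<and>
    Mu A (ebar (Tset X) x1, ebar X x0, x0) \<cdot>
      pairing V (Ups A x0 \<cdot> bang V a) (e_mat (Mat A) (x1, x0)) = Ident V a)"

definition tv_assoc_law :: "('o, 'u) tvcat \<Rightarrow> bool" where
  "tv_assoc_law A \<longleftrightarrow> (\<forall>x3\<in>Tset (Tset (Tset (Car A))). \<forall>x2\<in>Tset (Tset (Car A)).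
    \<forall>x1\<in>Tset (Car A). \<forall>x0\<in>Car A.
    let X = Car A; a = Mat A;
      A1 = ent a (x1, x0); A2 = ent (Tbar a) (x2, x1); A3 = ent (Tbar (Tbar a)) (x3, x2);
      p1 = prod_fst V A1 (prod_ob V A2 A3);
      p23 = prod_snd V A1 (prod_ob V A2 A3);
      p2 = prod_fst V A2 A3 \<cdot> p23;
      p3 = prod_snd V A2 A3 \<cdot> p23
    in
    Mu A (Tfun (Tset (Tset X)) (mbar X) (Tset X) x3, x1, x0) \<cdot>
      pairing V p1 (T_Mu A (x3, x1) \<cdot> (m_str a (Tbar a) (x3, x2, x1) \<cdot> p23)) =
    Mu A (mbar (Tset X) x3, mbar X x2, x0) \<cdot>
      pairing V (Mu A (x2, x1, x0) \<cdot> pairing V p1 p2) (m_mat a (x3, x2) \<cdot> p3))"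

definition is_tvcat :: "('u set \<Rightarrow> bool) \<Rightarrow> ('o, 'u) tvcat \<Rightarrow> bool" where
  "is_tvcat small A \<longleftrightarrow>
    small (Car A) \<and>
    src (Mat A) = Tset (Car A) \<and> tgt (Mat A) = Car A \<and>
    ent (Mat A) \<in> Tset (Car A) \<times> Car A \<rightarrow>\<^sub>E Obj V \<and>
    Ups A \<in> extensional (Car A) \<and>
    (\<forall>x\<in>Car A. Ups A x \<in> hom V (one V) (ent (Mat A) (ebar (Car A) x, x))) \<and>
    Mu A \<in> extensional (Tset (Tset (Car A)) \<times> Tset (Car A) \<times> Car A) \<and>
    (\<forall>x2\<in>Tset (Tset (Car A)). \<forall>x1\<in>Tset (Car A). \<forall>x0\<in>Car A.
      Mu A (x2, x1, x0) \<in> hom V (prod_ob V (ent (Mat A) (x1, x0)) (ent (Tbar (Mat A)) (x2, x1)))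
        (ent (Mat A) (mbar (Car A) x2, x0))) \<and>
    tv_unit_laws A \<and> tv_assoc_law A"

definition is_tvfun :: "('u set \<Rightarrow> bool) \<Rightarrow> ('o, 'u) tvfun \<Rightarrow> bool" where
  "is_tvfun small = (\<lambda>(A, f, \<phi>, B). is_tvcat small A \<and> is_tvcat small B \<and>
    f \<in> Car A \<rightarrow>\<^sub>E Car B \<and>
    \<phi> \<in> extensional (Tset (Car A) \<times> Car A) \<and>
    (\<forall>x1\<in>Tset (Car A). \<forall>x0\<in>Car A.
      \<phi> (x1, x0) \<in> hom V (ent (Mat A) (x1, x0))
        (ent (Mat B) (Tfun (Car A) f (Car B) x1, f x0))) \<and>
    (\<forall>x\<in>Car A. \<phi> (ebar (Car A) x, x) \<cdot> Ups A x = Ups B (f x)) \<and>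
    (\<forall>x2\<in>Tset (Tset (Car A)). \<forall>x1\<in>Tset (Car A). \<forall>x0\<in>Car A.
      let Tf = Tfun (Car A) f (Car B); TTf = Tfun (Tset (Car A)) Tf (Tset (Car B));
        A1 = ent (Mat A) (x1, x0); A2 = ent (Tbar (Mat A)) (x2, x1)
      in
      \<phi> (mbar (Car A) x2, x0) \<cdot> Mu A (x2, x1, x0) =
      Mu B (TTf x2, Tf x1, f x0) \<cdot>
        pairing V (\<phi> (x1, x0) \<cdot> prod_fst V A1 A2)
          (Tbar_map (Mat A) (Mat B) Tf f \<phi> (x2, x1) \<cdot> prod_snd V A1 A2)))"

definition TVCat :: "('u set \<Rightarrow> bool) \<Rightarrow> (('o, 'u) tvcat, ('o, 'u) tvfun) cat" where
  "TVCat small = \<lparr>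
    Obj = {A. is_tvcat small A},
    Arr = {p. is_tvfun small p},
    Dom = (\<lambda>(A, f, \<phi>, B). A),
    Cod = (\<lambda>(A, f, \<phi>, B). B),
    Ident = (\<lambda>A. (A, \<lambda>x\<in>Car A. x,
      \<lambda>xx \<in> Tset (Car A) \<times> Car A. Ident V (ent (Mat A) xx), A)),
    Comp = (\<lambda>(B', g, \<psi>, D) (A, f, \<phi>, B). (A, compose (Car A) g f,
      \<lambda>(x1, x0) \<in> Tset (Car A) \<times> Car A.
        \<psi> (Tfun (Car A) f (Car B) x1, f x0) \<cdot> \<phi> (x1, x0), D))\<rparr>"


section \<open>The embedding into internal T-categories\<close>

text \<open>The composition of \<open>A \<cdot> 1\<close> is induced by \<open>\<mu>\<close> along the canonical isomorphism \<open>emb_chain_iso\<close>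
  from the coproduct of the objects \<open>a (x\<^sub>1, x\<^sub>0) \<times> Tbar a (x\<^sub>2, x\<^sub>1)\<close> to the object of 2-chains.\<close>

definition emb_D1 :: "('o, 'u) tvcat \<Rightarrow> 'u" where
  "emb_D1 A = eps_hat V (FO T (copow V (Car A))) \<cdot> tot_src (Mat A)"

definition emb_D0 :: "('o, 'u) tvcat \<Rightarrow> 'u" where
  "emb_D0 A = tot_tgt (Mat A)"

definition chain_index :: "('o, 'u) tvcat \<Rightarrow> ('u \<times> 'u \<times> 'u) set" where
  "chain_index A = Tset (Tset (Car A)) \<times> Tset (Car A) \<times> Car A"

definition chain_family :: "('o, 'u) tvcat \<Rightarrow> 'u \<times> 'u \<times> 'u \<Rightarrow> 'o" where
  "chain_family A = (\<lambda>(x2, x1, x0).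
    prod_ob V (ent (Mat A) (x1, x0)) (ent (Tbar (Mat A)) (x2, x1)))"

definition emb_chain_iso :: "('o, 'u) tvcat \<Rightarrow> 'u" where
  "emb_chain_iso A = copair V (chain_index A) (chain_family A)
    (pb_ob V (emb_D1 A) (FA T (emb_D0 A)))
    (\<lambda>(x2, x1, x0).
      let A1 = ent (Mat A) (x1, x0); A2 = ent (Tbar (Mat A)) (x2, x1) in
      pb_lift V (emb_D1 A) (FA T (emb_D0 A))
        (tot_in (Mat A) (x1, x0) \<cdot> prod_fst V A1 A2)
        (fib_in (Mat A) (x2, x1) \<cdot> prod_snd V A1 A2))"

definition emb_ob :: "('o, 'u) tvcat \<Rightarrow> ('o, 'u) icat" where
  "emb_ob A = \<lparr>
    I0 = copow V (Car A),
    I1 = tot (Mat A),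
    D1 = emb_D1 A,
    D0 = emb_D0 A,
    S0 = copair V (Car A) (\<lambda>_. one V) (tot (Mat A))
      (\<lambda>x. tot_in (Mat A) (ebar (Car A) x, x) \<cdot> Ups A x),
    Cm = copair V (chain_index A) (chain_family A) (tot (Mat A))
      (\<lambda>(x2, x1, x0). tot_in (Mat A) (mbar (Car A) x2, x0) \<cdot> Mu A (x2, x1, x0))
      \<cdot> inv_arrow V (emb_chain_iso A)\<rparr>"

definition emb_functor ::
  "(('o, 'u) tvcat, ('o, 'u) tvfun, ('o, 'u) icat, ('o, 'u) ifun) ftor" where
  "emb_functor = \<lparr>
    FO = emb_ob,
    FA = (\<lambda>(A, f, \<phi>, B).
      (emb_ob A, copow_map V (Car A) f (Car B),
       tot_map (Mat A) (Mat B) (Tfun (Car A) f (Car B)) f \<phi>, emb_ob B))\<rparr>"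

end

end

theory Submission
  imports Defs
begin

text \<open>A morphism \<open>q\<close> is of effective descent iff all its pullbacks are coequalizers of their kernel
  pairs over the codomain and every descent datum for \<open>q\<close> arises from a pullback along \<open>q\<close>. Both conditions
  are reflected by a fully faithful functor \<open>K\<close> whose image is closed under pullbacks, as soon as an
  object over \<open>K B\<close> is in the image whenever its pullback along \<open>K p\<close> is.

  For \<open>K = - \<cdot> 1\<close>, an internal category over some \<open>B \<cdot> 1\<close> is in the essential image iff its object of
  objects is discrete, i.e. a copower of \<open>1\<close>: as the counit at \<open>T 1\<close> is monic and the counits form
  a cartesian transformation, the domain map then factors through a copower of \<open>1\<close>, so the object of
  arrows decomposes into the entries of a matrix. Pullbacks of internal categories are pullbacks on
  objects, hence preserve discreteness, and discreteness descends along maps that are surjective on points.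
  Finally, if \<open>(f, \<phi>) \<cdot> 1\<close> is of effective descent then \<open>f\<close> is surjective, since \<open>(f, \<phi>) \<cdot> 1\<close>
  factors through the full subcategory on the image of \<open>f\<close>, which is a pullback of indiscrete categories.\<close>

section \<open>Pullbacks and equivalences of categories\<close>

text \<open>Effective descent is defined through chosen pullbacks and the monad built from them,
  while \<open>K\<close> carries a chosen pullback only to some pullback; hence the reformulation
  with arbitrary pullbacks. Existence of pullbacks in \<open>ICat\<close> is part of the assumption
  that the image is of effective descent, so they are never constructed there, and those of
  \<open>TVCat\<close> are inferred from them. The enriched and the internal laws are matched on
  generalized elements: an arrow into a coproduct is locally, on the summands of a decomposition of
  its domain, an arrow into a single summand. Disjointness then compares indices, always up to the
  degenerate case of an initial domain. Monicity of the counit at \<open>T\<close> of the terminal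
  object spreads to all copowers along pullback squares, and it is what allows points of
  \<open>T\<close> of a copower to serve as indices.\<close>

context category
begin

abbreviation arr where "arr f \<equiv> f \<in> Arr C"
abbreviation dom where "dom \<equiv> Dom C"
abbreviation cod where "cod \<equiv> Cod C"

lemma hom_iff: "f \<in> hom C A B \<longleftrightarrow> arr f \<and> dom f = A \<and> cod f = B"
  by (auto simp: hom_def)

lemma comp_typed [simp]:
  assumes "arr f" "arr g" "cod f = dom g"
  shows "arr (g\<cdot>f)" "dom (g\<cdot>f) = dom f" "cod (g\<cdot>f) = cod g"
  using Comp_in_hom[of f "dom f" "dom g" g "cod g"] assms by (auto simp: hom_def)

lemma assoc [simp]:
  assumes "arr f" "arr g" "arr h" "cod f = dom g" "cod g = dom h"
  shows "(h\<cdot>g)\<cdot>f = h\<cdot>(g\<cdot>f)"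
  using Comp_assoc[of f "dom f" "dom g" g "dom h" h "cod h"] assms by (auto simp: hom_def)

lemma Obj_typed [simp]: "arr f \<Longrightarrow> dom f \<in> Obj C" "arr f \<Longrightarrow> cod f \<in> Obj C"
  by (auto intro: Dom_in_Obj Cod_in_Obj)

lemma Ident_typed [simp]:
  assumes "A \<in> Obj C"
  shows "arr (Ident C A)" "dom (Ident C A) = A" "cod (Ident C A) = A"
  using Ident_in_hom[OF assms] by (auto simp: hom_def)

lemma Ident_right [simp]: "\<lbrakk>arr f; A = dom f\<rbrakk> \<Longrightarrow> f\<cdot>Ident C A = f"
  using Comp_Ident[of f "dom f" "cod f"] by (auto simp: hom_def)

lemma Ident_left [simp]: "\<lbrakk>arr f; A = cod f\<rbrakk> \<Longrightarrow> Ident C A\<cdot>f = f"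
  using Ident_Comp[of f "dom f" "cod f"] by (auto simp: hom_def)

text \<open>Composites are kept associated to the right, so an equation for \<open>g\<cdot>f\<close>
  does not match inside a longer composite. This is its form with a further factor on the
  right.\<close>

lemma comp_cong:
  assumes "g\<cdot>f = h" "arr f" "arr g" "cod f = dom g" "arr k" "cod k = dom f"
  shows "g\<cdot>(f\<cdot>k) = h\<cdot>k"
  using assms by (metis assoc)

lemma pullback_typed:
  assumes "is_pullback C f g p q"
  shows "arr f" "arr g" "arr p" "arr q"
    "cod g = cod f" "cod p = dom f" "cod q = dom g" "dom q = dom p"
    "f\<cdot>p = g\<cdot>q"
  using assms by (auto simp: is_pullback_def)

lemma pullback_ex:
  assumes "is_pullback C f g p q" "arr h" "arr k" "dom h = dom k"
    "cod h = dom f" "cod k = dom g" "f\<cdot>h = g\<cdot>k"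
  obtains u where "arr u" "dom u = dom h" "cod u = dom p" "p\<cdot>u = h" "q\<cdot>u = k"
proof -
  have "\<exists>!u. u \<in> hom C (dom h) (dom p) \<and> p\<cdot>u = h \<and> q\<cdot>u = k"
    by (rule assms(1)[unfolded is_pullback_def, THEN conjunct2, THEN conjunct2, THEN conjunct2,
      THEN conjunct2, THEN conjunct2, THEN conjunct2, THEN conjunct2, THEN conjunct2, THEN conjunct2,
      rule_format]) (use assms in \<open>auto simp: hom_iff\<close>)
  then show ?thesis using that by (auto simp: hom_iff)
qed

lemma pullback_eq:
  assumes "is_pullback C f g p q" "arr u" "arr u'" "dom u = dom u'"
    "cod u = dom p" "cod u' = dom p" "p\<cdot>u = p\<cdot>u'" "q\<cdot>u = q\<cdot>u'"
  shows "u = u'"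
proof -
  note t = pullback_typed[OF assms(1)]
  have "f\<cdot>(p\<cdot>u) = g\<cdot>(q\<cdot>u)"
    using t assms(2,5) by (metis assoc)
  have "\<exists>!w. w \<in> hom C (dom u) (dom p) \<and> p\<cdot>w = p\<cdot>u \<and> q\<cdot>w = q\<cdot>u"
    by (rule assms(1)[unfolded is_pullback_def, THEN conjunct2, THEN conjunct2, THEN conjunct2,
      THEN conjunct2, THEN conjunct2, THEN conjunct2, THEN conjunct2, THEN conjunct2, THEN conjunct2,
      rule_format]) (use assms t \<open>f\<cdot>(p\<cdot>u) = g\<cdot>(q\<cdot>u)\<close> in \<open>auto simp: hom_iff\<close>)
  then show ?thesis using assms by (auto simp: hom_iff)
qed

lemma pullbackI:
  assumes "arr f" "arr g" "arr p" "arr q"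
    "cod f = cod g" "cod p = dom f" "cod q = dom g" "dom p = dom q"
    "f\<cdot>p = g\<cdot>q"
    "\<And>h k. \<lbrakk>arr h; arr k; dom h = dom k; cod h = dom f; cod k = dom g; f\<cdot>h = g\<cdot>k\<rbrakk>
      \<Longrightarrow> \<exists>u. arr u \<and> dom u = dom h \<and> cod u = dom p \<and> p\<cdot>u = h \<and> q\<cdot>u = k"
    "\<And>u u'. \<lbrakk>arr u; arr u'; dom u = dom u'; cod u = dom p; cod u' = dom p;
      p\<cdot>u = p\<cdot>u'; q\<cdot>u = q\<cdot>u'\<rbrakk> \<Longrightarrow> u = u'"
  shows "is_pullback C f g p q"
  unfolding is_pullback_def
proof (intro conjI ballI impI)
  fix Z h k assume Z: "Z \<in> Obj C" "h \<in> hom C Z (dom f)" "k \<in> hom C Z (dom g)" "f\<cdot>h = g\<cdot>k"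
  then obtain u where "arr u" "dom u = dom h" "cod u = dom p" "p\<cdot>u = h" "q\<cdot>u = k"
    using assms(10)[of h k] by (auto simp: hom_iff)
  then show "\<exists>!u. u \<in> hom C Z (dom p) \<and> p\<cdot>u = h \<and> q\<cdot>u = k"
    using Z assms(11) by (intro ex1I[of _ u]) (auto simp: hom_iff)
qed (use assms in auto)

lemma isoI:
  assumes "arr f" "arr g" "dom g = cod f" "cod g = dom f"
    "g\<cdot>f = Ident C (dom f)" "f\<cdot>g = Ident C (cod f)"
  shows "is_iso C f"
  using assms by (auto simp: is_iso_def inverse_arrows_def hom_iff)

lemma isoE:
  assumes "is_iso C f"
  obtains g where "arr f" "arr g" "dom g = cod f" "cod g = dom f"
    "g\<cdot>f = Ident C (dom f)" "f\<cdot>g = Ident C (cod f)"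
  using assms by (auto simp: is_iso_def inverse_arrows_def hom_iff)

lemma inv_arrow:
  assumes "is_iso C f"
  shows "arr (inv_arrow C f)" "dom (inv_arrow C f) = cod f" "cod (inv_arrow C f) = dom f"
    "inv_arrow C f\<cdot>f = Ident C (dom f)" "f\<cdot>inv_arrow C f = Ident C (cod f)"
proof -
  obtain g where g: "inverse_arrows C f g" using assms by (auto simp: is_iso_def)
  have "h = g" if "inverse_arrows C f h" for h
  proof -
    have t: "arr f" "arr h" "arr g" "dom h = cod f" "cod h = dom f"
      "dom g = cod f" "cod g = dom f" "h\<cdot>f = Ident C (dom f)" "f\<cdot>g = Ident C (cod f)"
      using that g by (auto simp: inverse_arrows_def hom_iff)
    have "h\<cdot>(f\<cdot>g) = Ident C (dom f)\<cdot>g" by (rule comp_cong[OF t(8)]) (use t in auto)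
    then show ?thesis using t by simp
  qed
  with g have "inverse_arrows C f (inv_arrow C f)" unfolding inv_arrow_def by (metis theI)
  then show "arr (inv_arrow C f)" "dom (inv_arrow C f) = cod f" "cod (inv_arrow C f) = dom f"
    "inv_arrow C f\<cdot>f = Ident C (dom f)" "f\<cdot>inv_arrow C f = Ident C (cod f)"
    by (auto simp: inverse_arrows_def hom_iff)
qed

lemma iso_cancel_left:
  assumes "is_iso C i" "arr u" "arr u'" "cod u = dom i" "cod u' = dom i" "i\<cdot>u = i\<cdot>u'"
  shows "u = u'"
proof -
  obtain g where g: "arr i" "arr g" "dom g = cod i" "cod g = dom i"
    "g\<cdot>i = Ident C (dom i)" "i\<cdot>g = Ident C (cod i)"
    using assms(1) by (rule isoE)
  have "g\<cdot>(i\<cdot>u) = u" "g\<cdot>(i\<cdot>u') = u'"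
    using comp_cong[OF g(5), of u] comp_cong[OF g(5), of u'] g assms(2-5) by simp_all
  then show ?thesis using assms(6) by metis
qed

lemma iso_cancel_right:
  assumes "is_iso C i" "arr u" "arr u'" "dom u = cod i" "dom u' = cod i" "u\<cdot>i = u'\<cdot>i"
  shows "u = u'"
proof -
  obtain g where g: "arr i" "arr g" "dom g = cod i" "cod g = dom i"
    "g\<cdot>i = Ident C (dom i)" "i\<cdot>g = Ident C (cod i)"
    using assms(1) by (rule isoE)
  have "(u\<cdot>i)\<cdot>g = u" "(u'\<cdot>i)\<cdot>g = u'" using g assms(2-5) by simp_all
  then show ?thesis using assms(6) by metis
qed

lemma pullback_iso:
  assumes pb: "is_pullback C f g p q" and i: "is_iso C i" "cod i = dom p"
  shows "is_pullback C f g (p\<cdot>i) (q\<cdot>i)"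
proof -
  obtain j where j: "arr i" "arr j" "dom j = cod i" "cod j = dom i"
    "j\<cdot>i = Ident C (dom i)" "i\<cdot>j = Ident C (cod i)"
    using i(1) by (rule isoE)
  note t = pullback_typed[OF pb]
  show ?thesis
  proof (rule pullbackI)
    fix h k assume h: "arr h" "arr k" "dom h = dom k" "cod h = dom f" "cod k = dom g" "f\<cdot>h = g\<cdot>k"
    obtain u where u: "arr u" "dom u = dom h" "cod u = dom p" "p\<cdot>u = h" "q\<cdot>u = k"
      using pullback_ex[OF pb h] .
    show "\<exists>u. arr u \<and> dom u = dom h \<and> cod u = dom (p\<cdot>i) \<and> (p\<cdot>i)\<cdot>u = h \<and> (q\<cdot>i)\<cdot>u = k"
      using u j i t comp_cong[OF j(6)] by (intro exI[of _ "j\<cdot>u"]) auto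
  next
    fix u u' assume u: "arr u" "arr u'" "dom u = dom u'" "cod u = dom (p\<cdot>i)"
      "cod u' = dom (p\<cdot>i)" "(p\<cdot>i)\<cdot>u = (p\<cdot>i)\<cdot>u'" "(q\<cdot>i)\<cdot>u = (q\<cdot>i)\<cdot>u'"
    have "i\<cdot>u = i\<cdot>u'"
      by (rule pullback_eq[OF pb]) (use u j i t in auto)
    then show "u = u'" using iso_cancel_left[OF i(1)] u t j i by auto
  qed (use t j i in \<open>auto simp: comp_cong[OF t(9)]\<close>)
qed

lemma pullback_unique:
  assumes pb: "is_pullback C f g p q" and pb': "is_pullback C f g p' q'"
  obtains i where "is_iso C i" "arr i" "dom i = dom p'" "cod i = dom p" "p\<cdot>i = p'" "q\<cdot>i = q'"
proof -
  note t = pullback_typed[OF pb] and t' = pullback_typed[OF pb']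
  obtain i where i: "arr i" "dom i = dom p'" "cod i = dom p" "p\<cdot>i = p'" "q\<cdot>i = q'"
    by (rule pullback_ex[OF pb, of p' q']) (use t' in auto)
  obtain j where j: "arr j" "dom j = dom p" "cod j = dom p'" "p'\<cdot>j = p" "q'\<cdot>j = q"
    by (rule pullback_ex[OF pb', of p q]) (use t in auto)
  have "p\<cdot>(i\<cdot>j) = p" "q\<cdot>(i\<cdot>j) = q" "p'\<cdot>(j\<cdot>i) = p'" "q'\<cdot>(j\<cdot>i) = q'"
    using i j t t' by (metis assoc)+
  note e = this
  have "i\<cdot>j = Ident C (dom p)"
    by (rule pullback_eq[OF pb]) (use i(1-3) j(1-3) t(1-8) e in simp_all)
  moreover have "j\<cdot>i = Ident C (dom p')"
    by (rule pullback_eq[OF pb']) (use i(1-3) j(1-3) t'(1-8) e in simp_all)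
  ultimately have "is_iso C i" using i j by (intro isoI[of i j]) auto
  then show ?thesis using that i by blast
qed

end

section \<open>Functors and equivalences of categories\<close>

lemma functorD:
  assumes "is_functor C D F"
  shows "A \<in> Obj C \<Longrightarrow> FO F A \<in> Obj D"
    "f \<in> Arr C \<Longrightarrow> FA F f \<in> Arr D"
    "f \<in> Arr C \<Longrightarrow> Dom D (FA F f) = FO F (Dom C f)"
    "f \<in> Arr C \<Longrightarrow> Cod D (FA F f) = FO F (Cod C f)"
    "A \<in> Obj C \<Longrightarrow> FA F (Ident C A) = Ident D (FO F A)"
    "\<lbrakk>f \<in> Arr C; g \<in> Arr C; Cod C f = Dom C g\<rbrakk> \<Longrightarrow> FA F (g \<cdot>\<^bsub>C\<^esub> f) = FA F g \<cdot>\<^bsub>D\<^esub> FA F f"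
  using assms by (auto simp: is_functor_def hom_def)

lemma functor_iso:
  assumes "category C" "category D" "is_functor C D F" "is_iso C f"
  shows "is_iso D (FA F f)"
proof -
  interpret C: category C by fact
  interpret D: category D by fact
  note F = functorD[OF assms(3)]
  obtain g where g: "f \<in> Arr C" "g \<in> Arr C" "Dom C g = Cod C f" "Cod C g = Dom C f"
    "g \<cdot>\<^bsub>C\<^esub> f = Ident C (Dom C f)" "f \<cdot>\<^bsub>C\<^esub> g = Ident C (Cod C f)"
    using C.isoE[OF assms(4)] .
  show ?thesis
    by (rule D.isoI[of _ "FA F g"]) (use g F F(6)[of f g, symmetric] F(6)[of g f, symmetric] in auto)
qed

text \<open>Naturality of \<open>\<alpha>\<close> makes \<open>F\<close> faithful, and naturality of
  \<open>\<beta>\<close> makes \<open>G\<close> faithful between objects in the image of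
  \<open>F\<close>. The preimage of \<open>g\<close> is the conjugate of \<open>FA G g\<close> by
  \<open>\<alpha>\<close>; it is sent to \<open>g\<close> because \<open>G\<close> does not
  distinguish the two.\<close>

lemma equivalence_full_faithful:
  fixes F :: "('o, 'a, 'p, 'b) ftor"
  assumes "category C" "category D" "is_equivalence C D F" "A \<in> Obj C" "B \<in> Obj C"
    "g \<in> hom D (FO F A) (FO F B)"
  shows "\<exists>!f. f \<in> hom C A B \<and> FA F f = g"
proof -
  interpret C: category C by fact
  interpret D: category D by fact
  obtain G :: "('p, 'b, 'o, 'a) ftor" and \<alpha> \<beta> where F: "is_functor C D F" and G: "is_functor D C G"
    and al: "is_nat_iso C C id_functor (comp_functor G F) \<alpha>"
    and be: "is_nat_iso D D (comp_functor F G) id_functor \<beta>"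
    using assms(3) unfolding is_equivalence_def by blast
  note F = functorD[OF F] and G = functorD[OF G]
  have al_iso: "is_iso C (\<alpha> X)" and al_hom: "\<alpha> X \<in> hom C X (FO G (FO F X))" if "X \<in> Obj C" for X
    using al that by (auto simp: is_nat_iso_def is_nat_trans_def id_functor_def comp_functor_def)
  have al_nat: "\<alpha> (Cod C f) \<cdot>\<^bsub>C\<^esub> f = FA G (FA F f) \<cdot>\<^bsub>C\<^esub> \<alpha> (Dom C f)" if "f \<in> Arr C" for f
    using al that by (auto simp: is_nat_iso_def is_nat_trans_def id_functor_def comp_functor_def)
  have be_iso: "is_iso D (\<beta> X)" and be_hom: "\<beta> X \<in> hom D (FO F (FO G X)) X" if "X \<in> Obj D" for X
    using be that by (auto simp: is_nat_iso_def is_nat_trans_def id_functor_def comp_functor_def)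
  have be_nat: "\<beta> (Cod D f) \<cdot>\<^bsub>D\<^esub> FA F (FA G f) = f \<cdot>\<^bsub>D\<^esub> \<beta> (Dom D f)" if "f \<in> Arr D" for f
    using be that by (auto simp: is_nat_iso_def is_nat_trans_def id_functor_def comp_functor_def)
  have faithful: "f = f'" if "f \<in> hom C A B" "f' \<in> hom C A B" "FA F f = FA F f'" for f f'
    by (rule C.iso_cancel_left[of "\<alpha> B"]) (use al_nat[of f] al_nat[of f'] that al_iso[of B] al_hom[of B] in \<open>auto simp: C.hom_iff\<close>)
  have Gfaithful: "h = h'"
    if "h \<in> hom D (FO F A) (FO F B)" "h' \<in> hom D (FO F A) (FO F B)" "FA G h = FA G h'" for h h'
    by (rule D.iso_cancel_right[of "\<beta> (FO F A)"]) (use be_nat[of h] be_nat[of h'] that be_iso[of "FO F A"] be_hom[of "FO F A"] assms F in \<open>auto simp: D.hom_iff\<close>)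
  note i = C.inv_arrow[OF al_iso[OF assms(5)]]
  note aA = al_hom[OF assms(4), unfolded C.hom_iff] and aB = al_hom[OF assms(5), unfolded C.hom_iff]
  define f where "f = inv_arrow C (\<alpha> B) \<cdot>\<^bsub>C\<^esub> (FA G g \<cdot>\<^bsub>C\<^esub> \<alpha> A)"
  have comp_i: "\<alpha> B \<cdot>\<^bsub>C\<^esub> (inv_arrow C (\<alpha> B) \<cdot>\<^bsub>C\<^esub> k) = k" if "k \<in> Arr C" "Cod C k = Cod C (\<alpha> B)" for k
    using C.comp_cong[OF i(5), of k] i that aB by simp
  have f: "f \<in> hom C A B" "\<alpha> B \<cdot>\<^bsub>C\<^esub> f = FA G g \<cdot>\<^bsub>C\<^esub> \<alpha> A"
    unfolding f_def using i(1-3) aA aB assms(6) G(2-4) comp_i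
    by (simp_all add: C.hom_iff D.hom_iff)
  have "FA G (FA F f) \<cdot>\<^bsub>C\<^esub> \<alpha> A = FA G g \<cdot>\<^bsub>C\<^esub> \<alpha> A" using al_nat[of f] f by (auto simp: C.hom_iff)
  then have "FA G (FA F f) = FA G g"
    by - (rule C.iso_cancel_right[of "\<alpha> A"], use f assms al_iso[of A] aA F G in \<open>auto simp: C.hom_iff D.hom_iff\<close>)
  then have "FA F f = g" using assms f F by (intro Gfaithful) (auto simp: C.hom_iff D.hom_iff)
  then show ?thesis using f faithful by blast
qed

lemma equivalence_ess_surj:
  fixes F :: "('o, 'a, 'p, 'b) ftor"
  assumes "is_equivalence C D F" "Y \<in> Obj D"
  obtains X i where "X \<in> Obj C" "is_iso D i" "i \<in> hom D (FO F X) Y"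
proof -
  obtain G :: "('p, 'b, 'o, 'a) ftor" and \<beta> where G: "is_functor D C G" and be: "is_nat_iso D D (comp_functor F G) id_functor \<beta>"
    using assms(1) unfolding is_equivalence_def by blast
  have "FO G Y \<in> Obj C" "is_iso D (\<beta> Y)" "\<beta> Y \<in> hom D (FO F (FO G Y)) Y"
    using G be assms(2) by (auto simp: is_functor_def is_nat_iso_def is_nat_trans_def id_functor_def comp_functor_def)
  then show ?thesis using that by blast
qed

text \<open>The quasi-inverse is chosen: \<open>S\<close> picks objects, \<open>\<beta>\<close> the
  isomorphisms, and an arrow goes to the unique preimage of its conjugate by \<open>\<beta>\<close>.
  Every equation that is needed in \<open>C\<close> can be checked after applying
  \<open>F\<close>.\<close>

lemma equivalenceI:
  fixes F :: "('o, 'a, 'p, 'b) ftor"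
  assumes "category C" "category D" and F: "is_functor C D F"
    and ff: "\<And>A B g. \<lbrakk>A \<in> Obj C; B \<in> Obj C; g \<in> hom D (FO F A) (FO F B)\<rbrakk> \<Longrightarrow> \<exists>!f. f \<in> hom C A B \<and> FA F f = g"
    and es: "\<And>Y. Y \<in> Obj D \<Longrightarrow> \<exists>X\<in>Obj C. \<exists>i. is_iso D i \<and> i \<in> hom D (FO F X) Y"
  shows "is_equivalence C D F"
proof -
  interpret C: category C by fact
  interpret D: category D by fact
  note Ff = functorD[OF F]
  define S where "S Y = (SOME X. X \<in> Obj C \<and> (\<exists>i. is_iso D i \<and> i \<in> hom D (FO F X) Y))" for Y
  define \<beta> where "\<beta> Y = (SOME i. is_iso D i \<and> i \<in> hom D (FO F (S Y)) Y)" for Y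
  have S': "S Y \<in> Obj C \<and> (\<exists>i. is_iso D i \<and> i \<in> hom D (FO F (S Y)) Y)" if "Y \<in> Obj D" for Y
    unfolding S_def by (rule someI_ex) (use es[OF that] in blast)
  have "is_iso D (\<beta> Y) \<and> \<beta> Y \<in> hom D (FO F (S Y)) Y" if "Y \<in> Obj D" for Y
    unfolding \<beta>_def by (rule someI_ex) (use S'[OF that] in blast)
  then have S: "S Y \<in> Obj C" "is_iso D (\<beta> Y)" "\<beta> Y \<in> hom D (FO F (S Y)) Y" if "Y \<in> Obj D" for Y
    using S' that by auto
  define pre where "pre A B g = (THE f. f \<in> hom C A B \<and> FA F f = g)" for A B g
  have pre: "pre A B g \<in> hom C A B" "FA F (pre A B g) = g"
    if "A \<in> Obj C" "B \<in> Obj C" "g \<in> hom D (FO F A) (FO F B)" for A B g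
    using theI'[OF ff[OF that]] by (auto simp: pre_def)
  have faithful: "f = f'" if "f \<in> Arr C" "f' \<in> Arr C" "Dom C f = Dom C f'" "Cod C f = Cod C f'" "FA F f = FA F f'" for f f'
    using ff[of "Dom C f" "Cod C f" "FA F f"] that Ff by (auto simp: C.hom_iff D.hom_iff)
  note bi = D.inv_arrow[OF S(2)]
  have b: "\<beta> Y \<in> Arr D" "Dom D (\<beta> Y) = FO F (S Y)" "Cod D (\<beta> Y) = Y" if "Y \<in> Obj D" for Y
    using S(3)[OF that] by (auto simp: D.hom_iff)
  define GA where "GA g = pre (S (Dom D g)) (S (Cod D g)) (inv_arrow D (\<beta> (Cod D g)) \<cdot>\<^bsub>D\<^esub> (g \<cdot>\<^bsub>D\<^esub> \<beta> (Dom D g)))" for g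
  have GA: "GA g \<in> hom C (S (Dom D g)) (S (Cod D g))"
    "FA F (GA g) = inv_arrow D (\<beta> (Cod D g)) \<cdot>\<^bsub>D\<^esub> (g \<cdot>\<^bsub>D\<^esub> \<beta> (Dom D g))" if "g \<in> Arr D" for g
    unfolding GA_def using that S(1) bi b by (auto intro!: pre simp: D.hom_iff)
  note GAt = GA(1)[unfolded C.hom_iff]
  define G where "G = \<lparr>FO = S, FA = GA\<rparr>"
  have G: "is_functor D C G" unfolding is_functor_def
  proof (intro conjI ballI impI)
    fix A assume A: "A \<in> Obj D"
    then show "FA G (Ident D A) = Ident C (FO G A)"
      using GAt[of "Ident D A"] GA(2)[of "Ident D A"] S(1) bi[OF A] b[OF A] Ff by (intro faithful) (auto simp: G_def)
  next
    fix f g assume fg: "f \<in> Arr D" "g \<in> Arr D" "Cod D f = Dom D g"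
    have cg: "Cod D g \<in> Obj D" "Dom D g \<in> Obj D" "Dom D f \<in> Obj D" using fg by auto
    have "FA F (GA (g \<cdot>\<^bsub>D\<^esub> f)) = FA F (GA g \<cdot>\<^bsub>C\<^esub> GA f)"
      using GAt[of f] GAt[of g] GA(2) Ff fg bi[OF cg(1)] bi[OF cg(2)] b[OF cg(1)] b[OF cg(2)] b[OF cg(3)] D.comp_cong[OF bi(5)[OF cg(2)]]
      by (simp add: C.hom_iff)
    then show "FA G (g \<cdot>\<^bsub>D\<^esub> f) = FA G g \<cdot>\<^bsub>C\<^esub> FA G f"
      using GAt[of f] GAt[of g] GAt[of "g \<cdot>\<^bsub>D\<^esub> f"] fg unfolding G_def by (intro faithful) auto
  qed (use GA(1) S(1) in \<open>auto simp: G_def\<close>)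
  have be: "is_nat_iso D D (comp_functor F G) id_functor \<beta>"
    unfolding is_nat_iso_def is_nat_trans_def comp_functor_def id_functor_def
  proof (safe)
    fix f assume f: "f \<in> Arr D"
    then have o: "Cod D f \<in> Obj D" "Dom D f \<in> Obj D" by auto
    show "\<beta> (Cod D f) \<cdot>\<^bsub>D\<^esub> FA \<lparr>FO = \<lambda>A. FO F (FO G A), FA = \<lambda>f. FA F (FA G f)\<rparr> f =
         FA \<lparr>FO = \<lambda>A. A, FA = \<lambda>f. f\<rparr> f \<cdot>\<^bsub>D\<^esub> \<beta> (Dom D f)"
      using f GA(2)[OF f] bi[OF o(1)] b[OF o(1)] b[OF o(2)] D.comp_cong[OF bi(5)[OF o(1)]] by (simp add: G_def)
  qed (use S in \<open>auto simp: G_def\<close>)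
  define \<alpha> where "\<alpha> X = pre X (S (FO F X)) (inv_arrow D (\<beta> (FO F X)))" for X
  have al: "\<alpha> X \<in> Arr C \<and> Dom C (\<alpha> X) = X \<and> Cod C (\<alpha> X) = S (FO F X)" "FA F (\<alpha> X) = inv_arrow D (\<beta> (FO F X))" if "X \<in> Obj C" for X
    using pre[of X "S (FO F X)" "inv_arrow D (\<beta> (FO F X))"] that Ff S(1) bi b
    by (auto simp: \<alpha>_def D.hom_iff C.hom_iff)
  have "is_nat_iso C C id_functor (comp_functor G F) \<alpha>"
    unfolding is_nat_iso_def is_nat_trans_def comp_functor_def id_functor_def
  proof (intro conjI ballI)
    fix f assume f: "f \<in> Arr C"
    then have o: "FO F (Cod C f) \<in> Obj D" "FO F (Dom C f) \<in> Obj D" using Ff by auto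
    have "\<alpha> (Cod C f) \<cdot>\<^bsub>C\<^esub> f = GA (FA F f) \<cdot>\<^bsub>C\<^esub> \<alpha> (Dom C f)"
      using f GAt[of "FA F f"] GA(2)[of "FA F f"] al Ff bi[OF o(1)] bi[OF o(2)] b[OF o(1)] b[OF o(2)]
      by (intro faithful) auto
    then show "\<alpha> (Cod C f) \<cdot>\<^bsub>C\<^esub> FA \<lparr>FO = \<lambda>A. A, FA = \<lambda>f. f\<rparr> f =
         FA \<lparr>FO = \<lambda>A. FO G (FO F A), FA = \<lambda>f. FA G (FA F f)\<rparr> f \<cdot>\<^bsub>C\<^esub> \<alpha> (Dom C f)"
      by (simp add: G_def)
  next
    fix X assume X: "X \<in> Obj C"
    then have o: "FO F X \<in> Obj D" using Ff by auto
    define j where "j = pre (S (FO F X)) X (\<beta> (FO F X))"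
    have j: "j \<in> Arr C" "Dom C j = S (FO F X)" "Cod C j = X" "FA F j = \<beta> (FO F X)"
      using pre[of "S (FO F X)" X "\<beta> (FO F X)"] X S(1)[OF o] b[OF o] by (auto simp: j_def C.hom_iff D.hom_iff)
    show "is_iso C (\<alpha> X)"
      by (rule C.isoI[of _ j]; (rule faithful)?)
        (use j al[OF X] S(1)[OF o] Ff bi[OF o] b[OF o] in auto)
  qed (use al in \<open>auto simp: G_def C.hom_iff\<close>)
  then show ?thesis using F G be by (auto simp: is_equivalence_def)
qed

lemma (in category) fully_faithful_bij:
  assumes "fully_faithful C D F" "A \<in> Obj C" "B \<in> Obj C" "g \<in> hom D (FO F A) (FO F B)"
  obtains f where "arr f" "dom f = A" "cod f = B" "FA F f = g"
proof -
  have "bij_betw (FA F) (hom C A B) (hom D (FO F A) (FO F B))"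
    using assms by (simp add: fully_faithful_def)
  then have "g \<in> FA F ` hom C A B" using assms(4) by (simp add: bij_betw_def)
  then show ?thesis using that by (auto simp: hom_iff)
qed

lemma (in category) fully_faithful_inj:
  assumes "fully_faithful C D F" "arr f" "arr f'" "dom f = dom f'" "cod f = cod f'" "FA F f = FA F f'"
  shows "f = f'"
proof -
  have "inj_on (FA F) (hom C (dom f') (cod f'))"
    using assms by (auto simp: fully_faithful_def bij_betw_def)
  then show ?thesis by (rule inj_onD) (use assms in \<open>auto simp: hom_iff\<close>)
qed

section \<open>Categories with chosen pullbacks\<close>

locale pullback_category = category +
  assumes has_pullbacks: "has_pullbacks C"
begin

lemma pb:
  assumes "arr f" "arr g" "cod f = cod g"
  shows "is_pullback C f g (pb_fst C f g) (pb_snd C f g)"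
proof -
  have "\<exists>pq. case pq of (p, q) \<Rightarrow> is_pullback C f g p q"
    using has_pullbacks assms by (auto simp: has_pullbacks_def)
  from someI_ex[OF this] show ?thesis
    by (simp add: pb_fst_def pb_snd_def pb_cone_def split: prod.splits)
qed

lemma pb_typed [simp]:
  assumes "arr f" "arr g" "cod f = cod g"
  shows "arr (pb_fst C f g)" "arr (pb_snd C f g)"
    "dom (pb_fst C f g) = pb_ob C f g" "dom (pb_snd C f g) = pb_ob C f g"
    "cod (pb_fst C f g) = dom f" "cod (pb_snd C f g) = dom g"
    "pb_ob C f g \<in> Obj C"
  using pullback_typed[OF pb[OF assms]] by (auto simp: pb_ob_def)

lemma pb_comm [simp]:
  assumes "arr f" "arr g" "cod f = cod g"
  shows "f\<cdot>pb_fst C f g = g\<cdot>pb_snd C f g"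
    "\<lbrakk>arr z; cod z = pb_ob C f g\<rbrakk> \<Longrightarrow> f\<cdot>(pb_fst C f g\<cdot>z) = g\<cdot>(pb_snd C f g\<cdot>z)"
proof -
  show e: "f\<cdot>pb_fst C f g = g\<cdot>pb_snd C f g"
    by (rule pullback_typed(9)[OF pb[OF assms]])
  show "f\<cdot>(pb_fst C f g\<cdot>z) = g\<cdot>(pb_snd C f g\<cdot>z)" if "arr z" "cod z = pb_ob C f g"
    using comp_cong[OF e, of z] that assms by simp
qed

lemma pb_ext:
  assumes "arr f" "arr g" "cod f = cod g"
    "arr u" "arr u'" "dom u = dom u'" "cod u = pb_ob C f g" "cod u' = pb_ob C f g"
    "pb_fst C f g\<cdot>u = pb_fst C f g\<cdot>u'" "pb_snd C f g\<cdot>u = pb_snd C f g\<cdot>u'"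
  shows "u = u'"
  by (rule pullback_eq[OF pb[of f g]]) (use assms in auto)

lemma pb_lift:
  assumes "arr f" "arr g" "cod f = cod g"
    "arr h" "arr k" "dom h = dom k" "cod h = dom f" "cod k = dom g" "f\<cdot>h = g\<cdot>k"
  shows "arr (pb_lift C f g h k)" "dom (pb_lift C f g h k) = dom k"
    "cod (pb_lift C f g h k) = pb_ob C f g"
    "pb_fst C f g\<cdot>pb_lift C f g h k = h" "pb_snd C f g\<cdot>pb_lift C f g h k = k"
proof -
  obtain u where u: "arr u" "dom u = dom h" "cod u = dom (pb_fst C f g)"
    "pb_fst C f g\<cdot>u = h" "pb_snd C f g\<cdot>u = k"
    using pullback_ex[OF pb[OF assms(1-3)] assms(4-9)] .
  have "pb_lift C f g h k = u" unfolding pb_lift_def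
    by (rule the_equality)
      (use u assms(1-8) in \<open>auto simp: hom_iff intro: pb_ext[of f g]\<close>)
  then show "arr (pb_lift C f g h k)" "dom (pb_lift C f g h k) = dom k"
    "cod (pb_lift C f g h k) = pb_ob C f g"
    "pb_fst C f g\<cdot>pb_lift C f g h k = h" "pb_snd C f g\<cdot>pb_lift C f g h k = k"
    using u assms(1-8) by auto
qed

lemma pb_lift_eqI:
  assumes "arr f" "arr g" "cod f = cod g"
    "arr u" "cod u = pb_ob C f g"
    "pb_fst C f g\<cdot>u = h" "pb_snd C f g\<cdot>u = k"
  shows "pb_lift C f g h k = u"
proof -
  have "f\<cdot>h = g\<cdot>k" "arr h" "arr k" "dom h = dom u" "dom k = dom u"
    "cod h = dom f" "cod k = dom g"
    unfolding assms(6,7)[symmetric] using assms(1-5) by auto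
  then show ?thesis
    by - (rule pb_ext[of f g], use assms in \<open>auto simp: pb_lift\<close>)
qed

end

section \<open>Effective descent without choices\<close>

context category
begin

text \<open>\<open>h\<close> is an algebra structure on \<open>g\<close> for the descent monad of \<open>q\<close>. Its unit and associativity laws are
  expressed by means of arbitrary pullbacks, with \<open>u\<close>, \<open>v\<close> and \<open>v'\<close> induced by their universal property.\<close>

definition descent_datum where
  "descent_datum q g p1 p2 h r1 r2 u v v' \<longleftrightarrow> arr g \<and> cod g = dom q \<and>
    is_pullback C q (q\<cdot>g) p1 p2 \<and> is_pullback C q (q\<cdot>p1) r1 r2 \<and>
    arr h \<and> dom h = dom p1 \<and> cod h = dom g \<and> g\<cdot>h = p1 \<and>
    arr u \<and> dom u = dom g \<and> cod u = dom p1 \<and>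
    p1\<cdot>u = g \<and> p2\<cdot>u = Ident C (dom g) \<and> h\<cdot>u = Ident C (dom g) \<and>
    arr v \<and> dom v = dom r1 \<and> cod v = dom p1 \<and> p1\<cdot>v = r1 \<and> p2\<cdot>v = h\<cdot>r2 \<and>
    arr v' \<and> dom v' = dom r1 \<and> cod v' = dom p1 \<and>
    p1\<cdot>v' = r1 \<and> p2\<cdot>v' = p2\<cdot>r2 \<and> h\<cdot>v = h\<cdot>v'"

text \<open>A datum is effective when it is isomorphic to the canonical one on a pullback of some
  \<open>r\<close>. Of the canonical action only the composite with the projection \<open>k\<close>
  matters, since its other component is prescribed by \<open>g\<cdot>h = p1\<close>.\<close>

definition descent_effective where
  "descent_effective q \<longleftrightarrow> (\<forall>g p1 p2 h r1 r2 u v v'. descent_datum q g p1 p2 h r1 r2 u v v' \<longrightarrow>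
    (\<exists>k r. is_pullback C q r g k \<and> k\<cdot>h = k\<cdot>p2))"

text \<open>Every pullback of \<open>q\<close> is the coequalizer of its kernel pair, for arrows over the codomain of \<open>q\<close>.\<close>

definition descent_morphism where
  "descent_morphism q \<longleftrightarrow> (\<forall>r g k w1 w2 l r'.
    is_pullback C q r g k \<and> is_pullback C k k w1 w2 \<and> arr l \<and> dom l = dom k \<and>
    arr r' \<and> cod l = dom r' \<and> cod r' = cod q \<and> r'\<cdot>l = r\<cdot>k \<and> l\<cdot>w1 = l\<cdot>w2 \<longrightarrow>
    (\<exists>!t. arr t \<and> dom t = dom r \<and> cod t = dom r' \<and> r'\<cdot>t = r \<and> t\<cdot>k = l))"

end

lemma slice_simps [simp]:
  "f \<in> Obj (slice C b) \<longleftrightarrow> f \<in> Arr C \<and> Cod C f = b"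
  "Dom (slice C b) (f, h, g) = f" "Cod (slice C b) (f, h, g) = g"
  "Ident (slice C b) f = (f, Ident C (Dom C f), f)"
  "(g', k, l) \<cdot>\<^bsub>slice C b\<^esub> (f, h, g) = (f, k \<cdot>\<^bsub>C\<^esub> h, l)"
  by (simp_all add: slice_def)

lemma EM_simps [simp]:
  "Dom (EM C T) (x, f, y) = x" "Cod (EM C T) (x, f, y) = y"
  "Ident (EM C T) x = (x, Ident C (fst x), x)"
  "(y', g, z) \<cdot>\<^bsub>EM C T\<^esub> (x, f, y) = (x, g \<cdot>\<^bsub>C\<^esub> f, z)"
  by (simp_all add: EM_def split: prod.splits)

lemma (in category) slice_hom:
  "x \<in> hom (slice C b) f g \<longleftrightarrow> (\<exists>h. x = (f, h, g) \<and> arr f \<and> cod f = b \<and> arr g \<and>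
    cod g = b \<and> arr h \<and> dom h = dom f \<and> cod h = dom g \<and> g\<cdot>h = f)"
  by (cases x) (auto simp: slice_def hom_def)

lemma (in category) category_slice: "category (slice C b)"
proof
  fix f g A B D
  assume f: "f \<in> hom (slice C b) A B" and g: "g \<in> hom (slice C b) B D"
  obtain h k where fg: "f = (A, h, B)" "g = (B, k, D)"
    using f g by (auto simp: slice_hom)
  have a: "arr A" "cod A = b" "arr B" "cod B = b" "arr D" "cod D = b"
    "arr h" "dom h = dom A" "cod h = dom B" "B\<cdot>h = A"
    "arr k" "dom k = dom B" "cod k = dom D" "D\<cdot>k = B"
    using f g by (simp_all add: slice_hom fg)
  have "D\<cdot>(k\<cdot>h) = A"
    using comp_cong[OF a(14), of h] a by simp
  then show "g \<cdot>\<^bsub>slice C b\<^esub> f \<in> hom (slice C b) A D"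
    unfolding slice_hom fg using a by (simp add: slice_def)
next
  fix f g h A B D E
  assume "f \<in> hom (slice C b) A B" "g \<in> hom (slice C b) B D" "h \<in> hom (slice C b) D E"
  then obtain i j k where "f = (A, i, B)" "g = (B, j, D)" "h = (D, k, E)"
    "arr i" "arr j" "arr k" "cod i = dom B" "dom j = dom B" "cod j = dom D" "dom k = dom D"
    unfolding slice_hom by blast
  then show "h \<cdot>\<^bsub>slice C b\<^esub> (g \<cdot>\<^bsub>slice C b\<^esub> f) = (h \<cdot>\<^bsub>slice C b\<^esub> g) \<cdot>\<^bsub>slice C b\<^esub> f"
    by (simp add: slice_def)
next
  fix f A B
  assume f: "f \<in> hom (slice C b) A B"
  then obtain h where "f = (A, h, B)" "arr h" "dom h = dom A" "cod h = dom B"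
    unfolding slice_hom by blast
  then show "f \<cdot>\<^bsub>slice C b\<^esub> Ident (slice C b) A = f" "Ident (slice C b) B \<cdot>\<^bsub>slice C b\<^esub> f = f"
    by (simp_all add: slice_def)
next
  fix A assume "A \<in> Obj (slice C b)"
  then show "Ident (slice C b) A \<in> hom (slice C b) A A" by (simp add: slice_hom)
qed (auto simp: slice_def)

lemma (in category) category_EM:
  assumes "is_functor C C T"
  shows "category (EM C T)"
proof -
  note T = functorD[OF assms]
  show ?thesis
  proof
    fix f g A B D
    assume f: "f \<in> hom (EM C T) A B" and g: "g \<in> hom (EM C T) B D"
    obtain x h y k z l s t where [simp]: "A = (x, h)" "B = (y, k)" "D = (z, l)" "f = ((x, h), s, (y, k))"
      "g = ((y, k), t, (z, l))"
      using f g by (cases A; cases B; cases D) (auto simp: EM_def hom_def)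
    have a: "(x, h) \<in> EM_algebras C T" "(y, k) \<in> EM_algebras C T" "(z, l) \<in> EM_algebras C T"
      "arr s" "dom s = x" "cod s = y" "arr t" "dom t = y" "cod t = z"
      "s\<cdot>h = k\<cdot>FA T s" "t\<cdot>k = l\<cdot>FA T t"
      using f g by (auto simp: EM_def hom_def)
    have b: "arr h" "dom h = FO T x" "cod h = x" "arr k" "dom k = FO T y" "cod k = y"
      "arr l" "dom l = FO T z" "cod l = z"
      using a by (auto simp: EM_algebras_def hom_iff)
    have "(t\<cdot>s)\<cdot>h = t\<cdot>(k\<cdot>FA T s)" using a b by simp
    also have "\<dots> = l\<cdot>FA T (t\<cdot>s)" using a b T comp_cong[OF a(11), of "FA T s"] by simp
    finally show "g \<cdot>\<^bsub>EM C T\<^esub> f \<in> hom (EM C T) A D"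
      using a b by (auto simp: EM_def hom_def)
  qed (use T in \<open>auto simp: EM_def hom_def EM_algebras_def\<close>)
qed

section \<open>The descent monad and its algebras\<close>

locale descent_arrow = pullback_category +
  fixes q
  assumes q [simp]: "q \<in> Arr C"
begin

text \<open>The chosen pullback of \<open>q\<close> along \<open>q\<cdot>g\<close>; its first
  projection \<open>P1 g\<close>, as an object over \<open>dom q\<close>, is the value of the
  descent monad at \<open>g\<close>.\<close>

definition "P1 g = pb_fst C q (q\<cdot>g)"
definition "P2 g = pb_snd C q (q\<cdot>g)"
definition "PO g = pb_ob C q (q\<cdot>g)"
definition "L g x y = pb_lift C q (q\<cdot>g) x y"

lemma P_typed [simp]:
  assumes "arr g" "cod g = dom q"
  shows "arr (P1 g)" "arr (P2 g)" "dom (P1 g) = PO g" "dom (P2 g) = PO g"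
    "cod (P1 g) = dom q" "cod (P2 g) = dom g" "q\<cdot>P1 g = q\<cdot>(g\<cdot>P2 g)"
    "is_pullback C q (q\<cdot>g) (P1 g) (P2 g)"
  unfolding P1_def P2_def PO_def using assms pb[of q "q\<cdot>g"] by simp_all

lemma P_comm [simp]:
  assumes "arr g" "cod g = dom q" "arr k" "cod k = PO g"
  shows "q\<cdot>(P1 g\<cdot>k) = q\<cdot>(g\<cdot>(P2 g\<cdot>k))"
  using comp_cong[OF P_typed(7)[OF assms(1,2)], of k] assms by simp

lemma P_ext:
  assumes "arr g" "cod g = dom q"
    "arr u" "arr u'" "dom u = dom u'" "cod u = PO g" "cod u' = PO g"
    "P1 g\<cdot>u = P1 g\<cdot>u'" "P2 g\<cdot>u = P2 g\<cdot>u'"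
  shows "u = u'"
  by (rule pb_ext[of q "q\<cdot>g"]) (use assms in \<open>simp_all add: P1_def P2_def PO_def\<close>)

lemma L_typed:
  assumes "arr g" "cod g = dom q" "arr x" "arr y" "cod x = dom q" "cod y = dom g"
    "dom x = dom y" "q\<cdot>x = q\<cdot>(g\<cdot>y)"
  shows "arr (L g x y)" "dom (L g x y) = dom y" "cod (L g x y) = PO g"
    "P1 g\<cdot>L g x y = x" "P2 g\<cdot>L g x y = y"
  using pb_lift[of q "q\<cdot>g" x y] assms unfolding L_def P1_def P2_def PO_def by simp_all

lemma L_eqI:
  assumes "arr g" "cod g = dom q" "arr u" "cod u = PO g" "P1 g\<cdot>u = x" "P2 g\<cdot>u = y"
  shows "L g x y = u"
  unfolding L_def by (rule pb_lift_eqI) (use assms in \<open>simp_all add: P1_def P2_def PO_def\<close>)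

text \<open>Eilenberg-Moore algebras of the descent monad, freed from the triples that represent
  arrows of a slice.\<close>

definition alg where
  "alg g h \<longleftrightarrow> arr g \<and> cod g = dom q \<and> arr h \<and> dom h = PO g \<and>
    cod h = dom g \<and> g\<cdot>h = P1 g \<and>
    h\<cdot>L g g (Ident C (dom g)) = Ident C (dom g) \<and>
    h\<cdot>L g (P1 (P1 g)) (h\<cdot>P2 (P1 g)) = h\<cdot>L g (P1 (P1 g)) (P2 g\<cdot>P2 (P1 g))"

lemma algD:
  assumes "alg g h"
  shows "arr g" "cod g = dom q" "arr h" "dom h = PO g" "cod h = dom g" "g\<cdot>h = P1 g"
    "h\<cdot>L g g (Ident C (dom g)) = Ident C (dom g)"
    "h\<cdot>L g (P1 (P1 g)) (h\<cdot>P2 (P1 g)) = h\<cdot>L g (P1 (P1 g)) (P2 g\<cdot>P2 (P1 g))"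
  using assms by (auto simp: alg_def)

abbreviation "S \<equiv> slice C (dom q)"
abbreviation "M \<equiv> descent_monad C q"
abbreviation "\<Phi> \<equiv> EM_comparison (slice C (cod q)) (pull_functor C q) (pull_counit C q)"
text \<open>The canonical action on the pullback of \<open>r\<close>. In terms of elements, it sends
  a point \<open>e\<close> together with a pair \<open>(e', x)\<close> over the same base point to
  \<open>(e, x)\<close>.\<close>

definition "can r = pb_lift C q r (P1 (pb_fst C q r)) (pb_snd C q r\<cdot>P2 (pb_fst C q r))"

lemma M_simps:
  "FO M f = P1 f" "FA M (f, h, g) = (P1 f, L g (P1 f) (h\<cdot>P2 f), P1 g)"
  "Unit M f = (f, L f f (Ident C (dom f)), P1 f)"
  "Mult M f = (P1 (P1 f), L f (P1 (P1 f)) (P2 f\<cdot>P2 (P1 f)), P1 f)"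
  by (simp_all add: descent_monad_def adj_monad_def push_functor_def pull_functor_def pull_unit_def
    pull_counit_def P1_def P2_def L_def)

lemma action_lift:
  assumes "arr g" "cod g = dom q" "arr g'" "cod g' = dom q"
    "arr s" "dom s = dom g" "cod s = dom g'" "g'\<cdot>s = g"
  shows "arr (L g' (P1 g) (s\<cdot>P2 g))" "dom (L g' (P1 g) (s\<cdot>P2 g)) = PO g"
    "cod (L g' (P1 g) (s\<cdot>P2 g)) = PO g'"
    "P1 g'\<cdot>L g' (P1 g) (s\<cdot>P2 g) = P1 g" "P2 g'\<cdot>L g' (P1 g) (s\<cdot>P2 g) = s\<cdot>P2 g"
  using L_typed[of g' "P1 g" "s\<cdot>P2 g"] comp_cong[OF assms(8), of "P2 g"] assms by simp_all

lemma M_functor: "is_functor S S M"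
  unfolding is_functor_def
proof (intro conjI ballI impI)
  fix A assume "A \<in> Obj S"
  then have A: "arr A" "cod A = dom q" by (auto simp: slice_def)
  then show "FO M A \<in> Obj S" by (simp add: slice_def M_simps)
  have "L A (P1 A) (Ident C (dom A)\<cdot>P2 A) = Ident C (PO A)"
    by (rule L_eqI) (use A Obj_typed(1)[of "P1 A"] in simp_all)
  with A show "FA M (Ident S A) = Ident S (FO M A)" by (simp add: slice_def M_simps)
next
  fix x assume "x \<in> Arr S"
  then obtain f h g where x: "x = (f, h, g)" and a: "arr f" "cod f = dom q" "arr g" "cod g = dom q"
    "arr h" "dom h = dom f" "cod h = dom g" "g\<cdot>h = f"
    by (auto simp: slice_def hom_iff)
  note al = action_lift[OF a]
  show "FA M x \<in> hom S (FO M (Dom S x)) (FO M (Cod S x))"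
    using a al unfolding slice_hom x by (simp add: slice_def M_simps)
  fix y assume "y \<in> Arr S" "Cod S x = Dom S y"
  then obtain k l where y: "y = (g, k, l)" and b: "arr l" "cod l = dom q"
    "arr k" "dom k = dom g" "cod k = dom l" "l\<cdot>k = g"
    by (auto simp: slice_def hom_iff x)
  note bl = action_lift[OF a(3,4) b]
  have "L l (P1 f) ((k\<cdot>h)\<cdot>P2 f) = L l (P1 g) (k\<cdot>P2 g)\<cdot>L g (P1 f) (h\<cdot>P2 f)"
    by (rule L_eqI) (use a b al bl comp_cong[OF bl(4)] comp_cong[OF bl(5)] in simp_all)
  then show "FA M (y \<cdot>\<^bsub>S\<^esub> x) = FA M y \<cdot>\<^bsub>S\<^esub> FA M x"
    by (simp add: slice_def x y M_simps)
qed

text \<open>The structure map of an algebra is a slice triple whose outer components are forced;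
  only the middle arrow carries information.\<close>

lemma EM_alg: "(g, hh) \<in> EM_algebras S M \<longleftrightarrow> (\<exists>h. hh = (P1 g, h, g) \<and> alg g h)"
proof -
  have "(g, (x, h, y)) \<in> EM_algebras S M \<longleftrightarrow> x = P1 g \<and> y = g \<and> alg g h" for x h y
  proof (cases "arr g \<and> cod g = dom q")
    case True
    then show ?thesis
      unfolding EM_algebras_def mem_Collect_eq case_prod_conv slice_hom M_simps alg_def
      by (auto simp: slice_def M_simps)
  next
    case False
    then show ?thesis by (auto simp: EM_algebras_def alg_def slice_def)
  qed
  then show ?thesis by (cases hh) auto
qed

lemma EM_Arr: "((g, P1 g, h, g), (g1, s, g2), (g', P1 g', h', g')) \<in> Arr (EM S M) \<longleftrightarrow>
    alg g h \<and> alg g' h' \<and> g1 = g \<and> g2 = g' \<and> arr s \<and> dom s = dom g \<and> cod s = dom g' \<and>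
    g'\<cdot>s = g \<and> s\<cdot>h = h'\<cdot>L g' (P1 g) (s\<cdot>P2 g)"
  unfolding EM_def by (simp add: EM_alg slice_hom) (auto simp: slice_def M_simps alg_def)

lemma comparison: "FO \<Phi> r = (pb_fst C q r, P1 (pb_fst C q r), can r, pb_fst C q r)"
  by (simp add: EM_comparison_def pull_functor_def pull_counit_def can_def P1_def P2_def)

lemma can_typed:
  assumes "arr r" "cod r = cod q"
  shows "arr (can r)" "dom (can r) = PO (pb_fst C q r)" "cod (can r) = pb_ob C q r"
    "pb_fst C q r\<cdot>can r = P1 (pb_fst C q r)" "pb_snd C q r\<cdot>can r = pb_snd C q r\<cdot>P2 (pb_fst C q r)"
proof -
  have w: "q\<cdot>P1 (pb_fst C q r) = r\<cdot>(pb_snd C q r\<cdot>P2 (pb_fst C q r))"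
    using assms by simp
  show "arr (can r)" "dom (can r) = PO (pb_fst C q r)" "cod (can r) = pb_ob C q r"
    "pb_fst C q r\<cdot>can r = P1 (pb_fst C q r)" "pb_snd C q r\<cdot>can r = pb_snd C q r\<cdot>P2 (pb_fst C q r)"
    using pb_lift[OF _ _ _ _ _ _ _ _ w] assms unfolding can_def by simp_all
qed

lemma alg_can:
  assumes "arr r" "cod r = cod q"
  shows "alg (pb_fst C q r) (can r)"
proof -
  define d where "d = pb_fst C q r"
  define e where "e = pb_snd C q r"
  define c where "c = can r"
  have t: "arr d" "arr e" "dom d = pb_ob C q r" "dom e = pb_ob C q r" "cod d = dom q" "cod e = dom r"
    using assms by (simp_all add: d_def e_def)
  note c = can_typed[OF assms, folded d_def e_def c_def]
  note cc = comp_cong[OF c(4)] comp_cong[OF c(5)]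
  note n = L_typed[of d d "Ident C (dom d)"]
  define x where "x = P1 (P1 d)"
  define y where "y = P2 (P1 d)"
  have xy: "arr x" "arr y" "dom x = dom y" "cod x = dom q" "cod y = PO d"
    "q\<cdot>x = q\<cdot>(d\<cdot>(P2 d\<cdot>y))"
    using t by (simp_all add: x_def y_def)
  define l where "l = L d x (c\<cdot>y)"
  define m where "m = L d x (P2 d\<cdot>y)"
  have l: "arr l" "dom l = dom y" "cod l = PO d" "P1 d\<cdot>l = x" "P2 d\<cdot>l = c\<cdot>y"
    using L_typed[of d x "c\<cdot>y"] xy t c cc unfolding l_def by simp_all
  have m: "arr m" "dom m = dom y" "cod m = PO d" "P1 d\<cdot>m = x" "P2 d\<cdot>m = P2 d\<cdot>y"
    using L_typed[of d x "P2 d\<cdot>y"] xy t unfolding m_def by simp_all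
  have 1: "c\<cdot>L d d (Ident C (dom d)) = Ident C (dom d)"
    by (rule pb_ext[of q r]) (use assms t c n cc in \<open>simp_all flip: d_def e_def\<close>)
  have 2: "c\<cdot>l = c\<cdot>m"
    by (rule pb_ext[of q r]) (use assms t c(1-3) l m xy(1-5) cc in \<open>simp_all flip: d_def e_def\<close>)
  show ?thesis
    unfolding alg_def d_def[symmetric] e_def[symmetric] c_def[symmetric]
    using t c 1 2[unfolded l_def m_def x_def y_def] by simp
qed

lemma EM_hom_cases:
  assumes "x \<in> hom (EM S M) (g, P1 g, h, g) (g', P1 g', h', g')"
  obtains s where "x = ((g, P1 g, h, g), (g, s, g'), (g', P1 g', h', g'))" "alg g h" "alg g' h'"
    "arr s" "dom s = dom g" "cod s = dom g'"
    "g'\<cdot>s = g" "s\<cdot>h = h'\<cdot>L g' (P1 g) (s\<cdot>P2 g)"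
proof -
  obtain g1 s g2 where x: "x = ((g, P1 g, h, g), (g1, s, g2), (g', P1 g', h', g'))" "x \<in> Arr (EM S M)"
    using assms by (cases x) (auto simp: hom_def EM_def)
  show ?thesis using that x(2) unfolding x(1) EM_Arr by blast
qed

lemma EM_homI:
  assumes "alg g h" "alg g' h'" "arr s" "dom s = dom g" "cod s = dom g'"
    "g'\<cdot>s = g" "s\<cdot>h = h'\<cdot>L g' (P1 g) (s\<cdot>P2 g)"
  shows "((g, P1 g, h, g), (g, s, g'), (g', P1 g', h', g')) \<in> hom (EM S M) (g, P1 g, h, g) (g', P1 g', h', g')"
proof -
  have "((g, P1 g, h, g), (g, s, g'), (g', P1 g', h', g')) \<in> Arr (EM S M)"
    using assms unfolding EM_Arr by simp
  then show ?thesis unfolding hom_def by (simp add: EM_def)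
qed

lemma category_E: "category (EM S M)"
  by (rule category.category_EM[OF category_slice M_functor])

lemma comparison_arr:
  "FA \<Phi> (r, t, r') = (FO \<Phi> r, (pb_fst C q r, pb_lift C q r' (pb_fst C q r) (t\<cdot>pb_snd C q r), pb_fst C q r'), FO \<Phi> r')"
  if "arr r" "arr r'"
  unfolding comparison by (simp add: EM_comparison_def pull_functor_def pull_counit_def slice_def can_def P1_def P2_def)

lemma slice_pull:
  assumes "arr r" "cod r = cod q" "arr r'" "cod r' = cod q"
    "arr t" "dom t = dom r" "cod t = dom r'" "r'\<cdot>t = r"
  defines "s \<equiv> pb_lift C q r' (pb_fst C q r) (t\<cdot>pb_snd C q r)"
  shows "arr s" "dom s = pb_ob C q r" "cod s = pb_ob C q r'"
    "pb_fst C q r'\<cdot>s = pb_fst C q r" "pb_snd C q r'\<cdot>s = t\<cdot>pb_snd C q r"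
proof -
  have "q\<cdot>pb_fst C q r = r'\<cdot>(t\<cdot>pb_snd C q r)"
    using assms(1-7) comp_cong[OF assms(8), of "pb_snd C q r"] by simp
  note l = pb_lift[OF q assms(3) _ _ _ _ _ _ this]
  show "arr s" "dom s = pb_ob C q r" "cod s = pb_ob C q r'"
    "pb_fst C q r'\<cdot>s = pb_fst C q r" "pb_snd C q r'\<cdot>s = t\<cdot>pb_snd C q r"
    unfolding s_def using assms(1-7) l by simp_all
qed

text \<open>The two sides of equivariance always agree after the first projection, because
  \<open>s\<close> is an arrow over \<open>dom q\<close>. What remains is their agreement after the
  second projection, and there \<open>can\<close> is explicit.\<close>

lemma equivariant_iff:
  assumes r: "arr r" "cod r = cod q" "arr r'" "cod r' = cod q"
    and s: "arr s" "dom s = pb_ob C q r" "cod s = pb_ob C q r'" "pb_fst C q r'\<cdot>s = pb_fst C q r"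
  defines "k \<equiv> pb_snd C q r'\<cdot>s"
  shows "s\<cdot>can r = can r'\<cdot>L (pb_fst C q r') (P1 (pb_fst C q r)) (s\<cdot>P2 (pb_fst C q r)) \<longleftrightarrow>
    k\<cdot>can r = k\<cdot>P2 (pb_fst C q r)"
proof -
  note c = can_typed[OF r(1,2)] and c' = can_typed[OF r(3,4)]
  note l = action_lift[of "pb_fst C q r" "pb_fst C q r'" s, simplified r s pb_typed q, simplified]
  let ?l = "L (pb_fst C q r') (P1 (pb_fst C q r)) (s\<cdot>P2 (pb_fst C q r))"
  have rhs: "pb_snd C q r'\<cdot>(can r'\<cdot>?l) = k\<cdot>P2 (pb_fst C q r)"
    using comp_cong[OF c'(5), of ?l] c' l r s unfolding k_def by simp
  have lhs: "pb_snd C q r'\<cdot>(s\<cdot>can r) = k\<cdot>can r"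
    using c r s unfolding k_def by simp
  have "pb_fst C q r'\<cdot>(can r'\<cdot>?l) = pb_fst C q r'\<cdot>(s\<cdot>can r)"
    using comp_cong[OF c'(4), of ?l] comp_cong[OF s(4), of "can r"] c c' l r s by simp
  then have "pb_snd C q r'\<cdot>(s\<cdot>can r) = pb_snd C q r'\<cdot>(can r'\<cdot>?l) \<Longrightarrow> s\<cdot>can r = can r'\<cdot>?l"
    by - (rule pb_ext[of q r'], use c c' l r s in simp_all)
  with lhs rhs show ?thesis by metis
qed

lemma \<Phi>_arr:
  assumes r: "arr r" "cod r = cod q" "arr r'" "cod r' = cod q"
    "arr t" "dom t = dom r" "cod t = dom r'" "r'\<cdot>t = r"
  shows "FA \<Phi> (r, t, r') \<in> hom (EM S M) (FO \<Phi> r) (FO \<Phi> r')"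
  unfolding comparison_arr[OF r(1,3)] unfolding comparison
proof (rule EM_homI)
  note s = slice_pull[OF r] and c = can_typed[OF r(1,2)]
  show "pb_lift C q r' (pb_fst C q r) (t\<cdot>pb_snd C q r)\<cdot>can r = can r' \<cdot>
    L (pb_fst C q r') (P1 (pb_fst C q r)) (pb_lift C q r' (pb_fst C q r) (t\<cdot>pb_snd C q r)\<cdot>P2 (pb_fst C q r))"
    unfolding equivariant_iff[OF r(1-4) s(1-4)] s(5) using r c by simp
qed (use slice_pull[OF r] alg_can r in simp_all)

lemma \<Phi>_functor: "is_functor (slice C (cod q)) (EM S M) \<Phi>"
  unfolding is_functor_def
proof (intro conjI ballI impI)
  fix A assume "A \<in> Obj (slice C (cod q))"
  then have A: "arr A" "cod A = cod q" by (auto simp: slice_def)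
  show "FO \<Phi> A \<in> Obj (EM S M)"
    unfolding comparison using alg_can[OF A] by (simp add: EM_def EM_alg)
  have "pb_lift C q A (pb_fst C q A) (Ident C (dom A)\<cdot>pb_snd C q A) = Ident C (pb_ob C q A)"
    by (rule pb_lift_eqI) (use A in simp_all)
  then show "FA \<Phi> (Ident (slice C (cod q)) A) = Ident (EM S M) (FO \<Phi> A)"
    using A by (simp add: comparison_arr comparison)
next
  fix x assume "x \<in> Arr (slice C (cod q))"
  then obtain f h g where x: "x = (f, h, g)" and a: "arr f" "cod f = cod q" "arr g" "cod g = cod q"
    "arr h" "dom h = dom f" "cod h = dom g" "g\<cdot>h = f"
    by (auto simp: slice_def hom_iff)
  show "FA \<Phi> x \<in> hom (EM S M) (FO \<Phi> (Dom (slice C (cod q)) x)) (FO \<Phi> (Cod (slice C (cod q)) x))"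
    using \<Phi>_arr[OF a] by (simp add: x)
  fix y assume "y \<in> Arr (slice C (cod q))" "Cod (slice C (cod q)) x = Dom (slice C (cod q)) y"
  then obtain k l where y: "y = (g, k, l)" and b: "arr l" "cod l = cod q"
    "arr k" "dom k = dom g" "cod k = dom l" "l\<cdot>k = g"
    by (auto simp: slice_def hom_iff x)
  note sa = slice_pull[OF a] and sb = slice_pull[OF a(3,4) b]
  have "pb_lift C q l (pb_fst C q f) ((k\<cdot>h)\<cdot>pb_snd C q f) =
    pb_lift C q l (pb_fst C q g) (k\<cdot>pb_snd C q g)\<cdot>pb_lift C q g (pb_fst C q f) (h\<cdot>pb_snd C q f)"
    by (rule pb_lift_eqI)
      (use a(1-7) b(1-5) sa sb comp_cong[OF sb(4) sb(1) _ _ sa(1)] comp_cong[OF sb(5) sb(1) _ _ sa(1)] in simp_all)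
  then show "FA \<Phi> (y \<cdot>\<^bsub>slice C (cod q)\<^esub> x) = FA \<Phi> y \<cdot>\<^bsub>EM S M\<^esub> FA \<Phi> x"
    using a b by (simp add: x y comparison_arr)
qed

text \<open>The kernel pair of \<open>pb_snd q r\<close> is given by the canonical action and the second projection.\<close>

lemma kernel_pair_iff:
  assumes r: "arr r" "cod r = cod q" and pb': "is_pullback C q r g k"
    and w: "is_pullback C k k w1 w2"
    and i: "arr i" "dom i = pb_ob C q r" "cod i = dom k" "g\<cdot>i = pb_fst C q r" "k\<cdot>i = pb_snd C q r" "is_iso C i"
    and l: "arr l" "dom l = dom k"
  shows "l\<cdot>w1 = l\<cdot>w2 \<longleftrightarrow> (l\<cdot>i)\<cdot>can r = (l\<cdot>i)\<cdot>P2 (pb_fst C q r)"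
proof
  note c = can_typed[OF r] and t = pullback_typed[OF w] and t' = pullback_typed[OF pb']
  assume lw: "l\<cdot>w1 = l\<cdot>w2"
  have "k\<cdot>(i\<cdot>can r) = k\<cdot>(i\<cdot>P2 (pb_fst C q r))"
    using comp_cong[OF i(5), of "can r"] comp_cong[OF i(5), of "P2 (pb_fst C q r)"] i(1-5) c t'
    by simp
  then obtain w where "arr w" "dom w = PO (pb_fst C q r)" "cod w = dom w1" "w1\<cdot>w = i\<cdot>can r" "w2\<cdot>w = i\<cdot>P2 (pb_fst C q r)"
    using pullback_ex[OF w, of "i\<cdot>can r" "i\<cdot>P2 (pb_fst C q r)"] i(1-3) c t t' r by auto
  then show "(l\<cdot>i)\<cdot>can r = (l\<cdot>i)\<cdot>P2 (pb_fst C q r)"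
    using comp_cong[OF lw, of w] i(1-3) c t t' r l by simp
next
  note c = can_typed[OF r] and t = pullback_typed[OF w] and t' = pullback_typed[OF pb']
  assume lc: "(l\<cdot>i)\<cdot>can r = (l\<cdot>i)\<cdot>P2 (pb_fst C q r)"
  define j where "j = inv_arrow C i"
  have j: "arr j" "dom j = dom k" "cod j = pb_ob C q r" "i\<cdot>j = Ident C (dom k)"
    using inv_arrow[OF i(6)] i(1-3) by (simp_all add: j_def)
  have gj: "pb_fst C q r\<cdot>j = g" "pb_snd C q r\<cdot>j = k"
    unfolding i(4,5)[symmetric] using i(1-3) j t' by simp_all
  have e: "q\<cdot>(g\<cdot>w1) = q\<cdot>(pb_fst C q r\<cdot>(j\<cdot>w2))"
    using comp_cong[OF gj(1), of w2] comp_cong[OF t'(9), of w1] comp_cong[OF t'(9), of w2] j t t'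
    by (simp del: pb_comm)
  \<comment> \<open>The pair formed by the first coordinate of \<open>w1\<close> and the element
    \<open>w2\<close>. The action replaces the first coordinate of \<open>w2\<close> by that of
    \<open>w1\<close>, and since \<open>k\<close> identifies \<open>w1\<close> and \<open>w2\<close>
    the result is \<open>w1\<close>.\<close>
  define x where "x = L (pb_fst C q r) (g\<cdot>w1) (j\<cdot>w2)"
  have x: "arr x" "dom x = dom w1" "cod x = PO (pb_fst C q r)"
    "P1 (pb_fst C q r)\<cdot>x = g\<cdot>w1" "P2 (pb_fst C q r)\<cdot>x = j\<cdot>w2"
    using L_typed[OF _ _ _ _ _ _ _ e] j t t' unfolding x_def by simp_all
  have cx: "can r\<cdot>x = j\<cdot>w1"
    by (rule pb_ext[of q r])
      (use c x j t t' comp_cong[OF gj(1)] comp_cong[OF gj(2)] comp_cong[OF c(4), of x] comp_cong[OF c(5), of x] in simp_all)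
  have "(l\<cdot>(i\<cdot>can r))\<cdot>x = (l\<cdot>(i\<cdot>P2 (pb_fst C q r)))\<cdot>x"
    using lc r c l i(1-3) by simp
  then have "l\<cdot>(i\<cdot>(j\<cdot>w1)) = l\<cdot>(i\<cdot>(j\<cdot>w2))"
    using r c l i(1-3) x cx by simp
  then show "l\<cdot>w1 = l\<cdot>w2"
    using comp_cong[OF j(4), of w1] comp_cong[OF j(4), of w2] i(1-3) j t l by simp
qed

text \<open>By \<open>equivariant_iff\<close> and \<open>kernel_pair_iff\<close>, an arrow
  \<open>l\<close> that coequalizes the kernel pair of \<open>k\<close> is the same thing as an
  algebra homomorphism between canonical algebras. Full faithfulness of the comparison then yields
  exactly one factorization \<open>t\<close>.\<close>

lemma equivalence_imp_descent_morphism: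
  assumes eq: "is_equivalence (slice C (cod q)) (EM S M) \<Phi>"
  shows "descent_morphism q"
  unfolding descent_morphism_def
proof (intro allI impI, elim conjE)
  fix r g k w1 w2 l r'
  assume pb': "is_pullback C q r g k" and w: "is_pullback C k k w1 w2"
    and l: "arr l" "dom l = dom k" "arr r'" "cod l = dom r'" "cod r' = cod q"
      "r'\<cdot>l = r\<cdot>k" "l\<cdot>w1 = l\<cdot>w2"
  note t = pullback_typed[OF pb']
  obtain i where i: "is_iso C i" "arr i" "dom i = pb_ob C q r" "cod i = dom g" "g\<cdot>i = pb_fst C q r" "k\<cdot>i = pb_snd C q r"
    using pullback_unique[OF pb' pb[of q r]] t by auto
  have ik: "cod i = dom k" using i t by simp
  have r: "arr r" "cod r = cod q" using t by auto
  define s where "s = pb_lift C q r' (pb_fst C q r) (l\<cdot>i)"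
  have li: "q\<cdot>pb_fst C q r = r'\<cdot>(l\<cdot>i)"
    using comp_cong[OF l(6), of i] i t l by simp
  have s: "arr s" "dom s = pb_ob C q r" "cod s = pb_ob C q r'" "pb_fst C q r'\<cdot>s = pb_fst C q r"
    "pb_snd C q r'\<cdot>s = l\<cdot>i"
    using pb_lift[OF q l(3) _ _ _ _ _ _ li] i ik l r unfolding s_def by simp_all
  have kp: "(l\<cdot>i)\<cdot>can r = (l\<cdot>i)\<cdot>P2 (pb_fst C q r)"
    using kernel_pair_iff[OF r pb' w i(2,3) ik i(5,6,1) l(1,2)] l by blast
  have eqv: "s\<cdot>can r = can r'\<cdot>L (pb_fst C q r') (P1 (pb_fst C q r)) (s\<cdot>P2 (pb_fst C q r))"
    unfolding equivariant_iff[OF r l(3,5) s(1-4)] s(5) by (rule kp)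
  have sh: "(FO \<Phi> r, (pb_fst C q r, s, pb_fst C q r'), FO \<Phi> r') \<in> hom (EM S M) (FO \<Phi> r) (FO \<Phi> r')"
    unfolding comparison by (rule EM_homI) (use alg_can r l s eqv in simp_all)
  have ex: "\<exists>!f. f \<in> hom (slice C (cod q)) r r' \<and> FA \<Phi> f = (FO \<Phi> r, (pb_fst C q r, s, pb_fst C q r'), FO \<Phi> r')"
    by (rule equivalence_full_faithful[OF category_slice category_E eq _ _ sh]) (use r l in simp_all)
  have lift_iff: "pb_lift C q r' (pb_fst C q r) (t\<cdot>pb_snd C q r) = s \<longleftrightarrow> t\<cdot>k = l"
    if t': "arr t" "dom t = dom r" "cod t = dom r'" "r'\<cdot>t = r" for t
  proof -
    note sp = slice_pull[OF r l(3,5) t']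
    have "pb_lift C q r' (pb_fst C q r) (t\<cdot>pb_snd C q r) = s \<longleftrightarrow> t\<cdot>pb_snd C q r = l\<cdot>i"
    proof
      assume "t\<cdot>pb_snd C q r = l\<cdot>i"
      then show "pb_lift C q r' (pb_fst C q r) (t\<cdot>pb_snd C q r) = s" by (simp add: s_def)
    qed (use sp(5) s(5) in metis)
    also have "\<dots> \<longleftrightarrow> (t\<cdot>k)\<cdot>i = l\<cdot>i" unfolding i(6)[symmetric] using t t' i by simp
    also have "\<dots> \<longleftrightarrow> t\<cdot>k = l"
    proof
      show "t\<cdot>k = l" if "(t\<cdot>k)\<cdot>i = l\<cdot>i"
        by (rule iso_cancel_right[OF i(1) _ _ _ _ that]) (use t(1-8) t'(1-3) ik l in simp_all)
    qed simp
    finally show ?thesis .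
  qed
  show "\<exists>!t. arr t \<and> dom t = dom r \<and> cod t = dom r' \<and> r'\<cdot>t = r \<and> t\<cdot>k = l"
  proof -
    obtain f where f: "f \<in> hom (slice C (cod q)) r r'" "FA \<Phi> f = (FO \<Phi> r, (pb_fst C q r, s, pb_fst C q r'), FO \<Phi> r')"
      using ex by blast
    obtain t where t: "f = (r, t, r')" "arr t" "dom t = dom r" "cod t = dom r'" "r'\<cdot>t = r"
      using f(1) unfolding slice_hom by blast
    have "t\<cdot>k = l" using f(2) lift_iff[OF t(2-5)] unfolding t(1) comparison_arr[OF r(1) l(3)] by simp
    moreover have "t' = t" if t': "arr t'" "dom t' = dom r" "cod t' = dom r'" "r'\<cdot>t' = r" "t'\<cdot>k = l" for t'
    proof -
      have "(r, t', r') \<in> hom (slice C (cod q)) r r'" unfolding slice_hom using t' l by auto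
      moreover have "FA \<Phi> (r, t', r') = (FO \<Phi> r, (pb_fst C q r, s, pb_fst C q r'), FO \<Phi> r')"
        using lift_iff[OF t'(1-4)] t'(5) unfolding comparison_arr[OF r(1) l(3)] by simp
      ultimately have "(r, t', r') = f" using ex f by blast
      then show ?thesis using t(1) by simp
    qed
    ultimately show ?thesis using t(2-5) by blast
  qed
qed

text \<open>The given pullbacks are compared with the chosen ones by \<open>i\<close>, along which
  \<open>h\<close> becomes an algebra \<open>h\<cdot>i\<close>. Essential surjectivity presents this
  algebra as the canonical one of some \<open>r\<close>; the underlying arrow \<open>s'\<close> of
  the isomorphism identifies \<open>g\<close> with the chosen pullback of \<open>r\<close>, and its
  equivariance is the equation for \<open>k\<close>.\<close>

lemma equivalence_imp_descent_effective:
  assumes eq: "is_equivalence (slice C (cod q)) (EM S M) \<Phi>"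
  shows "descent_effective q"
  unfolding descent_effective_def
proof (intro allI impI)
  fix g p1 p2 h r1 r2 u v v'
  assume "descent_datum q g p1 p2 h r1 r2 u v v'"
  then have g: "arr g" "cod g = dom q"
    and pb1: "is_pullback C q (q\<cdot>g) p1 p2" and pb2: "is_pullback C q (q\<cdot>p1) r1 r2"
    and h: "arr h" "dom h = dom p1" "cod h = dom g" "g\<cdot>h = p1"
    and u: "arr u" "dom u = dom g" "cod u = dom p1"
      "p1\<cdot>u = g" "p2\<cdot>u = Ident C (dom g)" "h\<cdot>u = Ident C (dom g)"
    and v: "arr v" "dom v = dom r1" "cod v = dom p1" "p1\<cdot>v = r1" "p2\<cdot>v = h\<cdot>r2"
    and v': "arr v'" "dom v' = dom r1" "cod v' = dom p1" "p1\<cdot>v' = r1" "p2\<cdot>v' = p2\<cdot>r2"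
    and hv: "h\<cdot>v = h\<cdot>v'"
    unfolding descent_datum_def by auto
  have p: "arr p1" "arr p2" "dom p2 = dom p1" "cod p1 = dom q" "cod p2 = dom g"
    "q\<cdot>p1 = q\<cdot>(g\<cdot>p2)"
    using pullback_typed[OF pb1] g by simp_all
  have r: "arr r1" "arr r2" "dom r2 = dom r1" "cod r1 = dom q" "cod r2 = dom p1"
    using pullback_typed[OF pb2] p(1-5) by simp_all
  obtain i where i: "is_iso C i" "arr i" "dom i = PO g" "cod i = dom p1" "p1\<cdot>i = P1 g" "p2\<cdot>i = P2 g"
    using pullback_unique[OF pb1 P_typed(8)[OF g]] g by auto
  note hi = comp_cong[OF i(5)] comp_cong[OF i(6)] comp_cong[OF h(4)] comp_cong[OF v(4)] comp_cong[OF v(5)]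
    comp_cong[OF v'(4)] comp_cong[OF v'(5)] comp_cong[OF p(6)]
  define x where "x = P1 (P1 g)"
  define y where "y = P2 (P1 g)"
  have xy: "arr x" "arr y" "dom x = dom y" "cod x = dom q" "cod y = PO g"
    "q\<cdot>x = q\<cdot>(g\<cdot>(P2 g\<cdot>y))"
    using g by (simp_all add: x_def y_def)
  obtain j where j: "arr j" "dom j = dom y" "cod j = dom r1" "r1\<cdot>j = x" "r2\<cdot>j = i\<cdot>y"
    by (rule pullback_ex[OF pb2, of x "i\<cdot>y"]) (use xy i g p hi in simp_all)
  note jj = comp_cong[OF hv] comp_cong[OF j(4)] comp_cong[OF j(5)]
  have i1: "i\<cdot>L g g (Ident C (dom g)) = u"
    by (rule pullback_eq[OF pb1]) (use L_typed[of g g "Ident C (dom g)"] g i(2-6) p u hi in simp_all)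
  have l: "arr (L g x (h\<cdot>(i\<cdot>y)))" "dom (L g x (h\<cdot>(i\<cdot>y))) = dom y" "cod (L g x (h\<cdot>(i\<cdot>y))) = PO g"
    "P1 g\<cdot>L g x (h\<cdot>(i\<cdot>y)) = x" "P2 g\<cdot>L g x (h\<cdot>(i\<cdot>y)) = h\<cdot>(i\<cdot>y)"
    using L_typed[of g x "h\<cdot>(i\<cdot>y)"] g xy i(2-6) h p hi by simp_all
  have m: "arr (L g x (P2 g\<cdot>y))" "dom (L g x (P2 g\<cdot>y)) = dom y" "cod (L g x (P2 g\<cdot>y)) = PO g"
    "P1 g\<cdot>L g x (P2 g\<cdot>y) = x" "P2 g\<cdot>L g x (P2 g\<cdot>y) = P2 g\<cdot>y"
    using L_typed[of g x "P2 g\<cdot>y"] g xy by simp_all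
  have i2: "i\<cdot>L g x (h\<cdot>(i\<cdot>y)) = v\<cdot>j"
    by (rule pullback_eq[OF pb1]) (use l i(2-6) p(1-5) v j r hi(1-7) h in simp_all)
  have i3: "i\<cdot>L g x (P2 g\<cdot>y) = v'\<cdot>j"
    by (rule pullback_eq[OF pb1]) (use m i(2-6) p(1-5) v' j r hi(1-7) xy(1-5) in simp_all)
  have "(h\<cdot>i)\<cdot>L g x ((h\<cdot>i)\<cdot>y) = h\<cdot>(v\<cdot>j)"
    using i2 l h i(2-4) xy(1-5) by simp
  moreover have "(h\<cdot>i)\<cdot>L g x (P2 g\<cdot>y) = h\<cdot>(v'\<cdot>j)"
    using i3 m h i(2-4) by simp
  moreover have "h\<cdot>(v\<cdot>j) = h\<cdot>(v'\<cdot>j)" using jj(1)[of j] h v v' j by simp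
  ultimately have as: "(h\<cdot>i)\<cdot>L g x ((h\<cdot>i)\<cdot>y) = (h\<cdot>i)\<cdot>L g x (P2 g\<cdot>y)" by simp
  have un: "(h\<cdot>i)\<cdot>L g g (Ident C (dom g)) = Ident C (dom g)"
    using i1 u h i(2-4) L_typed[of g g "Ident C (dom g)"] g by simp
  have "alg g (h\<cdot>i)"
    unfolding alg_def using as un g h i hi by (simp add: x_def y_def)
  then have "(g, P1 g, h\<cdot>i, g) \<in> Obj (EM S M)" by (simp add: EM_def EM_alg)
  then obtain r z where z: "r \<in> Obj (slice C (cod q))" "is_iso (EM S M) z" "z \<in> hom (EM S M) (FO \<Phi> r) (g, P1 g, h\<cdot>i, g)"
    using equivalence_ess_surj[OF eq] by blast
  have r: "arr r" "cod r = cod q" using z by simp_all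
  note c = can_typed[OF r]
  interpret E: category "EM S M" by (rule category_E)
  obtain z' where z': "z' \<in> hom (EM S M) (g, P1 g, h\<cdot>i, g) (FO \<Phi> r)" "z' \<cdot>\<^bsub>EM S M\<^esub> z = Ident (EM S M) (FO \<Phi> r)"
    "z \<cdot>\<^bsub>EM S M\<^esub> z' = Ident (EM S M) (g, P1 g, h\<cdot>i, g)"
    using E.isoE[OF z(2)] z(3) by (metis E.hom_iff)
  obtain s where s: "z = ((pb_fst C q r, P1 (pb_fst C q r), can r, pb_fst C q r), (pb_fst C q r, s, g), (g, P1 g, h\<cdot>i, g))"
    "arr s" "dom s = pb_ob C q r" "cod s = dom g" "g\<cdot>s = pb_fst C q r"
    using z(3) r unfolding comparison by (auto elim: EM_hom_cases)
  obtain s' where s': "z' = ((g, P1 g, h\<cdot>i, g), (g, s', pb_fst C q r), (pb_fst C q r, P1 (pb_fst C q r), can r, pb_fst C q r))"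
    "alg g (h\<cdot>i)" "alg (pb_fst C q r) (can r)"
    "arr s'" "dom s' = dom g" "cod s' = dom (pb_fst C q r)" "pb_fst C q r\<cdot>s' = g"
    "s'\<cdot>(h\<cdot>i) = can r\<cdot>L (pb_fst C q r) (P1 g) (s'\<cdot>P2 g)"
    by (rule EM_hom_cases[OF z'(1)[unfolded comparison]])
  have "cod s' = pb_ob C q r" using s'(6) r by simp
  note s' = s'(1,4,5) this s'(7,8)
  have iso: "is_iso C s'"
    by (rule isoI[of s' s]) (use z'(2,3) r s s' in \<open>simp_all add: comparison\<close>)
  have pbk: "is_pullback C q r g (pb_snd C q r\<cdot>s')"
    using pullback_iso[OF pb iso, of q r] r s' by simp
  have al: "arr (L (pb_fst C q r) (P1 g) (s'\<cdot>P2 g))" "dom (L (pb_fst C q r) (P1 g) (s'\<cdot>P2 g)) = PO g"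
    "cod (L (pb_fst C q r) (P1 g) (s'\<cdot>P2 g)) = PO (pb_fst C q r)"
    "P2 (pb_fst C q r)\<cdot>L (pb_fst C q r) (P1 g) (s'\<cdot>P2 g) = s'\<cdot>P2 g"
    using action_lift[of g "pb_fst C q r" s'] g r s' by simp_all
  have "((pb_snd C q r\<cdot>s')\<cdot>h)\<cdot>i = ((pb_snd C q r\<cdot>s')\<cdot>p2)\<cdot>i"
  proof -
    have "pb_snd C q r\<cdot>(s'\<cdot>(h\<cdot>i)) = pb_snd C q r\<cdot>(s'\<cdot>P2 g)"
      unfolding s'(6) using comp_cong[OF c(5) _ _ _ al(1)] r c(1-3) al by simp
    then have "pb_snd C q r\<cdot>(s'\<cdot>(h\<cdot>i)) = pb_snd C q r\<cdot>(s'\<cdot>(p2\<cdot>i))"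
      unfolding i(6) .
    then show ?thesis using s'(2-4) r g h(1-3) i(2-4) p(1-5) by simp
  qed
  then have "(pb_snd C q r\<cdot>s')\<cdot>h = (pb_snd C q r\<cdot>s')\<cdot>p2"
    by - (rule iso_cancel_right[OF i(1)], use s' r g h i p in simp_all)
  with pbk show "\<exists>k r. is_pullback C q r g k \<and> k\<cdot>h = k\<cdot>p2" by blast
qed

text \<open>The correspondence between homomorphisms and arrows coequalizing a kernel pair gives
  full faithfulness. For essential surjectivity, effectiveness provides \<open>r\<close> and an
  isomorphism \<open>i\<close> onto its chosen pullback; the equation
  \<open>k\<cdot>h = k\<cdot>P2 g\<close> is what makes \<open>i\<close> a homomorphism.\<close>

lemma equivalence_if:
  assumes dm: "descent_morphism q" and de: "descent_effective q"
  shows "is_equivalence (slice C (cod q)) (EM S M) \<Phi>"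
proof (rule equivalenceI[OF category_slice category_E \<Phi>_functor])
  fix r r' z
  assume "r \<in> Obj (slice C (cod q))" "r' \<in> Obj (slice C (cod q))"
    and z: "z \<in> hom (EM S M) (FO \<Phi> r) (FO \<Phi> r')"
  then have r: "arr r" "cod r = cod q" "arr r'" "cod r' = cod q" by auto
  let ?d = "pb_fst C q r" and ?e = "pb_snd C q r"
  have i: "arr (Ident C (pb_ob C q r))" "is_iso C (Ident C (pb_ob C q r))"
    using r isoI[of "Ident C (pb_ob C q r)" "Ident C (pb_ob C q r)"] by simp_all
  obtain s where s: "z = (FO \<Phi> r, (?d, s, pb_fst C q r'), FO \<Phi> r')"
    "arr s" "dom s = pb_ob C q r" "cod s = pb_ob C q r'" "pb_fst C q r'\<cdot>s = ?d"
    "s\<cdot>can r = can r'\<cdot>L (pb_fst C q r') (P1 ?d) (s\<cdot>P2 ?d)"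
    using z r unfolding comparison by (auto elim: EM_hom_cases)
  define l where "l = pb_snd C q r'\<cdot>s"
  have l: "arr l" "dom l = dom ?e" "cod l = dom r'" "r'\<cdot>l = r\<cdot>?e"
  proof -
    have "r'\<cdot>l = q\<cdot>(pb_fst C q r'\<cdot>s)" using r s(2-4) by (simp add: l_def)
    also have "\<dots> = r\<cdot>?e" unfolding s(5) using r by simp
    finally show "r'\<cdot>l = r\<cdot>?e" .
  qed (use r s in \<open>simp_all add: l_def\<close>)
  have kp: "l\<cdot>can r = l\<cdot>P2 ?d"
    using equivariant_iff[OF r s(2-5)] s(6) unfolding l_def by blast
  have w: "is_pullback C ?e ?e (pb_fst C ?e ?e) (pb_snd C ?e ?e)" using r by (intro pb) auto
  have "l\<cdot>pb_fst C ?e ?e = l\<cdot>pb_snd C ?e ?e"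
    by (subst kernel_pair_iff[OF r(1,2) pb[OF q r(1)] w, of "Ident C (pb_ob C q r)"]) (use r l i kp in simp_all)
  then have ex: "\<exists>!t. arr t \<and> dom t = dom r \<and> cod t = dom r' \<and> r'\<cdot>t = r \<and> t\<cdot>?e = l"
    using dm[unfolded descent_morphism_def, rule_format, of r ?d ?e _ _ l r'] pb[OF q r(1)] w l r by auto
  have lift_iff: "pb_lift C q r' ?d (t\<cdot>?e) = s \<longleftrightarrow> t\<cdot>?e = l"
    if t': "arr t" "dom t = dom r" "cod t = dom r'" "r'\<cdot>t = r" for t
  proof
    show "pb_lift C q r' ?d (t\<cdot>?e) = s \<Longrightarrow> t\<cdot>?e = l"
      using slice_pull(5)[OF r t'] l_def by metis
    show "t\<cdot>?e = l \<Longrightarrow> pb_lift C q r' ?d (t\<cdot>?e) = s"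
      by (rule pb_lift_eqI) (use r s l_def in auto)
  qed
  have A: "FA \<Phi> (r, t, r') = z \<longleftrightarrow> t\<cdot>?e = l"
    if t': "arr t" "dom t = dom r" "cod t = dom r'" "r'\<cdot>t = r" for t
    unfolding comparison_arr[OF r(1,3)] s(1) using lift_iff[OF that] by simp
  obtain t where t: "arr t" "dom t = dom r" "cod t = dom r'" "r'\<cdot>t = r" "t\<cdot>?e = l"
    using ex by blast
  show "\<exists>!f. f \<in> hom (slice C (cod q)) r r' \<and> FA \<Phi> f = z"
  proof (rule ex1I[of _ "(r, t, r')"])
    show "(r, t, r') \<in> hom (slice C (cod q)) r r' \<and> FA \<Phi> (r, t, r') = z"
      using A[OF t(1-4)] t r unfolding slice_hom by auto
    fix f assume f: "f \<in> hom (slice C (cod q)) r r' \<and> FA \<Phi> f = z"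
    then obtain t' where t': "f = (r, t', r')" "arr t'" "dom t' = dom r" "cod t' = dom r'" "r'\<cdot>t' = r"
      unfolding slice_hom by blast
    then have "t'\<cdot>?e = l" using A[OF t'(2-5)] f by simp
    then have "t' = t" using ex t t' by blast
    then show "f = (r, t, r')" using t' by simp
  qed
next
  fix Y assume Y: "Y \<in> Obj (EM S M)"
  obtain g hh where "Y = (g, hh)" by (cases Y)
  with Y obtain h where h: "Y = (g, P1 g, h, g)" "alg g h" by (auto simp: EM_def EM_alg)
  note a = algD[OF h(2)]
  define x where "x = P1 (P1 g)"
  define y where "y = P2 (P1 g)"
  have xy: "arr x" "arr y" "dom x = dom y" "cod x = dom q" "cod y = PO g"
    "q\<cdot>x = q\<cdot>(g\<cdot>(P2 g\<cdot>y))" "dom x = PO (P1 g)"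
    using a(1,2) by (simp_all add: x_def y_def)
  have l: "arr (L g x (h\<cdot>y))" "dom (L g x (h\<cdot>y)) = dom y" "cod (L g x (h\<cdot>y)) = PO g"
    "P1 g\<cdot>L g x (h\<cdot>y) = x" "P2 g\<cdot>L g x (h\<cdot>y) = h\<cdot>y"
    using L_typed[of g x "h\<cdot>y"] a(1-5) xy comp_cong[OF a(6), of y] by simp_all
  have m: "arr (L g x (P2 g\<cdot>y))" "dom (L g x (P2 g\<cdot>y)) = dom y" "cod (L g x (P2 g\<cdot>y)) = PO g"
    "P1 g\<cdot>L g x (P2 g\<cdot>y) = x" "P2 g\<cdot>L g x (P2 g\<cdot>y) = P2 g\<cdot>y"
    using L_typed[of g x "P2 g\<cdot>y"] a(1,2) xy by simp_all
  have "descent_datum q g (P1 g) (P2 g) h x y (L g g (Ident C (dom g))) (L g x (h\<cdot>y)) (L g x (P2 g\<cdot>y))"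
    unfolding descent_datum_def
    using a(1-6) a(7) a(8)[folded x_def y_def] l m L_typed[of g g "Ident C (dom g)"] xy P_typed(8)[of "P1 g", folded x_def y_def] by simp
  then obtain k r where kr: "is_pullback C q r g k" "k\<cdot>h = k\<cdot>P2 g"
    using de unfolding descent_effective_def by blast
  note t = pullback_typed[OF kr(1)]
  have r: "arr r" "cod r = cod q" using t by auto
  note c = can_typed[OF r]
  let ?d = "pb_fst C q r" and ?e = "pb_snd C q r"
  obtain i where i: "is_iso C i" "arr i" "dom i = dom g" "cod i = pb_ob C q r" "?d\<cdot>i = g" "?e\<cdot>i = k"
    using pullback_unique[OF pb[OF q r(1)] kr(1)] r by auto
  have dt: "arr ?d" "cod ?d = dom q" "cod i = dom ?d" using r i by simp_all
  note al = action_lift[OF a(1,2) dt(1,2) i(2,3) dt(3) i(5)]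
  have eqv: "i\<cdot>h = can r\<cdot>L ?d (P1 g) (i\<cdot>P2 g)"
    by (rule pb_ext[of q r]) (use a(1-6) i(2-6) al c t kr(2) comp_cong[OF i(5), of h] comp_cong[OF i(6), of h] comp_cong[OF i(6), of "P2 g"] comp_cong[OF c(4) _ _ _ al(1)] comp_cong[OF c(5) _ _ _ al(1)] in simp_all)
  define j where "j = inv_arrow C i"
  have j: "arr j" "dom j = pb_ob C q r" "cod j = dom g" "i\<cdot>j = Ident C (pb_ob C q r)" "j\<cdot>i = Ident C (dom g)"
    using inv_arrow[OF i(1)] i(2-4) by (simp_all add: j_def)
  have gj: "g\<cdot>j = ?d" unfolding i(5)[symmetric] using i(2-4) j r by simp
  have jt: "dom j = dom ?d" using j r by simp
  note bl = action_lift[OF dt(1,2) a(1,2) j(1) jt j(3) gj]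
  \<comment> \<open>The action of the monad on \<open>j\<close> is right inverse to that on
    \<open>i\<close>. This turns equivariance of \<open>i\<close> into equivariance of its inverse,
    so that \<open>i\<close> is an isomorphism of algebras.\<close>
  have id: "L ?d (P1 g) (i\<cdot>P2 g)\<cdot>L g (P1 ?d) (j\<cdot>P2 ?d) = Ident C (PO ?d)"
    by (rule P_ext[of ?d]) (use al bl i(2-4) j a(1,2) r Obj_typed(1)[of "P1 ?d"] comp_cong[OF al(4) _ _ _ bl(1)] comp_cong[OF al(5) _ _ _ bl(1)] comp_cong[OF j(4), of "P2 ?d"] in simp_all)
  have eqv': "j\<cdot>can r = h\<cdot>L g (P1 ?d) (j\<cdot>P2 ?d)"
  proof (rule iso_cancel_left[OF i(1)])
    have "i\<cdot>(h\<cdot>L g (P1 ?d) (j\<cdot>P2 ?d)) = can r\<cdot>(L ?d (P1 g) (i\<cdot>P2 g)\<cdot>L g (P1 ?d) (j\<cdot>P2 ?d))"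
      using comp_cong[OF eqv _ _ _ bl(1)] al bl c a(1-6) i(2-4) by simp
    also have "\<dots> = can r" unfolding id using c by simp
    finally show "i\<cdot>(j\<cdot>can r) = i\<cdot>(h\<cdot>L g (P1 ?d) (j\<cdot>P2 ?d))"
      using comp_cong[OF j(4), of "can r"] c i(2-4) j r by simp
  qed (use i j c bl a(1-6) in simp_all)
  have ih: "((g, P1 g, h, g), (g, i, ?d), FO \<Phi> r) \<in> hom (EM S M) Y (FO \<Phi> r)"
    unfolding comparison h(1) by (rule EM_homI) (use h(2) alg_can r i eqv in simp_all)
  have jh: "(FO \<Phi> r, (?d, j, g), (g, P1 g, h, g)) \<in> hom (EM S M) (FO \<Phi> r) Y"
    unfolding comparison h(1) by (rule EM_homI) (use h(2) alg_can r j gj eqv' in simp_all)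
  interpret E: category "EM S M" by (rule category_E)
  have "is_iso (EM S M) (FO \<Phi> r, (?d, j, g), (g, P1 g, h, g))"
    by (rule E.isoI[where g = "((g, P1 g, h, g), (g, i, ?d), FO \<Phi> r)"])
      (use ih jh j r in \<open>simp_all add: E.hom_iff comparison h(1)\<close>)
  then show "\<exists>X\<in>Obj (slice C (cod q)). \<exists>i. is_iso (EM S M) i \<and> i \<in> hom (EM S M) (FO \<Phi> X) Y"
    using jh r by (intro bexI[of _ r] exI conjI) simp_all
qed

end

text \<open>The conditions on the right involve neither a chosen pullback nor a monad, so they can
  be compared along a functor that preserves pullbacks only up to isomorphism.\<close>

theorem (in category) effective_descent_iff:
  "effective_descent C q \<longleftrightarrow> has_pullbacks C \<and> arr q \<and> descent_morphism q \<and> descent_effective q"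
proof (cases "has_pullbacks C \<and> arr q")
  case True
  then interpret descent_arrow C q by unfold_locales auto
  show ?thesis
    using equivalence_if equivalence_imp_descent_morphism equivalence_imp_descent_effective
    unfolding effective_descent_def by blast
qed (auto simp: effective_descent_def)

section \<open>Fully faithful functors reflecting effective descent\<close>

text \<open>Pullbacks are assumed in \<open>C\<close> only. Those of \<open>A\<close> are obtained
  by replacing the vertex of a pullback in \<open>C\<close> by an isomorphic object in the image of
  \<open>K\<close>.\<close>

locale reflection =
  A: category A + category C
  for A :: "('o, 'a) cat" and C :: "('p, 'b) cat" (structure) +
  fixes K :: "('o, 'a, 'p, 'b) ftor"
  assumes ff: "fully_faithful A C K"
    and C_pullbacks: "has_pullbacks C"
    and pullback_in_image: "\<And>f g p q. \<lbrakk>f \<in> Arr A; g \<in> Arr A; Cod A f = Cod A g; is_pullback C (FA K f) (FA K g) p q\<rbrakk>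
      \<Longrightarrow> \<exists>W\<in>Obj A. \<exists>i. is_iso C i \<and> i \<in> hom C (FO K W) (Dom C p)"
begin

lemma F: "is_functor A C K"
  using ff by (simp add: fully_faithful_def)

lemmas K [simp] = functorD(1-4)[OF F]
lemmas K_comp = functorD(6)[OF F]

lemma full:
  assumes "arr g" "dom g = FO K X" "cod g = FO K Y" "X \<in> Obj A" "Y \<in> Obj A"
  obtains f where "A.arr f" "A.dom f = X" "A.cod f = Y" "FA K f = g"
  using A.fully_faithful_bij[OF ff assms(4,5), of g] assms by (auto simp: hom_iff)

lemma faithful:
  assumes "FA K f = FA K f'" "A.arr f" "A.arr f'" "A.dom f = A.dom f'" "A.cod f = A.cod f'"
  shows "f = f'"
  using A.fully_faithful_inj[OF ff] assms by blast

lemma reflects_pullback: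
  assumes "A.arr f" "A.arr g" "A.arr p" "A.arr q" "A.cod f = A.cod g"
    "A.cod p = A.dom f" "A.cod q = A.dom g" "A.dom p = A.dom q"
    and pb: "is_pullback C (FA K f) (FA K g) (FA K p) (FA K q)"
  shows "is_pullback A f g p q"
proof (rule A.pullbackI)
  have "FA K (f \<cdot>\<^bsub>A\<^esub> p) = FA K (g \<cdot>\<^bsub>A\<^esub> q)"
    using pullback_typed(9)[OF pb] K_comp assms(1-8) by simp
  then show "f \<cdot>\<^bsub>A\<^esub> p = g \<cdot>\<^bsub>A\<^esub> q" by (rule faithful) (use assms(1-8) in simp_all)
next
  fix h k assume h: "A.arr h" "A.arr k" "A.dom h = A.dom k" "A.cod h = A.dom f" "A.cod k = A.dom g" "f \<cdot>\<^bsub>A\<^esub> h = g \<cdot>\<^bsub>A\<^esub> k"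
  have e: "FA K f\<cdot>FA K h = FA K g\<cdot>FA K k"
    using K_comp[of h f] K_comp[of k g] h assms(1,2) by simp
  obtain u where u: "arr u" "dom u = dom (FA K h)" "cod u = dom (FA K p)" "FA K p\<cdot>u = FA K h" "FA K q\<cdot>u = FA K k"
    by (rule pullback_ex[OF pb, of "FA K h" "FA K k"]) (use h assms(1-8) e in auto)
  obtain u' where u': "A.arr u'" "A.dom u' = A.dom h" "A.cod u' = A.dom p" "FA K u' = u"
    by (rule full[of u "A.dom h" "A.dom p"]) (use u(1-3) h assms(1-8) in simp_all)
  have "p \<cdot>\<^bsub>A\<^esub> u' = h" by (rule faithful) (use u' u h assms(1-8) K_comp in simp_all)
  moreover have "q \<cdot>\<^bsub>A\<^esub> u' = k" by (rule faithful) (use u' u h assms(1-8) K_comp in simp_all)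
  ultimately show "\<exists>u. A.arr u \<and> A.dom u = A.dom h \<and> A.cod u = A.dom p \<and> p \<cdot>\<^bsub>A\<^esub> u = h \<and> q \<cdot>\<^bsub>A\<^esub> u = k"
    using u' by blast
next
  fix u u' assume u: "A.arr u" "A.arr u'" "A.dom u = A.dom u'" "A.cod u = A.dom p" "A.cod u' = A.dom p"
    "p \<cdot>\<^bsub>A\<^esub> u = p \<cdot>\<^bsub>A\<^esub> u'" "q \<cdot>\<^bsub>A\<^esub> u = q \<cdot>\<^bsub>A\<^esub> u'"
  have e: "FA K p\<cdot>FA K u = FA K p\<cdot>FA K u'" "FA K q\<cdot>FA K u = FA K q\<cdot>FA K u'"
    using K_comp[of u p] K_comp[of u' p] K_comp[of u q] K_comp[of u' q] u assms(1-8) by simp_all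
  have "FA K u = FA K u'"
    by (rule pullback_eq[OF pb]) (use u(1-5) assms(1-8) e in simp_all)
  then show "u = u'" by (rule faithful) (use u(1-5) in simp_all)
qed (use assms in auto)

lemma image_pullback:
  assumes "A.arr f" "A.arr g" "A.cod f = A.cod g"
  obtains p q where "is_pullback A f g p q" "is_pullback C (FA K f) (FA K g) (FA K p) (FA K q)"
proof -
  obtain p q where pq: "is_pullback C (FA K f) (FA K g) p q"
    using C_pullbacks assms unfolding has_pullbacks_def by fastforce
  note t = pullback_typed[OF pq]
  obtain W i where W: "W \<in> Obj A" "is_iso C i" "arr i" "dom i = FO K W" "cod i = dom p"
    using pullback_in_image[OF assms pq] by (auto simp: hom_iff)
  note pi = pullback_iso[OF pq W(2,5)]
  obtain p' where p': "A.arr p'" "A.dom p' = W" "A.cod p' = A.dom f" "FA K p' = p\<cdot>i"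
    by (rule full[of "p\<cdot>i" W "A.dom f"]) (use t W assms in simp_all)
  obtain q' where q': "A.arr q'" "A.dom q' = W" "A.cod q' = A.dom g" "FA K q' = q\<cdot>i"
    by (rule full[of "q\<cdot>i" W "A.dom g"]) (use t W assms in simp_all)
  have "is_pullback C (FA K f) (FA K g) (FA K p') (FA K q')" using pi p' q' by simp
  then show ?thesis using that reflects_pullback[OF assms(1,2) p'(1) q'(1) assms(3)] p' q' by simp
qed

lemma A_pullbacks: "has_pullbacks A"
  unfolding has_pullbacks_def using image_pullback by metis

text \<open>A pullback in \<open>A\<close> is isomorphic to the one produced by
  \<open>image_pullback\<close>, whose image is a pullback by construction.\<close>

lemma preserves_pullback:
  assumes pb: "is_pullback A f g p q"
  shows "is_pullback C (FA K f) (FA K g) (FA K p) (FA K q)"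
proof -
  note t = A.pullback_typed[OF pb]
  obtain p' q' where pq: "is_pullback A f g p' q'" "is_pullback C (FA K f) (FA K g) (FA K p') (FA K q')"
    using image_pullback[OF t(1,2) t(5)[symmetric]] .
  note t' = A.pullback_typed[OF pq(1)]
  obtain i where i: "is_iso A i" "A.arr i" "A.dom i = A.dom p" "A.cod i = A.dom p'" "p' \<cdot>\<^bsub>A\<^esub> i = p" "q' \<cdot>\<^bsub>A\<^esub> i = q"
    using A.pullback_unique[OF pq(1) pb] .
  have "is_iso C (FA K i)" by (rule functor_iso[OF A.category_axioms category_axioms F i(1)])
  from pullback_iso[OF pq(2) this] show ?thesis
    using K_comp[of i p'] K_comp[of i q'] i t' by simp
qed

text \<open>Arrows between objects of the image lift by full faithfulness, which settles the
  coequalizer condition. A descent datum, however, may be effective in \<open>C\<close> through an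
  object outside the image; \<open>descends\<close> excludes this, since the pullback of that object
  is in the image.\<close>

theorem reflects_effective_descent:
  assumes p: "A.arr p" and ed: "effective_descent C (FA K p)"
    and descends: "\<And>r g k W. \<lbrakk>is_pullback C (FA K p) r g k; W \<in> Obj A; dom g = FO K W\<rbrakk>
      \<Longrightarrow> \<exists>Y\<in>Obj A. \<exists>i. is_iso C i \<and> i \<in> hom C (FO K Y) (dom r)"
  shows "effective_descent A p"
  unfolding A.effective_descent_iff
proof (intro conjI A_pullbacks p)
  have dm: "descent_morphism (FA K p)" and de: "descent_effective (FA K p)"
    using ed unfolding effective_descent_iff by auto
  show "A.descent_morphism p"
    unfolding A.descent_morphism_def
  proof (intro allI impI, elim conjE)
    fix r g k w1 w2 l r'
    assume a: "is_pullback A p r g k" "is_pullback A k k w1 w2" "A.arr l" "A.dom l = A.dom k" "A.arr r'"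
      "A.cod l = A.dom r'" "A.cod r' = A.cod p" "r' \<cdot>\<^bsub>A\<^esub> l = r \<cdot>\<^bsub>A\<^esub> k" "l \<cdot>\<^bsub>A\<^esub> w1 = l \<cdot>\<^bsub>A\<^esub> w2"
    note t = A.pullback_typed[OF a(1)] and t' = A.pullback_typed[OF a(2)]
    have "FA K r'\<cdot>FA K l = FA K r\<cdot>FA K k" "FA K l\<cdot>FA K w1 = FA K l\<cdot>FA K w2"
      using K_comp[of l r'] K_comp[of k r] K_comp[of w1 l] K_comp[of w2 l] a(3-9) t(1-8) t'(1-8) by simp_all
    then have "\<exists>!t. arr t \<and> dom t = dom (FA K r) \<and> cod t = dom (FA K r') \<and>
        FA K r'\<cdot>t = FA K r \<and> t\<cdot>FA K k = FA K l"
      using dm[unfolded descent_morphism_def, rule_format, of "FA K r" "FA K g" "FA K k" "FA K w1" "FA K w2" "FA K l" "FA K r'"] preserves_pullback[OF a(1)] preserves_pullback[OF a(2)] a(3-7) t(1-8) by auto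
    then obtain x where x: "arr x" "dom x = dom (FA K r)" "cod x = dom (FA K r')"
        "FA K r'\<cdot>x = FA K r" "x\<cdot>FA K k = FA K l"
      and x_unique: "\<And>y. \<lbrakk>arr y; dom y = dom (FA K r); cod y = dom (FA K r');
        FA K r'\<cdot>y = FA K r; y\<cdot>FA K k = FA K l\<rbrakk> \<Longrightarrow> y = x"
      by blast
    obtain y where y: "A.arr y" "A.dom y = A.dom r" "A.cod y = A.dom r'" "FA K y = x"
      by (rule full[of x "A.dom r" "A.dom r'"]) (use x(1-3) t(1-8) a(5) in simp_all)
    have e: "r' \<cdot>\<^bsub>A\<^esub> y = r" by (rule faithful) (use y x a t K_comp in simp_all)
    have e': "y \<cdot>\<^bsub>A\<^esub> k = l" by (rule faithful) (use y x a t K_comp in simp_all)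
    show "\<exists>!t. A.arr t \<and> A.dom t = A.dom r \<and> A.cod t = A.dom r' \<and> r' \<cdot>\<^bsub>A\<^esub> t = r \<and> t \<cdot>\<^bsub>A\<^esub> k = l"
    proof (intro ex1I[of _ y] conjI y e e', elim conjE)
      fix z assume z: "A.arr z" "A.dom z = A.dom r" "A.cod z = A.dom r'" "r' \<cdot>\<^bsub>A\<^esub> z = r" "z \<cdot>\<^bsub>A\<^esub> k = l"
      have "FA K z = x"
        by (rule x_unique) (use K_comp[of z r'] K_comp[of k z] z a(5) t(1-8) in simp_all)
      then show "z = y" using y by (intro faithful) (use z in simp_all)
    qed
  qed
  show "A.descent_effective p"
    unfolding A.descent_effective_def
  proof (intro allI impI)
    fix g p1 p2 h r1 r2 u v v'
    assume d: "A.descent_datum p g p1 p2 h r1 r2 u v v'"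
    have pb: "is_pullback A p (p \<cdot>\<^bsub>A\<^esub> g) p1 p2" "is_pullback A p (p \<cdot>\<^bsub>A\<^esub> p1) r1 r2"
      and g: "A.arr g" "A.cod g = A.dom p"
      and h: "A.arr h" "A.dom h = A.dom p1" "A.cod h = A.dom g"
      using d unfolding A.descent_datum_def by auto
    have gA: "A.dom g \<in> Obj A" using g by simp
    have t: "A.arr p1" "A.arr p2" "A.arr r1" "A.arr r2" "A.dom p2 = A.dom p1" "A.cod p1 = A.dom p"
      "A.cod p2 = A.dom g" "A.cod r2 = A.dom p1" "A.dom r2 = A.dom r1"
      using A.pullback_typed[OF pb(1)] A.pullback_typed[OF pb(2)] g by simp_all
    have "descent_datum (FA K p) (FA K g) (FA K p1) (FA K p2) (FA K h) (FA K r1) (FA K r2) (FA K u) (FA K v) (FA K v')"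
      unfolding descent_datum_def
      using d[unfolded A.descent_datum_def] preserves_pullback[OF pb(1)] preserves_pullback[OF pb(2)] t p functorD(5)[OF F gA]
      by (simp flip: K_comp)
    then obtain k r where kr: "is_pullback C (FA K p) r (FA K g) k" "k\<cdot>FA K h = k\<cdot>FA K p2"
      using de unfolding descent_effective_def by blast
    note tk = pullback_typed[OF kr(1)]
    obtain Y i where Y: "Y \<in> Obj A" "is_iso C i" "arr i" "dom i = FO K Y" "cod i = dom r"
      using descends[OF kr(1) gA] g by (auto simp: hom_iff)
    define j where "j = inv_arrow C i"
    have j: "arr j" "dom j = dom r" "cod j = FO K Y" "i\<cdot>j = Ident C (dom r)" "j\<cdot>i = Ident C (FO K Y)"
      using inv_arrow[OF Y(2)] Y by (simp_all add: j_def)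
    have kt: "arr k" "dom k = FO K (A.dom g)" "cod k = dom r" using tk g by simp_all
    obtain r' where r': "A.arr r'" "A.dom r' = Y" "A.cod r' = A.cod p" "FA K r' = r\<cdot>i"
      by (rule full[of "r\<cdot>i" Y "A.cod p"]) (use tk(1-8) Y p in simp_all)
    obtain k' where k': "A.arr k'" "A.dom k' = A.dom g" "A.cod k' = Y" "FA K k' = j\<cdot>k"
      by (rule full[of "j\<cdot>k" "A.dom g" Y]) (use kt j Y g in simp_all)
    have ri: "(r\<cdot>i)\<cdot>(j\<cdot>z) = r\<cdot>z" if "arr z" "cod z = dom r" for z
      using comp_cong[OF j(4), of z] that j(1-3) Y tk(1-8) by simp
    have ij: "i\<cdot>(j\<cdot>z) = z" if "arr z" "cod z = dom r" for z
      using comp_cong[OF j(4), of z] that j(1-3) Y by simp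
    have ji: "j\<cdot>(i\<cdot>z) = z" if "arr z" "cod z = FO K Y" for z
      using comp_cong[OF j(5), of z] that j(1-3) Y by simp
    \<comment> \<open>Replacing \<open>r\<close> by the isomorphic \<open>r\<cdot>i\<close> moves
      the object over the codomain into the image, so that all four sides of the square come from
      \<open>A\<close>.\<close>
    have "is_pullback C (FA K p) (r\<cdot>i) (FA K g) (j\<cdot>k)"
    proof (rule pullbackI)
      show "FA K p\<cdot>FA K g = (r\<cdot>i)\<cdot>(j\<cdot>k)"
        using ri[of k] kt tk(9) by simp
    next
      fix x y assume x: "arr x" "arr y" "dom x = dom y" "cod x = dom (FA K p)"
        "cod y = dom (r\<cdot>i)" "FA K p\<cdot>x = (r\<cdot>i)\<cdot>y"
      have y: "cod y = FO K Y" using x(5) tk(1-8) Y by simp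
      obtain z where z: "arr z" "dom z = dom x" "cod z = dom (FA K g)" "FA K g\<cdot>z = x" "k\<cdot>z = i\<cdot>y"
        by (rule pullback_ex[OF kr(1), of x "i\<cdot>y"]) (use x tk(1-8) Y in simp_all)
      have "(j\<cdot>k)\<cdot>z = y" using z ji[of y] x(2) y j(1-3) kt g by simp
      then show "\<exists>u. arr u \<and> dom u = dom x \<and> cod u = dom (FA K g) \<and> FA K g\<cdot>u = x \<and> (j\<cdot>k)\<cdot>u = y"
        using z by blast
    next
      fix x y assume x: "arr x" "arr y" "dom x = dom y" "cod x = dom (FA K g)" "cod y = dom (FA K g)"
        "FA K g\<cdot>x = FA K g\<cdot>y" "(j\<cdot>k)\<cdot>x = (j\<cdot>k)\<cdot>y"
      have "i\<cdot>(j\<cdot>(k\<cdot>x)) = i\<cdot>(j\<cdot>(k\<cdot>y))"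
        using x(1-5,7) j(1-3) kt g by simp
      then have "k\<cdot>x = k\<cdot>y"
        using ij[of "k\<cdot>x"] ij[of "k\<cdot>y"] x(1-5) kt g by simp
      then show "x = y" by - (rule pullback_eq[OF kr(1)], use x in simp_all)
    qed (use tk(1-8) j Y in simp_all)
    then have "is_pullback A p r' g k'"
      by - (rule reflects_pullback, use r' k' g p in simp_all)
    moreover have "k' \<cdot>\<^bsub>A\<^esub> h = k' \<cdot>\<^bsub>A\<^esub> p2"
      by (rule faithful) (use K_comp[of h k'] K_comp[of p2 k'] k' h t kr(2) j(1-3) kt in simp_all)
    ultimately show "\<exists>k r. is_pullback A p r g k \<and> k \<cdot>\<^bsub>A\<^esub> h = k \<cdot>\<^bsub>A\<^esub> p2" by blast
  qed
qed

end

section \<open>Lextensive categories\<close>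

text \<open>Index sets such as sets of pairs or triples do not consist of individuals, so
  \<open>small\<close> does not apply to them. They count as small when they are in bijection with a
  small set of individuals.\<close>

definition small_index :: "('u set \<Rightarrow> bool) \<Rightarrow> 'i set \<Rightarrow> bool" where
  "small_index small I \<longleftrightarrow> (\<exists>g. inj_on g I \<and> small (g ` I))"

section \<open>Closure properties of smallness\<close>

context set_universe
begin

text \<open>The empty set has exactly one subset, so the power set axiom produces a small singleton;
  a constant function moves it to \<open>{x}\<close>.\<close>

lemma small_singleton: "small {x}"
proof -
  obtain g where "small (g ` Pow ({} :: 'u set))" using small_Pow[OF small_empty] by blast
  then have "small ((\<lambda>_. x) ` g ` Pow ({} :: 'u set))" by (rule small_image)
  then show ?thesis by simp
qed

text \<open>The two subsets of a singleton provide a small index set with two elements, over which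
  the binary union is an indexed one.\<close>

lemma small_Un:
  assumes "small X" "small Y"
  shows "small (X \<union> Y)"
proof -
  obtain g where g: "inj_on g (Pow {undefined :: 'u})" "small (g ` Pow {undefined})"
    using small_Pow[OF small_singleton] by blast
  then have ne: "g {} \<noteq> g {undefined}" by (auto simp: inj_on_def)
  have "small (\<Union>i\<in>g ` Pow {undefined}. if i = g {} then X else Y)"
    by (rule small_UN) (use g assms in auto)
  moreover have "(\<Union>i\<in>g ` Pow {undefined}. if i = g {} then X else Y) = X \<union> Y"
    using ne by (auto simp: Pow_insert)
  ultimately show ?thesis by simp
qed

lemma small_index_small: "small X \<Longrightarrow> small_index small X"
  unfolding small_index_def by (rule exI[of _ "\<lambda>x. x"]) auto

lemma small_index_inj:
  assumes "small_index small J" "inj_on f I" "f ` I \<subseteq> J"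
  shows "small_index small I"
proof -
  obtain g where g: "inj_on g J" "small (g ` J)" using assms(1) by (auto simp: small_index_def)
  have "inj_on (g \<circ> f) I" using g assms by (auto intro: comp_inj_on inj_on_subset)
  moreover have "small ((g \<circ> f) ` I)" using small_subset[OF g(2), of "(g \<circ> f) ` I"] assms(3) by auto
  ultimately show ?thesis by (auto simp: small_index_def)
qed

text \<open>Kuratowski pairs, coded in the universe by means of two applications of the power set axiom.\<close>

lemma small_index_Times_small:
  assumes "small X" "small Y"
  shows "small_index small (X \<times> Y)"
proof -
  let ?Z = "X \<union> Y"
  obtain g where g: "inj_on g (Pow ?Z)" "small (g ` Pow ?Z)" using small_Pow[OF small_Un[OF assms]] by blast
  obtain h where h: "inj_on h (Pow (g ` Pow ?Z))" "small (h ` Pow (g ` Pow ?Z))" using small_Pow[OF g(2)] by blast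
  have J: "small_index small (Pow (g ` Pow ?Z))"
    using h by (auto simp: small_index_def)
  have inj: "inj_on (\<lambda>(x, y). {g {x}, g {x, y}}) (X \<times> Y)"
  proof (rule inj_onI, clarify)
    fix x y x' y' assume *: "x \<in> X" "y \<in> Y" "x' \<in> X" "y' \<in> Y" "{g {x}, g {x, y}} = {g {x'}, g {x', y'}}"
    then have "g ` {{x}, {x, y}} = g ` {{x'}, {x', y'}}" by simp
    then have "{{x}, {x, y}} = {{x'}, {x', y'}}"
      by (subst (asm) inj_on_image_eq_iff[OF g(1)]) (use * in auto)
    then show "x = x' \<and> y = y'" by (auto simp: doubleton_eq_iff)
  qed
  show ?thesis by (rule small_index_inj[OF J inj]) auto
qed

text \<open>With chosen codes \<open>g\<close> for the indices and \<open>h i\<close> for the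
  fibres, the dependent pair \<open>(i, j)\<close> is coded by \<open>(g i, h i j)\<close>, in a
  product of two small sets.\<close>

lemma small_index_Sigma:
  assumes I: "small_index small I" and J: "\<And>i. i \<in> I \<Longrightarrow> small_index small (J i)"
  shows "small_index small (Sigma I J)"
proof -
  obtain g where g: "inj_on g I" "small (g ` I)" using I by (auto simp: small_index_def)
  obtain h where h: "\<And>i. i \<in> I \<Longrightarrow> inj_on (h i) (J i) \<and> small (h i ` J i)"
    using J unfolding small_index_def by metis
  let ?U = "\<Union>x\<in>g ` I. h (inv_into I g x) ` J (inv_into I g x)"
  have U: "small ?U" by (rule small_UN[OF g(2)]) (use g h in auto)
  show ?thesis
  proof (rule small_index_inj[OF small_index_Times_small[OF g(2) U]])
    show "inj_on (\<lambda>(i, j). (g i, h i j)) (Sigma I J)"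
      using g(1) h by (auto simp: inj_on_def)
    show "(\<lambda>(i, j). (g i, h i j)) ` Sigma I J \<subseteq> g ` I \<times> ?U"
      using g(1) by auto
  qed
qed

end

section \<open>Coproducts\<close>

context category
begin

lemma coproduct_typed:
  assumes "is_coproduct C I A P \<iota>"
  shows "P \<in> Obj C" "i \<in> I \<Longrightarrow> arr (\<iota> i)" "i \<in> I \<Longrightarrow> dom (\<iota> i) = A i" "i \<in> I \<Longrightarrow> cod (\<iota> i) = P"
  using assms by (auto simp: is_coproduct_def hom_iff)

lemma coproduct_ex:
  assumes "is_coproduct C I A P \<iota>" "Z \<in> Obj C" "\<And>i. i \<in> I \<Longrightarrow> arr (g i)"
    "\<And>i. i \<in> I \<Longrightarrow> dom (g i) = A i" "\<And>i. i \<in> I \<Longrightarrow> cod (g i) = Z"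
  obtains u where "arr u" "dom u = P" "cod u = Z" "\<And>i. i \<in> I \<Longrightarrow> u\<cdot>\<iota> i = g i"
proof -
  have "\<exists>!u. u \<in> hom C P Z \<and> (\<forall>i\<in>I. u\<cdot>\<iota> i = g i)"
    by (rule assms(1)[unfolded is_coproduct_def, THEN conjunct2, THEN conjunct2, rule_format])
      (use assms in \<open>auto simp: hom_iff\<close>)
  then show ?thesis using that by (auto simp: hom_iff)
qed

lemma coproduct_eq:
  assumes c: "is_coproduct C I A P \<iota>" and u: "arr u" "arr u'" "dom u = P" "dom u' = P" "cod u = cod u'"
    and e: "\<And>i. i \<in> I \<Longrightarrow> u\<cdot>\<iota> i = u'\<cdot>\<iota> i"
  shows "u = u'"
proof -
  have "\<exists>!w. w \<in> hom C P (cod u) \<and> (\<forall>i\<in>I. w\<cdot>\<iota> i = u\<cdot>\<iota> i)"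
    by (rule c[unfolded is_coproduct_def, THEN conjunct2, THEN conjunct2, rule_format])
      (use u coproduct_typed[OF c] in \<open>auto simp: hom_iff\<close>)
  then obtain w where w: "\<And>v. v \<in> hom C P (cod u) \<and> (\<forall>i\<in>I. v\<cdot>\<iota> i = u\<cdot>\<iota> i) \<Longrightarrow> v = w"
    by (auto elim: ex1E)
  have "u = w" by (rule w) (use u in \<open>simp add: hom_iff\<close>)
  moreover have "u' = w" by (rule w) (use u e in \<open>simp add: hom_iff\<close>)
  ultimately show ?thesis by simp
qed

lemma coproductI:
  assumes "P \<in> Obj C" "\<And>i. i \<in> I \<Longrightarrow> arr (\<iota> i)" "\<And>i. i \<in> I \<Longrightarrow> dom (\<iota> i) = A i" "\<And>i. i \<in> I \<Longrightarrow> cod (\<iota> i) = P"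
    and ex: "\<And>Z g. \<lbrakk>Z \<in> Obj C; \<And>i. i \<in> I \<Longrightarrow> arr (g i); \<And>i. i \<in> I \<Longrightarrow> dom (g i) = A i; \<And>i. i \<in> I \<Longrightarrow> cod (g i) = Z\<rbrakk>
      \<Longrightarrow> \<exists>u. arr u \<and> dom u = P \<and> cod u = Z \<and> (\<forall>i\<in>I. u\<cdot>\<iota> i = g i)"
    and eq: "\<And>u u'. \<lbrakk>arr u; arr u'; dom u = P; dom u' = P; cod u = cod u'; \<And>i. i \<in> I \<Longrightarrow> u\<cdot>\<iota> i = u'\<cdot>\<iota> i\<rbrakk> \<Longrightarrow> u = u'"
  shows "is_coproduct C I A P \<iota>"
  unfolding is_coproduct_def
proof (intro conjI ballI allI impI)
  fix Z g assume Z: "Z \<in> Obj C" "\<forall>i\<in>I. g i \<in> hom C (A i) Z"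
  then obtain u where u: "arr u" "dom u = P" "cod u = Z" "\<forall>i\<in>I. u\<cdot>\<iota> i = g i"
    using ex[of Z g] by (auto simp: hom_iff)
  show "\<exists>!u. u \<in> hom C P Z \<and> (\<forall>i\<in>I. u\<cdot>\<iota> i = g i)"
  proof (rule ex1I[of _ u])
    fix v assume "v \<in> hom C P Z \<and> (\<forall>i\<in>I. v\<cdot>\<iota> i = g i)"
    then show "v = u" using u by - (rule eq, simp_all add: hom_iff)
  qed (use u in \<open>simp add: hom_iff\<close>)
qed (use assms in \<open>auto simp: hom_iff\<close>)

lemma coproduct_reindex:
  assumes c: "is_coproduct C J A P \<iota>" and b: "bij_betw g I J"
  shows "is_coproduct C I (\<lambda>i. A (g i)) P (\<lambda>i. \<iota> (g i))"
proof -
  note t = coproduct_typed[OF c]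
  have gI: "g i \<in> J" if "i \<in> I" for i using b that by (auto simp: bij_betw_def)
  define g' where "g' = inv_into I g"
  have g': "g' j \<in> I" "g (g' j) = j" if "j \<in> J" for j
    using b that by (auto simp: g'_def bij_betw_def inv_into_into f_inv_into_f)
  have g'g: "g' (g i) = i" if "i \<in> I" for i
    using b that by (simp add: g'_def bij_betw_inv_into_left)
  show ?thesis
  proof (rule coproductI)
    fix Z h assume h: "Z \<in> Obj C" "\<And>i. i \<in> I \<Longrightarrow> arr (h i)" "\<And>i. i \<in> I \<Longrightarrow> dom (h i) = A (g i)" "\<And>i. i \<in> I \<Longrightarrow> cod (h i) = Z"
    obtain u where "arr u" "dom u = P" "cod u = Z" "\<And>j. j \<in> J \<Longrightarrow> u\<cdot>\<iota> j = h (g' j)"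
      by (rule coproduct_ex[OF c h(1), of "\<lambda>j. h (g' j)"]) (use h g' in simp_all)
    then show "\<exists>u. arr u \<and> dom u = P \<and> cod u = Z \<and> (\<forall>i\<in>I. u\<cdot>\<iota> (g i) = h i)"
      using gI g'g by auto
  next
    fix u u' assume u: "arr u" "arr u'" "dom u = P" "dom u' = P" "cod u = cod u'"
      "\<And>i. i \<in> I \<Longrightarrow> u\<cdot>\<iota> (g i) = u'\<cdot>\<iota> (g i)"
    show "u = u'"
      by (rule coproduct_eq[OF c u(1-5)]) (use u(6) g' in metis)
  qed (use t gI in auto)
qed

lemma coproduct_iso:
  assumes c: "is_coproduct C I A P \<iota>" and c': "is_coproduct C I A P' \<iota>'"
  obtains i where "is_iso C i" "arr i" "dom i = P" "cod i = P'" "\<And>x. x \<in> I \<Longrightarrow> i\<cdot>\<iota> x = \<iota>' x"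
proof -
  note t = coproduct_typed[OF c] and t' = coproduct_typed[OF c']
  obtain i where i: "arr i" "dom i = P" "cod i = P'" "\<And>x. x \<in> I \<Longrightarrow> i\<cdot>\<iota> x = \<iota>' x"
    using coproduct_ex[OF c, of P' \<iota>'] t' by metis
  obtain j where j: "arr j" "dom j = P'" "cod j = P" "\<And>x. x \<in> I \<Longrightarrow> j\<cdot>\<iota>' x = \<iota> x"
    using coproduct_ex[OF c', of P \<iota>] t by metis
  have "j\<cdot>i = Ident C P"
    by (rule coproduct_eq[OF c]) (use i j t in simp_all)
  moreover have "i\<cdot>j = Ident C P'"
    by (rule coproduct_eq[OF c']) (use i j t' in simp_all)
  ultimately have "is_iso C i" using isoI[of i j] i j by simp
  then show ?thesis using that i by blast
qed

lemma initial_ex: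
  assumes "is_initial C Z" "A \<in> Obj C"
  obtains u where "arr u" "dom u = Z" "cod u = A"
  using assms by (auto simp: is_initial_def hom_iff)

lemma initial_eq:
  assumes "is_initial C Z" "arr u" "arr u'" "dom u = Z" "dom u' = Z" "cod u = cod u'"
  shows "u = u'"
proof -
  have "\<exists>!w. w \<in> hom C Z (cod u)" using assms Obj_typed(2)[OF assms(2)] unfolding is_initial_def by blast
  then show ?thesis using assms by (auto simp: hom_iff)
qed

lemma initial_coproduct: "is_initial C Z \<longleftrightarrow> is_coproduct C {} A Z \<iota>"
  by (auto simp: is_initial_def is_coproduct_def)

lemma coproduct_Sigma:
  assumes c: "is_coproduct C I A P \<iota>" and d: "\<And>i. i \<in> I \<Longrightarrow> is_coproduct C (J i) (B i) (A i) (\<kappa> i)"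
  shows "is_coproduct C (Sigma I J) (\<lambda>(i, j). B i j) P (\<lambda>(i, j). \<iota> i\<cdot>\<kappa> i j)"
proof -
  note t = coproduct_typed[OF c] and s = coproduct_typed[OF d]
  show ?thesis
  proof (rule coproductI)
    fix Z g assume g: "Z \<in> Obj C" "\<And>x. x \<in> Sigma I J \<Longrightarrow> arr (g x)"
      "\<And>x. x \<in> Sigma I J \<Longrightarrow> dom (g x) = (case x of (i, j) \<Rightarrow> B i j)" "\<And>x. x \<in> Sigma I J \<Longrightarrow> cod (g x) = Z"
    have "\<exists>u. arr u \<and> dom u = A i \<and> cod u = Z \<and> (\<forall>j\<in>J i. u\<cdot>\<kappa> i j = g (i, j))" if "i \<in> I" for i
    proof (rule coproduct_ex[OF d[OF that] g(1), of "\<lambda>j. g (i, j)"])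
      show "arr (g (i, j))" "dom (g (i, j)) = B i j" "cod (g (i, j)) = Z" if "j \<in> J i" for j
        using g(2-4)[of "(i, j)"] that \<open>i \<in> I\<close> by simp_all
    qed blast
    then obtain u where u: "\<And>i. i \<in> I \<Longrightarrow> arr (u i) \<and> dom (u i) = A i \<and> cod (u i) = Z \<and> (\<forall>j\<in>J i. u i\<cdot>\<kappa> i j = g (i, j))"
      by metis
    obtain v where v: "arr v" "dom v = P" "cod v = Z" "\<And>i. i \<in> I \<Longrightarrow> v\<cdot>\<iota> i = u i"
      using coproduct_ex[OF c g(1), of u] u by metis
    have "v\<cdot>(\<iota> i\<cdot>\<kappa> i j) = g (i, j)" if "i \<in> I" "j \<in> J i" for i j
      using comp_cong[OF v(4)[OF that(1)], of "\<kappa> i j"] t s[OF that(1)] v u that by auto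
    then show "\<exists>u. arr u \<and> dom u = P \<and> cod u = Z \<and> (\<forall>i\<in>Sigma I J. u\<cdot>(case i of (i, j) \<Rightarrow> \<iota> i\<cdot>\<kappa> i j) = g i)"
      using v by auto
  next
    fix u u' assume u: "arr u" "arr u'" "dom u = P" "dom u' = P" "cod u = cod u'"
      "\<And>x. x \<in> Sigma I J \<Longrightarrow> u\<cdot>(case x of (i, j) \<Rightarrow> \<iota> i\<cdot>\<kappa> i j) = u'\<cdot>(case x of (i, j) \<Rightarrow> \<iota> i\<cdot>\<kappa> i j)"
    show "u = u'"
    proof (rule coproduct_eq[OF c u(1-5)])
      fix i assume i: "i \<in> I"
      show "u\<cdot>\<iota> i = u'\<cdot>\<iota> i"
        by (rule coproduct_eq[OF d[OF i]]) (use u(1-5) u(6)[of "(i, _)"] t s[OF i] i in auto)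
    qed
  qed (use t s in auto)
qed

end

locale lextensive_category = category C + set_universe small
  for C :: "('o, 'u) cat" (structure) and small :: "'u set \<Rightarrow> bool" +
  assumes lext: "lextensive small C"
begin

lemma fin_lim: "finite I \<Longrightarrow> finite E \<Longrightarrow> is_diagram C (I :: nat set) D E \<Longrightarrow> \<exists>L p. is_limit C I D E L p"
  using lext by (auto simp: lextensive_def has_finite_limits_def)

text \<open>The limit of the cospan as a diagram with nodes \<open>0\<close>, \<open>1\<close> and
  \<open>2\<close>; the leg to the common codomain \<open>2\<close> is determined by the other
  two.\<close>

lemma has_pb: "has_pullbacks C"
  unfolding has_pullbacks_def
proof (intro ballI impI)
  fix f g assume fg: "arr f" "arr g" "cod f = cod g"
  define D where "D i = (if i = (0::nat) then dom f else if i = 1 then dom g else cod f)" for i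
  define E where "E = {(0 :: nat, f, 2 :: nat), (1, g, 2)}"
  have "is_diagram C {0, 1, 2} D E" using fg by (auto simp: is_diagram_def D_def E_def hom_iff)
  then obtain L p where l: "is_limit C {0, 1, 2} D E L p"
    using fin_lim[of "{0, 1, 2}" E D] by (auto simp: E_def)
  have c: "L \<in> Obj C" "arr (p 0)" "arr (p 1)" "dom (p 0) = L" "dom (p 1) = L" "cod (p 0) = dom f" "cod (p 1) = dom g"
    "f\<cdot>p 0 = p 2" "g\<cdot>p 1 = p 2"
    using l by (auto simp: is_limit_def is_cone_def D_def E_def hom_iff)
  have ex: "\<exists>!u. u \<in> hom C Z L \<and> (\<forall>i\<in>{0, 1, 2}. p i\<cdot>u = q i)" if "is_cone C {0, 1, 2} D E Z q" for Z q
    using l that by (auto simp: is_limit_def)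
  have "is_pullback C f g (p 0) (p 1)"
  proof (rule pullbackI)
    fix h k assume h: "arr h" "arr k" "dom h = dom k" "cod h = dom f" "cod k = dom g" "f\<cdot>h = g\<cdot>k"
    have "is_cone C {0, 1, 2} D E (dom h) (\<lambda>i. if i = 0 then h else if i = 1 then k else f\<cdot>h)"
      using h fg by (auto simp: is_cone_def D_def E_def hom_iff)
    from ex[OF this] show "\<exists>u. arr u \<and> dom u = dom h \<and> cod u = dom (p 0) \<and> p 0\<cdot>u = h \<and> p 1\<cdot>u = k"
      using c by (auto simp: hom_iff)
  next
    fix u u' assume u: "arr u" "arr u'" "dom u = dom u'" "cod u = dom (p 0)" "cod u' = dom (p 0)"
      "p 0\<cdot>u = p 0\<cdot>u'" "p 1\<cdot>u = p 1\<cdot>u'"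
    have "f\<cdot>(p 0\<cdot>u) = g\<cdot>(p 1\<cdot>u)" using comp_cong[OF c(8), of u] comp_cong[OF c(9), of u] c(1-7) u(1-5) fg by simp
    then have "is_cone C {0, 1, 2} D E (dom u) (\<lambda>i. if i = 0 then p 0\<cdot>u else if i = 1 then p 1\<cdot>u else f\<cdot>(p 0\<cdot>u))"
      using c(1-7) u(1-5) fg by (auto simp: is_cone_def D_def E_def hom_iff)
    from ex[OF this] have "\<exists>!w. w \<in> hom C (dom u) L \<and> p 0\<cdot>w = p 0\<cdot>u \<and> p 1\<cdot>w = p 1\<cdot>u \<and> p 2\<cdot>w = f\<cdot>(p 0\<cdot>u)"
      by simp
    moreover have "p 2\<cdot>u = f\<cdot>(p 0\<cdot>u)" "p 2\<cdot>u' = f\<cdot>(p 0\<cdot>u)"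
      using comp_cong[OF c(8), of u] comp_cong[OF c(8), of u'] c(1-7) u fg by simp_all
    ultimately show "u = u'" using u c(4) by (auto simp: hom_iff)
  qed (use c fg in simp_all)
  then show "\<exists>p q. is_pullback C f g p q" by blast
qed

sublocale pullback_category C by unfold_locales (rule has_pb)

lemma terminal_ex: "\<exists>t. is_terminal C t"
proof -
  obtain L p where l: "is_limit C {} (\<lambda>_ :: nat. undefined :: 'o) {} L p"
    using fin_lim[of "{}" "{}" "\<lambda>_. undefined"] by (auto simp: is_diagram_def)
  then have "is_terminal C L" by (auto simp: is_limit_def is_cone_def is_terminal_def)
  then show ?thesis by blast
qed

lemma terminal_one: "is_terminal C (one C)"
  unfolding one_def by (rule someI_ex[OF terminal_ex])

lemma one_Obj [simp]: "one C \<in> Obj C"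
  using terminal_one by (simp add: is_terminal_def)

lemma to_one_eq: "\<lbrakk>arr u; arr u'; dom u = dom u'; cod u = one C; cod u' = one C\<rbrakk> \<Longrightarrow> u = u'"
proof -
  assume u: "arr u" "arr u'" "dom u = dom u'" "cod u = one C" "cod u' = one C"
  have "\<exists>!w. w \<in> hom C (dom u) (one C)" using terminal_one Obj_typed(1)[OF u(1)] unfolding is_terminal_def by blast
  then show "u = u'" using u by (auto simp: hom_iff)
qed

lemma bang_typed [simp]:
  assumes "A \<in> Obj C"
  shows "arr (bang C A)" "dom (bang C A) = A" "cod (bang C A) = one C"
proof -
  have "\<exists>!u. u \<in> hom C A (one C)" using terminal_one assms unfolding is_terminal_def by blast
  from theI'[OF this] show "arr (bang C A)" "dom (bang C A) = A" "cod (bang C A) = one C"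
    by (auto simp: bang_def hom_iff)
qed

lemma bang_comp [simp]: "\<lbrakk>arr f; cod f = A\<rbrakk> \<Longrightarrow> bang C A\<cdot>f = bang C (dom f)"
  by (rule to_one_eq) auto

lemma bang_one [simp]: "bang C (one C) = Ident C (one C)"
  by (rule to_one_eq) auto

lemma bang_eq: "\<lbrakk>arr f; cod f = one C\<rbrakk> \<Longrightarrow> f = bang C (dom f)"
  by (rule to_one_eq) auto

text \<open>Products are obtained as pullbacks over the terminal object.\<close>

lemma prod_cone:
  assumes "A \<in> Obj C" "B \<in> Obj C"
  shows "is_product C A B (prod_fst C A B) (prod_snd C A B)"
proof -
  let ?f = "bang C A" and ?g = "bang C B"
  have "is_product C A B (pb_fst C ?f ?g) (pb_snd C ?f ?g)"
    unfolding is_product_def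
  proof (intro conjI ballI)
    fix Z h k assume h: "Z \<in> Obj C" "h \<in> hom C Z A" "k \<in> hom C Z B"
    then have "bang C A\<cdot>h = bang C B\<cdot>k" by (simp add: hom_iff)
    show "\<exists>!u. u \<in> hom C Z (dom (pb_fst C ?f ?g)) \<and> pb_fst C ?f ?g\<cdot>u = h \<and> pb_snd C ?f ?g\<cdot>u = k"
      by (rule ex1I[of _ "pb_lift C ?f ?g h k"]) (use h assms pb_lift[of ?f ?g h k] in \<open>auto simp: hom_iff intro: pb_lift_eqI[symmetric]\<close>)
  qed (use assms in simp_all)
  then have "\<exists>pq. case pq of (p, q) \<Rightarrow> is_product C A B p q" by auto
  from someI_ex[OF this] show ?thesis
    by (simp add: prod_fst_def prod_snd_def prod_cone_def split: prod.splits)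
qed

lemma prod_typed [simp]:
  assumes "A \<in> Obj C" "B \<in> Obj C"
  shows "arr (prod_fst C A B)" "arr (prod_snd C A B)" "dom (prod_fst C A B) = prod_ob C A B"
    "dom (prod_snd C A B) = prod_ob C A B" "cod (prod_fst C A B) = A" "cod (prod_snd C A B) = B" "prod_ob C A B \<in> Obj C"
  using prod_cone[OF assms] by (auto simp: is_product_def prod_ob_def)

lemma pairing [simp]:
  assumes "arr f" "arr g" "dom f = dom g" "A = cod f" "B = cod g"
  shows "arr (pairing C f g)" "dom (pairing C f g) = dom g" "cod (pairing C f g) = prod_ob C (cod f) (cod g)"
    "prod_fst C A B\<cdot>pairing C f g = f" "prod_snd C A B\<cdot>pairing C f g = g"
proof -
  have "\<exists>!u. u \<in> hom C (dom f) (prod_ob C A B) \<and> prod_fst C A B\<cdot>u = f \<and> prod_snd C A B\<cdot>u = g"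
    using prod_cone[of A B] assms unfolding is_product_def prod_ob_def
    by (simp add: hom_iff)
  from theI'[OF this] show "arr (pairing C f g)" "dom (pairing C f g) = dom g" "cod (pairing C f g) = prod_ob C (cod f) (cod g)"
    "prod_fst C A B\<cdot>pairing C f g = f" "prod_snd C A B\<cdot>pairing C f g = g"
    using assms by (auto simp: pairing_def hom_iff)
qed

lemma prod_ext:
  assumes "A \<in> Obj C" "B \<in> Obj C" "arr u" "arr u'" "dom u = dom u'" "cod u = prod_ob C A B" "cod u' = prod_ob C A B"
    "prod_fst C A B\<cdot>u = prod_fst C A B\<cdot>u'" "prod_snd C A B\<cdot>u = prod_snd C A B\<cdot>u'"
  shows "u = u'"
proof -
  have "\<exists>!w. w \<in> hom C (dom u) (prod_ob C A B) \<and> prod_fst C A B\<cdot>w = prod_fst C A B\<cdot>u \<and> prod_snd C A B\<cdot>w = prod_snd C A B\<cdot>u"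
    using prod_cone[of A B] assms unfolding is_product_def prod_ob_def
    by (simp add: hom_iff)
  then show ?thesis using assms by (auto simp: hom_iff)
qed

lemma pairing_comp:
  assumes "arr f" "arr g" "dom f = dom g" "arr z" "cod z = dom g"
  shows "pairing C f g\<cdot>z = pairing C (f\<cdot>z) (g\<cdot>z)"
  by (rule prod_ext[of "cod f" "cod g"])
    (use assms comp_cong[OF pairing(4)[OF assms(1-3) refl refl], of z] comp_cong[OF pairing(5)[OF assms(1-3) refl refl], of z] in simp_all)


text \<open>Lextensivity speaks of index sets of individuals. Reindexing along a bijection with such
  a set extends it to the pairs and triples that index entries and chains.\<close>

lemma coproduct_of_small_index:
  assumes I: "small_index small I" and A: "\<And>i. i \<in> I \<Longrightarrow> A i \<in> Obj C"
  shows "is_coproduct C I A (coprod_ob C I A) (coprod_in C I A)"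
proof -
  obtain g where g: "inj_on g I" "small (g ` I)" using I by (auto simp: small_index_def)
  define A' where "A' x = A (inv_into I g x)" for x
  have "\<forall>x\<in>g ` I. A' x \<in> Obj C" using A by (auto simp: A'_def inv_into_into)
  then obtain P \<iota> where "is_coproduct C (g ` I) A' P \<iota>"
    using lext g(2) unfolding lextensive_def by blast
  from coproduct_reindex[OF this, of g I] g
  have "is_coproduct C I (\<lambda>i. A' (g i)) P (\<lambda>i. \<iota> (g i))" by (simp add: bij_betw_def)
  then have "is_coproduct C I A P (\<lambda>i. \<iota> (g i))"
    using g by (simp add: A'_def is_coproduct_def)
  then have "\<exists>P\<iota>. case P\<iota> of (P, \<iota>) \<Rightarrow> is_coproduct C I A P \<iota>" by auto
  from someI_ex[OF this] show ?thesis
    by (simp add: coprod_ob_def coprod_in_def coprod_cocone_def split: prod.splits)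
qed

lemma copair:
  assumes I: "small_index small I" and A: "\<And>i. i \<in> I \<Longrightarrow> A i \<in> Obj C" and Z: "Z \<in> Obj C"
    and g: "\<And>i. i \<in> I \<Longrightarrow> arr (g i)" "\<And>i. i \<in> I \<Longrightarrow> dom (g i) = A i" "\<And>i. i \<in> I \<Longrightarrow> cod (g i) = Z"
  shows "arr (copair C I A Z g)" "dom (copair C I A Z g) = coprod_ob C I A" "cod (copair C I A Z g) = Z"
    "i \<in> I \<Longrightarrow> copair C I A Z g\<cdot>coprod_in C I A i = g i"
proof -
  note c = coproduct_of_small_index[OF I A]
  have "\<exists>!u. u \<in> hom C (coprod_ob C I A) Z \<and> (\<forall>i\<in>I. u\<cdot>coprod_in C I A i = g i)"
    by (rule c[unfolded is_coproduct_def, THEN conjunct2, THEN conjunct2, rule_format])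
      (use Z g in \<open>auto simp: hom_iff\<close>)
  from theI'[OF this]
  show "arr (copair C I A Z g)" "dom (copair C I A Z g) = coprod_ob C I A" "cod (copair C I A Z g) = Z"
    "i \<in> I \<Longrightarrow> copair C I A Z g\<cdot>coprod_in C I A i = g i"
    by (auto simp: copair_def hom_iff)
qed

lemma small_coproduct:
  fixes I :: "'u set"
  assumes "small I" "is_coproduct C I A P \<iota>"
  shows "disjoint_coproduct C I \<iota>" "universal_coproduct C I P \<iota>"
proof -
  have "\<forall>i\<in>I. A i \<in> Obj C" using coproduct_typed[OF assms(2)] Obj_typed(1) by metis
  then show "disjoint_coproduct C I \<iota>" "universal_coproduct C I P \<iota>"
    using lext assms unfolding lextensive_def by blast+
qed

text \<open>An initial object is an empty coproduct, and universality of the empty coproduct says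
  that every object over it is an empty coproduct as well.\<close>

lemma strict_initial:
  assumes "is_initial C Z" "arr f" "cod f = Z"
  shows "is_initial C (dom f)"
proof -
  have "is_coproduct C ({} :: 'u set) (\<lambda>_. Z) Z (\<lambda>_. f)" using assms(1) initial_coproduct by blast
  from small_coproduct(2)[OF small_empty this] have "is_coproduct C ({} :: 'u set) (\<lambda>_. dom f) (dom f) (\<lambda>_. f)"
    using assms by (auto simp: universal_coproduct_def)
  then show ?thesis using initial_coproduct by blast
qed

lemma reindex_small:
  assumes "small_index small I" "is_coproduct C I A P \<iota>"
  obtains g where "inj_on g I" "small (g ` I)" "is_coproduct C (g ` I) (\<lambda>x. A (inv_into I g x)) P (\<lambda>x. \<iota> (inv_into I g x))"
proof -
  obtain g where g: "inj_on g I" "small (g ` I)" using assms(1) by (auto simp: small_index_def)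
  have "bij_betw (inv_into I g) (g ` I) I" using g(1) by (simp add: bij_betw_inv_into inj_on_imp_bij_betw)
  from that[OF g coproduct_reindex[OF assms(2) this]] show ?thesis .
qed

lemma coproduct_mono:
  assumes I: "small_index small I" and c: "is_coproduct C I A P \<iota>" and i: "i \<in> I"
    and a: "arr a" "arr b" "dom a = dom b" "cod a = A i" "cod b = A i" "\<iota> i\<cdot>a = \<iota> i\<cdot>b"
  shows "a = b"
proof -
  obtain g where g: "inj_on g I" "small (g ` I)" "is_coproduct C (g ` I) (\<lambda>x. A (inv_into I g x)) P (\<lambda>x. \<iota> (inv_into I g x))"
    using reindex_small[OF I c] .
  have "is_mono C (\<iota> i)" using small_coproduct(1)[OF g(2,3)] i g(1) by (auto simp: disjoint_coproduct_def)
  then have "\<iota> i\<cdot>a = \<iota> i\<cdot>b \<longrightarrow> a = b"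
    unfolding is_mono_def using a coproduct_typed[OF c] i Obj_typed(1)[OF a(1)] hom_iff by metis
  then show ?thesis using a(6) by blast
qed

text \<open>A common value of two different injections factors through their pullback, which is
  initial; initial objects being strict, the domain is initial too.\<close>

lemma coproduct_disjoint:
  assumes I: "small_index small I" and c: "is_coproduct C I A P \<iota>" and i: "i \<in> I" "j \<in> I" "i \<noteq> j"
    and a: "arr a" "arr b" "dom a = dom b" "cod a = A i" "cod b = A j" "\<iota> i\<cdot>a = \<iota> j\<cdot>b"
  shows "is_initial C (dom a)"
proof -
  obtain g where g: "inj_on g I" "small (g ` I)" "is_coproduct C (g ` I) (\<lambda>x. A (inv_into I g x)) P (\<lambda>x. \<iota> (inv_into I g x))"
    using reindex_small[OF I c] .
  note t = coproduct_typed[OF c]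
  have pb: "is_pullback C (\<iota> i) (\<iota> j) (pb_fst C (\<iota> i) (\<iota> j)) (pb_snd C (\<iota> i) (\<iota> j))"
    by (rule pb) (use t i in simp_all)
  have "g i \<noteq> g j" "inv_into I g (g i) = i" "inv_into I g (g j) = j" using g(1) i by (auto simp: inj_on_def)
  then have "is_initial C (dom (pb_fst C (\<iota> i) (\<iota> j)))"
    using small_coproduct(1)[OF g(2,3)] i pb unfolding disjoint_coproduct_def by (metis imageI)
  moreover obtain u where "arr u" "dom u = dom a" "cod u = dom (pb_fst C (\<iota> i) (\<iota> j))"
    by (rule pullback_ex[OF pb, of a b]) (use a t i in simp_all)
  ultimately show ?thesis using strict_initial by metis
qed

text \<open>\<open>cov P S\<close>: the property \<open>S\<close> holds locally on \<open>P\<close>, i.e. on the summands of a small decomposition of \<open>P\<close>.\<close>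

definition cov where
  "cov P S \<longleftrightarrow> (\<exists>(I :: 'u set) Z k. small I \<and> is_coproduct C I Z P k \<and> (\<forall>i\<in>I. S (k i)))"

lemma cov_Obj: "cov P S \<Longrightarrow> P \<in> Obj C"
  by (auto simp: cov_def is_coproduct_def)

lemma cov_mono:
  assumes "cov P S" "\<And>k. \<lbrakk>arr k; cod k = P; S k\<rbrakk> \<Longrightarrow> S' k"
  shows "cov P S'"
proof -
  obtain I Z k where c: "small (I :: 'u set)" "is_coproduct C I Z P k" "\<forall>i\<in>I. S (k i)"
    using assms(1) unfolding cov_def by blast
  then have "\<forall>i\<in>I. S' (k i)" using assms(2) coproduct_typed[OF c(2)] by blast
  with c show ?thesis unfolding cov_def by blast
qed

lemma cov_Ident:
  assumes "P \<in> Obj C" "S (Ident C P)"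
  shows "cov P S"
proof -
  have "is_coproduct C {undefined :: 'u} (\<lambda>_. P) P (\<lambda>_. Ident C P)"
  proof (rule coproductI)
    fix Z g assume "Z \<in> Obj C" "\<And>i. i \<in> {undefined :: 'u} \<Longrightarrow> arr (g i)" "\<And>i. i \<in> {undefined} \<Longrightarrow> dom (g i) = P"
      "\<And>i. i \<in> {undefined} \<Longrightarrow> cod (g i) = Z"
    then show "\<exists>u. arr u \<and> dom u = P \<and> cod u = Z \<and> (\<forall>i\<in>{undefined}. u\<cdot>Ident C P = g i)"
      by (intro exI[of _ "g undefined"]) auto
  qed (use assms(1) in auto)
  then show ?thesis unfolding cov_def using assms(2) small_singleton by blast
qed

text \<open>The empty decomposition makes every property hold locally on an initial object. This
  disposes of the degenerate case left open by disjointness.\<close>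

lemma cov_initial: "is_initial C Z \<Longrightarrow> cov Z S"
  using initial_coproduct[of Z] unfolding cov_def by (metis small_empty empty_iff)

lemma cov_eq:
  assumes "cov P S" "arr u" "arr u'" "dom u = P" "dom u' = P" "cod u = cod u'"
    and e: "\<And>k. \<lbrakk>arr k; cod k = P; S k\<rbrakk> \<Longrightarrow> u\<cdot>k = u'\<cdot>k"
  shows "u = u'"
proof -
  obtain I Z k where c: "small (I :: 'u set)" "is_coproduct C I Z P k" "\<forall>i\<in>I. S (k i)"
    using assms(1) unfolding cov_def by blast
  show ?thesis
    by (rule coproduct_eq[OF c(2) assms(2-6)]) (use e c coproduct_typed[OF c(2)] in blast)
qed

text \<open>Decompositions can be refined: a decomposition of each summand combines with the given
  one, and the resulting set of dependent pairs is recoded by individuals.\<close>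

lemma cov_trans:
  assumes "cov P S" and s: "\<And>k. \<lbrakk>arr k; cod k = P; S k\<rbrakk> \<Longrightarrow> cov (dom k) (\<lambda>u. S' (k\<cdot>u))"
  shows "cov P S'"
proof -
  obtain I Z k where c: "small (I :: 'u set)" "is_coproduct C I Z P k" "\<forall>i\<in>I. S (k i)"
    using assms(1) unfolding cov_def by blast
  have "cov (Z i) (\<lambda>u. S' (k i\<cdot>u))" if "i \<in> I" for i
    using s[of "k i"] c(3) that coproduct_typed[OF c(2)] by auto
  then have "\<forall>i\<in>I. \<exists>J W l. small (J :: 'u set) \<and> is_coproduct C J W (Z i) l \<and> (\<forall>j\<in>J. S' (k i\<cdot>l j))"
    unfolding cov_def by blast
  then obtain J W l where d: "\<And>i. i \<in> I \<Longrightarrow> small (J i :: 'u set)" "\<And>i. i \<in> I \<Longrightarrow> is_coproduct C (J i) (W i) (Z i) (l i)"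
    "\<And>i j. i \<in> I \<Longrightarrow> j \<in> J i \<Longrightarrow> S' (k i\<cdot>l i j)"
    by metis
  have si: "small_index small (Sigma I J)"
    by (rule small_index_Sigma) (use c d small_index_small in auto)
  obtain g where g: "inj_on g (Sigma I J)" "small (g ` Sigma I J)"
    "is_coproduct C (g ` Sigma I J) (\<lambda>x. case inv_into (Sigma I J) g x of (i, j) \<Rightarrow> W i j) P
      (\<lambda>x. case inv_into (Sigma I J) g x of (i, j) \<Rightarrow> k i\<cdot>l i j)"
    using reindex_small[OF si coproduct_Sigma[OF c(2) d(2)]] .
  have "\<forall>x\<in>g ` Sigma I J. S' (case inv_into (Sigma I J) g x of (i, j) \<Rightarrow> k i\<cdot>l i j)"
    using g(1) d(3) by auto
  with g show ?thesis unfolding cov_def by blast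
qed

text \<open>This is universality: the decomposition of \<open>P\<close> pulled back along
  \<open>f\<close> decomposes the domain of \<open>f\<close>, and on each piece \<open>f\<close>
  takes values in one summand.\<close>

lemma cov_coproduct:
  assumes I: "small_index small I" and c: "is_coproduct C I A P \<iota>" and f: "arr f" "cod f = P"
  shows "cov (dom f) (\<lambda>u. \<exists>i\<in>I. \<exists>a. arr a \<and> dom a = dom u \<and> cod a = A i \<and> f\<cdot>u = \<iota> i\<cdot>a)"
proof -
  obtain g where g: "inj_on g I" "small (g ` I)" "is_coproduct C (g ` I) (\<lambda>x. A (inv_into I g x)) P (\<lambda>x. \<iota> (inv_into I g x))"
    using reindex_small[OF I c] .
  note t = coproduct_typed[OF c]
  let ?k = "\<lambda>x. \<iota> (inv_into I g x)"
  have inv: "inv_into I g x \<in> I" if "x \<in> g ` I" for x using that by (rule inv_into_into)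
  have pb: "is_pullback C f (?k x) (pb_fst C f (?k x)) (pb_snd C f (?k x))" if "x \<in> g ` I" for x
    by (rule pb) (use f t inv[OF that] in simp_all)
  have "is_coproduct C (g ` I) (\<lambda>x. dom (pb_fst C f (?k x))) (dom f) (\<lambda>x. pb_fst C f (?k x))"
    by (rule small_coproduct(2)[OF g(2,3), unfolded universal_coproduct_def, rule_format, OF f,
      of "\<lambda>x. pb_fst C f (?k x)" "\<lambda>x. pb_snd C f (?k x)"]) (rule pb)
  moreover have "\<exists>i\<in>I. \<exists>a. arr a \<and> dom a = dom (pb_fst C f (?k x)) \<and> cod a = A i \<and> f\<cdot>pb_fst C f (?k x) = \<iota> i\<cdot>a"
    if "x \<in> g ` I" for x
    using pullback_typed[OF pb[OF that]] t inv[OF that] by metis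
  ultimately show ?thesis unfolding cov_def using g(2) by blast
qed

text \<open>The local factorizations are glued by the universal property of the coproduct, which
  imposes no compatibility between different pieces.\<close>

lemma cov_factor:
  assumes "cov P S" "arr g" "dom g = P" "arr m" "cod m = cod g"
    and e: "\<And>k. \<lbrakk>arr k; cod k = P; S k\<rbrakk> \<Longrightarrow> \<exists>h. arr h \<and> dom h = dom k \<and> cod h = dom m \<and> m\<cdot>h = g\<cdot>k"
  obtains h where "arr h" "dom h = P" "cod h = dom m" "m\<cdot>h = g"
proof -
  obtain I Z k where c: "small (I :: 'u set)" "is_coproduct C I Z P k" "\<forall>i\<in>I. S (k i)"
    using assms(1) unfolding cov_def by blast
  note t = coproduct_typed[OF c(2)]
  have "\<forall>i\<in>I. \<exists>h. arr h \<and> dom h = Z i \<and> cod h = dom m \<and> m\<cdot>h = g\<cdot>k i"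
  proof
    fix i assume "i \<in> I"
    then show "\<exists>h. arr h \<and> dom h = Z i \<and> cod h = dom m \<and> m\<cdot>h = g\<cdot>k i"
      using e[of "k i"] c(3) t by auto
  qed
  then obtain h where h: "\<And>i. i \<in> I \<Longrightarrow> arr (h i) \<and> dom (h i) = Z i \<and> cod (h i) = dom m \<and> m\<cdot>h i = g\<cdot>k i"
    by metis
  obtain u where u: "arr u" "dom u = P" "cod u = dom m" "\<And>i. i \<in> I \<Longrightarrow> u\<cdot>k i = h i"
    by (rule coproduct_ex[OF c(2), of "dom m" h]) (use h assms in auto)
  have "m\<cdot>u = g"
    by (rule coproduct_eq[OF c(2)]) (use u h t assms in auto)
  then show ?thesis using that u by blast
qed

text \<open>In a lextensive category, coproducts are the jointly covering families of monic and
  pairwise disjoint arrows. All later descriptions of an object as a sum (a copower, a pullback of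
  sums, the object of chains) are obtained from this criterion.\<close>

lemma coproduct_recognition:
  assumes P: "cov P (\<lambda>k. \<exists>i\<in>I. \<exists>t. arr t \<and> dom t = dom k \<and> cod t = W i \<and> k = w i\<cdot>t)"
    and w: "\<And>i. i \<in> I \<Longrightarrow> arr (w i)" "\<And>i. i \<in> I \<Longrightarrow> dom (w i) = W i" "\<And>i. i \<in> I \<Longrightarrow> cod (w i) = P"
    and mono: "\<And>i a b. \<lbrakk>i \<in> I; arr a; arr b; dom a = dom b; cod a = W i; cod b = W i; w i\<cdot>a = w i\<cdot>b\<rbrakk> \<Longrightarrow> a = b"
    and disj: "\<And>i j a b. \<lbrakk>i \<in> I; j \<in> I; i \<noteq> j; arr a; arr b; dom a = dom b; cod a = W i; cod b = W j; w i\<cdot>a = w j\<cdot>b\<rbrakk>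
      \<Longrightarrow> is_initial C (dom a)"
  shows "is_coproduct C I W P w"
proof (rule coproductI)
  fix Z g assume g: "Z \<in> Obj C" "\<And>i. i \<in> I \<Longrightarrow> arr (g i)" "\<And>i. i \<in> I \<Longrightarrow> dom (g i) = W i" "\<And>i. i \<in> I \<Longrightarrow> cod (g i) = Z"
  obtain J D k where c: "small (J :: 'u set)" "is_coproduct C J D P k"
    "\<forall>j\<in>J. \<exists>i\<in>I. \<exists>t. arr t \<and> dom t = dom (k j) \<and> cod t = W i \<and> k j = w i\<cdot>t"
    using P unfolding cov_def by blast
  note kt = coproduct_typed[OF c(2)]
  from c(3) obtain \<sigma> t where s: "\<And>j. j \<in> J \<Longrightarrow> \<sigma> j \<in> I \<and> arr (t j) \<and> dom (t j) = D j \<and> cod (t j) = W (\<sigma> j) \<and> k j = w (\<sigma> j)\<cdot>t j"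
    using kt(3) by metis
  \<comment> \<open>On the piece \<open>j\<close> the arrow is prescribed through the chosen index
    \<open>\<sigma> j\<close> and factor \<open>t j\<close>. That it restricts to \<open>g i\<close>
    along \<open>w i\<close> whatever was chosen is where \<open>mono\<close> and
    \<open>disj\<close> enter.\<close>
  obtain u where u: "arr u" "dom u = P" "cod u = Z" "\<And>j. j \<in> J \<Longrightarrow> u\<cdot>k j = g (\<sigma> j)\<cdot>t j"
    by (rule coproduct_ex[OF c(2) g(1), of "\<lambda>j. g (\<sigma> j)\<cdot>t j"]) (use s g in auto)
  have "u\<cdot>w i = g i" if i: "i \<in> I" for i
  proof (rule cov_eq[OF cov_coproduct[OF small_index_small[OF c(1)] c(2), of "w i"]])
    fix x assume x: "arr x" "cod x = dom (w i)" "\<exists>j\<in>J. \<exists>a. arr a \<and> dom a = dom x \<and> cod a = D j \<and> w i\<cdot>x = k j\<cdot>a"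
    then obtain j a where a: "j \<in> J" "arr a" "dom a = dom x" "cod a = D j" "w i\<cdot>x = k j\<cdot>a" by blast
    note sj = s[OF a(1)]
    have wx: "w i\<cdot>x = w (\<sigma> j)\<cdot>(t j\<cdot>a)" using a sj w by simp
    have "(u\<cdot>w i)\<cdot>x = (u\<cdot>k j)\<cdot>a" using a x(1,2) u(1-3) w i kt by simp
    also have "\<dots> = g (\<sigma> j)\<cdot>(t j\<cdot>a)" unfolding u(4)[OF a(1)] using a(2,4) sj g by simp
    finally have e: "(u\<cdot>w i)\<cdot>x = g (\<sigma> j)\<cdot>(t j\<cdot>a)" .
    show "(u\<cdot>w i)\<cdot>x = g i\<cdot>x"
    proof (cases "\<sigma> j = i")
      case True
      have "x = t j\<cdot>a" by (rule mono[OF i]) (use x a sj w i True in simp_all)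
      then show ?thesis using e True by simp
    next
      case False
      have "is_initial C (dom x)"
        by (rule disj[of i "\<sigma> j" x "t j\<cdot>a"]) (use x a(2-4) sj w i wx False in simp_all)
      then show ?thesis by (rule initial_eq) (use x u g w i in simp_all)
    qed
  qed (use i w u g in simp_all)
  then show "\<exists>u. arr u \<and> dom u = P \<and> cod u = Z \<and> (\<forall>i\<in>I. u\<cdot>w i = g i)" using u by blast
next
  fix u u' assume u: "arr u" "arr u'" "dom u = P" "dom u' = P" "cod u = cod u'"
    "\<And>i. i \<in> I \<Longrightarrow> u\<cdot>w i = u'\<cdot>w i"
  show "u = u'"
  proof (rule cov_eq[OF P u(1-5)])
    fix k assume "arr k" "\<exists>i\<in>I. \<exists>t. arr t \<and> dom t = dom k \<and> cod t = W i \<and> k = w i\<cdot>t"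
    then obtain i t where i: "i \<in> I" "arr t" "cod t = W i" "k = w i\<cdot>t" by blast
    then show "u\<cdot>k = u'\<cdot>k" using comp_cong[OF u(6)[OF i(1)], of t] u(1-5) w[OF i(1)] by simp
  qed
qed (use w cov_Obj[OF P] in auto)

section \<open>Copowers and discrete objects\<close>

lemma copow_coproduct: "small X \<Longrightarrow> is_coproduct C X (\<lambda>_. one C) (copow C X) (pt C X)"
  unfolding copow_def pt_def by (rule coproduct_of_small_index) (auto simp: small_index_small)

lemma copow_Obj [simp]: "small X \<Longrightarrow> copow C X \<in> Obj C"
  using coproduct_typed[OF copow_coproduct] by blast

lemma pt_typed [simp]:
  assumes "small X" "x \<in> X"
  shows "arr (pt C X x)" "dom (pt C X x) = one C" "cod (pt C X x) = copow C X"
  using coproduct_typed[OF copow_coproduct[OF assms(1)]] assms(2) by auto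

lemma copow_ext:
  assumes "small X" "arr u" "arr u'" "dom u = copow C X" "dom u' = copow C X" "cod u = cod u'"
    "\<And>x. x \<in> X \<Longrightarrow> u\<cdot>pt C X x = u'\<cdot>pt C X x"
  shows "u = u'"
  by (rule coproduct_eq[OF copow_coproduct[OF assms(1)] assms(2-7)])

lemma copow_map_typed [simp]:
  assumes "small X" "small Y" "\<And>x. x \<in> X \<Longrightarrow> f x \<in> Y"
  shows "arr (copow_map C X f Y)" "dom (copow_map C X f Y) = copow C X" "cod (copow_map C X f Y) = copow C Y"
  using copair[of X "\<lambda>_. one C" "copow C Y" "\<lambda>x. pt C Y (f x)"] assms
  by (auto simp: copow_map_def copow_def[of C X] small_index_small)

lemma copow_map_pt [simp]:
  assumes "small X" "small Y" "\<And>x. x \<in> X \<Longrightarrow> f x \<in> Y" "x \<in> X"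
  shows "copow_map C X f Y\<cdot>pt C X x = pt C Y (f x)"
    "\<lbrakk>arr z; cod z = one C\<rbrakk> \<Longrightarrow> copow_map C X f Y\<cdot>(pt C X x\<cdot>z) = pt C Y (f x)\<cdot>z"
proof -
  show e: "copow_map C X f Y\<cdot>pt C X x = pt C Y (f x)"
    using copair(4)[of X "\<lambda>_. one C" "copow C Y" "\<lambda>x. pt C Y (f x)" x] assms
    by (simp add: copow_map_def pt_def[of C X] small_index_small)
  show "copow_map C X f Y\<cdot>(pt C X x\<cdot>z) = pt C Y (f x)\<cdot>z" if "arr z" "cod z = one C"
    using comp_cong[OF e, of z] assms that by simp
qed

lemma copow_map_cong:
  assumes "small X" "small Y" "\<And>x. x \<in> X \<Longrightarrow> f x \<in> Y" "\<And>x. x \<in> X \<Longrightarrow> f x = g x"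
  shows "copow_map C X f Y = copow_map C X g Y"
proof -
  have "\<And>x. x \<in> X \<Longrightarrow> g x \<in> Y" using assms(3,4) by metis
  then show ?thesis by - (rule copow_ext[of X], use assms in simp_all)
qed

lemma copow_map_id: "small X \<Longrightarrow> (\<And>x. x \<in> X \<Longrightarrow> f x = x) \<Longrightarrow> copow_map C X f X = Ident C (copow C X)"
  by (rule copow_ext[of X]) simp_all

lemma copow_map_comp:
  assumes "small X" "small Y" "small Z" "\<And>x. x \<in> X \<Longrightarrow> f x \<in> Y" "\<And>y. y \<in> Y \<Longrightarrow> g y \<in> Z"
  shows "copow_map C Y g Z\<cdot>copow_map C X f Y = copow_map C X (\<lambda>x. g (f x)) Z"
  by (rule copow_ext[of X]) (use assms in simp_all)

text \<open>The second alternative is unavoidable: over an initial object all points become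
  equal.\<close>

lemma pt_disjoint:
  assumes "small X" "x \<in> X" "x' \<in> X" "Z \<in> Obj C" "pt C X x\<cdot>bang C Z = pt C X x'\<cdot>bang C Z"
  shows "x = x' \<or> is_initial C Z"
  using coproduct_disjoint[OF small_index_small[OF assms(1)] copow_coproduct[OF assms(1)] assms(2,3), of "bang C Z" "bang C Z"] assms
  by auto

lemma cov_pt:
  assumes "small X" "arr g" "cod g = copow C X"
  shows "cov (dom g) (\<lambda>u. \<exists>x\<in>X. g\<cdot>u = pt C X x\<cdot>bang C (dom u))"
proof (rule cov_mono[OF cov_coproduct[OF small_index_small[OF assms(1)] copow_coproduct[OF assms(1)] assms(2,3)]])
  fix k assume "\<exists>i\<in>X. \<exists>a. arr a \<and> dom a = dom k \<and> cod a = one C \<and> g\<cdot>k = pt C X i\<cdot>a"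
  then show "\<exists>x\<in>X. g\<cdot>k = pt C X x\<cdot>bang C (dom k)" using bang_eq by metis
qed

text \<open>Locally both arrows are constant, at points \<open>x\<close> and \<open>y\<close> say.
  On such a piece either \<open>f x = f y\<close>, and injectivity applies, or the piece is
  initial.\<close>

lemma copow_map_inj_mono:
  assumes X: "small X" "small Y" "\<And>x. x \<in> X \<Longrightarrow> f x \<in> Y" "inj_on f X"
    and a: "arr a" "arr b" "dom a = dom b" "cod a = copow C X" "cod b = copow C X"
      "copow_map C X f Y\<cdot>a = copow_map C X f Y\<cdot>b"
  shows "a = b"
proof -
  have "cov (dom a) (\<lambda>u. a\<cdot>u = b\<cdot>u)"
  proof (rule cov_trans[OF cov_pt[OF X(1) a(1,4)]])
    fix k assume k: "arr k" "cod k = dom a" "\<exists>x\<in>X. a\<cdot>k = pt C X x\<cdot>bang C (dom k)"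
    then obtain x where x: "x \<in> X" "a\<cdot>k = pt C X x\<cdot>bang C (dom k)" by blast
    have "cov (dom (b\<cdot>k)) (\<lambda>u. \<exists>x\<in>X. (b\<cdot>k)\<cdot>u = pt C X x\<cdot>bang C (dom u))"
      by (rule cov_pt) (use k a X in simp_all)
    then have c: "cov (dom k) (\<lambda>u. \<exists>x\<in>X. (b\<cdot>k)\<cdot>u = pt C X x\<cdot>bang C (dom u))"
      using k a by simp
    show "cov (dom k) (\<lambda>u. a\<cdot>(k\<cdot>u) = b\<cdot>(k\<cdot>u))"
    proof (rule cov_mono[OF c])
      fix u assume u: "arr u" "cod u = dom k" "\<exists>x\<in>X. (b\<cdot>k)\<cdot>u = pt C X x\<cdot>bang C (dom u)"
      then obtain y where y: "y \<in> X" "b\<cdot>(k\<cdot>u) = pt C X y\<cdot>bang C (dom u)" using k a by auto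
      have x': "a\<cdot>(k\<cdot>u) = pt C X x\<cdot>bang C (dom u)"
        using comp_cong[OF x(2) _ _ _ u(1)] k(1,2) a u(1,2) x(1) X(1) by simp
      have "copow_map C X f Y\<cdot>(a\<cdot>(k\<cdot>u)) = copow_map C X f Y\<cdot>(b\<cdot>(k\<cdot>u))"
        using comp_cong[OF a(6), of "k\<cdot>u"] a(1-5) k(1,2) u(1,2) X by simp
      then have "pt C Y (f x)\<cdot>bang C (dom u) = pt C Y (f y)\<cdot>bang C (dom u)"
        unfolding x' y(2) using x(1) y(1) X u(1) by simp
      then have "f x = f y \<or> is_initial C (dom u)"
        using pt_disjoint[OF X(2), of "f x" "f y" "dom u"] x(1) y(1) X(3) u(1) by simp
      then show "a\<cdot>(k\<cdot>u) = b\<cdot>(k\<cdot>u)"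
      proof
        assume "f x = f y"
        then have "x = y" using X(4) x(1) y(1) by (auto simp: inj_on_def)
        then show ?thesis using x' y(2) by simp
      next
        assume "is_initial C (dom u)"
        then show ?thesis by (rule initial_eq) (use a(1-5) k(1,2) u(1,2) in simp_all)
      qed
    qed
  qed
  then show ?thesis by (rule cov_eq) (use a in simp_all)
qed

text \<open>Discrete objects are the copowers of the terminal object, up to smallness of the set of points.\<close>

definition points_disjoint where
  "points_disjoint Z \<longleftrightarrow> (\<forall>p q W. p \<in> hom C (one C) Z \<and> q \<in> hom C (one C) Z \<and> W \<in> Obj C \<and>
    p\<cdot>bang C W = q\<cdot>bang C W \<longrightarrow> p = q \<or> is_initial C W)"

text \<open>Stated through local constancy rather than as an isomorphism with a copower, so that it
  can be transferred along pullbacks without constructing the set of points.\<close>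

definition discrete where
  "discrete Z \<longleftrightarrow> points_disjoint Z \<and> cov Z (\<lambda>u. \<exists>p\<in>hom C (one C) Z. u = p\<cdot>bang C (dom u))"

lemma points_disjointD:
  "\<lbrakk>points_disjoint Z; arr p; arr q; dom p = one C; dom q = one C; cod p = Z; cod q = Z;
    W \<in> Obj C; p\<cdot>bang C W = q\<cdot>bang C W\<rbrakk> \<Longrightarrow> p = q \<or> is_initial C W"
  unfolding points_disjoint_def hom_iff by blast

text \<open>The decomposition of \<open>Z\<close> into points is pulled back along \<open>p\<close>;
  arrows into a discrete object are locally constant.\<close>

lemma cov_discrete:
  assumes "discrete Z" and p: "arr p" "cod p = Z"
  shows "cov (dom p) (\<lambda>u. \<exists>x. arr x \<and> dom x = one C \<and> cod x = Z \<and> p\<cdot>u = x\<cdot>bang C (dom u))"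
proof -
  obtain I W k where c: "small (I :: 'u set)" "is_coproduct C I W Z k" "\<forall>i\<in>I. \<exists>x\<in>hom C (one C) Z. k i = x\<cdot>bang C (dom (k i))"
    using assms(1) unfolding discrete_def cov_def by blast
  show ?thesis
  proof (rule cov_mono[OF cov_coproduct[OF small_index_small[OF c(1)] c(2) p]])
    fix u assume "\<exists>i\<in>I. \<exists>a. arr a \<and> dom a = dom u \<and> cod a = W i \<and> p\<cdot>u = k i\<cdot>a"
    then obtain i a where a: "i \<in> I" "arr a" "dom a = dom u" "cod a = W i" "p\<cdot>u = k i\<cdot>a" by blast
    obtain x where x: "x \<in> hom C (one C) Z" "k i = x\<cdot>bang C (dom (k i))" using c(3) a(1) by blast
    have "W i \<in> Obj C" using Obj_typed(2)[OF a(2)] a(4) by simp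
    then have "k i\<cdot>a = x\<cdot>bang C (dom u)" using x a coproduct_typed(3)[OF c(2) a(1)] by (subst x(2)) (simp add: hom_iff)
    then show "\<exists>x. arr x \<and> dom x = one C \<and> cod x = Z \<and> p\<cdot>u = x\<cdot>bang C (dom u)" using x(1) a(5) by (auto simp: hom_iff)
  qed
qed

text \<open>Locally both projections are constant, at points \<open>x\<close> and \<open>y\<close>.
  Since points of the base are disjoint, \<open>f\<cdot>x\<close> and \<open>g\<cdot>y\<close> are
  equal unless the piece is initial, and then \<open>x\<close> and \<open>y\<close> define a point
  of the pullback at which the piece is constant.\<close>

lemma discrete_pullback:
  assumes pb: "is_pullback C f g p q" and d: "discrete (dom f)" "discrete (dom g)" "points_disjoint (cod f)"
  shows "discrete (dom p)"
proof -
  note t = pullback_typed[OF pb]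
  have pd: "points_disjoint (dom f)" "points_disjoint (dom g)" using d by (auto simp: discrete_def)
  have 1: "points_disjoint (dom p)"
    unfolding points_disjoint_def
  proof (intro allI impI, elim conjE)
    fix a b W assume "a \<in> hom C (one C) (dom p)" "b \<in> hom C (one C) (dom p)" and W: "W \<in> Obj C" "a\<cdot>bang C W = b\<cdot>bang C W"
    then have a: "arr a" "arr b" "dom a = one C" "dom b = one C" "cod a = dom p" "cod b = dom p"
      by (simp_all add: hom_iff)
    have "(p\<cdot>a)\<cdot>bang C W = (p\<cdot>b)\<cdot>bang C W" "(q\<cdot>a)\<cdot>bang C W = (q\<cdot>b)\<cdot>bang C W"
      using W a t by simp_all
    then have "p\<cdot>a = p\<cdot>b \<or> is_initial C W" "q\<cdot>a = q\<cdot>b \<or> is_initial C W"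
      using points_disjointD[OF pd(1), of "p\<cdot>a" "p\<cdot>b" W] points_disjointD[OF pd(2), of "q\<cdot>a" "q\<cdot>b" W] W(1) a t(1-8) by auto
    then show "a = b \<or> is_initial C W" using pullback_eq[OF pb, of a b] a by auto
  qed
  define S where "S u \<longleftrightarrow> (\<exists>x\<in>hom C (one C) (dom p). u = x\<cdot>bang C (dom u))" for u
  have "cov (dom p) S"
  proof (rule cov_trans[OF cov_discrete[OF d(1) t(3,6)]])
    fix k assume k: "arr k" "cod k = dom p" "\<exists>x. arr x \<and> dom x = one C \<and> cod x = dom f \<and> p\<cdot>k = x\<cdot>bang C (dom k)"
    then obtain x where x: "arr x" "dom x = one C" "cod x = dom f" "p\<cdot>k = x\<cdot>bang C (dom k)" by blast
    have c: "cov (dom k) (\<lambda>u. \<exists>y. arr y \<and> dom y = one C \<and> cod y = dom g \<and> (q\<cdot>k)\<cdot>u = y\<cdot>bang C (dom u))"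
      using cov_discrete[OF d(2), of "q\<cdot>k"] k t by simp
    show "cov (dom k) (\<lambda>u. S (k\<cdot>u))"
    proof (rule cov_trans[OF c])
      fix u assume u: "arr u" "cod u = dom k" "\<exists>y. arr y \<and> dom y = one C \<and> cod y = dom g \<and> (q\<cdot>k)\<cdot>u = y\<cdot>bang C (dom u)"
      then obtain y where y: "arr y" "dom y = one C" "cod y = dom g" "q\<cdot>(k\<cdot>u) = y\<cdot>bang C (dom u)"
        using k t by auto
      have x': "p\<cdot>(k\<cdot>u) = x\<cdot>bang C (dom u)" using comp_cong[OF x(4) _ _ _ u(1)] k(1,2) t x(1-3) u(1,2) by simp
      have "(f\<cdot>x)\<cdot>bang C (dom u) = f\<cdot>(p\<cdot>(k\<cdot>u))" unfolding x' using x(1-3) t u by simp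
      also have "\<dots> = g\<cdot>(q\<cdot>(k\<cdot>u))" using comp_cong[OF t(9), of "k\<cdot>u"] t(1-8) k(1,2) u(1,2) by simp
      also have "\<dots> = (g\<cdot>y)\<cdot>bang C (dom u)" unfolding y(4) using y(1-3) t u by simp
      finally have e: "f\<cdot>x = g\<cdot>y \<or> is_initial C (dom u)"
        using points_disjointD[OF d(3), of "f\<cdot>x" "g\<cdot>y" "dom u"] x(1-3) y(1-3) t(1-8) u(1) by simp
      show "cov (dom u) (\<lambda>v. S (k\<cdot>(u\<cdot>v)))"
      proof (cases "is_initial C (dom u)")
        case True then show ?thesis by (rule cov_initial)
      next
        case False
        with e have e: "f\<cdot>x = g\<cdot>y" by simp
        obtain z where z: "arr z" "dom z = one C" "cod z = dom p" "p\<cdot>z = x" "q\<cdot>z = y"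
          by (rule pullback_ex[OF pb, of x y]) (use x y e in simp_all)
        have "k\<cdot>u = z\<cdot>bang C (dom u)"
          by (rule pullback_eq[OF pb])
            (use z k(1,2) u(1,2) x' y t comp_cong[OF z(4), of "bang C (dom u)"] comp_cong[OF z(5), of "bang C (dom u)"] in simp_all)
        then have "S (k\<cdot>(u\<cdot>Ident C (dom u)))" unfolding S_def using z k(1,2) u(1,2)
          by (intro bexI[of _ z]) (simp_all add: hom_iff)
        then show ?thesis using u by (intro cov_Ident) simp_all
      qed
    qed
  qed
  with 1 show ?thesis unfolding discrete_def S_def by blast
qed

text \<open>A piece of \<open>dom g\<close> lying over a point of the base is lifted into the
  pullback by means of a preimage of that point under \<open>f\<close>, which \<open>surj\<close>
  provides. The lift is locally constant because the pullback is discrete, hence so is the piece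
  itself.\<close>

lemma discrete_descends:
  assumes pb: "is_pullback C f g p q" and d: "discrete (dom p)" "discrete (cod f)"
    and surj: "\<And>b. \<lbrakk>arr b; dom b = one C; cod b = cod f\<rbrakk> \<Longrightarrow> \<exists>a. arr a \<and> dom a = one C \<and> cod a = dom f \<and> f\<cdot>a = b"
  shows "discrete (dom g)"
proof -
  note t = pullback_typed[OF pb]
  have pd: "points_disjoint (dom p)" "points_disjoint (cod f)" using d by (auto simp: discrete_def)
  have 1: "points_disjoint (dom g)"
    unfolding points_disjoint_def
  proof (intro allI impI, elim conjE)
    fix a b W assume "a \<in> hom C (one C) (dom g)" "b \<in> hom C (one C) (dom g)" and W: "W \<in> Obj C" "a\<cdot>bang C W = b\<cdot>bang C W"
    then have a: "arr a" "arr b" "dom a = one C" "dom b = one C" "cod a = dom g" "cod b = dom g"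
      by (simp_all add: hom_iff)
    show "a = b \<or> is_initial C W"
    proof (cases "is_initial C W")
      case False
      have "(g\<cdot>a)\<cdot>bang C W = (g\<cdot>b)\<cdot>bang C W" using W a t by simp
      with False have e: "g\<cdot>a = g\<cdot>b"
        using points_disjointD[OF pd(2), of "g\<cdot>a" "g\<cdot>b" W] W(1) a t(1-8) by auto
      obtain c where c: "arr c" "dom c = one C" "cod c = dom f" "f\<cdot>c = g\<cdot>a"
        using surj[of "g\<cdot>a"] a t by auto
      obtain x where x: "arr x" "dom x = dom c" "cod x = dom p" "p\<cdot>x = c" "q\<cdot>x = a"
        by (rule pullback_ex[OF pb, of c a]) (use c a in simp_all)
      obtain y where y: "arr y" "dom y = dom c" "cod y = dom p" "p\<cdot>y = c" "q\<cdot>y = b"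
        by (rule pullback_ex[OF pb, of c b]) (use c a e in simp_all)
      have "x\<cdot>bang C W = y\<cdot>bang C W"
        by (rule pullback_eq[OF pb])
          (use x(1-3) y(1-3) t W c comp_cong[OF x(4), of "bang C W"] comp_cong[OF x(5), of "bang C W"] comp_cong[OF y(4), of "bang C W"] comp_cong[OF y(5), of "bang C W"] in simp_all)
      then have "x = y" using points_disjointD[OF pd(1), of x y W] x(1-3) y(1-3) c(2) W(1) False by simp
      then show ?thesis using x(5) y(5) by simp
    qed simp
  qed
  define S where "S u \<longleftrightarrow> (\<exists>x\<in>hom C (one C) (dom g). u = x\<cdot>bang C (dom u))" for u
  have "cov (dom g) S"
  proof (rule cov_trans[OF cov_discrete[OF d(2) t(2) t(5)]])
    fix u assume u: "arr u" "cod u = dom g" "\<exists>x. arr x \<and> dom x = one C \<and> cod x = cod f \<and> g\<cdot>u = x\<cdot>bang C (dom u)"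
    then obtain x where x: "arr x" "dom x = one C" "cod x = cod f" and gu: "g\<cdot>u = x\<cdot>bang C (dom u)" by blast
    obtain y where y: "arr y" "dom y = one C" "cod y = dom f" "f\<cdot>y = x" using surj[OF x(1-3)] by blast
    have fy: "f\<cdot>(y\<cdot>bang C (dom u)) = g\<cdot>u" using comp_cong[OF y(4), of "bang C (dom u)"] y(1-3) t(1-8) u(1) gu by simp
    obtain v where v: "arr v" "dom v = dom u" "cod v = dom p" "p\<cdot>v = y\<cdot>bang C (dom u)" "q\<cdot>v = u"
      by (rule pullback_ex[OF pb, of "y\<cdot>bang C (dom u)" u]) (use y u fy in simp_all)
    show "cov (dom u) (\<lambda>w. S (u\<cdot>w))"
    proof (rule cov_mono[OF cov_discrete[OF d(1) v(1,3), unfolded v(2)]])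
      fix w assume w: "arr w" "cod w = dom u" "\<exists>z. arr z \<and> dom z = one C \<and> cod z = dom p \<and> v\<cdot>w = z\<cdot>bang C (dom w)"
      then obtain z where z: "arr z" "dom z = one C" "cod z = dom p" and vw: "v\<cdot>w = z\<cdot>bang C (dom w)" by blast
      have "u\<cdot>w = q\<cdot>(v\<cdot>w)" using comp_cong[OF v(5), of w] v(1-3) w(1,2) t(1-8) by simp
      also have "\<dots> = (q\<cdot>z)\<cdot>bang C (dom w)" unfolding vw using z(1-3) t(1-8) w(1) by simp
      finally show "S (u\<cdot>w)" unfolding S_def using z(1-3) t(1-8) w(1,2) u(1)
        by (intro bexI[of _ "q\<cdot>z"]) (simp_all add: hom_iff)
    qed
  qed
  with 1 show ?thesis unfolding discrete_def S_def by blast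
qed

text \<open>The pieces of a decomposition witnessing \<open>discrete\<close> need not be copies of
  \<open>one C\<close>; the recognition criterion allows them to be replaced by the family of all
  points.\<close>

lemma discrete_coproduct:
  assumes "discrete Z"
  shows "is_coproduct C (hom C (one C) Z) (\<lambda>_. one C) Z (\<lambda>z. z)"
proof (rule coproduct_recognition)
  show "cov Z (\<lambda>k. \<exists>i\<in>hom C (one C) Z. \<exists>t. arr t \<and> dom t = dom k \<and> cod t = one C \<and> k = i\<cdot>t)"
  proof (rule cov_mono)
    show "cov Z (\<lambda>u. \<exists>p\<in>hom C (one C) Z. u = p\<cdot>bang C (dom u))"
      using assms by (simp add: discrete_def)
    fix k assume "arr k" "\<exists>p\<in>hom C (one C) Z. k = p\<cdot>bang C (dom k)"
    then show "\<exists>i\<in>hom C (one C) Z. \<exists>t. arr t \<and> dom t = dom k \<and> cod t = one C \<and> k = i\<cdot>t"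
      by (metis Obj_typed(1) bang_typed)
  qed
next
  fix i j a b assume *: "i \<in> hom C (one C) Z" "j \<in> hom C (one C) Z" "i \<noteq> j" "arr a" "arr b" "dom a = dom b"
    "cod a = one C" "cod b = one C" "i\<cdot>a = j\<cdot>b"
  have "a = bang C (dom a)" "b = bang C (dom a)" using bang_eq[of a] bang_eq[of b] * by simp_all
  then have "i\<cdot>bang C (dom a) = j\<cdot>bang C (dom a)" using *(9) by metis
  then show "is_initial C (dom a)"
    using assms * points_disjointD[of Z i j "dom a"] unfolding discrete_def hom_iff by auto
qed (auto simp: hom_iff intro: to_one_eq)

lemma discrete_iso:
  assumes "discrete Z" "small (hom C (one C) Z)"
  obtains i where "is_iso C i" "arr i" "dom i = copow C (hom C (one C) Z)" "cod i = Z"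
  using coproduct_iso[OF copow_coproduct[OF assms(2)] discrete_coproduct[OF assms(1)]] by metis

end


section \<open>Standing hypotheses, points of copowers and the counit\<close>

locale embedding_setting = monad_setting V T + lextensive_category V small
  for small :: "'u set \<Rightarrow> bool" and V :: "('o, 'u) cat" (structure) and T :: "('o, 'u) monad" +
  assumes locally_small: "locally_small small V"
    and copow_ff: "fully_faithful (Sets small) V (copow_functor V)"
    and cartesian_monad: "is_cartesian_monad V T"
    and eps_cartesian: "is_cartesian_trans (Sets small) V
      (comp_functor (copow_functor V) (monad_setting.Tset_functor V T))
      (comp_functor T (copow_functor V)) (\<lambda>X. eps_hat V (FO T (copow V X)))"
    and eps_one_mono: "is_mono V (eps_hat V (FO T (one V)))"
begin

lemma T_functor: "is_functor V V T"
  using cartesian_monad by (simp add: is_cartesian_monad_def is_monad_def)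

lemmas T_typed [simp] = functorD(1-5)[OF T_functor]

lemma T_comp [simp]: "\<lbrakk>arr f; arr g; cod f = dom g\<rbrakk> \<Longrightarrow> FA T (g\<cdot>f) = FA T g\<cdot>FA T f"
  by (rule functorD(6)[OF T_functor])

lemma T_cong: "\<lbrakk>g\<cdot>f = h; arr f; arr g; cod f = dom g\<rbrakk> \<Longrightarrow> FA T g\<cdot>FA T f = FA T h"
  using T_comp by metis

lemma T_cong2: "\<lbrakk>g\<cdot>f = g'\<cdot>f'; arr f; arr g; arr f'; arr g'; cod f = dom g; cod f' = dom g'\<rbrakk>
    \<Longrightarrow> FA T g\<cdot>FA T f = FA T g'\<cdot>FA T f'"
  using T_comp by metis

lemma T_pullback: "is_pullback V f g p q \<Longrightarrow> is_pullback V (FA T f) (FA T g) (FA T p) (FA T q)"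
  using cartesian_monad by (auto simp: is_cartesian_monad_def preserves_pullbacks_def)

lemma Unit_typed [simp]:
  assumes "A \<in> Obj V"
  shows "arr (Unit T A)" "dom (Unit T A) = A" "cod (Unit T A) = FO T A"
  using cartesian_monad assms
  by (auto simp: is_cartesian_monad_def is_monad_def is_nat_trans_def id_functor_def comp_functor_def hom_iff)

lemma Mult_typed [simp]:
  assumes "A \<in> Obj V"
  shows "arr (Mult T A)" "dom (Mult T A) = FO T (FO T A)" "cod (Mult T A) = FO T A"
  using cartesian_monad assms
  by (auto simp: is_cartesian_monad_def is_monad_def is_nat_trans_def id_functor_def comp_functor_def hom_iff)

lemma Unit_nat: "arr f \<Longrightarrow> Unit T (cod f)\<cdot>f = FA T f\<cdot>Unit T (dom f)"
  using cartesian_monad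
  by (auto simp: is_cartesian_monad_def is_monad_def is_nat_trans_def id_functor_def comp_functor_def)

lemma Mult_nat: "arr f \<Longrightarrow> Mult T (cod f)\<cdot>FA T (FA T f) = FA T f\<cdot>Mult T (dom f)"
  using cartesian_monad
  by (auto simp: is_cartesian_monad_def is_monad_def is_nat_trans_def id_functor_def comp_functor_def)

lemma monad_laws:
  assumes "A \<in> Obj V"
  shows "Mult T A\<cdot>Unit T (FO T A) = Ident V (FO T A)" "Mult T A\<cdot>FA T (Unit T A) = Ident V (FO T A)"
    "Mult T A\<cdot>Mult T (FO T A) = Mult T A\<cdot>FA T (Mult T A)"
  using cartesian_monad assms by (auto simp: is_cartesian_monad_def is_monad_def)

lemma small_hom [simp]: "\<lbrakk>A \<in> Obj V; B \<in> Obj V\<rbrakk> \<Longrightarrow> small (hom V A B)"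
  using locally_small by (auto simp: locally_small_def)

lemma Tset_small [simp]: "small X \<Longrightarrow> small (Tset X)"
  unfolding Tset_def by simp

lemma Tset_iff: "\<xi> \<in> Tset X \<longleftrightarrow> arr \<xi> \<and> dom \<xi> = one V \<and> cod \<xi> = FO T (copow V X)"
  by (simp add: Tset_def hom_iff)

lemma Tset_typed: "\<xi> \<in> Tset X \<Longrightarrow> arr \<xi>" "\<xi> \<in> Tset X \<Longrightarrow> dom \<xi> = one V"
  "\<xi> \<in> Tset X \<Longrightarrow> cod \<xi> = FO T (copow V X)"
  by (simp_all add: Tset_iff)

lemma Tfun_in [simp]:
  assumes "small X" "small Y" "\<And>x. x \<in> X \<Longrightarrow> f x \<in> Y" "\<xi> \<in> Tset X"
  shows "Tfun X f Y \<xi> \<in> Tset Y"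
  using assms by (simp add: Tfun_def Tset_iff)

lemma Tfun_app: "\<xi> \<in> Tset X \<Longrightarrow> Tfun X f Y \<xi> = FA T (copow_map V X f Y)\<cdot>\<xi>"
  by (simp add: Tfun_def)

lemma eps_typed:
  assumes "Z \<in> Obj V"
  shows "arr (eps_hat V Z)" "dom (eps_hat V Z) = copow V (hom V (one V) Z)" "cod (eps_hat V Z) = Z"
  unfolding eps_hat_def copow_def
  by (rule copair; use assms in \<open>simp add: small_index_small hom_iff\<close>)+

lemma eps_pt:
  assumes "Z \<in> Obj V" "z \<in> hom V (one V) Z"
  shows "eps_hat V Z\<cdot>pt V (hom V (one V) Z) z = z"
  unfolding eps_hat_def pt_def
  by (rule copair(4); use assms in \<open>simp add: small_index_small hom_iff\<close>)

abbreviation epsT where "epsT X \<equiv> eps_hat V (FO T (copow V X))"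

lemma epsT_typed [simp]:
  assumes "small X"
  shows "arr (epsT X)" "dom (epsT X) = copow V (Tset X)" "cod (epsT X) = FO T (copow V X)"
  using assms eps_typed[of "FO T (copow V X)"] by (simp_all add: Tset_def)

lemma epsT_pt [simp]:
  assumes "small X" "\<xi> \<in> Tset X"
  shows "epsT X\<cdot>pt V (Tset X) \<xi> = \<xi>" "\<lbrakk>arr z; cod z = one V\<rbrakk> \<Longrightarrow> epsT X\<cdot>(pt V (Tset X) \<xi>\<cdot>z) = \<xi>\<cdot>z"
proof -
  show e: "epsT X\<cdot>pt V (Tset X) \<xi> = \<xi>"
    using eps_pt[of "FO T (copow V X)" \<xi>] assms by (simp add: Tset_def)
  show "epsT X\<cdot>(pt V (Tset X) \<xi>\<cdot>z) = \<xi>\<cdot>z" if "arr z" "cod z = one V"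
    using comp_cong[OF e, of z] assms that by simp
qed

text \<open>Cartesianness of the counit for plain functions. Arrows of \<open>Sets small\<close> are
  extensional, whence the detour through \<open>restrict\<close>.\<close>

lemma epsT_pullback:
  assumes "small X" "small Y" "\<And>x. x \<in> X \<Longrightarrow> f x \<in> Y"
  shows "is_pullback V (epsT Y) (FA T (copow_map V X f Y)) (copow_map V (Tset X) (Tfun X f Y) (Tset Y)) (epsT X)"
proof -
  let ?f = "restrict f X"
  have "(X, ?f, Y) \<in> Arr (Sets small)" using assms by (auto simp: Sets_def)
  then have "is_pullback V (epsT Y) (FA T (copow_map V X ?f Y)) (copow_map V (Tset X) (Tfun X ?f Y) (Tset Y)) (epsT X)"
    using eps_cartesian unfolding is_cartesian_trans_def comp_functor_def copow_functor_def Tset_functor_def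
    by (force simp: Sets_def)
  moreover have "copow_map V X ?f Y = copow_map V X f Y" by (rule copow_map_cong) (use assms in auto)
  moreover from this have "Tfun X ?f Y = Tfun X f Y" by (simp add: Tfun_def fun_eq_iff)
  ultimately show ?thesis by simp
qed

lemma copow_full:
  assumes "small X" "small Y" "arr g" "dom g = copow V X" "cod g = copow V Y"
  obtains f where "f \<in> X \<rightarrow>\<^sub>E Y" "g = copow_map V X f Y"
proof -
  have "bij_betw (FA (copow_functor V)) (hom (Sets small) X Y) (hom V (copow V X) (copow V Y))"
    using copow_ff assms(1,2) by (simp add: fully_faithful_def copow_functor_def Sets_def)
  then have "g \<in> FA (copow_functor V) ` hom (Sets small) X Y" using assms by (simp add: bij_betw_def hom_iff)
  then show ?thesis using that by (auto simp: hom_def Sets_def copow_functor_def)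
qed

lemma copow_faithful:
  assumes "small X" "small Y" "f \<in> X \<rightarrow>\<^sub>E Y" "g \<in> X \<rightarrow>\<^sub>E Y" "copow_map V X f Y = copow_map V X g Y"
  shows "f = g"
proof -
  have "bij_betw (FA (copow_functor V)) (hom (Sets small) X Y) (hom V (copow V X) (copow V Y))"
    using copow_ff assms(1,2) by (simp add: fully_faithful_def copow_functor_def Sets_def)
  then have "inj_on (FA (copow_functor V)) (hom (Sets small) X Y)" by (simp add: bij_betw_def)
  from inj_onD[OF this, of "(X, f, Y)" "(X, g, Y)"] show ?thesis
    using assms by (simp add: hom_def Sets_def copow_functor_def)
qed

text \<open>The copower of a singleton is isomorphic to \<open>one V\<close> but need not be equal
  to it, so \<open>star\<close> takes the place of the terminal object wherever a copower is
  required.\<close>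

abbreviation "star \<equiv> {undefined :: 'u}"

lemma small_star [simp]: "small star" by (rule small_singleton)

lemma star_iso: "pt V star undefined\<cdot>bang V (copow V star) = Ident V (copow V star)"
  by (rule copow_ext[of star]) auto

text \<open>Two elements with equal points give constant functions on \<open>star\<close> with equal
  copower maps, which faithfulness separates. Disjointness alone would leave open the case of an
  initial \<open>one V\<close>.\<close>

lemma pt_inj:
  assumes "small X" "x \<in> X" "y \<in> X" "pt V X x = pt V X y"
  shows "x = y"
proof -
  have f: "\<And>z u. z \<in> X \<Longrightarrow> u \<in> star \<Longrightarrow> (\<lambda>u\<in>star. z) u \<in> X" by simp
  have "copow_map V star (\<lambda>u\<in>star. x) X = copow_map V star (\<lambda>u\<in>star. y) X"
  proof (rule copow_ext[of star])
    fix u assume "u \<in> star"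
    then show "copow_map V star (\<lambda>u\<in>star. x) X\<cdot>pt V star u = copow_map V star (\<lambda>u\<in>star. y) X\<cdot>pt V star u"
      using copow_map_pt(1)[of star X "\<lambda>u\<in>star. x", OF small_star assms(1) f[OF assms(2)]] copow_map_pt(1)[of star X "\<lambda>u\<in>star. y", OF small_star assms(1) f[OF assms(3)]] assms(4)
      by simp
  qed (use copow_map_typed[of star X "\<lambda>u\<in>star. x", OF small_star assms(1) f[OF assms(2)]] copow_map_typed[of star X "\<lambda>u\<in>star. y", OF small_star assms(1) f[OF assms(3)]] in simp_all)
  from copow_faithful[OF _ assms(1) _ _ this] assms have "(\<lambda>u\<in>star. x) = (\<lambda>u\<in>star. y)" by simp
  from fun_cong[OF this, of undefined] show ?thesis by simp
qed

text \<open>Fullness of the copower functor: a point corresponds to an arrow out of the copower of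
  \<open>star\<close>, which is induced by a function. It expresses that the terminal object is
  connected.\<close>

lemma point_cases:
  assumes "small X" "arr p" "dom p = one V" "cod p = copow V X"
  obtains x where "x \<in> X" "p = pt V X x"
proof -
  obtain f where f: "f \<in> star \<rightarrow>\<^sub>E X" "p\<cdot>bang V (copow V star) = copow_map V star f X"
    by (rule copow_full[of star X "p\<cdot>bang V (copow V star)"]) (use assms in auto)
  have fx: "\<And>x. x \<in> star \<Longrightarrow> f x \<in> X" using f(1) by auto
  have "p = (p\<cdot>bang V (copow V star))\<cdot>pt V star undefined" using assms by simp
  also have "\<dots> = pt V X (f undefined)" unfolding f(2) by (rule copow_map_pt(1)[OF small_star assms(1) fx]) auto
  finally show ?thesis using that fx by blast
qed

lemma discrete_copow:
  assumes "small X" shows "discrete (copow V X)"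
proof -
  have "cov (dom (Ident V (copow V X))) (\<lambda>u. \<exists>x\<in>X. Ident V (copow V X)\<cdot>u = pt V X x\<cdot>bang V (dom u))"
    by (rule cov_pt) (use assms in simp_all)
  then have "cov (copow V X) (\<lambda>u. \<exists>x\<in>X. Ident V (copow V X)\<cdot>u = pt V X x\<cdot>bang V (dom u))"
    using assms by simp
  then have "cov (copow V X) (\<lambda>u. \<exists>p\<in>hom V (one V) (copow V X). u = p\<cdot>bang V (dom u))"
    by (rule cov_mono) (use assms in \<open>auto simp: hom_iff intro!: bexI[of _ "pt V X _"]\<close>)
  moreover have "points_disjoint (copow V X)"
    unfolding points_disjoint_def
  proof (intro allI impI, elim conjE)
    fix p q W assume h: "p \<in> hom V (one V) (copow V X)" "q \<in> hom V (one V) (copow V X)" "W \<in> Obj V" "p\<cdot>bang V W = q\<cdot>bang V W"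
    obtain x where x: "x \<in> X" "p = pt V X x" by (rule point_cases[OF assms, of p]) (use h in \<open>auto simp: hom_iff\<close>)
    obtain y where y: "y \<in> X" "q = pt V X y" by (rule point_cases[OF assms, of q]) (use h in \<open>auto simp: hom_iff\<close>)
    show "p = q \<or> is_initial V W" using pt_disjoint[OF assms x(1) y(1) h(3)] h(4) x y by auto
  qed
  ultimately show ?thesis by (simp add: discrete_def)
qed

text \<open>Monicity is assumed at \<open>T (one V)\<close>, whereas cartesianness concerns
  copowers. The counit at \<open>star\<close> is therefore compared, by naturality, with the given
  one along the isomorphism between \<open>one V\<close> and the copower of
  \<open>star\<close>.\<close>

lemma eps_star_mono:
  assumes a: "arr a" "arr b" "dom a = dom b" "cod a = copow V (Tset star)" "cod b = copow V (Tset star)"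
    and e: "epsT star\<cdot>a = epsT star\<cdot>b"
  shows "a = b"
proof -
  define t where "t = FA T (bang V (copow V star))"
  define t' where "t' = FA T (pt V star undefined)"
  define H where "H = hom V (one V) (FO T (one V))"
  have t: "arr t" "dom t = FO T (copow V star)" "cod t = FO T (one V)"
    "arr t'" "dom t' = FO T (one V)" "cod t' = FO T (copow V star)" "t'\<cdot>t = Ident V (FO T (copow V star))"
    using T_cong[OF star_iso] by (simp_all add: t_def t'_def)
  define c where "c = copow_map V (Tset star) (\<lambda>z. t\<cdot>z) H"
  have H: "small H" "\<And>z. z \<in> Tset star \<Longrightarrow> t\<cdot>z \<in> H" "\<And>z. z \<in> H \<Longrightarrow> t'\<cdot>z \<in> Tset star"
    using t by (simp_all add: H_def hom_iff Tset_iff)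
  have c: "arr c" "dom c = copow V (Tset star)" "cod c = copow V H" using H by (simp_all add: c_def)
  have ec: "eps_hat V (FO T (one V))\<cdot>c = t\<cdot>epsT star"
  proof (rule copow_ext[of "Tset star"])
    fix \<xi> assume xi: "\<xi> \<in> Tset star"
    have cp: "c\<cdot>pt V (Tset star) \<xi> = pt V H (t\<cdot>\<xi>)"
      unfolding c_def by (rule copow_map_pt(1)[OF Tset_small[OF small_star] H(1) H(2) xi])
    have "eps_hat V (FO T (one V))\<cdot>(c\<cdot>pt V (Tset star) \<xi>) = t\<cdot>\<xi>"
      unfolding cp using H(2)[OF xi] eps_pt[of "FO T (one V)" "t\<cdot>\<xi>"] by (simp add: H_def)
    then show "(eps_hat V (FO T (one V))\<cdot>c)\<cdot>pt V (Tset star) \<xi> = (t\<cdot>epsT star)\<cdot>pt V (Tset star) \<xi>"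
      using xi t c Tset_typed[OF xi] eps_typed[of "FO T (one V)"] by (simp add: H_def)
  qed (use t c eps_typed[of "FO T (one V)"] in \<open>simp_all add: H_def\<close>)
  note eH = eps_typed[of "FO T (one V)", simplified, folded H_def]
  have "eps_hat V (FO T (one V))\<cdot>(c\<cdot>a) = eps_hat V (FO T (one V))\<cdot>(c\<cdot>b)"
    using comp_cong[OF ec, of a] comp_cong[OF ec, of b] a c t e eH by simp
  then have ca: "c\<cdot>a = c\<cdot>b"
    by - (rule eps_one_mono[unfolded is_mono_def, THEN conjunct2, rule_format, of "dom a"],
      use a c eH in \<open>simp_all add: hom_iff\<close>)
  define d where "d = copow_map V H (\<lambda>z. t'\<cdot>z) (Tset star)"
  have dc: "d\<cdot>c = Ident V (copow V (Tset star))"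
  proof -
    have "\<And>x. x \<in> Tset star \<Longrightarrow> t'\<cdot>(t\<cdot>x) = x"
      using comp_cong[OF t(7)] t(1-6) Tset_typed[of _ star] by simp
    then show ?thesis
      unfolding d_def c_def by (subst copow_map_comp) (use H in \<open>auto intro!: copow_map_id\<close>)
  qed
  have d: "arr d" "dom d = copow V H" using H by (simp_all add: d_def)
  have "d\<cdot>(c\<cdot>a) = a" "d\<cdot>(c\<cdot>b) = b"
    using comp_cong[OF dc, of a] comp_cong[OF dc, of b] d c a by simp_all
  then show ?thesis using ca by metis
qed

text \<open>The naturality square for the function from \<open>X\<close> to \<open>star\<close> is a
  pullback, and a pullback of the monic counit at \<open>star\<close> is monic.\<close>

lemma epsT_mono:
  assumes X: "small X" and a: "arr a" "arr b" "dom a = dom b" "cod a = copow V (Tset X)" "cod b = copow V (Tset X)"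
    and e: "epsT X\<cdot>a = epsT X\<cdot>b"
  shows "a = b"
proof -
  note pb = epsT_pullback[OF X small_star, of "\<lambda>_. undefined", simplified]
  note t = pullback_typed[OF pb]
  let ?c = "copow_map V (Tset X) (Tfun X (\<lambda>_. undefined) star) (Tset star)"
  have "epsT star\<cdot>(?c\<cdot>a) = epsT star\<cdot>(?c\<cdot>b)"
    using comp_cong[OF t(9), of a] comp_cong[OF t(9), of b] a X e by simp
  then have "?c\<cdot>a = ?c\<cdot>b" by - (rule eps_star_mono, use a X in simp_all)
  then show ?thesis by - (rule pullback_eq[OF pb], use a X e in simp_all)
qed

text \<open>Through the monic counit, points of \<open>T (copow V X)\<close> inherit disjointness
  from the copower of \<open>Tset X\<close>, even where \<open>T (copow V X)\<close> is not a
  copower.\<close>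

lemma epsT_disjoint:
  assumes "small X" "\<xi> \<in> Tset X" "\<xi>' \<in> Tset X" "W \<in> Obj V" "\<xi>\<cdot>bang V W = \<xi>'\<cdot>bang V W"
  shows "\<xi> = \<xi>' \<or> is_initial V W"
proof -
  note Tset_typed[OF assms(2), simp] Tset_typed[OF assms(3), simp]
  have "pt V (Tset X) \<xi>\<cdot>bang V W = pt V (Tset X) \<xi>'\<cdot>bang V W"
    by (rule epsT_mono[OF assms(1)]) (use assms in simp_all)
  then show ?thesis by (intro pt_disjoint[of "Tset X"]) (use assms in simp_all)
qed

text \<open>Factorization through the counit is lifted along the pullback square of
  \<open>f\<close>: for an arrow into \<open>T (copow V X)\<close> it can be tested after passing to
  \<open>T (copow V Y)\<close>.\<close>

lemma epsT_factor:
  assumes X: "small X" "small Y" "\<And>x. x \<in> X \<Longrightarrow> f x \<in> Y"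
    and g: "arr g" "cod g = FO T (copow V X)"
    and s: "arr s" "dom s = dom g" "cod s = copow V (Tset Y)" "epsT Y\<cdot>s = FA T (copow_map V X f Y)\<cdot>g"
  obtains h where "arr h" "dom h = dom g" "cod h = copow V (Tset X)" "epsT X\<cdot>h = g"
proof -
  have c: "cod s = dom (epsT Y)" "cod g = dom (FA T (copow_map V X f Y))" using X g s by simp_all
  obtain h where "arr h" "dom h = dom s" "cod h = dom (copow_map V (Tset X) (Tfun X f Y) (Tset Y))"
    "copow_map V (Tset X) (Tfun X f Y) (Tset Y)\<cdot>h = s" "epsT X\<cdot>h = g"
    by (rule pullback_ex[OF epsT_pullback[OF X] s(1) g(1) s(2) c s(4)])
  moreover have "dom (copow_map V (Tset X) (Tfun X f Y) (Tset Y)) = copow V (Tset X)"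
    using X by simp
  ultimately show ?thesis using that s(2) by simp
qed

lemma cov_epsT:
  assumes X: "small X" and h: "arr h" "cod h = copow V (Tset X)"
  shows "cov (dom h) (\<lambda>u. \<exists>\<xi>\<in>Tset X. (epsT X\<cdot>h)\<cdot>u = \<xi>\<cdot>bang V (dom u))"
proof (rule cov_mono[OF cov_pt[of "Tset X" h]])
  fix k assume k: "arr k" "cod k = dom h" "\<exists>x\<in>Tset X. h\<cdot>k = pt V (Tset X) x\<cdot>bang V (dom k)"
  then obtain \<xi> where xi: "\<xi> \<in> Tset X" "h\<cdot>k = pt V (Tset X) \<xi>\<cdot>bang V (dom k)" by blast
  then have "(epsT X\<cdot>h)\<cdot>k = \<xi>\<cdot>bang V (dom k)" using X h k by simp
  with xi(1) show "\<exists>\<xi>\<in>Tset X. (epsT X\<cdot>h)\<cdot>k = \<xi>\<cdot>bang V (dom k)" by blast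
qed (use X h in simp_all)

end

section \<open>Internal categories\<close>

text \<open>Supplies the instance of \<open>descent_morphism\<close> in which the arrow is the
  coequalizer of its own kernel pair.\<close>

lemma (in category) pullback_Ident:
  assumes "arr f"
  shows "is_pullback C f (Ident C (cod f)) (Ident C (dom f)) f"
proof (rule pullbackI)
  fix h k assume "arr h" "arr k" "dom h = dom k" "cod h = dom f" "cod k = dom (Ident C (cod f))"
    "f\<cdot>h = Ident C (cod f)\<cdot>k"
  then show "\<exists>u. arr u \<and> dom u = dom h \<and> cod u = dom (Ident C (dom f)) \<and> Ident C (dom f)\<cdot>u = h \<and> f\<cdot>u = k"
    using assms by (intro exI[of _ h]) simp
qed (use assms in simp_all)

context embedding_setting
begin

text \<open>The part of an internal category on which its object of chains depends.\<close>

definition graph where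
  "graph x \<longleftrightarrow> I0 x \<in> Obj V \<and> I1 x \<in> Obj V \<and> arr (D1 x) \<and> dom (D1 x) = I1 x \<and> cod (D1 x) = FO T (I0 x) \<and>
    arr (D0 x) \<and> dom (D0 x) = I1 x \<and> cod (D0 x) = I0 x"

lemma graphD [simp]:
  assumes "graph x"
  shows "I0 x \<in> Obj V" "I1 x \<in> Obj V" "arr (D1 x)" "dom (D1 x) = I1 x" "cod (D1 x) = FO T (I0 x)"
    "arr (D0 x)" "dom (D0 x) = I1 x" "cod (D0 x) = I0 x"
  using assms by (auto simp: graph_def)

lemma chain_typed [simp]:
  assumes "graph x"
  shows "arr (chain_fst x)" "arr (chain_snd x)" "dom (chain_fst x) = chain_ob x" "dom (chain_snd x) = chain_ob x"
    "cod (chain_fst x) = I1 x" "cod (chain_snd x) = FO T (I1 x)" "chain_ob x \<in> Obj V"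
  unfolding chain_fst_def chain_snd_def chain_ob_def using assms by simp_all

lemma chain_comm:
  assumes "graph x"
  shows "D1 x\<cdot>chain_fst x = FA T (D0 x)\<cdot>chain_snd x"
    "\<lbrakk>arr z; cod z = chain_ob x\<rbrakk> \<Longrightarrow> D1 x\<cdot>(chain_fst x\<cdot>z) = FA T (D0 x)\<cdot>(chain_snd x\<cdot>z)"
  unfolding chain_fst_def chain_snd_def chain_ob_def using assms by simp_all

lemma chain_pullback: "graph x \<Longrightarrow> is_pullback V (D1 x) (FA T (D0 x)) (chain_fst x) (chain_snd x)"
  unfolding chain_fst_def chain_snd_def by (rule pb) simp_all

lemma chain_lift:
  assumes "graph x" "arr f" "arr g" "dom f = dom g" "cod f = I1 x" "cod g = FO T (I1 x)"
    "D1 x\<cdot>f = FA T (D0 x)\<cdot>g"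
  shows "arr (chain_lift x f g)" "dom (chain_lift x f g) = dom g" "cod (chain_lift x f g) = chain_ob x"
    "chain_fst x\<cdot>chain_lift x f g = f" "chain_snd x\<cdot>chain_lift x f g = g"
  unfolding chain_fst_def chain_snd_def chain_ob_def chain_lift_def
  using pb_lift[of "D1 x" "FA T (D0 x)" f g] assms by simp_all

lemma chain_lift_eqI:
  assumes "graph x" "arr u" "cod u = chain_ob x" "chain_fst x\<cdot>u = f" "chain_snd x\<cdot>u = g"
  shows "chain_lift x f g = u"
  unfolding chain_lift_def by (rule pb_lift_eqI) (use assms in \<open>simp_all add: chain_fst_def chain_snd_def chain_ob_def\<close>)

lemma chain_lift_comp:
  assumes "graph x" "arr f" "arr g" "dom f = dom g" "cod f = I1 x" "cod g = FO T (I1 x)"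
    "D1 x\<cdot>f = FA T (D0 x)\<cdot>g" "arr z" "cod z = dom g"
  shows "chain_lift x f g\<cdot>z = chain_lift x (f\<cdot>z) (g\<cdot>z)"
proof -
  note l = chain_lift[OF assms(1-7)]
  show ?thesis
    by (rule chain_lift_eqI[symmetric])
      (use assms l comp_cong[OF l(4), of z] comp_cong[OF l(5), of z] in simp_all)
qed

lemma chain3_pullback: "graph x \<Longrightarrow> is_pullback V (chain_snd x) (FA T (chain_fst x)) (chain3_fst x) (chain3_snd x)"
  unfolding chain3_fst_def chain3_snd_def by (rule pb) simp_all

lemma chain3_typed [simp]:
  assumes "graph x"
  shows "arr (chain3_fst x)" "arr (chain3_snd x)" "dom (chain3_snd x) = dom (chain3_fst x)"
    "cod (chain3_fst x) = chain_ob x" "cod (chain3_snd x) = FO T (chain_ob x)"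
  using pullback_typed[OF chain3_pullback[OF assms]] assms by simp_all

lemma chain3_comm:
  assumes "graph x"
  shows "chain_snd x\<cdot>chain3_fst x = FA T (chain_fst x)\<cdot>chain3_snd x"
  using pullback_typed(9)[OF chain3_pullback[OF assms]] .

text \<open>All the data and equations of an internal category except for the unit and associativity laws.\<close>

definition precategory where
  "precategory x \<longleftrightarrow> graph x \<and> arr (S0 x) \<and> dom (S0 x) = I0 x \<and> cod (S0 x) = I1 x \<and>
    arr (Cm x) \<and> dom (Cm x) = chain_ob x \<and> cod (Cm x) = I1 x \<and>
    D0 x\<cdot>S0 x = Ident V (I0 x) \<and> D1 x\<cdot>S0 x = Unit T (I0 x) \<and>
    D0 x\<cdot>Cm x = D0 x\<cdot>chain_fst x \<and> D1 x\<cdot>Cm x = Mult T (I0 x)\<cdot>(FA T (D1 x)\<cdot>chain_snd x)"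

lemma is_icat_iff: "is_icat x \<longleftrightarrow> precategory x \<and>
    Cm x\<cdot>chain_lift x (S0 x\<cdot>D0 x) (Unit T (I1 x)) = Ident V (I1 x) \<and>
    Cm x\<cdot>chain_lift x (Ident V (I1 x)) (FA T (S0 x)\<cdot>D1 x) = Ident V (I1 x) \<and>
    Cm x\<cdot>chain_lift x (chain_fst x\<cdot>chain3_fst x) (FA T (Cm x)\<cdot>chain3_snd x) =
    Cm x\<cdot>chain_lift x (Cm x\<cdot>chain3_fst x) (Mult T (I1 x)\<cdot>(FA T (chain_snd x)\<cdot>chain3_snd x))"
  unfolding is_icat_def precategory_def graph_def hom_iff by blast

lemma precategoryD:
  assumes "precategory x"
  shows "graph x" "arr (S0 x)" "dom (S0 x) = I0 x" "cod (S0 x) = I1 x"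
    "arr (Cm x)" "dom (Cm x) = chain_ob x" "cod (Cm x) = I1 x"
    "D0 x\<cdot>S0 x = Ident V (I0 x)" "D1 x\<cdot>S0 x = Unit T (I0 x)"
    "D0 x\<cdot>Cm x = D0 x\<cdot>chain_fst x" "D1 x\<cdot>Cm x = Mult T (I0 x)\<cdot>(FA T (D1 x)\<cdot>chain_snd x)"
  using assms by (auto simp: precategory_def)

lemma icat_precategory: "is_icat x \<Longrightarrow> precategory x"
  by (simp add: is_icat_iff)

text \<open>These compatibilities make the four arrows into the object of chains that occur in the
  unit and associativity laws well defined; the laws are meaningful before they are known to
  hold.\<close>

lemma chain_lift_conditions:
  assumes "precategory x"
  shows "D1 x\<cdot>(S0 x\<cdot>D0 x) = FA T (D0 x)\<cdot>Unit T (I1 x)"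
    "D1 x\<cdot>Ident V (I1 x) = FA T (D0 x)\<cdot>(FA T (S0 x)\<cdot>D1 x)"
    "D1 x\<cdot>(chain_fst x\<cdot>chain3_fst x) = FA T (D0 x)\<cdot>(FA T (Cm x)\<cdot>chain3_snd x)"
    "D1 x\<cdot>(Cm x\<cdot>chain3_fst x) = FA T (D0 x)\<cdot>(Mult T (I1 x)\<cdot>(FA T (chain_snd x)\<cdot>chain3_snd x))"
proof -
  note x = precategoryD[OF assms] and c3 = chain3_comm[OF precategoryD(1)[OF assms]]
  show "D1 x\<cdot>(S0 x\<cdot>D0 x) = FA T (D0 x)\<cdot>Unit T (I1 x)"
    using Unit_nat[of "D0 x"] comp_cong[OF x(9), of "D0 x"] x(1-4) by simp
  show "D1 x\<cdot>Ident V (I1 x) = FA T (D0 x)\<cdot>(FA T (S0 x)\<cdot>D1 x)"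
    using comp_cong[OF T_cong[OF x(8)], of "D1 x"] x(1-4) by simp
  have "D1 x\<cdot>(chain_fst x\<cdot>chain3_fst x) = FA T (D0 x)\<cdot>(FA T (chain_fst x)\<cdot>chain3_snd x)"
    using x(1) chain_comm(2)[OF x(1), of "chain3_fst x"] c3 by simp
  also have "\<dots> = FA T (D0 x)\<cdot>(FA T (Cm x)\<cdot>chain3_snd x)"
    using comp_cong[OF T_cong2[OF x(10)], of "chain3_snd x"] x(1-7) by simp
  finally show "D1 x\<cdot>(chain_fst x\<cdot>chain3_fst x) = FA T (D0 x)\<cdot>(FA T (Cm x)\<cdot>chain3_snd x)" .
  have "D1 x\<cdot>(Cm x\<cdot>chain3_fst x) = Mult T (I0 x)\<cdot>(FA T (D1 x)\<cdot>(FA T (chain_fst x)\<cdot>chain3_snd x))"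
    using comp_cong[OF x(11), of "chain3_fst x"] c3 x(1-7) by simp
  also have "\<dots> = Mult T (I0 x)\<cdot>(FA T (FA T (D0 x))\<cdot>(FA T (chain_snd x)\<cdot>chain3_snd x))"
    using comp_cong[OF T_cong2[OF chain_comm(1)[OF x(1)]], of "chain3_snd x"] x(1-7) by simp
  also have "\<dots> = FA T (D0 x)\<cdot>(Mult T (I1 x)\<cdot>(FA T (chain_snd x)\<cdot>chain3_snd x))"
    using comp_cong[OF Mult_nat[of "D0 x"], of "FA T (chain_snd x)\<cdot>chain3_snd x"] x(1-7) by simp
  finally show "D1 x\<cdot>(Cm x\<cdot>chain3_fst x) = FA T (D0 x)\<cdot>(Mult T (I1 x)\<cdot>(FA T (chain_snd x)\<cdot>chain3_snd x))" .
qed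

lemma is_ifun_iff: "is_ifun (x, p0, p1, y) \<longleftrightarrow> is_icat x \<and> is_icat y \<and>
    arr p0 \<and> dom p0 = I0 x \<and> cod p0 = I0 y \<and> arr p1 \<and> dom p1 = I1 x \<and> cod p1 = I1 y \<and>
    D1 y\<cdot>p1 = FA T p0\<cdot>D1 x \<and> D0 y\<cdot>p1 = p0\<cdot>D0 x \<and> p1\<cdot>S0 x = S0 y\<cdot>p0 \<and>
    p1\<cdot>Cm x = Cm y\<cdot>chain_lift y (p1\<cdot>chain_fst x) (FA T p1\<cdot>chain_snd x)"
  unfolding is_ifun_def by (auto simp: hom_iff)

lemma ifunD:
  assumes "is_ifun (x, p0, p1, y)"
  shows "is_icat x" "is_icat y" "arr p0" "dom p0 = I0 x" "cod p0 = I0 y" "arr p1" "dom p1 = I1 x" "cod p1 = I1 y"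
    "D1 y\<cdot>p1 = FA T p0\<cdot>D1 x" "D0 y\<cdot>p1 = p0\<cdot>D0 x" "p1\<cdot>S0 x = S0 y\<cdot>p0"
    "p1\<cdot>Cm x = Cm y\<cdot>chain_lift y (p1\<cdot>chain_fst x) (FA T p1\<cdot>chain_snd x)"
    "precategory x" "precategory y" "graph x" "graph y"
  using assms by (auto simp: is_ifun_iff icat_precategory precategoryD(1))

text \<open>Makes the arrow induced on chains, which occurs in preservation of composition, well
  defined.\<close>

lemma ifun_chain_condition:
  assumes "graph x" "graph y" "arr p0" "dom p0 = I0 x" "cod p0 = I0 y" "arr p1" "dom p1 = I1 x" "cod p1 = I1 y"
    "D1 y\<cdot>p1 = FA T p0\<cdot>D1 x" "D0 y\<cdot>p1 = p0\<cdot>D0 x"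
  shows "D1 y\<cdot>(p1\<cdot>chain_fst x) = FA T (D0 y)\<cdot>(FA T p1\<cdot>chain_snd x)"
  using comp_cong[OF assms(9), of "chain_fst x"] comp_cong[OF T_cong2[OF assms(10)], of "chain_snd x"] chain_comm[OF assms(1)] assms(1-8) by simp

lemma ICat_simps [simp]:
  "x \<in> Obj ICat \<longleftrightarrow> is_icat x" "p \<in> Arr ICat \<longleftrightarrow> is_ifun p"
  "Dom ICat (x, p0, p1, y) = x" "Cod ICat (x, p0, p1, y) = y"
  "Ident ICat x = (x, Ident V (I0 x), Ident V (I1 x), x)"
  "(y', q0, q1, z) \<cdot>\<^bsub>ICat\<^esub> (x, p0, p1, y) = (x, q0\<cdot>p0, q1\<cdot>p1, z)"
  by (simp_all add: ICat_def)

lemma ICat_hom: "p \<in> hom ICat x y \<longleftrightarrow> (\<exists>p0 p1. p = (x, p0, p1, y) \<and> is_ifun (x, p0, p1, y))"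
  by (cases p) (auto simp: hom_def)

lemma category_ICat: "category ICat"
proof
  fix p q x y z assume "p \<in> hom ICat x y" "q \<in> hom ICat y z"
  then obtain p0 p1 q0 q1 where p: "p = (x, p0, p1, y)" "is_ifun (x, p0, p1, y)" and q: "q = (y, q0, q1, z)" "is_ifun (y, q0, q1, z)"
    unfolding ICat_hom by blast
  note a = ifunD[OF p(2)] and b = ifunD[OF q(2)]
  note xt = precategoryD(1-7)[OF a(13)] and yt = precategoryD(1-7)[OF b(13)] and zt = precategoryD(1-7)[OF b(14)]
  note ca = ifun_chain_condition[OF a(15,16,3-10)] and cb = ifun_chain_condition[OF b(15,16,3-10)]
  note la = chain_lift[OF a(16) _ _ _ _ _ ca] and lb = chain_lift[OF b(16) _ _ _ _ _ cb]
  let ?l = "chain_lift y (p1\<cdot>chain_fst x) (FA T p1\<cdot>chain_snd x)"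
  have lt: "arr ?l" "dom ?l = chain_ob x" "cod ?l = chain_ob y" "chain_fst y\<cdot>?l = p1\<cdot>chain_fst x" "chain_snd y\<cdot>?l = FA T p1\<cdot>chain_snd x"
    using la a(3-8) xt by simp_all
  have "(q1\<cdot>p1)\<cdot>Cm x = (q1\<cdot>Cm y)\<cdot>?l" using a(3-8,12) b(3-8) xt yt lt by simp
  also have "\<dots> = Cm z\<cdot>(chain_lift z (q1\<cdot>chain_fst y) (FA T q1\<cdot>chain_snd y)\<cdot>?l)"
    unfolding b(12) using lt b(3-8) yt zt lb(1-3) by simp
  also have "chain_lift z (q1\<cdot>chain_fst y) (FA T q1\<cdot>chain_snd y)\<cdot>?l =
    chain_lift z ((q1\<cdot>chain_fst y)\<cdot>?l) ((FA T q1\<cdot>chain_snd y)\<cdot>?l)"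
    by (rule chain_lift_comp) (use lt b(3-8) yt zt cb in simp_all)
  also have "(q1\<cdot>chain_fst y)\<cdot>?l = (q1\<cdot>p1)\<cdot>chain_fst x" using lt b(3-8) a(3-8) xt yt by simp
  also have "(FA T q1\<cdot>chain_snd y)\<cdot>?l = FA T (q1\<cdot>p1)\<cdot>chain_snd x" using lt b(3-8) a(3-8) xt yt by simp
  finally have e: "(q1\<cdot>p1)\<cdot>Cm x = Cm z\<cdot>chain_lift z ((q1\<cdot>p1)\<cdot>chain_fst x) (FA T (q1\<cdot>p1)\<cdot>chain_snd x)" .
  have "is_ifun (x, q0\<cdot>p0, q1\<cdot>p1, z)"
    unfolding is_ifun_iff
  proof (intro conjI)
    show "D1 z\<cdot>(q1\<cdot>p1) = FA T (q0\<cdot>p0)\<cdot>D1 x" using comp_cong[OF b(9), of p1] a(3-9) b(3-8) xt yt zt by simp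
    show "D0 z\<cdot>(q1\<cdot>p1) = (q0\<cdot>p0)\<cdot>D0 x" using comp_cong[OF b(10), of p1] a(3-8,10) b(3-8) xt yt zt by simp
    show "(q1\<cdot>p1)\<cdot>S0 x = S0 z\<cdot>(q0\<cdot>p0)" using comp_cong[OF b(11), of p0] a(3-8,11) b(3-8) xt yt zt by simp
  qed (use a b e in simp_all)
  then show "q \<cdot>\<^bsub>ICat\<^esub> p \<in> hom ICat x z" by (simp add: p q ICat_hom)
next
  fix x assume "x \<in> Obj ICat"
  then have x: "is_icat x" by simp
  note t = precategoryD(1-7)[OF icat_precategory[OF x]]
  have "chain_lift x (chain_fst x) (chain_snd x) = Ident V (chain_ob x)"
    by (rule chain_lift_eqI) (use t in simp_all)
  then have "is_ifun (x, Ident V (I0 x), Ident V (I1 x), x)" unfolding is_ifun_iff using x t by simp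
  then show "Ident ICat x \<in> hom ICat x x" by (simp add: ICat_hom)
next
  fix p x y assume "p \<in> hom ICat x y"
  then obtain p0 p1 where p: "p = (x, p0, p1, y)" "is_ifun (x, p0, p1, y)" unfolding ICat_hom by blast
  note a = ifunD[OF p(2)]
  show "p \<cdot>\<^bsub>ICat\<^esub> Ident ICat x = p" "Ident ICat y \<cdot>\<^bsub>ICat\<^esub> p = p" using a(3-8) by (simp_all add: p)
next
  fix p q r x y z w assume "p \<in> hom ICat x y" "q \<in> hom ICat y z" "r \<in> hom ICat z w"
  then obtain p0 p1 q0 q1 r0 r1 where p: "p = (x, p0, p1, y)" "is_ifun (x, p0, p1, y)" "q = (y, q0, q1, z)" "is_ifun (y, q0, q1, z)"
      "r = (z, r0, r1, w)" "is_ifun (z, r0, r1, w)"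
    unfolding ICat_hom by blast
  note a = ifunD(3-8)[OF p(2)] and b = ifunD(3-8)[OF p(4)] and c = ifunD(3-8)[OF p(6)]
  show "r \<cdot>\<^bsub>ICat\<^esub> (q \<cdot>\<^bsub>ICat\<^esub> p) = (r \<cdot>\<^bsub>ICat\<^esub> q) \<cdot>\<^bsub>ICat\<^esub> p"
    using a b c by (simp add: p)
qed (auto simp: ICat_def is_ifun_def)

text \<open>The internal category with exactly one arrow from each element of \<open>T Z\<close> to each element of \<open>Z\<close>.\<close>

definition indiscrete where
  "indiscrete Z = (let g = \<lparr>I0 = Z, I1 = prod_ob V (FO T Z) Z, D1 = prod_fst V (FO T Z) Z, D0 = prod_snd V (FO T Z) Z,
      S0 = pairing V (Unit T Z) (Ident V Z), Cm = undefined\<rparr>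
    in g\<lparr>Cm := pairing V (Mult T Z\<cdot>(FA T (D1 g)\<cdot>chain_snd g)) (D0 g\<cdot>chain_fst g)\<rparr>)"

text \<open>The composition refers to the chains of the category being defined. Since the
  projections of chains depend on \<open>D1\<close> and \<open>D0\<close> only, the placeholder for
  \<open>Cm\<close> does not survive.\<close>

lemma indiscrete_simps:
  "I0 (indiscrete Z) = Z" "I1 (indiscrete Z) = prod_ob V (FO T Z) Z" "D1 (indiscrete Z) = prod_fst V (FO T Z) Z"
  "D0 (indiscrete Z) = prod_snd V (FO T Z) Z" "S0 (indiscrete Z) = pairing V (Unit T Z) (Ident V Z)"
  "Cm (indiscrete Z) = pairing V (Mult T Z\<cdot>(FA T (D1 (indiscrete Z))\<cdot>chain_snd (indiscrete Z))) (D0 (indiscrete Z)\<cdot>chain_fst (indiscrete Z))"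
  by (simp_all add: indiscrete_def Let_def chain_snd_def chain_fst_def)

lemma indiscrete_ext:
  assumes "Z \<in> Obj V" "x = indiscrete Z" "arr u" "arr u'" "dom u = dom u'" "cod u = I1 x" "cod u' = I1 x"
    "D1 x\<cdot>u = D1 x\<cdot>u'" "D0 x\<cdot>u = D0 x\<cdot>u'"
  shows "u = u'"
  by (rule prod_ext[of "FO T Z" Z]) (use assms in \<open>simp_all add: indiscrete_simps\<close>)

text \<open>An arrow into the object of arrows is determined by its two ends. On the
  \<open>D0\<close> side the laws reduce to identities of ends, and on the \<open>D1\<close> side
  they are the three monad laws.\<close>

lemma indiscrete_icat:
  assumes Z: "Z \<in> Obj V"
  shows "is_icat (indiscrete Z)"
proof -
  define x where "x = indiscrete Z"
  have g: "graph x" unfolding graph_def x_def indiscrete_simps using Z by simp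
  have IZ: "I0 x = Z" by (simp add: x_def indiscrete_simps)
  have S: "arr (S0 x)" "dom (S0 x) = Z" "cod (S0 x) = I1 x" "D0 x\<cdot>S0 x = Ident V Z" "D1 x\<cdot>S0 x = Unit T Z"
    unfolding x_def indiscrete_simps using Z by simp_all
  have Cd: "Cm x = pairing V (Mult T Z\<cdot>(FA T (D1 x)\<cdot>chain_snd x)) (D0 x\<cdot>chain_fst x)"
    unfolding x_def by (rule indiscrete_simps(6))
  have pr: "D1 x = prod_fst V (FO T Z) Z" "D0 x = prod_snd V (FO T Z) Z" "I1 x = prod_ob V (FO T Z) Z"
    by (simp_all add: x_def indiscrete_simps)
  define a where "a = Mult T Z\<cdot>(FA T (D1 x)\<cdot>chain_snd x)"
  define b where "b = D0 x\<cdot>chain_fst x"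
  have ab: "arr a" "arr b" "dom a = chain_ob x" "dom b = chain_ob x" "cod a = FO T Z" "cod b = Z"
    using g Z IZ by (simp_all add: a_def b_def)
  have Cab: "Cm x = pairing V a b" unfolding a_def b_def by (rule Cd)
  have Cm: "arr (Cm x)" "dom (Cm x) = chain_ob x" "cod (Cm x) = I1 x" "D0 x\<cdot>Cm x = D0 x\<cdot>chain_fst x"
    "D1 x\<cdot>Cm x = Mult T Z\<cdot>(FA T (D1 x)\<cdot>chain_snd x)"
    unfolding b_def[symmetric] a_def[symmetric] Cab unfolding pr using ab by simp_all
  have p: "precategory x" unfolding precategory_def using g S Cm IZ by simp
  note cond = chain_lift_conditions[OF p]
  note l1 = chain_lift[OF g _ _ _ _ _ cond(1)] and l2 = chain_lift[OF g _ _ _ _ _ cond(2)]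
    and l3 = chain_lift[OF g _ _ _ _ _ cond(3)] and l4 = chain_lift[OF g _ _ _ _ _ cond(4)]
  note ext = indiscrete_ext[OF Z x_def]
  have gZ: "cod (D1 x) = FO T Z" "cod (D0 x) = Z" using g IZ by simp_all
  note gs = graphD(1-4,6,7)[OF g] gZ
  note m1 = comp_cong[OF Cm(5)] and m0 = comp_cong[OF Cm(4)]
  have 1: "Cm x\<cdot>chain_lift x (S0 x\<cdot>D0 x) (Unit T (I1 x)) = Ident V (I1 x)" (is "Cm x\<cdot>?l = _")
  proof (rule ext)
    have l: "arr ?l" "dom ?l = I1 x" "cod ?l = chain_ob x" "chain_fst x\<cdot>?l = S0 x\<cdot>D0 x" "chain_snd x\<cdot>?l = Unit T (I1 x)"
      using l1 S gs by simp_all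
    have "D1 x\<cdot>(Cm x\<cdot>?l) = Mult T Z\<cdot>(FA T (D1 x)\<cdot>Unit T (I1 x))" using m1[of ?l] l Cm g gs Z by simp
    also have "\<dots> = (Mult T Z\<cdot>Unit T (FO T Z))\<cdot>D1 x" using Unit_nat[of "D1 x"] gs Z by simp
    finally show "D1 x\<cdot>(Cm x\<cdot>?l) = D1 x\<cdot>Ident V (I1 x)" using monad_laws(1)[OF Z] g gs by simp
    have "D0 x\<cdot>(Cm x\<cdot>?l) = D0 x\<cdot>(S0 x\<cdot>D0 x)" using m0[of ?l] l Cm g by simp
    then show "D0 x\<cdot>(Cm x\<cdot>?l) = D0 x\<cdot>Ident V (I1 x)" using comp_cong[OF S(4), of "D0 x"] S g gs by simp
  qed (use l1 Cm S gs in simp_all)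
  have 2: "Cm x\<cdot>chain_lift x (Ident V (I1 x)) (FA T (S0 x)\<cdot>D1 x) = Ident V (I1 x)" (is "Cm x\<cdot>?l = _")
  proof (rule ext)
    have l: "arr ?l" "dom ?l = I1 x" "cod ?l = chain_ob x" "chain_fst x\<cdot>?l = Ident V (I1 x)" "chain_snd x\<cdot>?l = FA T (S0 x)\<cdot>D1 x"
      using l2 S gs by simp_all
    have "D1 x\<cdot>(Cm x\<cdot>?l) = Mult T Z\<cdot>(FA T (D1 x)\<cdot>(FA T (S0 x)\<cdot>D1 x))" using m1[of ?l] l Cm g gs Z by simp
    also have "\<dots> = (Mult T Z\<cdot>FA T (Unit T Z))\<cdot>D1 x" using comp_cong[OF T_cong[OF S(5)], of "D1 x"] S gs Z by simp
    finally show "D1 x\<cdot>(Cm x\<cdot>?l) = D1 x\<cdot>Ident V (I1 x)" using monad_laws(2)[OF Z] g gs by simp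
    show "D0 x\<cdot>(Cm x\<cdot>?l) = D0 x\<cdot>Ident V (I1 x)" using m0[of ?l] l Cm g by simp
  qed (use l2 Cm S gs in simp_all)
  let ?l = "chain_lift x (chain_fst x\<cdot>chain3_fst x) (FA T (Cm x)\<cdot>chain3_snd x)"
  let ?m = "chain_lift x (Cm x\<cdot>chain3_fst x) (Mult T (I1 x)\<cdot>(FA T (chain_snd x)\<cdot>chain3_snd x))"
  have 3: "Cm x\<cdot>?l = Cm x\<cdot>?m"
  proof (rule ext)
    have l: "arr ?l" "dom ?l = dom (chain3_fst x)" "cod ?l = chain_ob x" "chain_fst x\<cdot>?l = chain_fst x\<cdot>chain3_fst x" "chain_snd x\<cdot>?l = FA T (Cm x)\<cdot>chain3_snd x"
      using l3 g Cm by simp_all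
    have m: "arr ?m" "dom ?m = dom (chain3_fst x)" "cod ?m = chain_ob x" "chain_fst x\<cdot>?m = Cm x\<cdot>chain3_fst x" "chain_snd x\<cdot>?m = Mult T (I1 x)\<cdot>(FA T (chain_snd x)\<cdot>chain3_snd x)"
      using l4 g Cm by simp_all
    have tc: "FA T (D1 x)\<cdot>FA T (Cm x) = FA T (Mult T Z\<cdot>(FA T (D1 x)\<cdot>chain_snd x))"
      by (rule T_cong[OF Cm(5)]) (use gs Cm(1-3) in simp_all)
    have "D1 x\<cdot>(Cm x\<cdot>?l) = Mult T Z\<cdot>((FA T (D1 x)\<cdot>FA T (Cm x))\<cdot>chain3_snd x)" using m1[of ?l] l Cm(1-3) g gs Z by simp
    also have "\<dots> = Mult T Z\<cdot>(FA T (Mult T Z)\<cdot>(FA T (FA T (D1 x))\<cdot>(FA T (chain_snd x)\<cdot>chain3_snd x)))"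
      unfolding tc using g gs Z by simp
    finally have L: "D1 x\<cdot>(Cm x\<cdot>?l) = Mult T Z\<cdot>(FA T (Mult T Z)\<cdot>(FA T (FA T (D1 x))\<cdot>(FA T (chain_snd x)\<cdot>chain3_snd x)))" .
    have "D1 x\<cdot>(Cm x\<cdot>?m) = Mult T Z\<cdot>(FA T (D1 x)\<cdot>(Mult T (I1 x)\<cdot>(FA T (chain_snd x)\<cdot>chain3_snd x)))"
      using m1[of ?m] m Cm(1-3) g gs Z by simp
    also have "\<dots> = (Mult T Z\<cdot>Mult T (FO T Z))\<cdot>(FA T (FA T (D1 x))\<cdot>(FA T (chain_snd x)\<cdot>chain3_snd x))"
      using comp_cong[OF Mult_nat[of "D1 x", symmetric], of "FA T (chain_snd x)\<cdot>chain3_snd x"] g gs Z by simp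
    finally show "D1 x\<cdot>(Cm x\<cdot>?l) = D1 x\<cdot>(Cm x\<cdot>?m)"
      unfolding L monad_laws(3)[OF Z] using g gs Z by simp
    show "D0 x\<cdot>(Cm x\<cdot>?l) = D0 x\<cdot>(Cm x\<cdot>?m)"
      using m0[of ?l] m0[of ?m] m0[of "chain3_fst x"] l m Cm(1-3) g by simp
  qed (use l3 l4 Cm g in simp_all)
  show ?thesis unfolding x_def[symmetric] is_icat_iff using p 1 2 3 by blast
qed

text \<open>The transpose of \<open>p\<close> under the adjunction in which
  \<open>indiscrete\<close> is right adjoint to taking the object of objects.\<close>

definition indiscrete_map where
  "indiscrete_map x p Z = (x, p, pairing V (FA T p\<cdot>D1 x) (p\<cdot>D0 x), indiscrete Z)"

lemma indiscrete_map:
  assumes x: "is_icat x" and p: "arr p" "dom p = I0 x" "cod p = Z"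
  shows "is_ifun (indiscrete_map x p Z)"
proof -
  define y where "y = indiscrete Z"
  have Z: "Z \<in> Obj V" using p by auto
  define q where "q = pairing V (FA T p\<cdot>D1 x) (p\<cdot>D0 x)"
  note xt = precategoryD[OF icat_precategory[OF x]] and y = indiscrete_icat[OF Z, folded y_def]
  note yt = precategoryD[OF icat_precategory[OF y]]
  have IZ: "I0 y = Z" by (simp add: y_def indiscrete_simps)
  have q: "arr q" "dom q = I1 x" "cod q = I1 y" "D1 y\<cdot>q = FA T p\<cdot>D1 x" "D0 y\<cdot>q = p\<cdot>D0 x"
    unfolding q_def y_def indiscrete_simps using p xt(1) by simp_all
  have c: "D1 y\<cdot>(q\<cdot>chain_fst x) = FA T (D0 y)\<cdot>(FA T q\<cdot>chain_snd x)"
    by (rule ifun_chain_condition[of x y p q]) (use p q xt(1) yt(1) IZ in simp_all)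
  let ?l = "chain_lift y (q\<cdot>chain_fst x) (FA T q\<cdot>chain_snd x)"
  have l: "arr ?l" "dom ?l = chain_ob x" "cod ?l = chain_ob y" "chain_fst y\<cdot>?l = q\<cdot>chain_fst x" "chain_snd y\<cdot>?l = FA T q\<cdot>chain_snd x"
    using chain_lift[OF yt(1) _ _ _ _ _ c] q xt(1) by simp_all
  have e1: "q\<cdot>S0 x = S0 y\<cdot>p"
    by (rule indiscrete_ext[OF Z y_def])
      (use q p xt yt(1-9) IZ Unit_nat[of p] comp_cong[OF q(4), of "S0 x"] comp_cong[OF q(5), of "S0 x"] comp_cong[OF yt(8), of p] comp_cong[OF yt(9), of p] in simp_all)
  have "D1 y\<cdot>(q\<cdot>Cm x) = FA T p\<cdot>(Mult T (I0 x)\<cdot>(FA T (D1 x)\<cdot>chain_snd x))"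
    using comp_cong[OF q(4), of "Cm x"] q p xt yt(1) by simp
  also have "\<dots> = Mult T Z\<cdot>(FA T (FA T p)\<cdot>(FA T (D1 x)\<cdot>chain_snd x))"
    using comp_cong[OF Mult_nat[of p, symmetric], of "FA T (D1 x)\<cdot>chain_snd x"] p xt(1) Z by simp
  also have "\<dots> = Mult T Z\<cdot>(FA T (D1 y)\<cdot>(FA T q\<cdot>chain_snd x))"
    using comp_cong[OF T_cong2[OF q(4)], of "chain_snd x"] q p xt(1) yt(1) by simp
  also have "\<dots> = D1 y\<cdot>(Cm y\<cdot>?l)"
    using comp_cong[OF yt(11), of ?l] l yt(1-7) IZ Z by simp
  finally have d1: "D1 y\<cdot>(q\<cdot>Cm x) = D1 y\<cdot>(Cm y\<cdot>?l)" .
  have d0: "D0 y\<cdot>(q\<cdot>Cm x) = D0 y\<cdot>(Cm y\<cdot>?l)"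
    using comp_cong[OF q(5), of "Cm x"] comp_cong[OF q(5), of "chain_fst x"] comp_cong[OF yt(10), of ?l] q p xt yt(1-7) l by simp
  have e2: "q\<cdot>Cm x = Cm y\<cdot>?l"
    by (rule indiscrete_ext[OF Z y_def]) (use d1 d0 q(1-3) xt yt(1-7) l in simp_all)
  show ?thesis
    unfolding indiscrete_map_def y_def[symmetric] q_def[symmetric] is_ifun_iff
    using x y p q e1 e2 IZ by simp
qed

lemma to_indiscrete_eq:
  assumes "is_ifun (x, p, q, indiscrete Z)" "is_ifun (x, p, q', indiscrete Z)"
  shows "q = q'"
proof -
  note a = ifunD[OF assms(1)] and b = ifunD[OF assms(2)]
  have "Z \<in> Obj V" using a(5) Obj_typed(2)[OF a(3)] by (simp add: indiscrete_simps)
  from indiscrete_ext[OF this refl, of q q'] show ?thesis using a b by simp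
qed

text \<open>The internal category with identities only: since domains live in \<open>T Z\<close>,
  the identity of an element has as domain its image under the unit. It is left adjoint to taking
  the object of objects, which is its use below.\<close>

definition discrete_icat where
  "discrete_icat Z = (let g = \<lparr>I0 = Z, I1 = Z, D1 = Unit T Z, D0 = Ident V Z, S0 = Ident V Z, Cm = undefined\<rparr>
    in g\<lparr>Cm := chain_fst g\<rparr>)"

lemma discrete_icat_simps:
  "I0 (discrete_icat Z) = Z" "I1 (discrete_icat Z) = Z" "D1 (discrete_icat Z) = Unit T Z" "D0 (discrete_icat Z) = Ident V Z"
  "S0 (discrete_icat Z) = Ident V Z" "Cm (discrete_icat Z) = chain_fst (discrete_icat Z)"
  by (simp_all add: discrete_icat_def Let_def chain_fst_def)

lemma discrete_graph: "Z \<in> Obj V \<Longrightarrow> graph (discrete_icat Z)"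
  by (simp add: graph_def discrete_icat_simps)

lemma discrete_chain_snd:
  assumes "Z \<in> Obj V"
  shows "Unit T Z\<cdot>chain_fst (discrete_icat Z) = chain_snd (discrete_icat Z)"
  using chain_comm(1)[OF discrete_graph[OF assms]] discrete_graph[OF assms] assms by (simp add: discrete_icat_simps)

lemma discrete_is_icat:
  assumes Z: "Z \<in> Obj V"
  shows "is_icat (discrete_icat Z)"
proof -
  define x where "x = discrete_icat Z"
  note d = discrete_icat_simps[of Z, folded x_def] and cs = discrete_chain_snd[OF Z, folded x_def]
  have g: "graph x" unfolding x_def by (rule discrete_graph[OF Z])
  have gt: "cod (chain_fst x) = Z" "cod (chain_snd x) = FO T Z" using g by (simp_all add: d)
  note ct = chain_typed(1-4,7)[OF g] gt
  have tu: "Mult T Z\<cdot>(FA T (Unit T Z)\<cdot>chain_snd x) = chain_snd x"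
    using comp_cong[OF monad_laws(2)[OF Z], of "chain_snd x"] Z ct by simp
  have p: "precategory x" unfolding precategory_def using g Z by (simp add: d cs tu)
  note cond = chain_lift_conditions[OF p]
  show ?thesis
    unfolding x_def[symmetric] is_icat_iff
  proof (intro conjI p)
    show "Cm x\<cdot>chain_lift x (S0 x\<cdot>D0 x) (Unit T (I1 x)) = Ident V (I1 x)"
      using chain_lift(4)[OF g _ _ _ _ _ cond(1)] Z unfolding d by (simp add: d)
    show "Cm x\<cdot>chain_lift x (Ident V (I1 x)) (FA T (S0 x)\<cdot>D1 x) = Ident V (I1 x)"
      using chain_lift(4)[OF g _ _ _ _ _ cond(2)] Z unfolding d by (simp add: d)
    show "Cm x\<cdot>chain_lift x (chain_fst x\<cdot>chain3_fst x) (FA T (Cm x)\<cdot>chain3_snd x) =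
      Cm x\<cdot>chain_lift x (Cm x\<cdot>chain3_fst x) (Mult T (I1 x)\<cdot>(FA T (chain_snd x)\<cdot>chain3_snd x))"
      using chain_lift(4)[OF g _ _ _ _ _ cond(3)] chain_lift(4)[OF g _ _ _ _ _ cond(4)] Z g unfolding d(6) by (simp add: d)
  qed
qed

text \<open>The arrow part is forced by preservation of identities; preservation of composition
  reduces to the unit law of \<open>y\<close> that involves \<open>S0 y\<cdot>D0 y\<close>.\<close>

lemma discrete_map:
  assumes y: "is_icat y" and p: "arr p" "dom p = Z" "cod p = I0 y"
  shows "is_ifun (discrete_icat Z, p, S0 y\<cdot>p, y)"
proof -
  have Z: "Z \<in> Obj V" using p by auto
  define x where "x = discrete_icat Z"
  note d = discrete_icat_simps[of Z, folded x_def] and cs = discrete_chain_snd[OF Z, folded x_def]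
  have g: "graph x" unfolding x_def by (rule discrete_graph[OF Z])
  have gt: "cod (chain_fst x) = Z" "cod (chain_snd x) = FO T Z" using g by (simp_all add: d)
  note ct = chain_typed(1-4,7)[OF g] gt
  note yt = precategoryD[OF icat_precategory[OF y]]
  note cond = chain_lift_conditions(1)[OF icat_precategory[OF y]]
  let ?q = "S0 y\<cdot>p"
  let ?z = "?q\<cdot>chain_fst x"
  have z: "arr ?z" "dom ?z = chain_ob x" "cod ?z = I1 y" using ct p yt(1-4) by simp_all
  have dq: "D0 y\<cdot>?q = p" "D1 y\<cdot>?q = FA T p\<cdot>Unit T Z"
    using comp_cong[OF yt(8), of p] comp_cong[OF yt(9), of p] Unit_nat[of p] p yt(1-4) by simp_all
  have "(S0 y\<cdot>D0 y)\<cdot>?z = ?z"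
    using comp_cong[OF dq(1), of "chain_fst x"] ct p yt(1-4) by simp
  moreover have "Unit T (I1 y)\<cdot>?z = FA T ?q\<cdot>chain_snd x"
    using comp_cong[OF Unit_nat[of ?q], of "chain_fst x"] cs ct p yt(1-4) Z by simp
  ultimately have l: "chain_lift y ?z (FA T ?q\<cdot>chain_snd x) = chain_lift y (S0 y\<cdot>D0 y) (Unit T (I1 y))\<cdot>?z"
    by (subst chain_lift_comp) (use yt(1-4) z cond in simp_all)
  have "Cm y\<cdot>chain_lift y (S0 y\<cdot>D0 y) (Unit T (I1 y)) = Ident V (I1 y)"
    using y by (simp add: is_icat_iff)
  from comp_cong[OF this, of ?z] have "Cm y\<cdot>chain_lift y ?z (FA T ?q\<cdot>chain_snd x) = ?z"
    unfolding l using chain_lift(1-3)[OF yt(1) _ _ _ _ _ cond] yt(1-7) z by simp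
  then show ?thesis
    unfolding is_ifun_iff x_def[symmetric]
    using discrete_is_icat[OF Z, folded x_def] y p yt(1-4) ct dq z by (simp add: d)
qed

text \<open>Taking objects is a right adjoint: a cone of objects is the same as a cone of internal
  functors out of a \<open>discrete_icat\<close>, to which the universal property of the given
  pullback applies.\<close>

lemma ob_pullback:
  assumes pb: "is_pullback ICat (x, f0, f1, z) (y, g0, g1, z) (w, p0, p1, x) (w, q0, q1, y)"
  shows "is_pullback V f0 g0 p0 q0"
proof -
  interpret I: category ICat by (rule category_ICat)
  note t = I.pullback_typed[OF pb]
  note f = ifunD[OF t(1)[simplified]] and g = ifunD[OF t(2)[simplified]] and p = ifunD[OF t(3)[simplified]] and q = ifunD[OF t(4)[simplified]]
  show ?thesis
  proof (rule pullbackI)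
    show "f0\<cdot>p0 = g0\<cdot>q0" using t(9) by simp
  next
    fix h k assume h: "arr h" "arr k" "dom h = dom k" "cod h = dom f0" "cod k = dom g0" "f0\<cdot>h = g0\<cdot>k"
    let ?D = "discrete_icat (dom k)"
    have H: "is_ifun (?D, h, S0 x\<cdot>h, x)" "is_ifun (?D, k, S0 y\<cdot>k, y)"
      using h f g by (auto intro!: discrete_map)
    have e: "f1\<cdot>(S0 x\<cdot>h) = g1\<cdot>(S0 y\<cdot>k)"
      using comp_cong[OF f(11), of h] comp_cong[OF g(11), of k] h f(3-8) g(3-8) precategoryD[OF f(13)] precategoryD[OF g(13)] precategoryD[OF f(14)] by simp
    obtain u where u: "u \<in> Arr ICat" "Dom ICat u = ?D" "Cod ICat u = w"
      "(w, p0, p1, x) \<cdot>\<^bsub>ICat\<^esub> u = (?D, h, S0 x\<cdot>h, x)" "(w, q0, q1, y) \<cdot>\<^bsub>ICat\<^esub> u = (?D, k, S0 y\<cdot>k, y)"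
      by (rule I.pullback_ex[OF pb, of "(?D, h, S0 x\<cdot>h, x)" "(?D, k, S0 y\<cdot>k, y)"]) (use H h e in simp_all)
    obtain u0 u1 where u': "u = (?D, u0, u1, w)" using u(2,3) by (cases u) simp
    have "is_ifun (?D, u0, u1, w)" using u(1) u' by simp
    note u0 = ifunD(3-5)[OF this]
    show "\<exists>u. arr u \<and> dom u = dom h \<and> cod u = dom p0 \<and> p0\<cdot>u = h \<and> q0\<cdot>u = k"
      using u0 u(4,5) h(3) p(4) unfolding u' by (intro exI[of _ u0]) (simp add: discrete_icat_simps)
  next
    fix u u' assume u: "arr u" "arr u'" "dom u = dom u'" "cod u = dom p0" "cod u' = dom p0"
      "p0\<cdot>u = p0\<cdot>u'" "q0\<cdot>u = q0\<cdot>u'"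
    let ?D = "discrete_icat (dom u')"
    have H: "is_ifun (?D, u, S0 w\<cdot>u, w)" "is_ifun (?D, u', S0 w\<cdot>u', w)"
      using u p by (auto intro!: discrete_map)
    note wt = precategoryD[OF p(13)] and xt = precategoryD[OF f(13)] and yt = precategoryD[OF g(13)]
    have e: "p1\<cdot>(S0 w\<cdot>u) = p1\<cdot>(S0 w\<cdot>u')" "q1\<cdot>(S0 w\<cdot>u) = q1\<cdot>(S0 w\<cdot>u')"
      using comp_cong[OF p(11), of u] comp_cong[OF p(11), of u'] comp_cong[OF q(11), of u] comp_cong[OF q(11), of u'] u p(3-8) q(3-8) wt(1-4) xt(1-4) yt(1-4) by simp_all
    have "(?D, u, S0 w\<cdot>u, w) = (?D, u', S0 w\<cdot>u', w)"
      by (rule I.pullback_eq[OF pb]) (use H u e in simp_all)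
    then show "u = u'" by simp
  qed (use f g p q in simp_all)
qed

text \<open>If the object part of \<open>p\<close> factors through a subobject, then \<open>p\<close> factors through the full
  subcategory on it, which is a pullback of indiscrete categories.\<close>

lemma descent_ob_extremal:
  assumes dm: "category.descent_morphism ICat (x, p0, p1, y)" and pbs: "has_pullbacks ICat" and p: "is_ifun (x, p0, p1, y)"
    and i: "arr i" "cod i = I0 y" and j: "arr j" "dom j = I0 x" "cod j = dom i" "i\<cdot>j = p0"
    and mono: "\<And>a b. \<lbrakk>arr a; arr b; dom a = dom b; cod a = dom i; cod b = dom i; i\<cdot>a = i\<cdot>b\<rbrakk> \<Longrightarrow> a = b"
  obtains s where "arr s" "dom s = I0 y" "cod s = dom i" "i\<cdot>s = Ident V (I0 y)"
proof -
  interpret I: pullback_category ICat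
    using category_ICat pbs by (simp add: pullback_category_def pullback_category_axioms_def)
  note a = ifunD[OF p]
  note yt = precategoryD[OF a(14)]
  define B where "B = dom i"
  have B: "B \<in> Obj V" "I0 y \<in> Obj V" using i yt by (simp_all add: B_def)
  have Bi: "is_icat (indiscrete B)" by (rule indiscrete_icat[OF B(1)])
  \<comment> \<open>\<open>\<eta>\<close> is the unit at \<open>y\<close> of the adjunction with
    \<open>indiscrete\<close>, and \<open>m\<close> is induced by \<open>i\<close>. The pullback
    \<open>r\<close> of \<open>m\<close> along \<open>\<eta>\<close> is the full subcategory of
    \<open>y\<close> on the subobject \<open>i\<close>.\<close>
  define \<eta> where "\<eta> = indiscrete_map y (Ident V (I0 y)) (I0 y)"
  define m where "m = indiscrete_map (indiscrete B) i (I0 y)"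
  define k where "k = indiscrete_map x j B"
  have eta: "is_ifun \<eta>" unfolding \<eta>_def by (rule indiscrete_map) (use a(2) B in simp_all)
  have m: "is_ifun m" unfolding m_def by (rule indiscrete_map) (use Bi i in \<open>simp_all add: B_def indiscrete_simps\<close>)
  have k: "is_ifun k" unfolding k_def by (rule indiscrete_map) (use a(1) j in \<open>simp_all add: B_def\<close>)
  obtain \<eta>1 where e: "\<eta> = (y, Ident V (I0 y), \<eta>1, indiscrete (I0 y))" by (simp add: \<eta>_def indiscrete_map_def)
  obtain m1 where me: "m = (indiscrete B, i, m1, indiscrete (I0 y))" by (simp add: m_def indiscrete_map_def)
  obtain k1 where ke: "k = (x, j, k1, indiscrete B)" by (simp add: k_def indiscrete_map_def)
  have ind_eq: "F = G" if "is_ifun F" "is_ifun G" "F = (w, f, f1, indiscrete Z)" "G = (w, f, g1, indiscrete Z)" for F G w f f1 g1 Z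
    using to_indiscrete_eq[of w f f1 Z g1] that by simp
  have ty: "\<eta> \<in> Arr ICat" "m \<in> Arr ICat" "Cod ICat \<eta> = Cod ICat m" using eta m by (simp_all add: e me)
  define r where "r = pb_fst ICat \<eta> m"
  define q where "q = pb_snd ICat \<eta> m"
  have pb: "is_pullback ICat \<eta> m r q" unfolding r_def q_def by (rule I.pb[OF ty])
  note rt = I.pullback_typed[OF pb]
  obtain w r0 r1 where re: "r = (w, r0, r1, y)" using rt(6) by (cases r) (simp add: e)
  obtain q0 q1 where qe: "q = (w, q0, q1, indiscrete B)" using rt(7,8) by (cases q) (simp add: me re)
  have ri: "is_ifun (w, r0, r1, y)" "is_ifun (w, q0, q1, indiscrete B)" using rt(3,4) by (simp_all add: re qe)
  note rr = ifunD[OF ri(1)] and qq = ifunD[OF ri(2)]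
  have IB: "I0 (indiscrete B) = B" by (simp add: indiscrete_simps)
  have cm: "\<eta> \<cdot>\<^bsub>ICat\<^esub> (x, p0, p1, y) = m \<cdot>\<^bsub>ICat\<^esub> k"
  proof (rule ind_eq)
    show "is_ifun (\<eta> \<cdot>\<^bsub>ICat\<^esub> (x, p0, p1, y))" using I.comp_typed(1)[of "(x, p0, p1, y)" \<eta>] p eta by (simp add: e)
    show "is_ifun (m \<cdot>\<^bsub>ICat\<^esub> k)" using I.comp_typed(1)[of k m] m k by (simp add: me ke)
    show "\<eta> \<cdot>\<^bsub>ICat\<^esub> (x, p0, p1, y) = (x, p0, \<eta>1\<cdot>p1, indiscrete (I0 y))" using a by (simp add: e)
    show "m \<cdot>\<^bsub>ICat\<^esub> k = (x, p0, m1\<cdot>k1, indiscrete (I0 y))" using j by (simp add: me ke)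
  qed
  obtain l where l: "l \<in> Arr ICat" "Dom ICat l = x" "Cod ICat l = w" "r \<cdot>\<^bsub>ICat\<^esub> l = (x, p0, p1, y)" "q \<cdot>\<^bsub>ICat\<^esub> l = k"
  proof (rule I.pullback_ex[OF pb, of "(x, p0, p1, y)" k])
    show "(x, p0, p1, y) \<in> Arr ICat" "k \<in> Arr ICat" "Dom ICat (x, p0, p1, y) = Dom ICat k" "Cod ICat (x, p0, p1, y) = Dom ICat \<eta>" "Cod ICat k = Dom ICat m"
      using p k by (simp_all add: e ke me)
  qed (use cm in \<open>auto simp: re\<close>)
  have idp: "is_pullback ICat (x, p0, p1, y) (Ident ICat y) (Ident ICat x) (x, p0, p1, y)"
    using I.pullback_Ident[of "(x, p0, p1, y)"] p by simp
  obtain w1 w2 where ww: "is_pullback ICat (x, p0, p1, y) (x, p0, p1, y) w1 w2"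
    using I.pb[of "(x, p0, p1, y)" "(x, p0, p1, y)"] p by auto
  note wt = I.pullback_typed[OF ww]
  \<comment> \<open>\<open>r\<close> is monic because \<open>m\<close> can be cancelled: functors
    into an indiscrete category are determined on objects, where \<open>i\<close> is monic.\<close>
  have rmono: "u = u'" if hu: "u \<in> Arr ICat" "u' \<in> Arr ICat" "Dom ICat u = Dom ICat u'" "Cod ICat u = w" "Cod ICat u' = w"
    "r \<cdot>\<^bsub>ICat\<^esub> u = r \<cdot>\<^bsub>ICat\<^esub> u'" for u u'
  proof (rule I.pullback_eq[OF pb hu(1-3) _ _ hu(6)])
    have ru: "r \<in> Arr ICat" "q \<in> Arr ICat" "Dom ICat r = w" "Dom ICat q = w" "Cod ICat r = y" "Cod ICat q = indiscrete B" using ri by (simp_all add: re qe)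
    have qu: "q \<cdot>\<^bsub>ICat\<^esub> u \<in> Arr ICat" "q \<cdot>\<^bsub>ICat\<^esub> u' \<in> Arr ICat" using ru hu I.comp_typed(1) by metis+
    obtain v u0 u1 where ue: "u = (v, u0, u1, w)" using hu(4) by (cases u) simp
    obtain u0' u1' where ue': "u' = (v, u0', u1', w)" using hu(3,5) ue by (cases u') simp
    have "m \<cdot>\<^bsub>ICat\<^esub> (q \<cdot>\<^bsub>ICat\<^esub> u) = \<eta> \<cdot>\<^bsub>ICat\<^esub> (r \<cdot>\<^bsub>ICat\<^esub> u)"
      using I.comp_cong[OF rt(9), of u] hu ru rt(1-8) I.assoc[of u q m] by metis
    also have "\<dots> = \<eta> \<cdot>\<^bsub>ICat\<^esub> (r \<cdot>\<^bsub>ICat\<^esub> u')" using hu(6) by simp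
    also have "\<dots> = m \<cdot>\<^bsub>ICat\<^esub> (q \<cdot>\<^bsub>ICat\<^esub> u')"
      using I.comp_cong[OF rt(9), of u'] hu ru rt(1-8) I.assoc[of u' q m] by metis
    finally have "i\<cdot>(q0\<cdot>u0) = i\<cdot>(q0\<cdot>u0')" by (simp add: me qe ue ue')
    moreover have "is_ifun (v, u0, u1, w)" "is_ifun (v, u0', u1', w)" using hu(1,2) by (simp_all add: ue ue')
    note ut = ifunD(3-5)[OF this(1)] ifunD(3-5)[OF this(2)]
    ultimately have "q0\<cdot>u0 = q0\<cdot>u0'"
      by - (rule mono, use qq(3-5) ut IB in \<open>simp_all add: B_def\<close>)
    then show "q \<cdot>\<^bsub>ICat\<^esub> u = q \<cdot>\<^bsub>ICat\<^esub> u'"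
      by - (rule ind_eq[of _ _ v "q0\<cdot>u0" "q1\<cdot>u1" B "q1\<cdot>u1'"], use qu in \<open>simp_all add: qe ue ue'\<close>)
  qed (use hu re in simp_all)
  have kp: "l \<cdot>\<^bsub>ICat\<^esub> w1 = l \<cdot>\<^bsub>ICat\<^esub> w2"
  proof (rule rmono)
    show "r \<cdot>\<^bsub>ICat\<^esub> (l \<cdot>\<^bsub>ICat\<^esub> w1) = r \<cdot>\<^bsub>ICat\<^esub> (l \<cdot>\<^bsub>ICat\<^esub> w2)"
      using I.comp_cong[OF l(4), of w1] I.comp_cong[OF l(4), of w2] wt l(1-3) rt(3) by (simp add: re del: ICat_simps(2,6))
  qed (use l(1-3) wt in \<open>simp_all del: ICat_simps(2,6)\<close>)
  \<comment> \<open>The coequalizer property is used for the trivial pullback over the identity of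
    \<open>y\<close>. As \<open>r\<close> is monic, \<open>l\<close> coequalizes the kernel pair of
    the given functor, so \<open>l\<close> factors through it, by an arrow \<open>t\<close> that is
    a section of \<open>r\<close>.\<close>
  have "\<exists>!t. t \<in> Arr ICat \<and> Dom ICat t = Dom ICat (Ident ICat y) \<and> Cod ICat t = Dom ICat r \<and> r \<cdot>\<^bsub>ICat\<^esub> t = Ident ICat y \<and> t \<cdot>\<^bsub>ICat\<^esub> (x, p0, p1, y) = l"
  proof (rule dm[unfolded I.descent_morphism_def, rule_format, of _ "Ident ICat x" _ w1 w2 l r])
    have "Ident ICat y \<cdot>\<^bsub>ICat\<^esub> (x, p0, p1, y) = (x, p0, p1, y)" using a by simp
    then show "is_pullback ICat (x, p0, p1, y) (Ident ICat y) (Ident ICat x) (x, p0, p1, y) \<and> is_pullback ICat (x, p0, p1, y) (x, p0, p1, y) w1 w2 \<and>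
      l \<in> Arr ICat \<and> Dom ICat l = Dom ICat (x, p0, p1, y) \<and> r \<in> Arr ICat \<and> Cod ICat l = Dom ICat r \<and> Cod ICat r = Cod ICat (x, p0, p1, y) \<and>
      r \<cdot>\<^bsub>ICat\<^esub> l = Ident ICat y \<cdot>\<^bsub>ICat\<^esub> (x, p0, p1, y) \<and> l \<cdot>\<^bsub>ICat\<^esub> w1 = l \<cdot>\<^bsub>ICat\<^esub> w2"
      using idp ww l kp rt(3) by (simp add: re del: ICat_simps(2,6))
  qed
  then obtain t where t: "t \<in> Arr ICat" "Dom ICat t = Dom ICat (Ident ICat y)" "Cod ICat t = Dom ICat r" "r \<cdot>\<^bsub>ICat\<^esub> t = Ident ICat y"
    by blast
  obtain t0 t1 where te: "t = (y, t0, t1, w)" using t(2,3) by (cases t) (simp add: re)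
  have "is_ifun (y, t0, t1, w)" using t(1) te by simp
  note tt = ifunD(3-5)[OF this]
  have rt0: "r0\<cdot>t0 = Ident V (I0 y)" using t(4) by (simp add: re te)
  \<comment> \<open>\<open>\<eta>\<close> is the identity on objects, so the object part of the
    pullback square presents \<open>r0\<close> as a composite ending in \<open>i\<close>; a section
    of \<open>r\<close> therefore splits \<open>i\<close>.\<close>
  have iq: "r0 = i\<cdot>q0" using rt(9) rr(3-5) by (simp add: e me re qe)
  have "i\<cdot>(q0\<cdot>t0) = Ident V (I0 y)" using rt0 iq tt qq(3-5) i IB by (simp add: B_def)
  then show ?thesis using that[of "q0\<cdot>t0"] tt qq(3-5) IB by (simp add: B_def)
qed

section \<open>Matrices and their coproducts\<close>

definition vmatrix :: "('o, 'u) vmat \<Rightarrow> bool" where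
  "vmatrix r \<longleftrightarrow> small (src r) \<and> small (tgt r) \<and> (\<forall>x\<in>src r. \<forall>y\<in>tgt r. ent r (x, y) \<in> Obj V)"

lemma vmatrixD [simp]: "vmatrix r \<Longrightarrow> small (src r)" "vmatrix r \<Longrightarrow> small (tgt r)"
  "\<lbrakk>vmatrix r; x \<in> src r; y \<in> tgt r\<rbrakk> \<Longrightarrow> ent r (x, y) \<in> Obj V"
  by (auto simp: vmatrix_def)

lemma tot_index: "vmatrix r \<Longrightarrow> small_index small (src r \<times> tgt r)"
  by (rule small_index_Times_small) simp_all

lemma tot_coproduct: "vmatrix r \<Longrightarrow> is_coproduct V (src r \<times> tgt r) (ent r) (tot r) (tot_in r)"
  unfolding tot_def tot_in_def by (rule coproduct_of_small_index[OF tot_index]) auto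

lemma tot_typed [simp]:
  assumes "vmatrix r"
  shows "tot r \<in> Obj V" "\<lbrakk>x \<in> src r; y \<in> tgt r\<rbrakk> \<Longrightarrow> arr (tot_in r (x, y))"
    "\<lbrakk>x \<in> src r; y \<in> tgt r\<rbrakk> \<Longrightarrow> dom (tot_in r (x, y)) = ent r (x, y)" "\<lbrakk>x \<in> src r; y \<in> tgt r\<rbrakk> \<Longrightarrow> cod (tot_in r (x, y)) = tot r"
  using coproduct_typed[OF tot_coproduct[OF assms]] by auto

lemma tot_copair:
  assumes r: "vmatrix r" and Z: "Z \<in> Obj V"
    and g: "\<And>x y. \<lbrakk>x \<in> src r; y \<in> tgt r\<rbrakk> \<Longrightarrow> arr (g (x, y))" "\<And>x y. \<lbrakk>x \<in> src r; y \<in> tgt r\<rbrakk> \<Longrightarrow> dom (g (x, y)) = ent r (x, y)"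
      "\<And>x y. \<lbrakk>x \<in> src r; y \<in> tgt r\<rbrakk> \<Longrightarrow> cod (g (x, y)) = Z"
  shows "arr (tot_copair r Z g)" "dom (tot_copair r Z g) = tot r" "cod (tot_copair r Z g) = Z"
    "\<lbrakk>x \<in> src r; y \<in> tgt r\<rbrakk> \<Longrightarrow> tot_copair r Z g\<cdot>tot_in r (x, y) = g (x, y)"
proof -
  have A: "\<And>i. i \<in> src r \<times> tgt r \<Longrightarrow> ent r i \<in> Obj V" using r by auto
  have g': "\<And>i. i \<in> src r \<times> tgt r \<Longrightarrow> arr (g i)" "\<And>i. i \<in> src r \<times> tgt r \<Longrightarrow> dom (g i) = ent r i"
    "\<And>i. i \<in> src r \<times> tgt r \<Longrightarrow> cod (g i) = Z" using g by auto
  note c = copair[OF tot_index[OF r] A Z g']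
  show "arr (tot_copair r Z g)" "dom (tot_copair r Z g) = tot r" "cod (tot_copair r Z g) = Z"
    "\<lbrakk>x \<in> src r; y \<in> tgt r\<rbrakk> \<Longrightarrow> tot_copair r Z g\<cdot>tot_in r (x, y) = g (x, y)"
    unfolding tot_copair_def tot_def tot_in_def using c by simp_all
qed

lemma tot_ext:
  assumes "vmatrix r" "arr u" "arr u'" "dom u = tot r" "dom u' = tot r" "cod u = cod u'"
    "\<And>x y. \<lbrakk>x \<in> src r; y \<in> tgt r\<rbrakk> \<Longrightarrow> u\<cdot>tot_in r (x, y) = u'\<cdot>tot_in r (x, y)"
  shows "u = u'"
  by (rule coproduct_eq[OF tot_coproduct[OF assms(1)] assms(2-6)]) (use assms(7) in auto)

lemma tot_mono:
  assumes "vmatrix r" "x \<in> src r" "y \<in> tgt r" "arr a" "arr b" "dom a = dom b"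
    "cod a = ent r (x, y)" "cod b = ent r (x, y)" "tot_in r (x, y)\<cdot>a = tot_in r (x, y)\<cdot>b"
  shows "a = b"
  by (rule coproduct_mono[OF tot_index[OF assms(1)] tot_coproduct[OF assms(1)], of "(x, y)"]) (use assms in auto)

lemma tot_disjoint:
  assumes "vmatrix r" "x \<in> src r" "y \<in> tgt r" "x' \<in> src r" "y' \<in> tgt r" "arr a" "arr b" "dom a = dom b"
    "cod a = ent r (x, y)" "cod b = ent r (x', y')" "tot_in r (x, y)\<cdot>a = tot_in r (x', y')\<cdot>b"
  shows "x = x' \<and> y = y' \<or> is_initial V (dom a)"
proof (cases "(x, y) = (x', y')")
  case False
  have "is_initial V (dom a)"
    by (rule coproduct_disjoint[OF tot_index[OF assms(1)] tot_coproduct[OF assms(1)] _ _ False assms(6-11)])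
      (use assms in auto)
  then show ?thesis by blast
qed auto

lemma cov_tot:
  assumes "vmatrix r" "arr f" "cod f = tot r"
  shows "cov (dom f) (\<lambda>u. \<exists>x\<in>src r. \<exists>y\<in>tgt r. \<exists>a. arr a \<and> dom a = dom u \<and> cod a = ent r (x, y) \<and> f\<cdot>u = tot_in r (x, y)\<cdot>a)"
  by (rule cov_mono[OF cov_coproduct[OF tot_index[OF assms(1)] tot_coproduct[OF assms(1)] assms(2,3)]]) blast

lemma tot_src [simp]:
  assumes "vmatrix r"
  shows "arr (tot_src r)" "dom (tot_src r) = tot r" "cod (tot_src r) = copow V (src r)"
    "\<lbrakk>x \<in> src r; y \<in> tgt r\<rbrakk> \<Longrightarrow> tot_src r\<cdot>tot_in r (x, y) = pt V (src r) x\<cdot>bang V (ent r (x, y))"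
  unfolding tot_src_def
  using tot_copair[of r "copow V (src r)" "\<lambda>(x, y). pt V (src r) x\<cdot>bang V (ent r (x, y))"] assms by simp_all

lemma tot_tgt [simp]:
  assumes "vmatrix r"
  shows "arr (tot_tgt r)" "dom (tot_tgt r) = tot r" "cod (tot_tgt r) = copow V (tgt r)"
    "\<lbrakk>x \<in> src r; y \<in> tgt r\<rbrakk> \<Longrightarrow> tot_tgt r\<cdot>tot_in r (x, y) = pt V (tgt r) y\<cdot>bang V (ent r (x, y))"
  unfolding tot_tgt_def
  using tot_copair[of r "copow V (tgt r)" "\<lambda>(x, y). pt V (tgt r) y\<cdot>bang V (ent r (x, y))"] assms by simp_all

lemma tot_src_tgt_comp [simp]:
  assumes "vmatrix r" "x \<in> src r" "y \<in> tgt r" "arr z" "cod z = ent r (x, y)"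
  shows "tot_src r\<cdot>(tot_in r (x, y)\<cdot>z) = pt V (src r) x\<cdot>bang V (dom z)"
    "tot_tgt r\<cdot>(tot_in r (x, y)\<cdot>z) = pt V (tgt r) y\<cdot>bang V (dom z)"
  using comp_cong[OF tot_src(4)[OF assms(1-3)], of z] comp_cong[OF tot_tgt(4)[OF assms(1-3)], of z] assms
  by simp_all

text \<open>Locally \<open>g\<close> lies in some entry, and disjointness of the points of the two
  copowers forces the indices of this entry to be \<open>x\<close> and \<open>y\<close>, unless the
  piece is initial. The local factorizations are then glued.\<close>

lemma tot_factor:
  assumes r: "vmatrix r" and xy: "x \<in> src r" "y \<in> tgt r" and g: "arr g" "cod g = tot r"
    "tot_src r\<cdot>g = pt V (src r) x\<cdot>bang V (dom g)" "tot_tgt r\<cdot>g = pt V (tgt r) y\<cdot>bang V (dom g)"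
  obtains h where "arr h" "dom h = dom g" "cod h = ent r (x, y)" "tot_in r (x, y)\<cdot>h = g"
proof (rule cov_factor[OF cov_tot[OF r g(1,2)] g(1) refl, of "tot_in r (x, y)"])
  fix k assume k: "arr k" "cod k = dom g"
    "\<exists>x\<in>src r. \<exists>y\<in>tgt r. \<exists>a. arr a \<and> dom a = dom k \<and> cod a = ent r (x, y) \<and> g\<cdot>k = tot_in r (x, y)\<cdot>a"
  then obtain x' y' a where a: "x' \<in> src r" "y' \<in> tgt r" "arr a" "dom a = dom k" "cod a = ent r (x', y')" "g\<cdot>k = tot_in r (x', y')\<cdot>a"
    by blast
  have D: "dom k \<in> Obj V" using k by simp
  have "pt V (src r) x\<cdot>bang V (dom k) = tot_src r\<cdot>(g\<cdot>k)" using comp_cong[OF g(3) _ _ _ k(1)] k(1,2) g(1,2) r xy by simp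
  also have "\<dots> = pt V (src r) x'\<cdot>bang V (dom k)" unfolding a(6) using a(1-5) r by simp
  finally have 1: "x = x' \<or> is_initial V (dom k)" using pt_disjoint[of "src r" x x' "dom k"] r xy a D by simp
  have "pt V (tgt r) y\<cdot>bang V (dom k) = tot_tgt r\<cdot>(g\<cdot>k)" using comp_cong[OF g(4) _ _ _ k(1)] k(1,2) g(1,2) r xy by simp
  also have "\<dots> = pt V (tgt r) y'\<cdot>bang V (dom k)" unfolding a(6) using a(1-5) r by simp
  finally have 2: "y = y' \<or> is_initial V (dom k)" using pt_disjoint[of "tgt r" y y' "dom k"] r xy a D by simp
  show "\<exists>h. arr h \<and> dom h = dom k \<and> cod h = dom (tot_in r (x, y)) \<and> tot_in r (x, y)\<cdot>h = g\<cdot>k"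
  proof (cases "is_initial V (dom k)")
    case True
    obtain h where h: "arr h" "dom h = dom k" "cod h = ent r (x, y)"
      using initial_ex[OF True] r xy by (metis vmatrixD(3))
    have "tot_in r (x, y)\<cdot>h = g\<cdot>k" by (rule initial_eq[OF True]) (use h k(1,2) g(1,2) r xy in simp_all)
    then show ?thesis using h r xy by auto
  next
    case False
    then have "x = x'" "y = y'" using 1 2 by auto
    then show ?thesis using a r xy by (intro exI[of _ a]) simp
  qed
qed (use r xy g in simp_all)

section \<open>Fibres over points and the matrix \<open>Tbar r\<close>\<close>

lemma Tbar_simps [simp]: "src (Tbar r) = Tset (src r)" "tgt (Tbar r) = Tset (tgt r)"
  by (simp_all add: Tbar_def)

lemma Tspan:
  assumes "vmatrix r"
  shows "arr (Tspan r)" "dom (Tspan r) = FO T (tot r)" "cod (Tspan r) = prod_ob V (FO T (copow V (src r))) (FO T (copow V (tgt r)))"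
    "prod_fst V (FO T (copow V (src r))) (FO T (copow V (tgt r)))\<cdot>Tspan r = FA T (tot_src r)"
    "prod_snd V (FO T (copow V (src r))) (FO T (copow V (tgt r)))\<cdot>Tspan r = FA T (tot_tgt r)"
  unfolding Tspan_def using assms by simp_all

lemma fib:
  assumes r: "vmatrix r" and x: "\<xi> \<in> Tset (src r)" "\<zeta> \<in> Tset (tgt r)"
  shows "arr (fib_in r (\<xi>, \<zeta>))" "dom (fib_in r (\<xi>, \<zeta>)) = ent (Tbar r) (\<xi>, \<zeta>)" "cod (fib_in r (\<xi>, \<zeta>)) = FO T (tot r)"
    "ent (Tbar r) (\<xi>, \<zeta>) \<in> Obj V"
    "FA T (tot_src r)\<cdot>fib_in r (\<xi>, \<zeta>) = \<xi>\<cdot>bang V (ent (Tbar r) (\<xi>, \<zeta>))"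
    "FA T (tot_tgt r)\<cdot>fib_in r (\<xi>, \<zeta>) = \<zeta>\<cdot>bang V (ent (Tbar r) (\<xi>, \<zeta>))"
    "is_pullback V (Tspan r) (pairing V \<xi> \<zeta>) (fib_in r (\<xi>, \<zeta>)) (bang V (ent (Tbar r) (\<xi>, \<zeta>)))"
proof -
  note [simp] = Tset_typed[OF x(1)] Tset_typed[OF x(2)]
  let ?A = "FO T (copow V (src r))" and ?B = "FO T (copow V (tgt r))"
  have p: "arr (pairing V \<xi> \<zeta>)" "dom (pairing V \<xi> \<zeta>) = one V" "cod (pairing V \<xi> \<zeta>) = prod_ob V ?A ?B"
    "prod_fst V ?A ?B\<cdot>pairing V \<xi> \<zeta> = \<xi>" "prod_snd V ?A ?B\<cdot>pairing V \<xi> \<zeta> = \<zeta>"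
     by simp_all
  note ts = Tspan[OF r]
  have e: "ent (Tbar r) (\<xi>, \<zeta>) = pb_ob V (Tspan r) (pairing V \<xi> \<zeta>)" using x by (simp add: Tbar_def)
  have fi: "fib_in r (\<xi>, \<zeta>) = pb_fst V (Tspan r) (pairing V \<xi> \<zeta>)" by (simp add: fib_in_def)
  have pb: "is_pullback V (Tspan r) (pairing V \<xi> \<zeta>) (fib_in r (\<xi>, \<zeta>)) (pb_snd V (Tspan r) (pairing V \<xi> \<zeta>))"
    unfolding fi by (rule pb) (use ts in simp_all)
  note t = pullback_typed[OF pb]
  show 1: "arr (fib_in r (\<xi>, \<zeta>))" "dom (fib_in r (\<xi>, \<zeta>)) = ent (Tbar r) (\<xi>, \<zeta>)" "cod (fib_in r (\<xi>, \<zeta>)) = FO T (tot r)"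
    "ent (Tbar r) (\<xi>, \<zeta>) \<in> Obj V"
    using ts by (simp_all add: fi e)
  have b: "pb_snd V (Tspan r) (pairing V \<xi> \<zeta>) = bang V (ent (Tbar r) (\<xi>, \<zeta>))"
    using bang_eq[of "pb_snd V (Tspan r) (pairing V \<xi> \<zeta>)"] ts by (simp add: e)
  show "is_pullback V (Tspan r) (pairing V \<xi> \<zeta>) (fib_in r (\<xi>, \<zeta>)) (bang V (ent (Tbar r) (\<xi>, \<zeta>)))"
    using pb b by simp
  have c: "Tspan r\<cdot>fib_in r (\<xi>, \<zeta>) = pairing V \<xi> \<zeta>\<cdot>bang V (ent (Tbar r) (\<xi>, \<zeta>))" using t(9) b by simp
  have "prod_fst V ?A ?B\<cdot>(Tspan r\<cdot>fib_in r (\<xi>, \<zeta>)) = \<xi>\<cdot>bang V (ent (Tbar r) (\<xi>, \<zeta>))"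
    "prod_snd V ?A ?B\<cdot>(Tspan r\<cdot>fib_in r (\<xi>, \<zeta>)) = \<zeta>\<cdot>bang V (ent (Tbar r) (\<xi>, \<zeta>))"
    unfolding c using comp_cong[OF p(4), of "bang V (ent (Tbar r) (\<xi>, \<zeta>))"] comp_cong[OF p(5), of "bang V (ent (Tbar r) (\<xi>, \<zeta>))"] r 1 by simp_all
  then show "FA T (tot_src r)\<cdot>fib_in r (\<xi>, \<zeta>) = \<xi>\<cdot>bang V (ent (Tbar r) (\<xi>, \<zeta>))"
    "FA T (tot_tgt r)\<cdot>fib_in r (\<xi>, \<zeta>) = \<zeta>\<cdot>bang V (ent (Tbar r) (\<xi>, \<zeta>))"
    using comp_cong[OF ts(4), of "fib_in r (\<xi>, \<zeta>)"] comp_cong[OF ts(5), of "fib_in r (\<xi>, \<zeta>)"] ts(1-3) 1 r by simp_all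
qed

lemma fib_comp:
  assumes "vmatrix r" "\<xi> \<in> Tset (src r)" "\<zeta> \<in> Tset (tgt r)" "arr z" "cod z = ent (Tbar r) (\<xi>, \<zeta>)"
  shows "FA T (tot_src r)\<cdot>(fib_in r (\<xi>, \<zeta>)\<cdot>z) = \<xi>\<cdot>bang V (dom z)"
    "FA T (tot_tgt r)\<cdot>(fib_in r (\<xi>, \<zeta>)\<cdot>z) = \<zeta>\<cdot>bang V (dom z)"
  using comp_cong[OF fib(5)[OF assms(1-3)], of z] comp_cong[OF fib(6)[OF assms(1-3)], of z] fib(1-4)[OF assms(1-3)] assms Tset_typed[OF assms(2)] Tset_typed[OF assms(3)] by simp_all

text \<open>The inclusion of a fibre is a pullback of an arrow out of the terminal object, and such
  arrows are monic.\<close>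

lemma fib_mono:
  assumes "vmatrix r" "\<xi> \<in> Tset (src r)" "\<zeta> \<in> Tset (tgt r)" "arr a" "arr b" "dom a = dom b"
    "cod a = ent (Tbar r) (\<xi>, \<zeta>)" "cod b = ent (Tbar r) (\<xi>, \<zeta>)" "fib_in r (\<xi>, \<zeta>)\<cdot>a = fib_in r (\<xi>, \<zeta>)\<cdot>b"
  shows "a = b"
  by (rule pullback_eq[OF fib(7)[OF assms(1-3)]]) (use assms fib(1-4)[OF assms(1-3)] in simp_all)

lemma fib_lift:
  assumes r: "vmatrix r" and x: "\<xi> \<in> Tset (src r)" "\<zeta> \<in> Tset (tgt r)" and g: "arr g" "cod g = FO T (tot r)"
    "FA T (tot_src r)\<cdot>g = \<xi>\<cdot>bang V (dom g)" "FA T (tot_tgt r)\<cdot>g = \<zeta>\<cdot>bang V (dom g)"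
  shows "arr (fib_lift r (\<xi>, \<zeta>) g)" "dom (fib_lift r (\<xi>, \<zeta>) g) = dom g" "cod (fib_lift r (\<xi>, \<zeta>) g) = ent (Tbar r) (\<xi>, \<zeta>)"
    "fib_in r (\<xi>, \<zeta>)\<cdot>fib_lift r (\<xi>, \<zeta>) g = g"
proof -
  note [simp] = Tset_typed[OF x(1)] Tset_typed[OF x(2)]
  let ?A = "FO T (copow V (src r))" and ?B = "FO T (copow V (tgt r))"
  have p: "arr (pairing V \<xi> \<zeta>)" "dom (pairing V \<xi> \<zeta>) = one V" "cod (pairing V \<xi> \<zeta>) = prod_ob V ?A ?B"
    "prod_fst V ?A ?B\<cdot>pairing V \<xi> \<zeta> = \<xi>" "prod_snd V ?A ?B\<cdot>pairing V \<xi> \<zeta> = \<zeta>"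
     by simp_all
  note ts = Tspan[OF r]
  have e: "ent (Tbar r) (\<xi>, \<zeta>) = pb_ob V (Tspan r) (pairing V \<xi> \<zeta>)" using x by (simp add: Tbar_def)
  have c: "Tspan r\<cdot>g = pairing V \<xi> \<zeta>\<cdot>bang V (dom g)"
    by (rule prod_ext[of ?A ?B])
      (use r g ts comp_cong[OF ts(4), of g] comp_cong[OF ts(5), of g] comp_cong[OF p(4), of "bang V (dom g)"] comp_cong[OF p(5), of "bang V (dom g)"] in simp_all)
  note l = pb_lift[OF ts(1) p(1) _ g(1) bang_typed(1) _ _ _ c]
  show "arr (fib_lift r (\<xi>, \<zeta>) g)" "dom (fib_lift r (\<xi>, \<zeta>) g) = dom g" "cod (fib_lift r (\<xi>, \<zeta>) g) = ent (Tbar r) (\<xi>, \<zeta>)"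
    "fib_in r (\<xi>, \<zeta>)\<cdot>fib_lift r (\<xi>, \<zeta>) g = g"
    unfolding fib_lift_def fib_in_def e case_prod_conv using l g(1,2) ts(1-3) by simp_all
qed

lemma vmatrix_Tbar [simp]: "vmatrix r \<Longrightarrow> vmatrix (Tbar r)"
  using fib(4)[of r] by (simp add: vmatrix_def[of "Tbar r"])

text \<open>Locally, an arrow into \<open>T (tot r)\<close> with constant target lies in a fibre: its source is locally
  constant by cartesianness, because source and target agree over \<open>T 1\<close>.\<close>

lemma cov_fib:
  assumes r: "vmatrix r" and z: "\<zeta> \<in> Tset (tgt r)" and b: "arr b" "cod b = FO T (tot r)"
    "FA T (tot_tgt r)\<cdot>b = \<zeta>\<cdot>bang V (dom b)"
  shows "cov (dom b) (\<lambda>v. \<exists>\<xi>\<in>Tset (src r). \<exists>c. arr c \<and> dom c = dom v \<and> cod c = ent (Tbar r) (\<xi>, \<zeta>) \<and>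
    b\<cdot>v = fib_in r (\<xi>, \<zeta>)\<cdot>c)"
proof -
  note [simp] = Tset_typed[OF z]
  let ?t = "copow_map V (tgt r) (\<lambda>_. undefined) star" and ?s = "copow_map V (src r) (\<lambda>_. undefined) star"
  have st: "arr ?t" "dom ?t = copow V (tgt r)" "cod ?t = copow V star" "arr ?s" "dom ?s = copow V (src r)" "cod ?s = copow V star"
    using r by simp_all
  have "?s\<cdot>tot_src r = ?t\<cdot>tot_tgt r"
    by (rule tot_ext[OF r]) (use r in simp_all)
  then have e: "FA T ?s\<cdot>FA T (tot_src r) = FA T ?t\<cdot>FA T (tot_tgt r)"
    by (rule T_cong2) (use r in simp_all)
  define \<zeta>' where "\<zeta>' = FA T ?t\<cdot>\<zeta>"
  have z': "\<zeta>' \<in> Tset star" using st unfolding \<zeta>'_def by (simp add: Tset_iff)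
  note [simp] = Tset_typed[OF z']
  have "FA T ?s\<cdot>(FA T (tot_src r)\<cdot>b) = FA T ?t\<cdot>(FA T (tot_tgt r)\<cdot>b)"
    using comp_cong[OF e, of b] r b by simp
  also have "\<dots> = \<zeta>'\<cdot>bang V (dom b)"
    unfolding b(3) \<zeta>'_def using b st by simp
  finally have sb: "FA T ?s\<cdot>(FA T (tot_src r)\<cdot>b) = \<zeta>'\<cdot>bang V (dom b)" .
  obtain h where h: "arr h" "dom h = dom (FA T (tot_src r)\<cdot>b)" "cod h = copow V (Tset (src r))" "epsT (src r)\<cdot>h = FA T (tot_src r)\<cdot>b"
    by (rule epsT_factor[of "src r" star "\<lambda>_. undefined" "FA T (tot_src r)\<cdot>b" "pt V (Tset star) \<zeta>'\<cdot>bang V (dom b)"])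
      (use r b sb z' in simp_all)
  have Dh: "dom h = dom b" using h r b by simp
  show ?thesis
  proof (rule cov_mono[OF cov_epsT[of "src r" h, unfolded Dh]])
    fix v assume v: "arr v" "cod v = dom b" "\<exists>\<xi>\<in>Tset (src r). (epsT (src r)\<cdot>h)\<cdot>v = \<xi>\<cdot>bang V (dom v)"
    then obtain \<xi> where xi: "\<xi> \<in> Tset (src r)" "FA T (tot_src r)\<cdot>(b\<cdot>v) = \<xi>\<cdot>bang V (dom v)"
      unfolding h(4) using r b by auto
    have zv: "FA T (tot_tgt r)\<cdot>(b\<cdot>v) = \<zeta>\<cdot>bang V (dom v)"
      using comp_cong[OF b(3), of v] r b(1,2) v(1,2) by simp
    note l = fib_lift[OF r xi(1) z, of "b\<cdot>v"]
    show "\<exists>\<xi>\<in>Tset (src r). \<exists>c. arr c \<and> dom c = dom v \<and> cod c = ent (Tbar r) (\<xi>, \<zeta>) \<and> b\<cdot>v = fib_in r (\<xi>, \<zeta>)\<cdot>c"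
      using xi zv l v(1,2) b(1,2) by (intro bexI[of _ \<xi>] exI[of _ "fib_lift r (\<xi>, \<zeta>) (b\<cdot>v)"]) simp_all
  qed (use r h in simp_all)
qed

text \<open>The canonical arrow from the total object of \<open>Tbar r\<close> to \<open>T\<close>
  of the total object of \<open>r\<close>; \<open>T\<close> of this arrow, followed by
  \<open>Mult\<close>, is what \<open>m_mat\<close> is built from.\<close>

definition fibs :: "('o, 'u) vmat \<Rightarrow> 'u" where
  "fibs r = tot_copair (Tbar r) (FO T (tot r)) (fib_in r)"

lemma fibs:
  assumes "vmatrix r"
  shows "arr (fibs r)" "dom (fibs r) = tot (Tbar r)" "cod (fibs r) = FO T (tot r)"
    "\<lbrakk>\<xi> \<in> Tset (src r); \<zeta> \<in> Tset (tgt r)\<rbrakk> \<Longrightarrow> fibs r\<cdot>tot_in (Tbar r) (\<xi>, \<zeta>) = fib_in r (\<xi>, \<zeta>)"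
    "FA T (tot_src r)\<cdot>fibs r = epsT (src r)\<cdot>tot_src (Tbar r)"
    "FA T (tot_tgt r)\<cdot>fibs r = epsT (tgt r)\<cdot>tot_tgt (Tbar r)"
proof -
  have b: "vmatrix (Tbar r)" using assms by simp
  show 1: "arr (fibs r)" "dom (fibs r) = tot (Tbar r)" "cod (fibs r) = FO T (tot r)"
    and 2: "\<And>\<xi> \<zeta>. \<lbrakk>\<xi> \<in> Tset (src r); \<zeta> \<in> Tset (tgt r)\<rbrakk> \<Longrightarrow> fibs r\<cdot>tot_in (Tbar r) (\<xi>, \<zeta>) = fib_in r (\<xi>, \<zeta>)"
    unfolding fibs_def using tot_copair[OF b, of "FO T (tot r)" "fib_in r"] fib[OF assms] assms by simp_all
  have e: "tot_src (Tbar r)\<cdot>tot_in (Tbar r) (\<xi>, \<zeta>) = pt V (Tset (src r)) \<xi>\<cdot>bang V (ent (Tbar r) (\<xi>, \<zeta>))"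
    "tot_tgt (Tbar r)\<cdot>tot_in (Tbar r) (\<xi>, \<zeta>) = pt V (Tset (tgt r)) \<zeta>\<cdot>bang V (ent (Tbar r) (\<xi>, \<zeta>))"
    if "\<xi> \<in> Tset (src r)" "\<zeta> \<in> Tset (tgt r)" for \<xi> \<zeta>
    using tot_src(4)[OF b, of \<xi> \<zeta>] tot_tgt(4)[OF b, of \<xi> \<zeta>] that by simp_all
  have ti: "arr (tot_in (Tbar r) (\<xi>, \<zeta>))" "dom (tot_in (Tbar r) (\<xi>, \<zeta>)) = ent (Tbar r) (\<xi>, \<zeta>)" "cod (tot_in (Tbar r) (\<xi>, \<zeta>)) = tot (Tbar r)"
    if "\<xi> \<in> Tset (src r)" "\<zeta> \<in> Tset (tgt r)" for \<xi> \<zeta> using b that by simp_all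
  show "FA T (tot_src r)\<cdot>fibs r = epsT (src r)\<cdot>tot_src (Tbar r)"
  proof (rule tot_ext[OF b])
    fix \<xi> \<zeta> assume "\<xi> \<in> src (Tbar r)" "\<zeta> \<in> tgt (Tbar r)"
    then have x: "\<xi> \<in> Tset (src r)" "\<zeta> \<in> Tset (tgt r)" by simp_all
    show "(FA T (tot_src r)\<cdot>fibs r)\<cdot>tot_in (Tbar r) (\<xi>, \<zeta>) = (epsT (src r)\<cdot>tot_src (Tbar r))\<cdot>tot_in (Tbar r) (\<xi>, \<zeta>)"
      using 1 2[OF x] fib(4,5)[OF assms x] x assms by simp
  qed (use 1 assms in simp_all)
  show "FA T (tot_tgt r)\<cdot>fibs r = epsT (tgt r)\<cdot>tot_tgt (Tbar r)"
  proof (rule tot_ext[OF b])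
    fix \<xi> \<zeta> assume "\<xi> \<in> src (Tbar r)" "\<zeta> \<in> tgt (Tbar r)"
    then have x: "\<xi> \<in> Tset (src r)" "\<zeta> \<in> Tset (tgt r)" by simp_all
    show "(FA T (tot_tgt r)\<cdot>fibs r)\<cdot>tot_in (Tbar r) (\<xi>, \<zeta>) = (epsT (tgt r)\<cdot>tot_tgt (Tbar r))\<cdot>tot_in (Tbar r) (\<xi>, \<zeta>)"
      using 1 2[OF x] fib(4,6)[OF assms x] x assms by simp
  qed (use 1 assms in simp_all)
qed

definition matrix_map where
  "matrix_map r r' g h \<theta> \<longleftrightarrow> vmatrix r \<and> vmatrix r' \<and> (\<forall>x\<in>src r. g x \<in> src r') \<and> (\<forall>y\<in>tgt r. h y \<in> tgt r') \<and>
    (\<forall>x\<in>src r. \<forall>y\<in>tgt r. arr (\<theta> (x, y)) \<and> dom (\<theta> (x, y)) = ent r (x, y) \<and> cod (\<theta> (x, y)) = ent r' (g x, h y))"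

lemma matrix_mapD:
  assumes "matrix_map r r' g h \<theta>"
  shows "vmatrix r" "vmatrix r'" "x \<in> src r \<Longrightarrow> g x \<in> src r'" "y \<in> tgt r \<Longrightarrow> h y \<in> tgt r'"
    "\<lbrakk>x \<in> src r; y \<in> tgt r\<rbrakk> \<Longrightarrow> arr (\<theta> (x, y))" "\<lbrakk>x \<in> src r; y \<in> tgt r\<rbrakk> \<Longrightarrow> dom (\<theta> (x, y)) = ent r (x, y)"
    "\<lbrakk>x \<in> src r; y \<in> tgt r\<rbrakk> \<Longrightarrow> cod (\<theta> (x, y)) = ent r' (g x, h y)"
  using assms by (auto simp: matrix_map_def)

lemma tot_map:
  assumes m: "matrix_map r r' g h \<theta>"
  shows "arr (tot_map r r' g h \<theta>)" "dom (tot_map r r' g h \<theta>) = tot r" "cod (tot_map r r' g h \<theta>) = tot r'"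
    "\<lbrakk>x \<in> src r; y \<in> tgt r\<rbrakk> \<Longrightarrow> tot_map r r' g h \<theta>\<cdot>tot_in r (x, y) = tot_in r' (g x, h y)\<cdot>\<theta> (x, y)"
    "tot_src r'\<cdot>tot_map r r' g h \<theta> = copow_map V (src r) g (src r')\<cdot>tot_src r"
    "tot_tgt r'\<cdot>tot_map r r' g h \<theta> = copow_map V (tgt r) h (tgt r')\<cdot>tot_tgt r"
proof -
  note d = matrix_mapD[OF m]
  show 1: "arr (tot_map r r' g h \<theta>)" "dom (tot_map r r' g h \<theta>) = tot r" "cod (tot_map r r' g h \<theta>) = tot r'"
    and 2: "\<And>x y. \<lbrakk>x \<in> src r; y \<in> tgt r\<rbrakk> \<Longrightarrow> tot_map r r' g h \<theta>\<cdot>tot_in r (x, y) = tot_in r' (g x, h y)\<cdot>\<theta> (x, y)"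
    unfolding tot_map_def
    using tot_copair[OF d(1), of "tot r'" "\<lambda>(x, y). tot_in r' (g x, h y)\<cdot>\<theta> (x, y)"] d by simp_all
  show "tot_src r'\<cdot>tot_map r r' g h \<theta> = copow_map V (src r) g (src r')\<cdot>tot_src r"
    by (rule tot_ext[OF d(1)]) (use 1 2 d in simp_all)
  show "tot_tgt r'\<cdot>tot_map r r' g h \<theta> = copow_map V (tgt r) h (tgt r')\<cdot>tot_tgt r"
    by (rule tot_ext[OF d(1)]) (use 1 2 d in simp_all)
qed

text \<open>The last equation determines the arrow, inclusions of fibres being monic.\<close>

lemma Tbar_map:
  assumes m: "matrix_map r r' g h \<theta>" and x: "\<xi> \<in> Tset (src r)" "\<zeta> \<in> Tset (tgt r)"
  defines "b \<equiv> Tbar_map r r' g h \<theta> (\<xi>, \<zeta>)"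
    and "\<xi>' \<equiv> Tfun (src r) g (src r') \<xi>" and "\<zeta>' \<equiv> Tfun (tgt r) h (tgt r') \<zeta>"
  shows "arr b" "dom b = ent (Tbar r) (\<xi>, \<zeta>)" "cod b = ent (Tbar r') (\<xi>', \<zeta>')"
    "fib_in r' (\<xi>', \<zeta>')\<cdot>b = FA T (tot_map r r' g h \<theta>)\<cdot>fib_in r (\<xi>, \<zeta>)"
proof -
  note d = matrix_mapD[OF m] and t = tot_map[OF m] and f = fib[OF d(1) x]
  note [simp] = Tset_typed[OF x(1)] Tset_typed[OF x(2)]
  let ?g = "FA T (tot_map r r' g h \<theta>)\<cdot>fib_in r (\<xi>, \<zeta>)"
  have x': "\<xi>' \<in> Tset (src r')" "\<zeta>' \<in> Tset (tgt r')" unfolding \<xi>'_def \<zeta>'_def using d x by simp_all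
  have e: "\<xi>' = FA T (copow_map V (src r) g (src r'))\<cdot>\<xi>" "\<zeta>' = FA T (copow_map V (tgt r) h (tgt r'))\<cdot>\<zeta>"
    unfolding \<xi>'_def \<zeta>'_def using x by (simp_all add: Tfun_app)
  have 1: "FA T (tot_src r')\<cdot>?g = \<xi>'\<cdot>bang V (dom ?g)"
    unfolding e using comp_cong[OF T_cong2[OF t(5)], of "fib_in r (\<xi>, \<zeta>)"] t(1-3) d f by simp
  have 2: "FA T (tot_tgt r')\<cdot>?g = \<zeta>'\<cdot>bang V (dom ?g)"
    unfolding e using comp_cong[OF T_cong2[OF t(6)], of "fib_in r (\<xi>, \<zeta>)"] t(1-3) d f by simp
  have g: "arr ?g" "cod ?g = FO T (tot r')" "dom ?g = ent (Tbar r) (\<xi>, \<zeta>)" using t(1-3) f by simp_all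
  have b: "b = fib_lift r' (\<xi>', \<zeta>') ?g" unfolding b_def Tbar_map_def \<xi>'_def \<zeta>'_def by simp
  show "arr b" "dom b = ent (Tbar r) (\<xi>, \<zeta>)" "cod b = ent (Tbar r') (\<xi>', \<zeta>')" "fib_in r' (\<xi>', \<zeta>')\<cdot>b = ?g"
    using fib_lift[OF d(2) x' g(1,2) 1 2] g(3) unfolding b by simp_all
qed

section \<open>Composition of matrices\<close>

definition composable where
  "composable s r \<longleftrightarrow> vmatrix s \<and> vmatrix r \<and> tgt r = src s"

abbreviation summand where "summand s r x y z \<equiv> prod_ob V (ent s (y, z)) (ent r (x, y))"

definition comp_in where
  "comp_in s r x y z = tot_in (mat_comp s r) (x, z)\<cdot>coprod_in V (tgt r) (\<lambda>y. summand s r x y z) y"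

definition comp_fst where
  "comp_fst s r = tot_copair (mat_comp s r) (tot s) (\<lambda>(x, z). comp_copair s r (x, z) (tot s)
      (\<lambda>y. tot_in s (y, z)\<cdot>prod_fst V (ent s (y, z)) (ent r (x, y))))"

definition comp_snd where
  "comp_snd s r = tot_copair (mat_comp s r) (tot r) (\<lambda>(x, z). comp_copair s r (x, z) (tot r)
      (\<lambda>y. tot_in r (x, y)\<cdot>prod_snd V (ent s (y, z)) (ent r (x, y))))"

lemma mat_comp_simps [simp]: "src (mat_comp s r) = src r" "tgt (mat_comp s r) = tgt s"
  "\<lbrakk>x \<in> src r; z \<in> tgt s\<rbrakk> \<Longrightarrow> ent (mat_comp s r) (x, z) = coprod_ob V (tgt r) (\<lambda>y. summand s r x y z)"
  by (simp_all add: mat_comp_def)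

lemma composableD:
  assumes "composable s r"
  shows "vmatrix s" "vmatrix r" "src s = tgt r"
  using assms by (auto simp: composable_def)

lemma summand_coproduct:
  assumes c: "composable s r" and x: "x \<in> src r" "z \<in> tgt s"
  shows "is_coproduct V (tgt r) (\<lambda>y. summand s r x y z) (ent (mat_comp s r) (x, z)) (coprod_in V (tgt r) (\<lambda>y. summand s r x y z))"
  unfolding mat_comp_simps(3)[OF x]
  by (rule coproduct_of_small_index) (use composableD[OF c] x in \<open>auto intro!: small_index_small\<close>)

lemma vmatrix_comp:
  assumes c: "composable s r"
  shows "vmatrix (mat_comp s r)"
proof -
  have "ent (mat_comp s r) (x, z) \<in> Obj V" if "x \<in> src r" "z \<in> tgt s" for x z
    using coproduct_typed(1)[OF summand_coproduct[OF c that]] .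
  then show ?thesis using composableD[OF c] by (simp add: vmatrix_def[of "mat_comp s r"])
qed

lemma comp_in:
  assumes c: "composable s r" and x: "x \<in> src r" "y \<in> tgt r" "z \<in> tgt s"
  shows "arr (comp_in s r x y z)" "dom (comp_in s r x y z) = summand s r x y z" "cod (comp_in s r x y z) = tot (mat_comp s r)"
    "summand s r x y z \<in> Obj V"
  unfolding comp_in_def using coproduct_typed[OF summand_coproduct[OF c x(1,3)]] vmatrix_comp[OF c] x composableD[OF c]
  by simp_all

lemma mat_comp_coproduct:
  assumes c: "composable s r"
  shows "is_coproduct V ((src r \<times> tgt s) \<times> tgt r) (\<lambda>((x, z), y). summand s r x y z) (tot (mat_comp s r)) (\<lambda>((x, z), y). comp_in s r x y z)"
proof -
  have 1: "is_coproduct V (src r \<times> tgt s) (ent (mat_comp s r)) (tot (mat_comp s r)) (tot_in (mat_comp s r))"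
    using tot_coproduct[OF vmatrix_comp[OF c]] by simp
  let ?B = "\<lambda>i y. case i of (x, z) \<Rightarrow> summand s r x y z"
  let ?k = "\<lambda>i. case i of (x, z) \<Rightarrow> coprod_in V (tgt r) (\<lambda>y. summand s r x y z)"
  have 2: "is_coproduct V (tgt r) (?B i) (ent (mat_comp s r) i) (?k i)" if "i \<in> src r \<times> tgt s" for i
  proof -
    obtain x z where i: "i = (x, z)" by (cases i)
    show ?thesis using summand_coproduct[OF c, of x z] that unfolding i case_prod_conv by simp
  qed
  have "is_coproduct V ((src r \<times> tgt s) \<times> tgt r) (\<lambda>(i, y). ?B i y) (tot (mat_comp s r)) (\<lambda>(i, y). tot_in (mat_comp s r) i\<cdot>?k i y)"
    by (rule coproduct_Sigma[where J = "\<lambda>_. tgt r" and B = ?B and \<kappa> = ?k, OF 1 2])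
  moreover have "(\<lambda>(i, y). ?B i y) = (\<lambda>((x, z), y). summand s r x y z)" by (simp add: fun_eq_iff)
  moreover have "(\<lambda>(i, y). tot_in (mat_comp s r) i\<cdot>?k i y) = (\<lambda>((x, z), y). comp_in s r x y z)"
    by (simp add: fun_eq_iff comp_in_def)
  ultimately show ?thesis by metis
qed

lemma mat_comp_ext:
  assumes c: "composable s r" and u: "arr u" "arr u'" "dom u = tot (mat_comp s r)" "dom u' = tot (mat_comp s r)" "cod u = cod u'"
    and e: "\<And>x y z. \<lbrakk>x \<in> src r; y \<in> tgt r; z \<in> tgt s\<rbrakk> \<Longrightarrow> u\<cdot>comp_in s r x y z = u'\<cdot>comp_in s r x y z"
  shows "u = u'"
  by (rule coproduct_eq[OF mat_comp_coproduct[OF c] u]) (use e in auto)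

lemma comp_copair:
  assumes c: "composable s r" and x: "x \<in> src r" "z \<in> tgt s" and Z: "Z \<in> Obj V"
    and g: "\<And>y. y \<in> tgt r \<Longrightarrow> arr (g y)" "\<And>y. y \<in> tgt r \<Longrightarrow> dom (g y) = summand s r x y z" "\<And>y. y \<in> tgt r \<Longrightarrow> cod (g y) = Z"
  shows "arr (comp_copair s r (x, z) Z g)" "dom (comp_copair s r (x, z) Z g) = ent (mat_comp s r) (x, z)" "cod (comp_copair s r (x, z) Z g) = Z"
    "y \<in> tgt r \<Longrightarrow> comp_copair s r (x, z) Z g\<cdot>coprod_in V (tgt r) (\<lambda>y. summand s r x y z) y = g y"
proof -
  have "small_index small (tgt r)" using composableD[OF c] by (simp add: small_index_small)
  note k = copair[OF this _ Z g]
  show "arr (comp_copair s r (x, z) Z g)" "dom (comp_copair s r (x, z) Z g) = ent (mat_comp s r) (x, z)" "cod (comp_copair s r (x, z) Z g) = Z"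
    "y \<in> tgt r \<Longrightarrow> comp_copair s r (x, z) Z g\<cdot>coprod_in V (tgt r) (\<lambda>y. summand s r x y z) y = g y"
    unfolding comp_copair_def case_prod_conv mat_comp_simps(3)[OF x] using k x composableD[OF c] by simp_all
qed

lemma mat_comp_copair:
  assumes c: "composable s r" and Z: "Z \<in> Obj V"
    and g: "\<And>x y z. \<lbrakk>x \<in> src r; y \<in> tgt r; z \<in> tgt s\<rbrakk> \<Longrightarrow> arr (g x z y) \<and> dom (g x z y) = summand s r x y z \<and> cod (g x z y) = Z"
  defines "k \<equiv> tot_copair (mat_comp s r) Z (\<lambda>(x, z). comp_copair s r (x, z) Z (g x z))"
  shows "arr k" "dom k = tot (mat_comp s r)" "cod k = Z"
    "\<lbrakk>x \<in> src r; y \<in> tgt r; z \<in> tgt s\<rbrakk> \<Longrightarrow> k\<cdot>comp_in s r x y z = g x z y"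
proof -
  note cc = comp_copair[OF c _ _ Z]
  have p: "arr (comp_copair s r (x, z) Z (g x z))" "dom (comp_copair s r (x, z) Z (g x z)) = ent (mat_comp s r) (x, z)"
    "cod (comp_copair s r (x, z) Z (g x z)) = Z"
    "\<And>y. y \<in> tgt r \<Longrightarrow> comp_copair s r (x, z) Z (g x z)\<cdot>coprod_in V (tgt r) (\<lambda>y. summand s r x y z) y = g x z y"
    if "x \<in> src r" "z \<in> tgt s" for x z
    using cc[OF that, of "g x z"] g that by auto
  note t = tot_copair[OF vmatrix_comp[OF c] Z, of "\<lambda>(x, z). comp_copair s r (x, z) Z (g x z)"]
  show 1: "arr k" "dom k = tot (mat_comp s r)" "cod k = Z"
    unfolding k_def using t(1-3) p by simp_all
  have 2: "k\<cdot>tot_in (mat_comp s r) (x, z) = comp_copair s r (x, z) Z (g x z)" if "x \<in> src r" "z \<in> tgt s" for x z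
    unfolding k_def using t(4)[of x z] p that by simp
  show "k\<cdot>comp_in s r x y z = g x z y" if x: "x \<in> src r" "y \<in> tgt r" "z \<in> tgt s"
    unfolding comp_in_def
    using comp_cong[OF 2[OF x(1,3)], of "coprod_in V (tgt r) (\<lambda>y. summand s r x y z) y"] 1 p[OF x(1,3)] x coproduct_typed[OF summand_coproduct[OF c x(1,3)]] vmatrix_comp[OF c] by simp
qed

lemma comp_proj:
  assumes c: "composable s r"
  shows "arr (comp_fst s r)" "dom (comp_fst s r) = tot (mat_comp s r)" "cod (comp_fst s r) = tot s"
    "\<lbrakk>x \<in> src r; y \<in> tgt r; z \<in> tgt s\<rbrakk> \<Longrightarrow> comp_fst s r\<cdot>comp_in s r x y z = tot_in s (y, z)\<cdot>prod_fst V (ent s (y, z)) (ent r (x, y))"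
    "arr (comp_snd s r)" "dom (comp_snd s r) = tot (mat_comp s r)" "cod (comp_snd s r) = tot r"
    "\<lbrakk>x \<in> src r; y \<in> tgt r; z \<in> tgt s\<rbrakk> \<Longrightarrow> comp_snd s r\<cdot>comp_in s r x y z = tot_in r (x, y)\<cdot>prod_snd V (ent s (y, z)) (ent r (x, y))"
proof -
  note d = composableD[OF c]
  note 1 = mat_comp_copair[OF c, of "tot s" "\<lambda>x z y. tot_in s (y, z)\<cdot>prod_fst V (ent s (y, z)) (ent r (x, y))", folded comp_fst_def]
  note 2 = mat_comp_copair[OF c, of "tot r" "\<lambda>x z y. tot_in r (x, y)\<cdot>prod_snd V (ent s (y, z)) (ent r (x, y))", folded comp_snd_def]
  show "arr (comp_fst s r)" "dom (comp_fst s r) = tot (mat_comp s r)" "cod (comp_fst s r) = tot s"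
    "\<lbrakk>x \<in> src r; y \<in> tgt r; z \<in> tgt s\<rbrakk> \<Longrightarrow> comp_fst s r\<cdot>comp_in s r x y z = tot_in s (y, z)\<cdot>prod_fst V (ent s (y, z)) (ent r (x, y))"
    using 1 d by simp_all
  show "arr (comp_snd s r)" "dom (comp_snd s r) = tot (mat_comp s r)" "cod (comp_snd s r) = tot r"
    "\<lbrakk>x \<in> src r; y \<in> tgt r; z \<in> tgt s\<rbrakk> \<Longrightarrow> comp_snd s r\<cdot>comp_in s r x y z = tot_in r (x, y)\<cdot>prod_snd V (ent s (y, z)) (ent r (x, y))"
    using 2 d by simp_all
qed

lemma comp_proj_comm:
  assumes c: "composable s r"
  shows "tot_src s\<cdot>comp_fst s r = tot_tgt r\<cdot>comp_snd s r"
    "tot_src (mat_comp s r) = tot_src r\<cdot>comp_snd s r" "tot_tgt (mat_comp s r) = tot_tgt s\<cdot>comp_fst s r"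
proof -
  note d = composableD[OF c] and m = vmatrix_comp[OF c]
  note p = comp_proj[OF c] and i = comp_in[OF c]
  show "tot_src s\<cdot>comp_fst s r = tot_tgt r\<cdot>comp_snd s r"
    by (rule mat_comp_ext[OF c]) (use p i d in simp_all)
  have ts: "tot_src (mat_comp s r)\<cdot>comp_in s r x y z = pt V (src r) x\<cdot>bang V (summand s r x y z)"
    "tot_tgt (mat_comp s r)\<cdot>comp_in s r x y z = pt V (tgt s) z\<cdot>bang V (summand s r x y z)"
    if "x \<in> src r" "y \<in> tgt r" "z \<in> tgt s" for x y z
    unfolding comp_in_def
    using tot_src_tgt_comp[OF m, of x z "coprod_in V (tgt r) (\<lambda>y. summand s r x y z) y"] coproduct_typed[OF summand_coproduct[OF c that(1,3)]] that by simp_all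
  show "tot_src (mat_comp s r) = tot_src r\<cdot>comp_snd s r"
    by (rule mat_comp_ext[OF c]) (use p i d m ts in simp_all)
  show "tot_tgt (mat_comp s r) = tot_tgt s\<cdot>comp_fst s r"
    by (rule mat_comp_ext[OF c]) (use p i d m ts in simp_all)
qed

text \<open>The pullback is recognized as the coproduct of the products of entries: locally its
  projections lie in entries of \<open>s\<close> and of \<open>r\<close>, and since they agree over
  the middle copower the two entries share the middle index. The comparison arrow matches the
  injections, hence is an isomorphism.\<close>

lemma tot_comp_iso:
  assumes c: "composable s r"
  shows "arr (tot_comp_iso s r)" "dom (tot_comp_iso s r) = tot (mat_comp s r)" "cod (tot_comp_iso s r) = pb_ob V (tot_src s) (tot_tgt r)"
    "pb_fst V (tot_src s) (tot_tgt r)\<cdot>tot_comp_iso s r = comp_fst s r" "pb_snd V (tot_src s) (tot_tgt r)\<cdot>tot_comp_iso s r = comp_snd s r"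
    "is_iso V (tot_comp_iso s r)"
proof -
  note d = composableD[OF c]
  note p = comp_proj[OF c] and i = comp_in[OF c]
  let ?P = "pb_ob V (tot_src s) (tot_tgt r)"
  let ?f = "pb_fst V (tot_src s) (tot_tgt r)" and ?g = "pb_snd V (tot_src s) (tot_tgt r)"
  have e: "tot_comp_iso s r = pb_lift V (tot_src s) (tot_tgt r) (comp_fst s r) (comp_snd s r)"
    unfolding tot_comp_iso_def comp_fst_def comp_snd_def ..
  have pbt: "arr (tot_src s)" "arr (tot_tgt r)" "cod (tot_src s) = cod (tot_tgt r)" using d by simp_all
  note l = pb_lift[OF pbt p(1,5) _ _ _ comp_proj_comm(1)[OF c]]
  show t: "arr (tot_comp_iso s r)" "dom (tot_comp_iso s r) = tot (mat_comp s r)" "cod (tot_comp_iso s r) = ?P"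
    "?f\<cdot>tot_comp_iso s r = comp_fst s r" "?g\<cdot>tot_comp_iso s r = comp_snd s r"
    unfolding e using l p d by simp_all
  define w where "w x y z = tot_comp_iso s r\<cdot>comp_in s r x y z" for x y z
  have w: "arr (w x y z)" "dom (w x y z) = summand s r x y z" "cod (w x y z) = ?P"
    "?f\<cdot>w x y z = tot_in s (y, z)\<cdot>prod_fst V (ent s (y, z)) (ent r (x, y))"
    "?g\<cdot>w x y z = tot_in r (x, y)\<cdot>prod_snd V (ent s (y, z)) (ent r (x, y))"
    if "x \<in> src r" "y \<in> tgt r" "z \<in> tgt s" for x y z
    unfolding w_def using t i[OF that] p that comp_cong[OF t(4), of "comp_in s r x y z"] comp_cong[OF t(5), of "comp_in s r x y z"] pbt by simp_all
  have wc: "?f\<cdot>(w x y z\<cdot>a) = tot_in s (y, z)\<cdot>(prod_fst V (ent s (y, z)) (ent r (x, y))\<cdot>a)"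
    "?g\<cdot>(w x y z\<cdot>a) = tot_in r (x, y)\<cdot>(prod_snd V (ent s (y, z)) (ent r (x, y))\<cdot>a)"
    if "x \<in> src r" "y \<in> tgt r" "z \<in> tgt s" "arr a" "cod a = summand s r x y z" for x y z a
    using comp_cong[OF w(4)[OF that(1-3)], of a] comp_cong[OF w(5)[OF that(1-3)], of a] w[OF that(1-3)] that d by simp_all
  have "is_coproduct V ((src r \<times> tgt s) \<times> tgt r) (\<lambda>((x, z), y). summand s r x y z) ?P (\<lambda>((x, z), y). w x y z)"
  proof (rule coproduct_recognition)
    fix i j a b assume h: "i \<in> (src r \<times> tgt s) \<times> tgt r" "j \<in> (src r \<times> tgt s) \<times> tgt r" "i \<noteq> j" "arr a" "arr b" "dom a = dom b"
      "cod a = (case i of (xa, xb) \<Rightarrow> (case xa of (x, z) \<Rightarrow> \<lambda>y. summand s r x y z) xb)"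
      "cod b = (case j of (xa, xb) \<Rightarrow> (case xa of (x, z) \<Rightarrow> \<lambda>y. summand s r x y z) xb)"
      "(case i of (xa, xb) \<Rightarrow> (case xa of (x, z) \<Rightarrow> \<lambda>y. w x y z) xb)\<cdot>a = (case j of (xa, xb) \<Rightarrow> (case xa of (x, z) \<Rightarrow> \<lambda>y. w x y z) xb)\<cdot>b"
    obtain x z y x' z' y' where ij: "i = ((x, z), y)" "j = ((x', z'), y')" by (metis surj_pair)
    have x: "x \<in> src r" "y \<in> tgt r" "z \<in> tgt s" "x' \<in> src r" "y' \<in> tgt r" "z' \<in> tgt s" using h(1,2) ij by auto
    have a: "cod a = summand s r x y z" "cod b = summand s r x' y' z'" "w x y z\<cdot>a = w x' y' z'\<cdot>b" using h(7-9) ij by simp_all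
    have 1: "tot_in s (y, z)\<cdot>(prod_fst V (ent s (y, z)) (ent r (x, y))\<cdot>a) = tot_in s (y', z')\<cdot>(prod_fst V (ent s (y', z')) (ent r (x', y'))\<cdot>b)"
      "tot_in r (x, y)\<cdot>(prod_snd V (ent s (y, z)) (ent r (x, y))\<cdot>a) = tot_in r (x', y')\<cdot>(prod_snd V (ent s (y', z')) (ent r (x', y'))\<cdot>b)"
      using wc[OF x(1-3) h(4) a(1)] wc[OF x(4-6) h(5) a(2)] a(3) by simp_all
    have "y = y' \<and> z = z' \<or> is_initial V (dom a)"
      using tot_disjoint[OF d(1) _ _ _ _ _ _ _ _ _ 1(1)] x d a h by simp
    moreover have "x = x' \<and> y = y' \<or> is_initial V (dom a)"
      using tot_disjoint[OF d(2) _ _ _ _ _ _ _ _ _ 1(2)] x d a h by simp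
    ultimately show "is_initial V (dom a)" using h(3) ij by auto
  next
    fix i a b assume h: "i \<in> (src r \<times> tgt s) \<times> tgt r" "arr a" "arr b" "dom a = dom b"
      "cod a = (case i of (xa, xb) \<Rightarrow> (case xa of (x, z) \<Rightarrow> \<lambda>y. summand s r x y z) xb)"
      "cod b = (case i of (xa, xb) \<Rightarrow> (case xa of (x, z) \<Rightarrow> \<lambda>y. summand s r x y z) xb)"
      "(case i of (xa, xb) \<Rightarrow> (case xa of (x, z) \<Rightarrow> \<lambda>y. w x y z) xb)\<cdot>a = (case i of (xa, xb) \<Rightarrow> (case xa of (x, z) \<Rightarrow> \<lambda>y. w x y z) xb)\<cdot>b"
    obtain x z y where i: "i = ((x, z), y)" by (metis surj_pair)
    have x: "x \<in> src r" "y \<in> tgt r" "z \<in> tgt s" using h(1) i by auto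
    have a: "cod a = summand s r x y z" "cod b = summand s r x y z" "w x y z\<cdot>a = w x y z\<cdot>b" using h(5-7) i by simp_all
    have 1: "tot_in s (y, z)\<cdot>(prod_fst V (ent s (y, z)) (ent r (x, y))\<cdot>a) = tot_in s (y, z)\<cdot>(prod_fst V (ent s (y, z)) (ent r (x, y))\<cdot>b)"
      "tot_in r (x, y)\<cdot>(prod_snd V (ent s (y, z)) (ent r (x, y))\<cdot>a) = tot_in r (x, y)\<cdot>(prod_snd V (ent s (y, z)) (ent r (x, y))\<cdot>b)"
      using wc[OF x h(2) a(1)] wc[OF x h(3) a(2)] a(3) by simp_all
    show "a = b"
      by (rule prod_ext[of "ent s (y, z)" "ent r (x, y)"])
        (use tot_mono[OF d(1) _ _ _ _ _ _ _ 1(1)] tot_mono[OF d(2) _ _ _ _ _ _ _ 1(2)] x d a h in simp_all)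
  next
    let ?S = "\<lambda>k. \<exists>i\<in>(src r \<times> tgt s) \<times> tgt r. \<exists>t. arr t \<and> dom t = dom k \<and>
      cod t = (case i of (xa, xb) \<Rightarrow> (case xa of (x, z) \<Rightarrow> \<lambda>y. summand s r x y z) xb) \<and>
      k = (case i of (xa, xb) \<Rightarrow> (case xa of (x, z) \<Rightarrow> \<lambda>y. w x y z) xb)\<cdot>t"
    have f: "arr ?f" "dom ?f = ?P" "cod ?f = tot s" "arr ?g" "dom ?g = ?P" "cod ?g = tot r" using d by simp_all
    have "cov (dom ?f) ?S"
    proof (rule cov_trans[OF cov_tot[OF d(1) f(1,3)]])
      fix u assume u: "arr u" "cod u = dom ?f"
        "\<exists>x\<in>src s. \<exists>y\<in>tgt s. \<exists>a. arr a \<and> dom a = dom u \<and> cod a = ent s (x, y) \<and> ?f\<cdot>u = tot_in s (x, y)\<cdot>a"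
      then obtain y z a where a: "y \<in> tgt r" "z \<in> tgt s" "arr a" "dom a = dom u" "cod a = ent s (y, z)" "?f\<cdot>u = tot_in s (y, z)\<cdot>a"
        unfolding d(3) by blast
      have gu: "arr (?g\<cdot>u)" "cod (?g\<cdot>u) = tot r" "dom (?g\<cdot>u) = dom u" using u f by simp_all
      show "cov (dom u) (\<lambda>v. ?S (u\<cdot>v))"
      proof (rule cov_trans[OF cov_tot[OF d(2) gu(1,2), unfolded gu(3)]])
        fix v assume v: "arr v" "cod v = dom u"
          "\<exists>x\<in>src r. \<exists>y\<in>tgt r. \<exists>a. arr a \<and> dom a = dom v \<and> cod a = ent r (x, y) \<and> (?g\<cdot>u)\<cdot>v = tot_in r (x, y)\<cdot>a"
        then obtain x y' b where b: "x \<in> src r" "y' \<in> tgt r" "arr b" "dom b = dom v" "cod b = ent r (x, y')" "?g\<cdot>(u\<cdot>v) = tot_in r (x, y')\<cdot>b"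
          using u f by auto
        have fv: "?f\<cdot>(u\<cdot>v) = tot_in s (y, z)\<cdot>(a\<cdot>v)" using comp_cong[OF a(6) _ _ _ v(1)] u(1,2) v(1,2) a(1-5) d by simp
        have "tot_src s\<cdot>(?f\<cdot>(u\<cdot>v)) = tot_tgt r\<cdot>(?g\<cdot>(u\<cdot>v))" using pbt u(1,2) v(1,2) by simp
        then have "pt V (tgt r) y\<cdot>bang V (dom v) = pt V (tgt r) y'\<cdot>bang V (dom v)"
          unfolding fv b(6) using a(1-5) b(1-5) v(1,2) d by simp
        then have or: "y = y' \<or> is_initial V (dom v)" using pt_disjoint[of "tgt r" y y' "dom v"] a b v d by simp
        show "cov (dom v) (\<lambda>k. ?S (u\<cdot>(v\<cdot>k)))"
        proof (cases "is_initial V (dom v)")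
          case True then show ?thesis by (rule cov_initial)
        next
          case False
          then have y: "y' = y" using or by simp
          define t where "t = pairing V (a\<cdot>v) b"
          have tt: "arr t" "dom t = dom v" "cod t = summand s r x y z"
            "prod_fst V (ent s (y, z)) (ent r (x, y))\<cdot>t = a\<cdot>v" "prod_snd V (ent s (y, z)) (ent r (x, y))\<cdot>t = b"
            unfolding t_def using a(1-5) b(1-5) v(1,2) y by simp_all
          have "u\<cdot>v = w x y z\<cdot>t"
            by (rule pb_ext[OF pbt])
              (use u(1,2) v(1,2) f w[OF b(1) a(1,2)] wc[OF b(1) a(1,2) tt(1,3)] tt fv b(6) y in simp_all)
          then have "?S (u\<cdot>(v\<cdot>Ident V (dom v)))"
            using tt u(1,2) v(1,2) b(1) a(1,2) w(1-3)[OF b(1) a(1,2)] by (intro bexI[of _ "((x, z), y)"] exI[of _ t]) simp_all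
          then show ?thesis using v by (intro cov_Ident) simp_all
        qed
      qed
    qed
    then show "cov ?P ?S" unfolding f(2) .
  qed (use w in auto)
  from coproduct_iso[OF mat_comp_coproduct[OF c] this]
  obtain j where j: "is_iso V j" "arr j" "dom j = tot (mat_comp s r)" "cod j = ?P"
    "\<And>k. k \<in> (src r \<times> tgt s) \<times> tgt r \<Longrightarrow> j\<cdot>(\<lambda>((x, z), y). comp_in s r x y z) k = (\<lambda>((x, z), y). w x y z) k"
    by blast
  have jc: "j\<cdot>comp_in s r x y z = w x y z" if "x \<in> src r" "y \<in> tgt r" "z \<in> tgt s" for x y z
    using j(5)[of "((x, z), y)"] that by simp
  have "tot_comp_iso s r = j"
    by (rule mat_comp_ext[OF c]) (use t j(2-4) jc in \<open>simp_all add: w_def\<close>)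
  then show "is_iso V (tot_comp_iso s r)" using j by simp
qed

text \<open>The last two equations describe the arrow through its components in \<open>tot s\<close>
  and \<open>tot r\<close>. They eliminate the two inverse isomorphisms of the definition, and later
  computations rely on them alone.\<close>

lemma m_str:
  assumes c: "composable s r" and x: "\<xi> \<in> Tset (src r)" "\<zeta> \<in> Tset (tgt r)" "\<omega> \<in> Tset (tgt s)"
  defines "m \<equiv> m_str s r (\<xi>, \<zeta>, \<omega>)" and "A \<equiv> ent (Tbar s) (\<zeta>, \<omega>)" and "B \<equiv> ent (Tbar r) (\<xi>, \<zeta>)"
  shows "arr m" "dom m = prod_ob V A B" "cod m = ent (Tbar (mat_comp s r)) (\<xi>, \<omega>)"
    "FA T (comp_fst s r)\<cdot>(fib_in (mat_comp s r) (\<xi>, \<omega>)\<cdot>m) = fib_in s (\<zeta>, \<omega>)\<cdot>prod_fst V A B"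
    "FA T (comp_snd s r)\<cdot>(fib_in (mat_comp s r) (\<xi>, \<omega>)\<cdot>m) = fib_in r (\<xi>, \<zeta>)\<cdot>prod_snd V A B"
proof -
  note d = composableD[OF c] and M = vmatrix_comp[OF c] and i = tot_comp_iso[OF c] and p = comp_proj[OF c]
  note [simp] = Tset_typed[OF x(1)] Tset_typed[OF x(2)] Tset_typed[OF x(3)]
  have xs: "\<zeta> \<in> Tset (src s)" "\<omega> \<in> Tset (tgt s)" using x d by simp_all
  note fs = fib[OF d(1) xs] and fr = fib[OF d(2) x(1,2)]
  have AB: "A \<in> Obj V" "B \<in> Obj V" using fs fr by (simp_all add: A_def B_def)
  let ?f = "pb_fst V (tot_src s) (tot_tgt r)" and ?g = "pb_snd V (tot_src s) (tot_tgt r)"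
  have pbt: "arr (tot_src s)" "arr (tot_tgt r)" "cod (tot_src s) = cod (tot_tgt r)" using d by simp_all
  have pbT: "arr (FA T (tot_src s))" "arr (FA T (tot_tgt r))" "cod (FA T (tot_src s)) = cod (FA T (tot_tgt r))" using d by simp_all
  have f: "arr ?f" "dom ?f = pb_ob V (tot_src s) (tot_tgt r)" "cod ?f = tot s" "arr ?g" "dom ?g = pb_ob V (tot_src s) (tot_tgt r)" "cod ?g = tot r"
    using d by simp_all
  obtain j where j: "is_iso V j" "arr j" "dom j = dom (FA T ?f)" "cod j = dom (pb_fst V (FA T (tot_src s)) (FA T (tot_tgt r)))"
    "pb_fst V (FA T (tot_src s)) (FA T (tot_tgt r))\<cdot>j = FA T ?f" "pb_snd V (FA T (tot_src s)) (FA T (tot_tgt r))\<cdot>j = FA T ?g"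
    using pullback_unique[OF pb[OF pbT] T_pullback[OF pb[OF pbt]]] .
  have "T_pb_iso s r = j"
    unfolding T_pb_iso_def by (rule pb_lift_eqI) (use pbT j in simp_all)
  then have tiso: "is_iso V (T_pb_iso s r)" "arr (T_pb_iso s r)" "dom (T_pb_iso s r) = FO T (pb_ob V (tot_src s) (tot_tgt r))"
    "cod (T_pb_iso s r) = pb_ob V (FA T (tot_src s)) (FA T (tot_tgt r))"
    "pb_fst V (FA T (tot_src s)) (FA T (tot_tgt r))\<cdot>T_pb_iso s r = FA T ?f" "pb_snd V (FA T (tot_src s)) (FA T (tot_tgt r))\<cdot>T_pb_iso s r = FA T ?g"
    using j f pbT by simp_all
  define k where "k = inv_arrow V (T_pb_iso s r)"
  have k: "arr k" "dom k = pb_ob V (FA T (tot_src s)) (FA T (tot_tgt r))" "cod k = FO T (pb_ob V (tot_src s) (tot_tgt r))"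
    "T_pb_iso s r\<cdot>k = Ident V (pb_ob V (FA T (tot_src s)) (FA T (tot_tgt r)))"
    using inv_arrow[OF tiso(1)] tiso by (simp_all add: k_def)
  define h where "h = inv_arrow V (tot_comp_iso s r)"
  have h: "arr h" "dom h = pb_ob V (tot_src s) (tot_tgt r)" "cod h = tot (mat_comp s r)"
    "tot_comp_iso s r\<cdot>h = Ident V (pb_ob V (tot_src s) (tot_tgt r))"
    using inv_arrow[OF i(6)] i by (simp_all add: h_def)
  have ch: "comp_fst s r\<cdot>h = ?f" "comp_snd s r\<cdot>h = ?g"
    unfolding i(4,5)[symmetric] using i(1-3) h pbt by simp_all
  have kf: "FA T ?f\<cdot>k = pb_fst V (FA T (tot_src s)) (FA T (tot_tgt r))" "FA T ?g\<cdot>k = pb_snd V (FA T (tot_src s)) (FA T (tot_tgt r))"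
    unfolding tiso(5,6)[symmetric] using tiso(2-4) k pbT by simp_all
  let ?a = "fib_in s (\<zeta>, \<omega>)\<cdot>prod_fst V A B" and ?b = "fib_in r (\<xi>, \<zeta>)\<cdot>prod_snd V A B"
  have ab: "arr ?a" "dom ?a = prod_ob V A B" "cod ?a = FO T (tot s)" "arr ?b" "dom ?b = prod_ob V A B" "cod ?b = FO T (tot r)"
    using fs(1-4) fr(1-4) by (simp_all add: A_def B_def)
  have abc: "FA T (tot_src s)\<cdot>?a = FA T (tot_tgt r)\<cdot>?b"
    using fib_comp[OF d(1) xs, of "prod_fst V A B"] fib_comp[OF d(2) x(1,2), of "prod_snd V A B"] AB by (simp add: A_def B_def)
  define l where "l = pb_lift V (FA T (tot_src s)) (FA T (tot_tgt r)) ?a ?b"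
  have l: "arr l" "dom l = prod_ob V A B" "cod l = pb_ob V (FA T (tot_src s)) (FA T (tot_tgt r))"
    "pb_fst V (FA T (tot_src s)) (FA T (tot_tgt r))\<cdot>l = ?a" "pb_snd V (FA T (tot_src s)) (FA T (tot_tgt r))\<cdot>l = ?b"
    using pb_lift[OF pbT ab(1,4) _ _ _ abc] ab d unfolding l_def by simp_all
  define n where "n = FA T h\<cdot>(k\<cdot>l)"
  have n: "arr n" "dom n = prod_ob V A B" "cod n = FO T (tot (mat_comp s r))" using h k l by (simp_all add: n_def)
  have c1: "FA T (comp_fst s r)\<cdot>n = ?a"
    unfolding n_def using comp_cong[OF T_cong[OF ch(1)], of "k\<cdot>l"] comp_cong[OF kf(1), of l] p h k l f by simp
  have c2: "FA T (comp_snd s r)\<cdot>n = ?b"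
    unfolding n_def using comp_cong[OF T_cong[OF ch(2)], of "k\<cdot>l"] comp_cong[OF kf(2), of l] p h k l f by simp
  have me: "m = fib_lift (mat_comp s r) (\<xi>, \<omega>) n"
    unfolding m_def m_str_def n_def h_def k_def l_def A_def B_def by simp
  have s: "FA T (tot_src (mat_comp s r))\<cdot>n = \<xi>\<cdot>bang V (dom n)"
  proof -
    have "FA T (tot_src (mat_comp s r))\<cdot>n = FA T (tot_src r)\<cdot>(FA T (comp_snd s r)\<cdot>n)"
      unfolding comp_proj_comm(2)[OF c] using p d n by simp
    then show ?thesis unfolding c2 using fib_comp[OF d(2) x(1,2), of "prod_snd V A B"] AB n by (simp add: A_def B_def)
  qed
  have t: "FA T (tot_tgt (mat_comp s r))\<cdot>n = \<omega>\<cdot>bang V (dom n)"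
  proof -
    have "FA T (tot_tgt (mat_comp s r))\<cdot>n = FA T (tot_tgt s)\<cdot>(FA T (comp_fst s r)\<cdot>n)"
      unfolding comp_proj_comm(3)[OF c] using p d n by simp
    then show ?thesis unfolding c1 using fib_comp[OF d(1) xs, of "prod_fst V A B"] AB n by (simp add: A_def B_def)
  qed
  have xm: "\<xi> \<in> Tset (src (mat_comp s r))" "\<omega> \<in> Tset (tgt (mat_comp s r))" using x by simp_all
  note L = fib_lift[OF M xm n(1,3) s t]
  show "arr m" "dom m = prod_ob V A B" "cod m = ent (Tbar (mat_comp s r)) (\<xi>, \<omega>)"
    "FA T (comp_fst s r)\<cdot>(fib_in (mat_comp s r) (\<xi>, \<omega>)\<cdot>m) = ?a"
    "FA T (comp_snd s r)\<cdot>(fib_in (mat_comp s r) (\<xi>, \<omega>)\<cdot>m) = ?b"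
    unfolding me L(4) using L n c1 c2 by simp_all
qed

section \<open>Structure maps of the monad on matrices\<close>

lemma ebar_in [simp]: "\<lbrakk>small X; x \<in> X\<rbrakk> \<Longrightarrow> ebar X x \<in> Tset X"
  by (simp add: ebar_def Tset_iff)

lemma mbar_eq: "\<lbrakk>small X; \<xi> \<in> Tset (Tset X)\<rbrakk> \<Longrightarrow> mbar X \<xi> = Mult T (copow V X)\<cdot>(FA T (epsT X)\<cdot>\<xi>)"
  by (simp add: mbar_def)

lemma mbar_in [simp]: "\<lbrakk>small X; \<xi> \<in> Tset (Tset X)\<rbrakk> \<Longrightarrow> mbar X \<xi> \<in> Tset X"
  using Tset_typed[of \<xi> "Tset X"] by (simp add: mbar_def Tset_iff[of _ X])

lemma e_mat:
  assumes r: "vmatrix r" and x: "x \<in> src r" "y \<in> tgt r"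
  shows "arr (e_mat r (x, y))" "dom (e_mat r (x, y)) = ent r (x, y)" "cod (e_mat r (x, y)) = ent (Tbar r) (ebar (src r) x, ebar (tgt r) y)"
    "fib_in r (ebar (src r) x, ebar (tgt r) y)\<cdot>e_mat r (x, y) = Unit T (tot r)\<cdot>tot_in r (x, y)"
proof -
  let ?g = "Unit T (tot r)\<cdot>tot_in r (x, y)"
  have s: "FA T (tot_src r)\<cdot>?g = ebar (src r) x\<cdot>bang V (dom ?g)"
    using comp_cong[OF Unit_nat[of "tot_src r", symmetric], of "tot_in r (x, y)"] r x by (simp add: ebar_def)
  have t: "FA T (tot_tgt r)\<cdot>?g = ebar (tgt r) y\<cdot>bang V (dom ?g)"
    using comp_cong[OF Unit_nat[of "tot_tgt r", symmetric], of "tot_in r (x, y)"] r x by (simp add: ebar_def)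
  have g: "arr ?g" "cod ?g = FO T (tot r)" using r x by simp_all
  have e: "ebar (src r) x \<in> Tset (src r)" "ebar (tgt r) y \<in> Tset (tgt r)" using r x by simp_all
  show "arr (e_mat r (x, y))" "dom (e_mat r (x, y)) = ent r (x, y)" "cod (e_mat r (x, y)) = ent (Tbar r) (ebar (src r) x, ebar (tgt r) y)"
    "fib_in r (ebar (src r) x, ebar (tgt r) y)\<cdot>e_mat r (x, y) = ?g"
    unfolding e_mat_def case_prod_conv using fib_lift[OF r e g s t] r x by simp_all
qed

lemma m_mat:
  assumes r: "vmatrix r" and x: "\<xi> \<in> Tset (Tset (src r))" "\<zeta> \<in> Tset (Tset (tgt r))"
  shows "arr (m_mat r (\<xi>, \<zeta>))" "dom (m_mat r (\<xi>, \<zeta>)) = ent (Tbar (Tbar r)) (\<xi>, \<zeta>)"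
    "cod (m_mat r (\<xi>, \<zeta>)) = ent (Tbar r) (mbar (src r) \<xi>, mbar (tgt r) \<zeta>)"
    "fib_in r (mbar (src r) \<xi>, mbar (tgt r) \<zeta>)\<cdot>m_mat r (\<xi>, \<zeta>) = Mult T (tot r)\<cdot>(FA T (fibs r)\<cdot>fib_in (Tbar r) (\<xi>, \<zeta>))"
proof -
  note [simp] = Tset_typed[OF x(1)] Tset_typed[OF x(2)]
  have b: "vmatrix (Tbar r)" using r by simp
  have x': "\<xi> \<in> Tset (src (Tbar r))" "\<zeta> \<in> Tset (tgt (Tbar r))" using x by simp_all
  note f = fib[OF b x'] and J = fibs[OF r]
  let ?q = "FA T (fibs r)\<cdot>fib_in (Tbar r) (\<xi>, \<zeta>)"
  let ?g = "Mult T (tot r)\<cdot>?q"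
  have 1: "FA T (FA T (tot_src r))\<cdot>?q = FA T (epsT (src r))\<cdot>(\<xi>\<cdot>bang V (ent (Tbar (Tbar r)) (\<xi>, \<zeta>)))"
    using comp_cong[OF T_cong2[OF J(5)], of "fib_in (Tbar r) (\<xi>, \<zeta>)"] J(1-3) f r by simp
  have 2: "FA T (FA T (tot_tgt r))\<cdot>?q = FA T (epsT (tgt r))\<cdot>(\<zeta>\<cdot>bang V (ent (Tbar (Tbar r)) (\<xi>, \<zeta>)))"
    using comp_cong[OF T_cong2[OF J(6)], of "fib_in (Tbar r) (\<xi>, \<zeta>)"] J(1-3) f r by simp
  have q: "arr ?q" "dom ?q = ent (Tbar (Tbar r)) (\<xi>, \<zeta>)" "cod ?q = FO T (FO T (tot r))" using J(1-3) f by simp_all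
  have s: "FA T (tot_src r)\<cdot>?g = mbar (src r) \<xi>\<cdot>bang V (dom ?g)"
    using comp_cong[OF Mult_nat[of "tot_src r", symmetric] _ _ _ q(1)] 1 q r f(4) by (simp add: mbar_def)
  have t: "FA T (tot_tgt r)\<cdot>?g = mbar (tgt r) \<zeta>\<cdot>bang V (dom ?g)"
    using comp_cong[OF Mult_nat[of "tot_tgt r", symmetric] _ _ _ q(1)] 2 q r f(4) by (simp add: mbar_def)
  have g: "arr ?g" "cod ?g = FO T (tot r)" using r q by simp_all
  have e: "mbar (src r) \<xi> \<in> Tset (src r)" "mbar (tgt r) \<zeta> \<in> Tset (tgt r)" using r x by simp_all
  show "arr (m_mat r (\<xi>, \<zeta>))" "dom (m_mat r (\<xi>, \<zeta>)) = ent (Tbar (Tbar r)) (\<xi>, \<zeta>)"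
    "cod (m_mat r (\<xi>, \<zeta>)) = ent (Tbar r) (mbar (src r) \<xi>, mbar (tgt r) \<zeta>)"
    "fib_in r (mbar (src r) \<xi>, mbar (tgt r) \<zeta>)\<cdot>m_mat r (\<xi>, \<zeta>) = ?g"
    unfolding m_mat_def case_prod_conv fibs_def[symmetric] using fib_lift[OF r e g s t] r q by simp_all
qed

lemma zero_initial: "is_initial V (zero V)"
proof -
  have "is_coproduct V ({} :: 'u set) (\<lambda>_. one V) (coprod_ob V ({} :: 'u set) (\<lambda>_. one V)) (coprod_in V {} (\<lambda>_. one V))"
    by (rule coproduct_of_small_index) (auto intro: small_index_small small_empty)
  then have "is_initial V (coprod_ob V ({} :: 'u set) (\<lambda>_. one V))" using initial_coproduct by blast
  then show ?thesis unfolding zero_def by (rule someI)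
qed

lemma zero_Obj [simp]: "zero V \<in> Obj V"
  using zero_initial by (simp add: is_initial_def)

lemma cobang [simp]:
  assumes "A \<in> Obj V"
  shows "arr (cobang V A)" "dom (cobang V A) = zero V" "cod (cobang V A) = A"
proof -
  have "\<exists>!u. u \<in> hom V (zero V) A" using zero_initial assms unfolding is_initial_def by blast
  from theI'[OF this] show "arr (cobang V A)" "dom (cobang V A) = zero V" "cod (cobang V A) = A"
    by (auto simp: cobang_def hom_iff)
qed

lemma idmat_simps [simp]: "src (idmat X) = X" "tgt (idmat X) = X"
  "\<lbrakk>x \<in> X; y \<in> X\<rbrakk> \<Longrightarrow> ent (idmat X) (x, y) = (if x = y then one V else zero V)"
  by (simp_all add: idmat_def)

lemma vmatrix_idmat [simp]: "small X \<Longrightarrow> vmatrix (idmat X)"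
  by (simp add: vmatrix_def)

definition diag where
  "diag X = copair V X (\<lambda>_. one V) (tot (idmat X)) (\<lambda>x. tot_in (idmat X) (x, x))"

lemma diag:
  assumes X: "small X"
  shows "arr (diag X)" "dom (diag X) = copow V X" "cod (diag X) = tot (idmat X)"
    "x \<in> X \<Longrightarrow> diag X\<cdot>pt V X x = tot_in (idmat X) (x, x)"
    "tot_src (idmat X)\<cdot>diag X = Ident V (copow V X)" "tot_tgt (idmat X)\<cdot>diag X = Ident V (copow V X)"
proof -
  have m: "vmatrix (idmat X)" using X by simp
  note c = copair[OF small_index_small[OF X], of "\<lambda>_. one V" "tot (idmat X)" "\<lambda>x. tot_in (idmat X) (x, x)"]
  show 1: "arr (diag X)" "dom (diag X) = copow V X" "cod (diag X) = tot (idmat X)"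
    and 2: "\<And>x. x \<in> X \<Longrightarrow> diag X\<cdot>pt V X x = tot_in (idmat X) (x, x)"
    unfolding diag_def copow_def pt_def using c m by simp_all
  show "tot_src (idmat X)\<cdot>diag X = Ident V (copow V X)"
    by (rule copow_ext[OF X]) (use 1 2 X in simp_all)
  show "tot_tgt (idmat X)\<cdot>diag X = Ident V (copow V X)"
    by (rule copow_ext[OF X]) (use 1 2 X in simp_all)
qed

lemma e_str:
  assumes X: "small X" and x: "\<xi> \<in> Tset X"
  shows "arr (e_str X \<xi>)" "dom (e_str X \<xi>) = one V" "cod (e_str X \<xi>) = ent (Tbar (idmat X)) (\<xi>, \<xi>)"
    "fib_in (idmat X) (\<xi>, \<xi>)\<cdot>e_str X \<xi> = FA T (diag X)\<cdot>\<xi>"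
proof -
  note [simp] = Tset_typed[OF x]
  note d = diag[OF X]
  have m: "vmatrix (idmat X)" using X by simp
  let ?g = "FA T (diag X)\<cdot>\<xi>"
  have g: "arr ?g" "dom ?g = one V" "cod ?g = FO T (tot (idmat X))" using d by simp_all
  have s: "FA T (tot_src (idmat X))\<cdot>?g = \<xi>\<cdot>bang V (dom ?g)" "FA T (tot_tgt (idmat X))\<cdot>?g = \<xi>\<cdot>bang V (dom ?g)"
    using comp_cong[OF T_cong[OF d(5)], of \<xi>] comp_cong[OF T_cong[OF d(6)], of \<xi>] d(1-3) X by simp_all
  show "arr (e_str X \<xi>)" "dom (e_str X \<xi>) = one V" "cod (e_str X \<xi>) = ent (Tbar (idmat X)) (\<xi>, \<xi>)"
    "fib_in (idmat X) (\<xi>, \<xi>)\<cdot>e_str X \<xi> = ?g"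
    unfolding e_str_def diag_def[symmetric] using fib_lift[OF m _ _ g(1,3) s] x g by simp_all
qed

end

section \<open>Enriched categories as internal categories\<close>

text \<open>The typed data of an enriched category without its laws. This suffices to form
  \<open>emb_ob A\<close>, so that the enriched laws can be compared with the internal ones before
  either are known.\<close>

locale pre_tvcat = embedding_setting small V T
  for small :: "'u set \<Rightarrow> bool" and V :: "('o, 'u) cat" (structure) and T :: "('o, 'u) monad" +
  fixes A :: "('o, 'u) tvcat"
  assumes small_Car [simp]: "small (Car A)"
    and src_Mat [simp]: "src (Mat A) = Tset (Car A)"
    and tgt_Mat [simp]: "tgt (Mat A) = Car A"
    and ent_Mat: "\<lbrakk>\<xi> \<in> Tset (Car A); x \<in> Car A\<rbrakk> \<Longrightarrow> ent (Mat A) (\<xi>, x) \<in> Obj V"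
    and Ups_hom: "x \<in> Car A \<Longrightarrow> Ups A x \<in> hom V (one V) (ent (Mat A) (ebar (Car A) x, x))"
    and Mu_hom: "\<lbrakk>x2 \<in> Tset (Tset (Car A)); x1 \<in> Tset (Car A); x0 \<in> Car A\<rbrakk> \<Longrightarrow>
      Mu A (x2, x1, x0) \<in> hom V (prod_ob V (ent (Mat A) (x1, x0)) (ent (Tbar (Mat A)) (x2, x1)))
        (ent (Mat A) (mbar (Car A) x2, x0))"
begin

abbreviation "X \<equiv> Car A"
abbreviation "a \<equiv> Mat A"
abbreviation "E \<equiv> emb_ob A"
abbreviation "a1 x1 x0 \<equiv> ent a (x1, x0)"
abbreviation "a2 x2 x1 \<equiv> ent (Tbar a) (x2, x1)"
abbreviation "a3 x3 x2 \<equiv> ent (Tbar (Tbar a)) (x3, x2)"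
abbreviation "pr1 x2 x1 x0 \<equiv> prod_fst V (a1 x1 x0) (a2 x2 x1)"
abbreviation "pr2 x2 x1 x0 \<equiv> prod_snd V (a1 x1 x0) (a2 x2 x1)"

lemma vma [simp]: "vmatrix a"
  by (simp add: vmatrix_def ent_Mat)

lemma Ups_typed:
  assumes "x \<in> X"
  shows "arr (Ups A x)" "dom (Ups A x) = one V" "cod (Ups A x) = a1 (ebar X x) x"
  using Ups_hom[OF assms] by (auto simp: hom_iff)

lemma Mu_typed:
  assumes "x2 \<in> Tset (Tset X)" "x1 \<in> Tset X" "x0 \<in> X"
  shows "arr (Mu A (x2, x1, x0))" "dom (Mu A (x2, x1, x0)) = prod_ob V (a1 x1 x0) (a2 x2 x1)"
    "cod (Mu A (x2, x1, x0)) = a1 (mbar X x2) x0"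
  using Mu_hom[OF assms] by (auto simp: hom_iff)

lemma ob_typed:
  assumes "x2 \<in> Tset (Tset X)" "x1 \<in> Tset X" "x0 \<in> X"
  shows "a1 x1 x0 \<in> Obj V" "a2 x2 x1 \<in> Obj V"
  using assms by simp_all

lemma fibA:
  assumes "x2 \<in> Tset (Tset X)" "x1 \<in> Tset X"
  shows "arr (fib_in a (x2, x1))" "dom (fib_in a (x2, x1)) = a2 x2 x1" "cod (fib_in a (x2, x1)) = FO T (tot a)"
    "a2 x2 x1 \<in> Obj V"
  using fib(1-4)[OF vma, of x2 x1] assms by simp_all

lemma E_simps: "I0 E = copow V X" "I1 E = tot a" "D1 E = epsT X\<cdot>tot_src a" "D0 E = tot_tgt a"
  by (simp_all add: emb_ob_def emb_D1_def emb_D0_def)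

lemma E_graph [simp]: "graph E"
  unfolding graph_def E_simps by simp

lemma E_typed: "arr (D1 E)" "dom (D1 E) = tot a" "cod (D1 E) = FO T (copow V X)"
  "arr (chain_fst E)" "arr (chain_snd E)" "dom (chain_fst E) = chain_ob E" "dom (chain_snd E) = chain_ob E"
  "cod (chain_fst E) = tot a" "cod (chain_snd E) = FO T (tot a)" "chain_ob E \<in> Obj V"
   by (simp_all add: E_simps)

lemma D1_tot_in:
  assumes "x1 \<in> Tset X" "x0 \<in> X" "arr z" "cod z = a1 x1 x0"
  shows "D1 E\<cdot>(tot_in a (x1, x0)\<cdot>z) = x1\<cdot>bang V (dom z)"
  unfolding E_simps using assms by simp

text \<open>Generalized elements \<open>f\<close> and \<open>g\<close> of two entries form a chain
  because both ends that have to match are constant at the same point \<open>x1\<close>.\<close>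

lemma element:
  assumes x: "x2 \<in> Tset (Tset X)" "x1 \<in> Tset X" "x0 \<in> X"
    and f: "arr f" "arr g" "dom f = dom g" "cod f = a1 x1 x0" "cod g = a2 x2 x1"
  defines "l \<equiv> chain_lift E (tot_in a (x1, x0)\<cdot>f) (fib_in a (x2, x1)\<cdot>g)"
  shows "arr l" "dom l = dom g" "cod l = chain_ob E"
    "chain_fst E\<cdot>l = tot_in a (x1, x0)\<cdot>f" "chain_snd E\<cdot>l = fib_in a (x2, x1)\<cdot>g"
proof -
  note fi = fibA[OF x(1,2)]
  have c: "D1 E\<cdot>(tot_in a (x1, x0)\<cdot>f) = FA T (D0 E)\<cdot>(fib_in a (x2, x1)\<cdot>g)"
    unfolding D1_tot_in[OF x(2,3) f(1,4)] E_simps using fib_comp(2)[OF vma, of x2 x1 g] x f by simp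
  have t: "arr (tot_in a (x1, x0)\<cdot>f)" "arr (fib_in a (x2, x1)\<cdot>g)" "dom (tot_in a (x1, x0)\<cdot>f) = dom (fib_in a (x2, x1)\<cdot>g)"
    "cod (tot_in a (x1, x0)\<cdot>f) = I1 E" "cod (fib_in a (x2, x1)\<cdot>g) = FO T (I1 E)" "dom (fib_in a (x2, x1)\<cdot>g) = dom g"
    using f x fi(1-4) by (simp_all add: E_simps)
  show "arr l" "dom l = dom g" "cod l = chain_ob E"
    "chain_fst E\<cdot>l = tot_in a (x1, x0)\<cdot>f" "chain_snd E\<cdot>l = fib_in a (x2, x1)\<cdot>g"
    using chain_lift[OF E_graph t(1-5) c] t(6) unfolding l_def by simp_all
qed

definition chain_in where
  "chain_in x2 x1 x0 = chain_lift E (tot_in a (x1, x0)\<cdot>pr1 x2 x1 x0) (fib_in a (x2, x1)\<cdot>pr2 x2 x1 x0)"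

lemma chain_in:
  assumes x: "x2 \<in> Tset (Tset X)" "x1 \<in> Tset X" "x0 \<in> X"
  shows "arr (chain_in x2 x1 x0)" "dom (chain_in x2 x1 x0) = prod_ob V (a1 x1 x0) (a2 x2 x1)" "cod (chain_in x2 x1 x0) = chain_ob E"
    "chain_fst E\<cdot>chain_in x2 x1 x0 = tot_in a (x1, x0)\<cdot>pr1 x2 x1 x0"
    "chain_snd E\<cdot>chain_in x2 x1 x0 = fib_in a (x2, x1)\<cdot>pr2 x2 x1 x0"
  unfolding chain_in_def using element[OF x, of "pr1 x2 x1 x0" "pr2 x2 x1 x0"] ob_typed[OF x] by simp_all

lemma element_chain_in:
  assumes x: "x2 \<in> Tset (Tset X)" "x1 \<in> Tset X" "x0 \<in> X"
    and f: "arr f" "arr g" "dom f = dom g" "cod f = a1 x1 x0" "cod g = a2 x2 x1"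
  shows "chain_lift E (tot_in a (x1, x0)\<cdot>f) (fib_in a (x2, x1)\<cdot>g) = chain_in x2 x1 x0\<cdot>pairing V f g"
proof -
  note c = chain_in[OF x] and fi = fibA[OF x(1,2)]
  have p: "arr (pairing V f g)" "dom (pairing V f g) = dom g" "cod (pairing V f g) = prod_ob V (a1 x1 x0) (a2 x2 x1)"
    "pr1 x2 x1 x0\<cdot>pairing V f g = f" "pr2 x2 x1 x0\<cdot>pairing V f g = g"
    using f by simp_all
  show ?thesis
    by (rule chain_lift_eqI[OF E_graph])
      (use c p x fi(1-3) comp_cong[OF c(4) _ _ _ p(1)] comp_cong[OF c(5) _ _ _ p(1)] in simp_all)
qed

text \<open>The first component of a chain lies locally in an entry, so its domain is constant at a
  point \<open>x1\<close>. This point is the target of the second component, which therefore lies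
  locally in a fibre by \<open>cov_fib\<close>.\<close>

lemma cov_chain:
  assumes u: "arr u" "cod u = chain_ob E"
  shows "cov (dom u) (\<lambda>v. \<exists>x2\<in>Tset (Tset X). \<exists>x1\<in>Tset X. \<exists>x0\<in>X. \<exists>f g. arr f \<and> arr g \<and> dom f = dom v \<and> dom g = dom v \<and>
    cod f = a1 x1 x0 \<and> cod g = a2 x2 x1 \<and> u\<cdot>v = chain_lift E (tot_in a (x1, x0)\<cdot>f) (fib_in a (x2, x1)\<cdot>g))" (is "cov _ ?S")
proof -
  have fu: "arr (chain_fst E\<cdot>u)" "cod (chain_fst E\<cdot>u) = tot a" "dom (chain_fst E\<cdot>u) = dom u" using u E_typed by simp_all
  show ?thesis
  proof (rule cov_trans[OF cov_tot[OF vma fu(1,2), unfolded fu(3) src_Mat tgt_Mat]])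
    fix v assume v: "arr v" "cod v = dom u"
      "\<exists>x\<in>Tset X. \<exists>y\<in>X. \<exists>f. arr f \<and> dom f = dom v \<and> cod f = a1 x y \<and> (chain_fst E\<cdot>u)\<cdot>v = tot_in a (x, y)\<cdot>f"
    then obtain x1 x0 f where f: "x1 \<in> Tset X" "x0 \<in> X" "arr f" "dom f = dom v" "cod f = a1 x1 x0" "chain_fst E\<cdot>(u\<cdot>v) = tot_in a (x1, x0)\<cdot>f"
      using u E_typed by auto
    let ?b = "chain_snd E\<cdot>(u\<cdot>v)"
    have b: "arr ?b" "cod ?b = FO T (tot a)" "dom ?b = dom v" using u v(1,2) E_typed by simp_all
    have "FA T (D0 E)\<cdot>?b = D1 E\<cdot>(chain_fst E\<cdot>(u\<cdot>v))" using chain_comm(2)[OF E_graph, of "u\<cdot>v"] u v(1,2) by simp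
    then have bt: "FA T (tot_tgt a)\<cdot>?b = x1\<cdot>bang V (dom ?b)"
      unfolding f(6) D1_tot_in[OF f(1,2,3,5)] E_simps(4) b(3) f(4) .
    have x1: "x1 \<in> Tset (tgt a)" using f by simp
    show "cov (dom v) (\<lambda>k. ?S (v\<cdot>k))"
    proof (rule cov_mono[OF cov_fib[OF vma x1 b(1,2) bt, unfolded b(3) src_Mat]])
      fix k assume k: "arr k" "cod k = dom v" "\<exists>\<xi>\<in>Tset (Tset X). \<exists>c. arr c \<and> dom c = dom k \<and> cod c = a2 \<xi> x1 \<and> ?b\<cdot>k = fib_in a (\<xi>, x1)\<cdot>c"
      then obtain x2 g where g: "x2 \<in> Tset (Tset X)" "arr g" "dom g = dom k" "cod g = a2 x2 x1" "?b\<cdot>k = fib_in a (x2, x1)\<cdot>g"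
        by blast
      have fk: "arr (f\<cdot>k)" "dom (f\<cdot>k) = dom g" "cod (f\<cdot>k) = a1 x1 x0" using f k(1,2) g by simp_all
      have e1: "chain_fst E\<cdot>(u\<cdot>(v\<cdot>k)) = tot_in a (x1, x0)\<cdot>(f\<cdot>k)"
        using comp_cong[OF f(6) _ _ _ k(1)] f(1-5) k(1,2) u v(1,2) by simp
      have e2: "chain_snd E\<cdot>(u\<cdot>(v\<cdot>k)) = fib_in a (x2, x1)\<cdot>g" using g(5) k(1,2) u v(1,2) by simp
      have "chain_lift E (tot_in a (x1, x0)\<cdot>(f\<cdot>k)) (fib_in a (x2, x1)\<cdot>g) = u\<cdot>(v\<cdot>k)"
        by (rule chain_lift_eqI[OF E_graph]) (use e1 e2 u v(1,2) k(1,2) in simp_all)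
      then have "u\<cdot>(v\<cdot>k) = chain_lift E (tot_in a (x1, x0)\<cdot>(f\<cdot>k)) (fib_in a (x2, x1)\<cdot>g)" by simp
      moreover have "dom (v\<cdot>k) = dom k" using v k(1,2) by simp
      ultimately show "?S (v\<cdot>k)" using fk g(1-4) f(1,2) by (metis (no_types, lifting))
    qed
  qed
qed

text \<open>Covering is \<open>cov_chain\<close>. For disjointness, \<open>x1\<close> and
  \<open>x0\<close> are separated by the injections of \<open>tot a\<close>, whereas
  \<open>x2\<close> is recovered as the source in \<open>T\<close> of a copower, where points are
  disjoint by monicity of the counit.\<close>

lemma chain_coproduct: "is_coproduct V (chain_index A) (chain_family A) (chain_ob E) (\<lambda>(x2, x1, x0). chain_in x2 x1 x0)"
proof (rule coproduct_recognition)
  have c: "cov (chain_ob E) (\<lambda>v. \<exists>x2\<in>Tset (Tset X). \<exists>x1\<in>Tset X. \<exists>x0\<in>X. \<exists>f g. arr f \<and> arr g \<and> dom f = dom v \<and> dom g = dom v \<and>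
    cod f = a1 x1 x0 \<and> cod g = a2 x2 x1 \<and> Ident V (chain_ob E)\<cdot>v = chain_lift E (tot_in a (x1, x0)\<cdot>f) (fib_in a (x2, x1)\<cdot>g))"
    using cov_chain[of "Ident V (chain_ob E)"] by simp
  show "cov (chain_ob E) (\<lambda>k. \<exists>i\<in>chain_index A. \<exists>t. arr t \<and> dom t = dom k \<and> cod t = chain_family A i \<and>
    k = (case i of (x2, x1, x0) \<Rightarrow> chain_in x2 x1 x0)\<cdot>t)"
  proof (rule cov_mono[OF c])
    fix k assume k: "arr k" "cod k = chain_ob E" "\<exists>x2\<in>Tset (Tset X). \<exists>x1\<in>Tset X. \<exists>x0\<in>X. \<exists>f g. arr f \<and> arr g \<and> dom f = dom k \<and> dom g = dom k \<and>
      cod f = a1 x1 x0 \<and> cod g = a2 x2 x1 \<and> Ident V (chain_ob E)\<cdot>k = chain_lift E (tot_in a (x1, x0)\<cdot>f) (fib_in a (x2, x1)\<cdot>g)"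
    then obtain x2 x1 x0 f g where h: "x2 \<in> Tset (Tset X)" "x1 \<in> Tset X" "x0 \<in> X" "arr f" "arr g" "dom f = dom k" "dom g = dom k"
      "cod f = a1 x1 x0" "cod g = a2 x2 x1" "k = chain_lift E (tot_in a (x1, x0)\<cdot>f) (fib_in a (x2, x1)\<cdot>g)" by auto
    have "k = chain_in x2 x1 x0\<cdot>pairing V f g" using element_chain_in[OF h(1-5) _ h(8,9)] h(6,7,10) by simp
    moreover have "arr (pairing V f g)" "dom (pairing V f g) = dom k" "cod (pairing V f g) = chain_family A (x2, x1, x0)"
      using h(4-9) by (simp_all add: chain_family_def)
    moreover have "(x2, x1, x0) \<in> chain_index A" using h by (simp add: chain_index_def)
    ultimately show "\<exists>i\<in>chain_index A. \<exists>t. arr t \<and> dom t = dom k \<and> cod t = chain_family A i \<and>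
      k = (case i of (x2, x1, x0) \<Rightarrow> chain_in x2 x1 x0)\<cdot>t" by force
  qed
next
  fix i assume "i \<in> chain_index A"
  then obtain x2 x1 x0 where i: "i = (x2, x1, x0)" "x2 \<in> Tset (Tset X)" "x1 \<in> Tset X" "x0 \<in> X" by (auto simp: chain_index_def)
  note c = chain_in[OF i(2-4)] and fi = fibA[OF i(2,3)] and o = ob_typed[OF i(2-4)]
  show "arr ((case i of (x2, x1, x0) \<Rightarrow> chain_in x2 x1 x0))" "dom (case i of (x2, x1, x0) \<Rightarrow> chain_in x2 x1 x0) = chain_family A i"
    "cod (case i of (x2, x1, x0) \<Rightarrow> chain_in x2 x1 x0) = chain_ob E"
    using c by (simp_all add: i chain_family_def)
  have ch: "chain_fst E\<cdot>(chain_in x2 x1 x0\<cdot>f) = tot_in a (x1, x0)\<cdot>(pr1 x2 x1 x0\<cdot>f)"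
    "chain_snd E\<cdot>(chain_in x2 x1 x0\<cdot>f) = fib_in a (x2, x1)\<cdot>(pr2 x2 x1 x0\<cdot>f)"
    if "arr f" "cod f = prod_ob V (a1 x1 x0) (a2 x2 x1)" for f
    using comp_cong[OF c(4), of f] comp_cong[OF c(5), of f] that c fi(1-3) i by simp_all
  {
    fix f g assume h: "arr f" "arr g" "dom f = dom g" "cod f = chain_family A i" "cod g = chain_family A i"
      "(case i of (x2, x1, x0) \<Rightarrow> chain_in x2 x1 x0)\<cdot>f = (case i of (x2, x1, x0) \<Rightarrow> chain_in x2 x1 x0)\<cdot>g"
    then have h': "cod f = prod_ob V (a1 x1 x0) (a2 x2 x1)" "cod g = prod_ob V (a1 x1 x0) (a2 x2 x1)" "chain_in x2 x1 x0\<cdot>f = chain_in x2 x1 x0\<cdot>g"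
      by (simp_all add: i chain_family_def)
    have 1: "tot_in a (x1, x0)\<cdot>(pr1 x2 x1 x0\<cdot>f) = tot_in a (x1, x0)\<cdot>(pr1 x2 x1 x0\<cdot>g)"
      "fib_in a (x2, x1)\<cdot>(pr2 x2 x1 x0\<cdot>f) = fib_in a (x2, x1)\<cdot>(pr2 x2 x1 x0\<cdot>g)"
      using ch[OF h(1) h'(1)] ch[OF h(2) h'(2)] h'(3) by simp_all
    show "f = g"
      by (rule prod_ext[OF o]) (use tot_mono[OF vma _ _ _ _ _ _ _ 1(1)] fib_mono[OF vma _ _ _ _ _ _ _ 1(2)] h(1-3) h' i in simp_all)
  }
  fix j f g assume j: "j \<in> chain_index A" "i \<noteq> j" and h: "arr f" "arr g" "dom f = dom g" "cod f = chain_family A i" "cod g = chain_family A j"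
      "(case i of (x2, x1, x0) \<Rightarrow> chain_in x2 x1 x0)\<cdot>f = (case j of (x2, x1, x0) \<Rightarrow> chain_in x2 x1 x0)\<cdot>g"
  obtain y2 y1 y0 where jj: "j = (y2, y1, y0)" "y2 \<in> Tset (Tset X)" "y1 \<in> Tset X" "y0 \<in> X" using j by (auto simp: chain_index_def)
  note c' = chain_in[OF jj(2-4)] and fi' = fibA[OF jj(2,3)]
  have h': "cod f = prod_ob V (a1 x1 x0) (a2 x2 x1)" "cod g = prod_ob V (a1 y1 y0) (a2 y2 y1)" "chain_in x2 x1 x0\<cdot>f = chain_in y2 y1 y0\<cdot>g"
    using h by (simp_all add: i jj chain_family_def)
  have ch': "chain_fst E\<cdot>(chain_in y2 y1 y0\<cdot>g) = tot_in a (y1, y0)\<cdot>(pr1 y2 y1 y0\<cdot>g)"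
    "chain_snd E\<cdot>(chain_in y2 y1 y0\<cdot>g) = fib_in a (y2, y1)\<cdot>(pr2 y2 y1 y0\<cdot>g)"
    using comp_cong[OF c'(4), of g] comp_cong[OF c'(5), of g] h(2) h'(2) c' fi'(1-3) jj by simp_all
  have 1: "tot_in a (x1, x0)\<cdot>(pr1 x2 x1 x0\<cdot>f) = tot_in a (y1, y0)\<cdot>(pr1 y2 y1 y0\<cdot>g)"
    "fib_in a (x2, x1)\<cdot>(pr2 x2 x1 x0\<cdot>f) = fib_in a (y2, y1)\<cdot>(pr2 y2 y1 y0\<cdot>g)"
    using ch[OF h(1) h'(1)] ch' h'(3) by simp_all
  have D: "dom f \<in> Obj V" using h(1) by simp
  have or1: "x1 = y1 \<and> x0 = y0 \<or> is_initial V (dom f)"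
    using tot_disjoint[OF vma _ _ _ _ _ _ _ _ _ 1(1)] h(1-3) h' i jj by simp
  have "x2\<cdot>bang V (dom f) = FA T (tot_src a)\<cdot>(fib_in a (x2, x1)\<cdot>(pr2 x2 x1 x0\<cdot>f))"
    using fib_comp(1)[OF vma, of x2 x1 "pr2 x2 x1 x0\<cdot>f"] h(1) h'(1) i by simp
  also have "\<dots> = y2\<cdot>bang V (dom f)" unfolding 1(2)
    using fib_comp(1)[OF vma, of y2 y1 "pr2 y2 y1 y0\<cdot>g"] h(2,3) h'(2) jj by simp
  finally have "x2 = y2 \<or> is_initial V (dom f)" using epsT_disjoint[of "Tset X" x2 y2 "dom f"] i jj D by simp
  then show "is_initial V (dom f)" using or1 j(2) i(1) jj(1) by auto
qed

lemma emb_chain_iso: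
  shows "arr (emb_chain_iso A)" "dom (emb_chain_iso A) = coprod_ob V (chain_index A) (chain_family A)" "cod (emb_chain_iso A) = chain_ob E"
    "\<lbrakk>x2 \<in> Tset (Tset X); x1 \<in> Tset X; x0 \<in> X\<rbrakk> \<Longrightarrow> emb_chain_iso A\<cdot>coprod_in V (chain_index A) (chain_family A) (x2, x1, x0) = chain_in x2 x1 x0"
    "is_iso V (emb_chain_iso A)"
proof -
  have I: "small_index small (chain_index A)"
    unfolding chain_index_def by (rule small_index_Sigma) (auto intro: small_index_small small_index_Times_small)
  have F: "\<And>i. i \<in> chain_index A \<Longrightarrow> chain_family A i \<in> Obj V"
     by (auto simp: chain_index_def chain_family_def)
  have e: "emb_chain_iso A = copair V (chain_index A) (chain_family A) (chain_ob E) (\<lambda>(x2, x1, x0). chain_in x2 x1 x0)"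
    unfolding emb_chain_iso_def chain_in_def chain_lift_def chain_ob_def Let_def by (simp add: emb_ob_def)
  have g: "\<And>i. i \<in> chain_index A \<Longrightarrow> arr ((\<lambda>(x2, x1, x0). chain_in x2 x1 x0) i)"
    "\<And>i. i \<in> chain_index A \<Longrightarrow> dom ((\<lambda>(x2, x1, x0). chain_in x2 x1 x0) i) = chain_family A i"
    "\<And>i. i \<in> chain_index A \<Longrightarrow> cod ((\<lambda>(x2, x1, x0). chain_in x2 x1 x0) i) = chain_ob E"
    using coproduct_typed[OF chain_coproduct] by blast+
  note c = copair[of "chain_index A" "chain_family A" "chain_ob E" "\<lambda>(x2, x1, x0). chain_in x2 x1 x0", OF I F E_typed(10) g, folded e]
  note cc = coproduct_of_small_index[of "chain_index A" "chain_family A", OF I F]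
  show 1: "arr (emb_chain_iso A)" "dom (emb_chain_iso A) = coprod_ob V (chain_index A) (chain_family A)" "cod (emb_chain_iso A) = chain_ob E"
    and 2: "\<And>x2 x1 x0. \<lbrakk>x2 \<in> Tset (Tset X); x1 \<in> Tset X; x0 \<in> X\<rbrakk> \<Longrightarrow> emb_chain_iso A\<cdot>coprod_in V (chain_index A) (chain_family A) (x2, x1, x0) = chain_in x2 x1 x0"
    using c by (simp_all add: chain_index_def)
  obtain j where j: "is_iso V j" "arr j" "dom j = coprod_ob V (chain_index A) (chain_family A)" "cod j = chain_ob E"
    "\<And>i. i \<in> chain_index A \<Longrightarrow> j\<cdot>coprod_in V (chain_index A) (chain_family A) i = (\<lambda>(x2, x1, x0). chain_in x2 x1 x0) i"
    using coproduct_iso[OF cc chain_coproduct] by blast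
  have "emb_chain_iso A = j"
    by (rule coproduct_eq[OF cc 1(1) j(2)]) (use 1 2 j in \<open>auto simp: chain_index_def\<close>)
  then show "is_iso V (emb_chain_iso A)" using j by simp
qed

lemma chain_ext':
  assumes "arr u" "arr u'" "dom u = chain_ob E" "dom u' = chain_ob E" "cod u = cod u'"
    "\<And>x2 x1 x0. \<lbrakk>x2 \<in> Tset (Tset X); x1 \<in> Tset X; x0 \<in> X\<rbrakk> \<Longrightarrow> u\<cdot>chain_in x2 x1 x0 = u'\<cdot>chain_in x2 x1 x0"
  shows "u = u'"
  by (rule coproduct_eq[OF chain_coproduct assms(1-5)]) (use assms(6) in \<open>auto simp: chain_index_def\<close>)

lemma E_S0: "arr (S0 E)" "dom (S0 E) = copow V X" "cod (S0 E) = tot a"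
  "x \<in> X \<Longrightarrow> S0 E\<cdot>pt V X x = tot_in a (ebar X x, x)\<cdot>Ups A x"
proof -
  have e: "S0 E = copair V X (\<lambda>_. one V) (tot a) (\<lambda>x. tot_in a (ebar X x, x)\<cdot>Ups A x)" by (simp add: emb_ob_def)
  note c = copair[OF small_index_small[OF small_Car], of "\<lambda>_. one V" "tot a" "\<lambda>x. tot_in a (ebar X x, x)\<cdot>Ups A x", folded e]
  show "arr (S0 E)" "dom (S0 E) = copow V X" "cod (S0 E) = tot a"
    "x \<in> X \<Longrightarrow> S0 E\<cdot>pt V X x = tot_in a (ebar X x, x)\<cdot>Ups A x"
    unfolding copow_def pt_def using c Ups_typed by simp_all
qed

lemma E_Cm: "arr (Cm E)" "dom (Cm E) = chain_ob E" "cod (Cm E) = tot a"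
  "\<lbrakk>x2 \<in> Tset (Tset X); x1 \<in> Tset X; x0 \<in> X\<rbrakk> \<Longrightarrow> Cm E\<cdot>chain_in x2 x1 x0 = tot_in a (mbar X x2, x0)\<cdot>Mu A (x2, x1, x0)"
proof -
  define k where "k = copair V (chain_index A) (chain_family A) (tot a) (\<lambda>(x2, x1, x0). tot_in a (mbar X x2, x0)\<cdot>Mu A (x2, x1, x0))"
  have e: "Cm E = k\<cdot>inv_arrow V (emb_chain_iso A)" by (simp add: emb_ob_def k_def)
  have I: "small_index small (chain_index A)"
    unfolding chain_index_def by (rule small_index_Sigma) (auto intro: small_index_small small_index_Times_small)
  have F: "\<And>i. i \<in> chain_index A \<Longrightarrow> chain_family A i \<in> Obj V"
     by (auto simp: chain_index_def chain_family_def)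
  note i = emb_chain_iso and j = inv_arrow[OF emb_chain_iso(5)]
  have g: "\<And>i. i \<in> chain_index A \<Longrightarrow> arr ((\<lambda>(x2, x1, x0). tot_in a (mbar X x2, x0)\<cdot>Mu A (x2, x1, x0)) i)"
    "\<And>i. i \<in> chain_index A \<Longrightarrow> dom ((\<lambda>(x2, x1, x0). tot_in a (mbar X x2, x0)\<cdot>Mu A (x2, x1, x0)) i) = chain_family A i"
    "\<And>i. i \<in> chain_index A \<Longrightarrow> cod ((\<lambda>(x2, x1, x0). tot_in a (mbar X x2, x0)\<cdot>Mu A (x2, x1, x0)) i) = tot a"
    using Mu_typed by (auto simp: chain_index_def chain_family_def)
  note k = copair[of "chain_index A" "chain_family A" "tot a" "\<lambda>(x2, x1, x0). tot_in a (mbar X x2, x0)\<cdot>Mu A (x2, x1, x0)",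
    OF I F tot_typed(1)[OF vma] g, folded k_def]
  have ci: "arr (coprod_in V (chain_index A) (chain_family A) i)" "cod (coprod_in V (chain_index A) (chain_family A) i) = coprod_ob V (chain_index A) (chain_family A)"
    if "i \<in> chain_index A" for i
    using coproduct_typed[OF coproduct_of_small_index[of "chain_index A" "chain_family A", OF I F]] that by simp_all
  show t: "arr (Cm E)" "dom (Cm E) = chain_ob E" "cod (Cm E) = tot a" unfolding e using i j k by simp_all
  assume x: "x2 \<in> Tset (Tset X)" "x1 \<in> Tset X" "x0 \<in> X"
  then have xi: "(x2, x1, x0) \<in> chain_index A" by (simp add: chain_index_def)
  have "Cm E\<cdot>chain_in x2 x1 x0 = k\<cdot>coprod_in V (chain_index A) (chain_family A) (x2, x1, x0)"
    unfolding i(4)[OF x, symmetric] e using i(1-3) j k ci[OF xi] comp_cong[OF j(4), of "coprod_in V (chain_index A) (chain_family A) (x2, x1, x0)"] by simp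
  then show "Cm E\<cdot>chain_in x2 x1 x0 = tot_in a (mbar X x2, x0)\<cdot>Mu A (x2, x1, x0)" using k(4)[of "(x2, x1, x0)"] xi by simp
qed

text \<open>On generalized elements the internal composition is \<open>Mu\<close>; the comparison of
  laws and of functors rests on this rule.\<close>

lemma Cm_element:
  assumes x: "x2 \<in> Tset (Tset X)" "x1 \<in> Tset X" "x0 \<in> X"
    and f: "arr f" "arr g" "dom f = dom g" "cod f = a1 x1 x0" "cod g = a2 x2 x1"
  shows "Cm E\<cdot>chain_lift E (tot_in a (x1, x0)\<cdot>f) (fib_in a (x2, x1)\<cdot>g) = tot_in a (mbar X x2, x0)\<cdot>(Mu A (x2, x1, x0)\<cdot>pairing V f g)"
  unfolding element_chain_in[OF x f]
  using comp_cong[OF E_Cm(4)[OF x], of "pairing V f g"] E_Cm(1-3) chain_in[OF x] Mu_typed[OF x] f x by simp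

lemma E_precategory: "precategory E"
  unfolding precategory_def
proof (intro conjI E_graph E_S0(1) E_Cm(1,2))
  note s = E_S0 and c = E_Cm and cT = Tset_typed[OF ebar_in[OF small_Car]]
  show "D0 E\<cdot>S0 E = Ident V (I0 E)"
    unfolding E_simps by (rule copow_ext[of X]) (use s Ups_typed in simp_all)
  show "D1 E\<cdot>S0 E = Unit T (I0 E)"
  proof (rule copow_ext[of X])
    fix x assume x: "x \<in> X"
    then show "(D1 E\<cdot>S0 E)\<cdot>pt V X x = Unit T (I0 E)\<cdot>pt V X x"
      using s(1-3) s(4)[OF x] Ups_typed[OF x] D1_tot_in[of "ebar X x" x "Ups A x"] cT[OF x] E_typed(1-3)
      by (simp add: E_simps(1)) (simp add: ebar_def)
  qed (use s E_typed in \<open>simp_all add: E_simps(1)\<close>)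
  note fi = fibA(1-3)
  show "D0 E\<cdot>Cm E = D0 E\<cdot>chain_fst E"
    unfolding E_simps(4) by (rule chain_ext') (use c chain_in Mu_typed E_typed in simp_all)
  show "D1 E\<cdot>Cm E = Mult T (I0 E)\<cdot>(FA T (D1 E)\<cdot>chain_snd E)"
  proof (rule chain_ext')
    fix x2 x1 x0 assume x: "x2 \<in> Tset (Tset X)" "x1 \<in> Tset X" "x0 \<in> X"
    let ?s = "pr2 x2 x1 x0"
    note o = ob_typed[OF x] and ci = chain_in[OF x] and mu = Mu_typed[OF x] and tx = Tset_typed[OF x(1)]
    have "(D1 E\<cdot>Cm E)\<cdot>chain_in x2 x1 x0 = mbar X x2\<cdot>bang V (prod_ob V (a1 x1 x0) (a2 x2 x1))"
      using D1_tot_in[of "mbar X x2" x0 "Mu A (x2, x1, x0)"] c(4)[OF x] c(1-3) ci mu x E_typed by simp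
    moreover have "FA T (D1 E)\<cdot>(fib_in a (x2, x1)\<cdot>?s) = FA T (epsT X)\<cdot>(x2\<cdot>bang V (prod_ob V (a1 x1 x0) (a2 x2 x1)))"
      unfolding E_simps using fib_comp(1)[OF vma, of x2 x1 ?s] fi[OF x(1,2)] x by simp
    ultimately show "(D1 E\<cdot>Cm E)\<cdot>chain_in x2 x1 x0 = (Mult T (I0 E)\<cdot>(FA T (D1 E)\<cdot>chain_snd E))\<cdot>chain_in x2 x1 x0"
      using ci fi[OF x(1,2)] o E_typed x tx by (simp add: mbar_eq E_simps(1))
  qed (use c E_typed in \<open>simp_all add: E_simps(1)\<close>)
qed (simp_all add: E_S0 E_Cm E_simps)

end

section \<open>Monad laws on index sets\<close>

context embedding_setting
begin

lemma Tfun_id: "\<lbrakk>small X; \<xi> \<in> Tset X\<rbrakk> \<Longrightarrow> Tfun X (\<lambda>x. x) X \<xi> = \<xi>"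
  using Tset_typed[of \<xi> X] by (simp add: Tfun_app copow_map_id)

text \<open>Composing the counit with the copower map of \<open>ebar\<close> gives the unit of
  \<open>T\<close>, so these follow from the unit laws of \<open>T\<close>. They ensure that the
  composites in the enriched unit laws return to the entry they started from.\<close>

lemma mbar_ebar:
  assumes X: "small X" and x: "\<xi> \<in> Tset X"
  shows "mbar X (Tfun X (ebar X) (Tset X) \<xi>) = \<xi>" "mbar X (ebar (Tset X) \<xi>) = \<xi>"
proof -
  note [simp] = Tset_typed[OF x]
  have c: "arr (copow_map V X (ebar X) (Tset X))" "dom (copow_map V X (ebar X) (Tset X)) = copow V X" "cod (copow_map V X (ebar X) (Tset X)) = copow V (Tset X)"
    using X by simp_all
  have "epsT X\<cdot>copow_map V X (ebar X) (Tset X) = Unit T (copow V X)"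
  proof (rule copow_ext[OF X])
    fix x assume "x \<in> X"
    then show "(epsT X\<cdot>copow_map V X (ebar X) (Tset X))\<cdot>pt V X x = Unit T (copow V X)\<cdot>pt V X x"
      using X c epsT_pt(1)[OF X, of "ebar X x"] by (simp add: ebar_def[symmetric])
  qed (use X in simp_all)
  then have e: "FA T (epsT X)\<cdot>FA T (copow_map V X (ebar X) (Tset X)) = FA T (Unit T (copow V X))"
    by (rule T_cong) (use X in simp_all)
  have "mbar X (Tfun X (ebar X) (Tset X) \<xi>) = Mult T (copow V X)\<cdot>(FA T (Unit T (copow V X))\<cdot>\<xi>)"
    unfolding mbar_def using comp_cong[OF e, of \<xi>] X x by (simp add: Tfun_app)
  also have "\<dots> = \<xi>" using comp_cong[OF monad_laws(2)[of "copow V X"], of \<xi>] X by simp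
  finally show "mbar X (Tfun X (ebar X) (Tset X) \<xi>) = \<xi>" .
  have "mbar X (ebar (Tset X) \<xi>) = Mult T (copow V X)\<cdot>(Unit T (FO T (copow V X))\<cdot>(epsT X\<cdot>pt V (Tset X) \<xi>))"
    unfolding mbar_def ebar_def using comp_cong[OF Unit_nat[of "epsT X", symmetric], of "pt V (Tset X) \<xi>"] X x
    by simp
  also have "\<dots> = \<xi>" using comp_cong[OF monad_laws(1)[of "copow V X"], of \<xi>] X x by simp
  finally show "mbar X (ebar (Tset X) \<xi>) = \<xi>" .
qed

text \<open>Associativity of \<open>T\<close> together with the description of \<open>mbar\<close>
  through the counit; it makes the two sides of the enriched associativity law parallel.\<close>

lemma mbar_mbar:
  assumes X: "small X" and x: "\<xi> \<in> Tset (Tset (Tset X))"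
  shows "mbar X (Tfun (Tset (Tset X)) (mbar X) (Tset X) \<xi>) = mbar X (mbar (Tset X) \<xi>)"
proof -
  note [simp] = Tset_typed[OF x]
  let ?c = "copow_map V (Tset (Tset X)) (mbar X) (Tset X)"
  have c: "arr ?c" "dom ?c = copow V (Tset (Tset X))" "cod ?c = copow V (Tset X)"
    using X by simp_all
  have "epsT X\<cdot>?c = Mult T (copow V X)\<cdot>(FA T (epsT X)\<cdot>epsT (Tset X))"
  proof (rule copow_ext[of "Tset (Tset X)"])
    fix y assume y: "y \<in> Tset (Tset X)"
    then show "(epsT X\<cdot>?c)\<cdot>pt V (Tset (Tset X)) y = (Mult T (copow V X)\<cdot>(FA T (epsT X)\<cdot>epsT (Tset X)))\<cdot>pt V (Tset (Tset X)) y"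
      using X c epsT_pt(1)[OF X, of "mbar X y"] by (simp add: mbar_eq[symmetric])
  qed (use X in simp_all)
  from T_cong[OF this]
  have e: "FA T (epsT X)\<cdot>FA T ?c = FA T (Mult T (copow V X))\<cdot>(FA T (FA T (epsT X))\<cdot>FA T (epsT (Tset X)))"
    using X c by simp
  have "mbar X (Tfun (Tset (Tset X)) (mbar X) (Tset X) \<xi>) =
    Mult T (copow V X)\<cdot>(FA T (Mult T (copow V X))\<cdot>(FA T (FA T (epsT X))\<cdot>(FA T (epsT (Tset X))\<cdot>\<xi>)))"
    using comp_cong[OF e, of \<xi>] mbar_eq[OF X Tfun_in[of "Tset (Tset X)" "Tset X" "mbar X" \<xi>]] X x by (simp add: Tfun_app)
  also have "\<dots> = Mult T (copow V X)\<cdot>(Mult T (FO T (copow V X))\<cdot>(FA T (FA T (epsT X))\<cdot>(FA T (epsT (Tset X))\<cdot>\<xi>)))"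
    using comp_cong[OF monad_laws(3)[of "copow V X"], of "FA T (FA T (epsT X))\<cdot>(FA T (epsT (Tset X))\<cdot>\<xi>)"] X by simp
  also have "\<dots> = mbar X (mbar (Tset X) \<xi>)"
    unfolding mbar_def using comp_cong[OF Mult_nat[of "epsT X"], of "FA T (epsT (Tset X))\<cdot>\<xi>"] X by simp
  finally show ?thesis .
qed

end

section \<open>Comparison of the unit laws\<close>

context pre_tvcat
begin

lemma Ups_map: "matrix_map (idmat X) a (ebar X) (\<lambda>x. x) (Ups_family A)"
  unfolding matrix_map_def Ups_family_def using Ups_typed by (auto simp: ent_Mat)

text \<open>\<open>diag\<close> only meets the diagonal entries, so the arrows out of
  \<open>zero V\<close> that complete \<open>Ups\<close> to a family on the identity matrix do not
  contribute.\<close>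

lemma Ups_diag: "tot_map (idmat X) a (ebar X) (\<lambda>x. x) (Ups_family A)\<cdot>diag X = S0 E"
proof (rule copow_ext[of X])
  note t = tot_map[OF Ups_map] and d = diag[OF small_Car]
  fix x assume x: "x \<in> X"
  then show "(tot_map (idmat X) a (ebar X) (\<lambda>x. x) (Ups_family A)\<cdot>diag X)\<cdot>pt V X x = S0 E\<cdot>pt V X x"
    using t(1-3) t(4)[of x x] d E_S0(4)[OF x] by (simp add: Ups_family_def)
qed (use tot_map[OF Ups_map] diag[OF small_Car] E_S0 in simp_all)

lemma T_Ups:
  assumes x: "x1 \<in> Tset X"
  defines "u \<equiv> T_Ups A (x1, x1)\<cdot>e_str X x1"
  shows "arr u" "dom u = one V" "cod u = a2 (Tfun X (ebar X) (Tset X) x1) x1"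
    "fib_in a (Tfun X (ebar X) (Tset X) x1, x1)\<cdot>u = FA T (S0 E)\<cdot>x1"
proof -
  note [simp] = Tset_typed[OF x]
  have x': "x1 \<in> Tset (src (idmat X))" "x1 \<in> Tset (tgt (idmat X))" using x by simp_all
  note b = Tbar_map[OF Ups_map x', folded T_Ups_def]
  note b = b[unfolded idmat_simps src_Mat tgt_Mat Tfun_id[OF small_Car x]]
  note e = e_str[OF small_Car x] and t = tot_map(1-3)[OF Ups_map] and d = diag(1-3)[OF small_Car]
  have f: "arr (fib_in a (Tfun X (ebar X) (Tset X) x1, x1))" "dom (fib_in a (Tfun X (ebar X) (Tset X) x1, x1)) = a2 (Tfun X (ebar X) (Tset X) x1) x1"
    using fibA[of "Tfun X (ebar X) (Tset X) x1" x1] x by simp_all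
  have g: "arr (fib_in (idmat X) (x1, x1))" "dom (fib_in (idmat X) (x1, x1)) = ent (Tbar (idmat X)) (x1, x1)" "cod (fib_in (idmat X) (x1, x1)) = FO T (tot (idmat X))"
    using fib(1-3)[of "idmat X" x1 x1] x by simp_all
  show "arr u" "dom u = one V" "cod u = a2 (Tfun X (ebar X) (Tset X) x1) x1"
    unfolding u_def T_Ups_def using b[unfolded T_Ups_def] e by simp_all
  have "fib_in a (Tfun X (ebar X) (Tset X) x1, x1)\<cdot>u = (FA T (tot_map (idmat X) a (ebar X) (\<lambda>x. x) (Ups_family A))\<cdot>FA T (diag X))\<cdot>x1"
    unfolding u_def T_Ups_def using comp_cong[OF b(4)[unfolded T_Ups_def] _ _ _ e(1)] b[unfolded T_Ups_def] e f g t d by simp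
  also have "FA T (tot_map (idmat X) a (ebar X) (\<lambda>x. x) (Ups_family A))\<cdot>FA T (diag X) = FA T (S0 E)"
    by (rule T_cong[OF Ups_diag]) (use t d in simp_all)
  finally show "fib_in a (Tfun X (ebar X) (Tset X) x1, x1)\<cdot>u = FA T (S0 E)\<cdot>x1" .
qed

text \<open>Restricted to the entry at \<open>(x1, x0)\<close>, the internal law is the enriched one
  followed by the injection of that entry. Injections are monic, which gives one direction, and
  jointly epic, which gives the other.\<close>

lemma right_unit_iff:
  "Cm E\<cdot>chain_lift E (Ident V (I1 E)) (FA T (S0 E)\<cdot>D1 E) = Ident V (I1 E) \<longleftrightarrow>
  (\<forall>x1\<in>Tset X. \<forall>x0\<in>X. Mu A (Tfun X (ebar X) (Tset X) x1, x1, x0) \<cdot>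
      pairing V (Ident V (a1 x1 x0)) ((T_Ups A (x1, x1)\<cdot>e_str X x1)\<cdot>bang V (a1 x1 x0)) = Ident V (a1 x1 x0))"
proof -
  let ?l = "chain_lift E (Ident V (I1 E)) (FA T (S0 E)\<cdot>D1 E)"
  note p = E_precategory and s = E_S0(1-3) and c = E_Cm(1-3)
  note cond = chain_lift_conditions(2)[OF p]
  have l: "arr ?l" "dom ?l = tot a" "cod ?l = chain_ob E" using chain_lift[OF E_graph _ _ _ _ _ cond] s by (simp_all add: E_simps(1,2))
  have e: "(Cm E\<cdot>?l)\<cdot>tot_in a (x1, x0) = tot_in a (x1, x0)\<cdot>(Mu A (Tfun X (ebar X) (Tset X) x1, x1, x0) \<cdot>
      pairing V (Ident V (a1 x1 x0)) ((T_Ups A (x1, x1)\<cdot>e_str X x1)\<cdot>bang V (a1 x1 x0)))" if x: "x1 \<in> Tset X" "x0 \<in> X" for x1 x0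
  proof -
    note [simp] = Tset_typed[OF x(1)] and u = T_Ups[OF x(1)]
    let ?x2 = "Tfun X (ebar X) (Tset X) x1"
    have x2: "?x2 \<in> Tset (Tset X)" using x by simp
    note f = fibA[OF x2 x(1)]
    have ti: "arr (tot_in a (x1, x0))" "dom (tot_in a (x1, x0)) = a1 x1 x0" "cod (tot_in a (x1, x0)) = tot a" "a1 x1 x0 \<in> Obj V" using x by simp_all
    have "?l\<cdot>tot_in a (x1, x0) = chain_lift E (Ident V (I1 E)\<cdot>tot_in a (x1, x0)) ((FA T (S0 E)\<cdot>D1 E)\<cdot>tot_in a (x1, x0))"
      by (rule chain_lift_comp[OF E_graph]) (use cond s ti in \<open>simp_all add: E_simps(1,2)\<close>)
    also have "Ident V (I1 E)\<cdot>tot_in a (x1, x0) = tot_in a (x1, x0)\<cdot>Ident V (a1 x1 x0)" using ti by (simp add: E_simps)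
    also have "(FA T (S0 E)\<cdot>D1 E)\<cdot>tot_in a (x1, x0) = FA T (S0 E)\<cdot>(x1\<cdot>bang V (a1 x1 x0))"
      using D1_tot_in[OF x, of "Ident V (a1 x1 x0)"] s ti E_typed by simp
    also have "\<dots> = fib_in a (?x2, x1)\<cdot>((T_Ups A (x1, x1)\<cdot>e_str X x1)\<cdot>bang V (a1 x1 x0))"
      using comp_cong[OF u(4), of "bang V (a1 x1 x0)"] u(1-3) f s ti by simp
    finally have "(Cm E\<cdot>?l)\<cdot>tot_in a (x1, x0) = Cm E\<cdot>chain_lift E (tot_in a (x1, x0)\<cdot>Ident V (a1 x1 x0))
        (fib_in a (?x2, x1)\<cdot>((T_Ups A (x1, x1)\<cdot>e_str X x1)\<cdot>bang V (a1 x1 x0)))"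
      using c l ti by simp
    then show ?thesis
      by (subst (asm) Cm_element[OF x2 x]) (use u(1-3) ti mbar_ebar(1)[OF small_Car x(1)] in simp_all)
  qed
  have m: "Mu A (Tfun X (ebar X) (Tset X) x1, x1, x0)\<cdot>pairing V (Ident V (a1 x1 x0)) ((T_Ups A (x1, x1)\<cdot>e_str X x1)\<cdot>bang V (a1 x1 x0)) \<in> hom V (a1 x1 x0) (a1 x1 x0)"
    if x: "x1 \<in> Tset X" "x0 \<in> X" for x1 x0
    using Mu_typed[of "Tfun X (ebar X) (Tset X) x1" x1 x0] T_Ups(1-3)[OF x(1)] x mbar_ebar(1)[OF small_Car x(1)] by (simp add: hom_iff)
  show ?thesis
  proof (intro iffI ballI)
    fix x1 x0 assume h: "Cm E\<cdot>?l = Ident V (I1 E)" and x: "x1 \<in> Tset X" "x0 \<in> X"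
    show "Mu A (Tfun X (ebar X) (Tset X) x1, x1, x0)\<cdot>pairing V (Ident V (a1 x1 x0)) ((T_Ups A (x1, x1)\<cdot>e_str X x1)\<cdot>bang V (a1 x1 x0)) = Ident V (a1 x1 x0)"
      by (rule tot_mono[OF vma, of x1 x0]) (use x m[OF x] e[OF x, unfolded h] in \<open>simp_all add: hom_iff E_simps(2)\<close>)
  next
    assume h: "\<forall>x1\<in>Tset X. \<forall>x0\<in>X. Mu A (Tfun X (ebar X) (Tset X) x1, x1, x0) \<cdot>
      pairing V (Ident V (a1 x1 x0)) ((T_Ups A (x1, x1)\<cdot>e_str X x1)\<cdot>bang V (a1 x1 x0)) = Ident V (a1 x1 x0)"
    show "Cm E\<cdot>?l = Ident V (I1 E)"
      by (rule tot_ext[OF vma]) (use c l e h in \<open>simp_all add: E_simps(2)\<close>)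
  qed
qed

lemma left_unit_iff:
  "Cm E\<cdot>chain_lift E (S0 E\<cdot>D0 E) (Unit T (I1 E)) = Ident V (I1 E) \<longleftrightarrow>
  (\<forall>x1\<in>Tset X. \<forall>x0\<in>X. Mu A (ebar (Tset X) x1, ebar X x0, x0) \<cdot>
      pairing V (Ups A x0\<cdot>bang V (a1 x1 x0)) (e_mat a (x1, x0)) = Ident V (a1 x1 x0))"
proof -
  let ?l = "chain_lift E (S0 E\<cdot>D0 E) (Unit T (I1 E))"
  note p = E_precategory and s = E_S0(1-3) and c = E_Cm(1-3)
  note cond = chain_lift_conditions(1)[OF p]
  have l: "arr ?l" "dom ?l = tot a" "cod ?l = chain_ob E" using chain_lift[OF E_graph _ _ _ _ _ cond] s by (simp_all add: E_simps(1,2,4))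
  have em: "arr (e_mat a (x1, x0))" "dom (e_mat a (x1, x0)) = a1 x1 x0" "cod (e_mat a (x1, x0)) = a2 (ebar (Tset X) x1) (ebar X x0)"
    "fib_in a (ebar (Tset X) x1, ebar X x0)\<cdot>e_mat a (x1, x0) = Unit T (tot a)\<cdot>tot_in a (x1, x0)" if x: "x1 \<in> Tset X" "x0 \<in> X" for x1 x0
    using e_mat[OF vma, of x1 x0] x by simp_all
  have e: "(Cm E\<cdot>?l)\<cdot>tot_in a (x1, x0) = tot_in a (x1, x0)\<cdot>(Mu A (ebar (Tset X) x1, ebar X x0, x0) \<cdot>
      pairing V (Ups A x0\<cdot>bang V (a1 x1 x0)) (e_mat a (x1, x0)))" if x: "x1 \<in> Tset X" "x0 \<in> X" for x1 x0
  proof -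
    note [simp] = Tset_typed[OF x(1)] and u = Ups_typed[OF x(2)]
    have x2: "ebar (Tset X) x1 \<in> Tset (Tset X)" "ebar X x0 \<in> Tset X" using x by simp_all
    have ti: "arr (tot_in a (x1, x0))" "dom (tot_in a (x1, x0)) = a1 x1 x0" "cod (tot_in a (x1, x0)) = tot a" "a1 x1 x0 \<in> Obj V" using x by simp_all
    have "?l\<cdot>tot_in a (x1, x0) = chain_lift E ((S0 E\<cdot>D0 E)\<cdot>tot_in a (x1, x0)) (Unit T (I1 E)\<cdot>tot_in a (x1, x0))"
      by (rule chain_lift_comp[OF E_graph]) (use cond s ti in \<open>simp_all add: E_simps(1,2,4)\<close>)
    also have "(S0 E\<cdot>D0 E)\<cdot>tot_in a (x1, x0) = tot_in a (ebar X x0, x0)\<cdot>(Ups A x0\<cdot>bang V (a1 x1 x0))"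
      using comp_cong[OF E_S0(4)[OF x(2)], of "bang V (a1 x1 x0)"] s u x by (simp add: E_simps(4))
    also have "Unit T (I1 E)\<cdot>tot_in a (x1, x0) = fib_in a (ebar (Tset X) x1, ebar X x0)\<cdot>e_mat a (x1, x0)"
      using em(4)[OF x] by (simp add: E_simps(2))
    finally have "(Cm E\<cdot>?l)\<cdot>tot_in a (x1, x0) = Cm E\<cdot>chain_lift E (tot_in a (ebar X x0, x0)\<cdot>(Ups A x0\<cdot>bang V (a1 x1 x0)))
        (fib_in a (ebar (Tset X) x1, ebar X x0)\<cdot>e_mat a (x1, x0))"
      using c l ti by simp
    then show ?thesis
      by (subst (asm) Cm_element[OF x2 x(2)]) (use u em[OF x] ti mbar_ebar(2)[OF small_Car x(1)] in simp_all)
  qed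
  have m: "Mu A (ebar (Tset X) x1, ebar X x0, x0)\<cdot>pairing V (Ups A x0\<cdot>bang V (a1 x1 x0)) (e_mat a (x1, x0)) \<in> hom V (a1 x1 x0) (a1 x1 x0)"
    if x: "x1 \<in> Tset X" "x0 \<in> X" for x1 x0
    using Mu_typed[of "ebar (Tset X) x1" "ebar X x0" x0] Ups_typed[OF x(2)] em[OF x] x mbar_ebar(2)[OF small_Car x(1)] by (simp add: hom_iff)
  show ?thesis
  proof (intro iffI ballI)
    fix x1 x0 assume h: "Cm E\<cdot>?l = Ident V (I1 E)" and x: "x1 \<in> Tset X" "x0 \<in> X"
    show "Mu A (ebar (Tset X) x1, ebar X x0, x0)\<cdot>pairing V (Ups A x0\<cdot>bang V (a1 x1 x0)) (e_mat a (x1, x0)) = Ident V (a1 x1 x0)"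
      by (rule tot_mono[OF vma, of x1 x0]) (use x m[OF x] e[OF x, unfolded h] in \<open>simp_all add: hom_iff E_simps(2)\<close>)
  next
    assume h: "\<forall>x1\<in>Tset X. \<forall>x0\<in>X. Mu A (ebar (Tset X) x1, ebar X x0, x0) \<cdot>
      pairing V (Ups A x0\<cdot>bang V (a1 x1 x0)) (e_mat a (x1, x0)) = Ident V (a1 x1 x0)"
    show "Cm E\<cdot>?l = Ident V (I1 E)"
      by (rule tot_ext[OF vma]) (use c l e h in \<open>simp_all add: E_simps(2)\<close>)
  qed
qed

lemma unit_laws_iff: "tv_unit_laws A \<longleftrightarrow>
    Cm E\<cdot>chain_lift E (S0 E\<cdot>D0 E) (Unit T (I1 E)) = Ident V (I1 E) \<and>
    Cm E\<cdot>chain_lift E (Ident V (I1 E)) (FA T (S0 E)\<cdot>D1 E) = Ident V (I1 E)"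
  unfolding left_unit_iff right_unit_iff tv_unit_laws_def Let_def by blast

section \<open>Comparison of the associativity laws\<close>

abbreviation "mc \<equiv> mat_comp a (Tbar a)"

lemma composable_a: "composable a (Tbar a)"
  by (simp add: composable_def)

lemma Mu_map: "matrix_map mc a (mbar X) (\<lambda>x. x) (Mu_family A)"
proof -
  have "arr (Mu_family A (x2, x0)) \<and> dom (Mu_family A (x2, x0)) = ent mc (x2, x0) \<and> cod (Mu_family A (x2, x0)) = a1 (mbar X x2) x0"
    if x: "x2 \<in> Tset (Tset X)" "x0 \<in> X" for x2 x0
    unfolding Mu_family_def case_prod_conv
    using comp_copair(1-3)[OF composable_a, of x2 x0 "a1 (mbar X x2) x0" "\<lambda>x1. Mu A (x2, x1, x0)"] x Mu_typed by simp
  then show ?thesis unfolding matrix_map_def using vmatrix_comp[OF composable_a] by simp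
qed

text \<open>\<open>T_Mu\<close> is formed from the matrix product of \<open>a\<close> and
  \<open>Tbar a\<close>, but internal composition is defined on chains. This arrow translates
  between the two, also under \<open>T\<close>.\<close>

definition chain_of_comp where
  "chain_of_comp = chain_lift E (comp_fst a (Tbar a)) (fibs a\<cdot>comp_snd a (Tbar a))"

lemma chain_of_comp:
  "arr chain_of_comp" "dom chain_of_comp = tot mc" "cod chain_of_comp = chain_ob E"
  "chain_fst E\<cdot>chain_of_comp = comp_fst a (Tbar a)" "chain_snd E\<cdot>chain_of_comp = fibs a\<cdot>comp_snd a (Tbar a)"
  "Cm E\<cdot>chain_of_comp = tot_map mc a (mbar X) (\<lambda>x. x) (Mu_family A)"
proof -
  note p = comp_proj[OF composable_a] and k = comp_proj_comm(1)[OF composable_a] and J = fibs[OF vma]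
  have c: "D1 E\<cdot>comp_fst a (Tbar a) = FA T (D0 E)\<cdot>(fibs a\<cdot>comp_snd a (Tbar a))"
    unfolding E_simps using k p J(1-3) comp_cong[OF J(6), of "comp_snd a (Tbar a)"] by simp
  note l = chain_lift[OF E_graph _ _ _ _ _ c, folded chain_of_comp_def]
  show t: "arr chain_of_comp" "dom chain_of_comp = tot mc" "cod chain_of_comp = chain_ob E"
    "chain_fst E\<cdot>chain_of_comp = comp_fst a (Tbar a)" "chain_snd E\<cdot>chain_of_comp = fibs a\<cdot>comp_snd a (Tbar a)"
    using l p J by (simp_all add: E_simps(2))
  note tm = tot_map[OF Mu_map] and m = matrix_mapD(5-7)[OF Mu_map]
  show "Cm E\<cdot>chain_of_comp = tot_map mc a (mbar X) (\<lambda>x. x) (Mu_family A)"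
  proof (rule mat_comp_ext[OF composable_a])
    fix x2 x1 x0 assume "x2 \<in> src (Tbar a)" "x1 \<in> tgt (Tbar a)" "x0 \<in> tgt a"
    then have x: "x2 \<in> Tset (Tset X)" "x1 \<in> Tset X" "x0 \<in> X" by simp_all
    have xx: "x2 \<in> src (Tbar a)" "x1 \<in> tgt (Tbar a)" "x0 \<in> tgt a" using x by simp_all
    note ci = comp_in[OF composable_a xx] and o = ob_typed[OF x]
    note pc = p(4)[OF xx] p(8)[OF xx]
    have tin: "arr (tot_in (Tbar a) (x2, x1))" "dom (tot_in (Tbar a) (x2, x1)) = a2 x2 x1" "cod (tot_in (Tbar a) (x2, x1)) = tot (Tbar a)"
      "fibs a\<cdot>tot_in (Tbar a) (x2, x1) = fib_in a (x2, x1)" using x J(4)[of x2 x1] by simp_all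
    have "chain_of_comp\<cdot>comp_in a (Tbar a) x2 x1 x0 = chain_in x2 x1 x0"
      unfolding chain_in_def
      by (rule chain_lift_eqI[OF E_graph, symmetric])
        (use t ci comp_cong[OF t(4) _ _ _ ci(1)] comp_cong[OF t(5) _ _ _ ci(1)] pc p J(1-3) o tin comp_cong[OF tin(4), of "pr2 x2 x1 x0"] in simp_all)
    then have L: "(Cm E\<cdot>chain_of_comp)\<cdot>comp_in a (Tbar a) x2 x1 x0 = tot_in a (mbar X x2, x0)\<cdot>Mu A (x2, x1, x0)"
      using E_Cm t(1-3) ci E_Cm(4)[OF x] by simp
    note cc = summand_coproduct[OF composable_a xx(1,3)]
    note cct = coproduct_typed[OF cc]
    have mf: "Mu_family A (x2, x0)\<cdot>coprod_in V (tgt (Tbar a)) (\<lambda>y. prod_ob V (a1 y x0) (a2 x2 y)) x1 = Mu A (x2, x1, x0)"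
      unfolding Mu_family_def case_prod_conv
      using comp_copair(4)[OF composable_a xx(1,3), of "a1 (mbar X x2) x0" "\<lambda>x1. Mu A (x2, x1, x0)" x1] x Mu_typed by simp
    have "tot_map mc a (mbar X) (\<lambda>x. x) (Mu_family A)\<cdot>comp_in a (Tbar a) x2 x1 x0 = tot_in a (mbar X x2, x0)\<cdot>Mu A (x2, x1, x0)"
      unfolding comp_in_def mf[symmetric]
      using tm(1-3) comp_cong[OF tm(4)[of x2 x0], of "coprod_in V (tgt (Tbar a)) (\<lambda>y. prod_ob V (a1 y x0) (a2 x2 y)) x1"] x cct(2-4)[of x1] m[of x2 x0] vmatrix_comp[OF composable_a] by simp
    then show "(Cm E\<cdot>chain_of_comp)\<cdot>comp_in a (Tbar a) x2 x1 x0 = tot_map mc a (mbar X) (\<lambda>x. x) (Mu_family A)\<cdot>comp_in a (Tbar a) x2 x1 x0"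
      using L by simp
  qed (use E_Cm t tm in simp_all)
qed

text \<open>The generalized element \<open>k\<close> of the object of 3-chains consists of the elements \<open>f, g, h\<close> of the entries.\<close>

definition element3 where
  "element3 x3 x2 x1 x0 f g h k \<longleftrightarrow> x3 \<in> Tset (Tset (Tset X)) \<and> x2 \<in> Tset (Tset X) \<and> x1 \<in> Tset X \<and> x0 \<in> X \<and>
    arr f \<and> arr g \<and> arr h \<and> arr k \<and> dom f = dom k \<and> dom g = dom k \<and> dom h = dom k \<and>
    cod f = a1 x1 x0 \<and> cod g = a2 x2 x1 \<and> cod h = a3 x3 x2 \<and> cod k = dom (chain3_fst E) \<and>
    chain3_fst E\<cdot>k = chain_lift E (tot_in a (x1, x0)\<cdot>f) (fib_in a (x2, x1)\<cdot>g) \<and>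
    FA T (chain_snd E)\<cdot>(chain3_snd E\<cdot>k) = FA T (fibs a)\<cdot>(fib_in (Tbar a) (x3, x2)\<cdot>h)"

text \<open>Only the last equation is not part of the definition: it expresses that the two
  projections of 3-chains share their middle arrow.\<close>

lemma element3D:
  assumes "element3 x3 x2 x1 x0 f g h k"
  shows "x3 \<in> Tset (Tset (Tset X))" "x2 \<in> Tset (Tset X)" "x1 \<in> Tset X" "x0 \<in> X"
    "arr f" "arr g" "arr h" "arr k" "dom f = dom k" "dom g = dom k" "dom h = dom k"
    "cod f = a1 x1 x0" "cod g = a2 x2 x1" "cod h = a3 x3 x2" "cod k = dom (chain3_fst E)"
    "chain3_fst E\<cdot>k = chain_lift E (tot_in a (x1, x0)\<cdot>f) (fib_in a (x2, x1)\<cdot>g)"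
    "FA T (chain_snd E)\<cdot>(chain3_snd E\<cdot>k) = FA T (fibs a)\<cdot>(fib_in (Tbar a) (x3, x2)\<cdot>h)"
    "FA T (chain_fst E)\<cdot>(chain3_snd E\<cdot>k) = fib_in a (x2, x1)\<cdot>g"
proof -
  show d: "x3 \<in> Tset (Tset (Tset X))" "x2 \<in> Tset (Tset X)" "x1 \<in> Tset X" "x0 \<in> X"
    "arr f" "arr g" "arr h" "arr k" "dom f = dom k" "dom g = dom k" "dom h = dom k"
    "cod f = a1 x1 x0" "cod g = a2 x2 x1" "cod h = a3 x3 x2" "cod k = dom (chain3_fst E)"
    "chain3_fst E\<cdot>k = chain_lift E (tot_in a (x1, x0)\<cdot>f) (fib_in a (x2, x1)\<cdot>g)"
    "FA T (chain_snd E)\<cdot>(chain3_snd E\<cdot>k) = FA T (fibs a)\<cdot>(fib_in (Tbar a) (x3, x2)\<cdot>h)"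
    using assms unfolding element3_def by blast+
  have "FA T (chain_fst E)\<cdot>(chain3_snd E\<cdot>k) = chain_snd E\<cdot>(chain3_fst E\<cdot>k)"
    using comp_cong[OF chain3_comm[OF E_graph], of k] d(8,15) by simp
  then show "FA T (chain_fst E)\<cdot>(chain3_snd E\<cdot>k) = fib_in a (x2, x1)\<cdot>g"
    unfolding d(16) using element(5)[OF d(2-6) _ d(12,13)] d(9,10) by simp
qed

lemma fibTbar:
  assumes "x3 \<in> Tset (Tset (Tset X))" "x2 \<in> Tset (Tset X)"
  shows "arr (fib_in (Tbar a) (x3, x2))" "dom (fib_in (Tbar a) (x3, x2)) = a3 x3 x2" "cod (fib_in (Tbar a) (x3, x2)) = FO T (tot (Tbar a))" "a3 x3 x2 \<in> Obj V"
  using fib(1-4)[of "Tbar a" x3 x2] assms by simp_all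

text \<open>The side on which the last two arrows are composed under \<open>T\<close>, evaluated at
  an element: the composite of \<open>g\<close> and \<open>h\<close> is formed in the product matrix
  by \<open>m_str\<close> and then mapped by \<open>T_Mu\<close>.\<close>

lemma assoc_left:
  assumes e: "element3 x3 x2 x1 x0 f g h k"
  defines "y \<equiv> Tfun (Tset (Tset X)) (mbar X) (Tset X) x3"
  shows "(Cm E\<cdot>chain_lift E (chain_fst E\<cdot>chain3_fst E) (FA T (Cm E)\<cdot>chain3_snd E))\<cdot>k =
    tot_in a (mbar X (mbar (Tset X) x3), x0)\<cdot>(Mu A (y, x1, x0)\<cdot>pairing V f (T_Mu A (x3, x1)\<cdot>(m_str a (Tbar a) (x3, x2, x1)\<cdot>pairing V g h)))"
proof -
  note d = element3D[OF e] and c3 = chain3_typed[OF E_graph] and C = E_Cm(1-3) and cond = chain_lift_conditions(3)[OF E_precategory]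
  have x: "x3 \<in> Tset (src (Tbar a))" "x2 \<in> Tset (tgt (Tbar a))" "x1 \<in> Tset (tgt a)" "x3 \<in> Tset (src mc)" "x1 \<in> Tset (tgt mc)" using d(1-3) by simp_all
  have y: "y \<in> Tset (Tset X)" unfolding y_def using d(1) by simp
  note m = m_str[OF composable_a x(1-3)] and b = Tbar_map[OF Mu_map x(4,5)] and M = vmatrix_comp[OF composable_a]
  note b = b[folded T_Mu_def, unfolded mat_comp_simps Tbar_simps src_Mat tgt_Mat Tfun_id[OF small_Car d(3)], folded y_def]
  have T_Mu: "arr (T_Mu A (x3, x1))" "dom (T_Mu A (x3, x1)) = ent (Tbar mc) (x3, x1)" "cod (T_Mu A (x3, x1)) = a2 y x1"
    "fib_in a (y, x1)\<cdot>T_Mu A (x3, x1) = FA T (tot_map mc a (mbar X) (\<lambda>x. x) (Mu_family A))\<cdot>fib_in mc (x3, x1)"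
    unfolding T_Mu_def using b[unfolded T_Mu_def] by simp_all
  note f3 = fibTbar[OF d(1,2)] and fa = fibA[OF d(2,3)] and fy = fibA[OF y d(3)]
  note fm = fib(1-3)[OF M x(4,5)] and j = chain_of_comp and p = comp_proj[OF composable_a] and J = fibs(1-3)[OF vma] and tm = tot_map(1-3)[OF Mu_map]
  define q where "q = pairing V g h"
  have q: "arr q" "dom q = dom k" "cod q = prod_ob V (a2 x2 x1) (a3 x3 x2)"
    "prod_fst V (a2 x2 x1) (a3 x3 x2)\<cdot>q = g" "prod_snd V (a2 x2 x1) (a3 x3 x2)\<cdot>q = h"
    unfolding q_def using d by simp_all
  define n where "n = fib_in mc (x3, x1)\<cdot>(m_str a (Tbar a) (x3, x2, x1)\<cdot>q)"
  have n: "arr n" "dom n = dom k" "cod n = FO T (tot mc)" using fm m q by (simp_all add: n_def)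
  have nc: "FA T (comp_fst a (Tbar a))\<cdot>n = fib_in a (x2, x1)\<cdot>g" "FA T (comp_snd a (Tbar a))\<cdot>n = fib_in (Tbar a) (x3, x2)\<cdot>h"
    using comp_cong[OF m(4) _ _ _ q(1)] comp_cong[OF m(5) _ _ _ q(1)] m(1-3) fm p fa f3 q unfolding n_def by simp_all
  \<comment> \<open>The two components of the element agree with those of \<open>n\<close> in the
    pullback of chains, which \<open>T\<close> preserves; hence the pair of \<open>g\<close> and
    \<open>h\<close> under \<open>T\<close> is represented by an element of the product
    matrix.\<close>
  have t: "FA T chain_of_comp\<cdot>n = chain3_snd E\<cdot>k"
  proof (rule pullback_eq[OF T_pullback[OF chain_pullback[OF E_graph]]])
    show "FA T (chain_fst E)\<cdot>(FA T chain_of_comp\<cdot>n) = FA T (chain_fst E)\<cdot>(chain3_snd E\<cdot>k)"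
      unfolding d(18) nc(1)[symmetric] using comp_cong[OF T_cong[OF j(4)], of n] j(1-3) n by simp
    show "FA T (chain_snd E)\<cdot>(FA T chain_of_comp\<cdot>n) = FA T (chain_snd E)\<cdot>(chain3_snd E\<cdot>k)"
      unfolding d(17) nc(2)[symmetric] using comp_cong[OF T_cong[OF j(5)], of n] j(1-3) n J p by simp
  qed (use j n d(8,15) in simp_all)
  have "FA T (Cm E)\<cdot>(chain3_snd E\<cdot>k) = FA T (tot_map mc a (mbar X) (\<lambda>x. x) (Mu_family A))\<cdot>n"
    unfolding t[symmetric] using comp_cong[OF T_cong[OF j(6)], of n] C j(1-3) n by simp
  also have "\<dots> = fib_in a (y, x1)\<cdot>(T_Mu A (x3, x1)\<cdot>(m_str a (Tbar a) (x3, x2, x1)\<cdot>q))"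
    unfolding n_def using comp_cong[OF T_Mu(4), of "m_str a (Tbar a) (x3, x2, x1)\<cdot>q"] T_Mu(1-3) fy fm m q tm by simp
  finally have 2: "FA T (Cm E)\<cdot>(chain3_snd E\<cdot>k) = fib_in a (y, x1)\<cdot>(T_Mu A (x3, x1)\<cdot>(m_str a (Tbar a) (x3, x2, x1)\<cdot>q))" .
  have 1: "chain_fst E\<cdot>(chain3_fst E\<cdot>k) = tot_in a (x1, x0)\<cdot>f"
    unfolding d(16) using element(4)[OF d(2-6) _ d(12,13)] d(9,10) by simp
  have tt: "arr (chain_fst E\<cdot>chain3_fst E)" "arr (FA T (Cm E)\<cdot>chain3_snd E)" "dom (chain_fst E\<cdot>chain3_fst E) = dom (FA T (Cm E)\<cdot>chain3_snd E)"
    "cod (chain_fst E\<cdot>chain3_fst E) = I1 E" "cod (FA T (Cm E)\<cdot>chain3_snd E) = FO T (I1 E)"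
    using C by (simp_all add: E_simps(2))
  note L = chain_lift[OF E_graph tt cond]
  have "chain_lift E (chain_fst E\<cdot>chain3_fst E) (FA T (Cm E)\<cdot>chain3_snd E)\<cdot>k =
    chain_lift E ((chain_fst E\<cdot>chain3_fst E)\<cdot>k) ((FA T (Cm E)\<cdot>chain3_snd E)\<cdot>k)"
    by (rule chain_lift_comp[OF E_graph tt cond d(8)]) (use d(15) C in simp)
  also have "(chain_fst E\<cdot>chain3_fst E)\<cdot>k = tot_in a (x1, x0)\<cdot>f" using 1 d(8,15) by simp
  also have "(FA T (Cm E)\<cdot>chain3_snd E)\<cdot>k = fib_in a (y, x1)\<cdot>(T_Mu A (x3, x1)\<cdot>(m_str a (Tbar a) (x3, x2, x1)\<cdot>q))" using 2 d(8,15) C by simp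
  finally have "(Cm E\<cdot>chain_lift E (chain_fst E\<cdot>chain3_fst E) (FA T (Cm E)\<cdot>chain3_snd E))\<cdot>k =
    Cm E\<cdot>chain_lift E (tot_in a (x1, x0)\<cdot>f) (fib_in a (y, x1)\<cdot>(T_Mu A (x3, x1)\<cdot>(m_str a (Tbar a) (x3, x2, x1)\<cdot>q)))"
    using C L(1-3) d(8,15) c3 by simp
  also have "\<dots> = tot_in a (mbar X y, x0)\<cdot>(Mu A (y, x1, x0)\<cdot>pairing V f (T_Mu A (x3, x1)\<cdot>(m_str a (Tbar a) (x3, x2, x1)\<cdot>q)))"
    by (rule Cm_element[OF y d(3-5)]) (use T_Mu m q d in simp_all)
  finally show ?thesis unfolding q_def y_def mbar_mbar[OF small_Car d(1)] .
qed

lemma assoc_right: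
  assumes e: "element3 x3 x2 x1 x0 f g h k"
  shows "(Cm E\<cdot>chain_lift E (Cm E\<cdot>chain3_fst E) (Mult T (I1 E)\<cdot>(FA T (chain_snd E)\<cdot>chain3_snd E)))\<cdot>k =
    tot_in a (mbar X (mbar (Tset X) x3), x0)\<cdot>(Mu A (mbar (Tset X) x3, mbar X x2, x0)\<cdot>pairing V (Mu A (x2, x1, x0)\<cdot>pairing V f g) (m_mat a (x3, x2)\<cdot>h))"
proof -
  note d = element3D[OF e] and c3 = chain3_typed[OF E_graph] and C = E_Cm(1-3) and cond = chain_lift_conditions(4)[OF E_precategory]
  have y: "mbar (Tset X) x3 \<in> Tset (Tset X)" "mbar X x2 \<in> Tset X" using d(1,2) by simp_all
  have mm: "arr (m_mat a (x3, x2))" "dom (m_mat a (x3, x2)) = a3 x3 x2" "cod (m_mat a (x3, x2)) = a2 (mbar (Tset X) x3) (mbar X x2)"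
    "fib_in a (mbar (Tset X) x3, mbar X x2)\<cdot>m_mat a (x3, x2) = Mult T (tot a)\<cdot>(FA T (fibs a)\<cdot>fib_in (Tbar a) (x3, x2))"
    using m_mat[OF vma, of x3 x2] d(1,2) by simp_all
  note f3 = fibTbar[OF d(1,2)] and fy = fibA[OF y] and J = fibs(1-3)[OF vma] and mu = Mu_typed[OF d(2-4)]
  have 1: "Cm E\<cdot>(chain3_fst E\<cdot>k) = tot_in a (mbar X x2, x0)\<cdot>(Mu A (x2, x1, x0)\<cdot>pairing V f g)"
    unfolding d(16) by (rule Cm_element[OF d(2-6) _ d(12,13)]) (use d(9,10) in simp)
  have 2: "Mult T (I1 E)\<cdot>(FA T (chain_snd E)\<cdot>(chain3_snd E\<cdot>k)) = fib_in a (mbar (Tset X) x3, mbar X x2)\<cdot>(m_mat a (x3, x2)\<cdot>h)"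
    unfolding d(17) using comp_cong[OF mm(4), of h] mm(1-3) fy f3 J d(7,14) by (simp add: E_simps(2))
  have tt: "arr (Cm E\<cdot>chain3_fst E)" "arr (Mult T (I1 E)\<cdot>(FA T (chain_snd E)\<cdot>chain3_snd E))"
    "dom (Cm E\<cdot>chain3_fst E) = dom (Mult T (I1 E)\<cdot>(FA T (chain_snd E)\<cdot>chain3_snd E))"
    "cod (Cm E\<cdot>chain3_fst E) = I1 E" "cod (Mult T (I1 E)\<cdot>(FA T (chain_snd E)\<cdot>chain3_snd E)) = FO T (I1 E)"
    using C by (simp_all add: E_simps(2))
  note L = chain_lift[OF E_graph tt cond]
  have "chain_lift E (Cm E\<cdot>chain3_fst E) (Mult T (I1 E)\<cdot>(FA T (chain_snd E)\<cdot>chain3_snd E))\<cdot>k =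
    chain_lift E ((Cm E\<cdot>chain3_fst E)\<cdot>k) ((Mult T (I1 E)\<cdot>(FA T (chain_snd E)\<cdot>chain3_snd E))\<cdot>k)"
    by (rule chain_lift_comp[OF E_graph tt cond d(8)]) (use d(15) in \<open>simp add: E_simps(2)\<close>)
  also have "(Cm E\<cdot>chain3_fst E)\<cdot>k = tot_in a (mbar X x2, x0)\<cdot>(Mu A (x2, x1, x0)\<cdot>pairing V f g)" using 1 d(8,15) C by simp
  also have "(Mult T (I1 E)\<cdot>(FA T (chain_snd E)\<cdot>chain3_snd E))\<cdot>k = fib_in a (mbar (Tset X) x3, mbar X x2)\<cdot>(m_mat a (x3, x2)\<cdot>h)"
    using 2 d(8,15) by (simp add: E_simps(2))
  finally have "(Cm E\<cdot>chain_lift E (Cm E\<cdot>chain3_fst E) (Mult T (I1 E)\<cdot>(FA T (chain_snd E)\<cdot>chain3_snd E)))\<cdot>k =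
    Cm E\<cdot>chain_lift E (tot_in a (mbar X x2, x0)\<cdot>(Mu A (x2, x1, x0)\<cdot>pairing V f g)) (fib_in a (mbar (Tset X) x3, mbar X x2)\<cdot>(m_mat a (x3, x2)\<cdot>h))"
    using C L(1-3) d(8,15) c3 E_typed by (simp add: E_simps(2))
  also have "\<dots> = tot_in a (mbar X (mbar (Tset X) x3), x0)\<cdot>(Mu A (mbar (Tset X) x3, mbar X x2, x0)\<cdot>pairing V (Mu A (x2, x1, x0)\<cdot>pairing V f g) (m_mat a (x3, x2)\<cdot>h))"
    by (rule Cm_element[OF y d(4)]) (use mu mm d in simp_all)
  finally show ?thesis .
qed

text \<open>\<open>T\<close> of the pullback of chains yields the last two arrows, and the pullback
  of 3-chains adds the first. The matching condition holds since the source of \<open>g\<close> and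
  the target of \<open>h\<close> are the same point \<open>x2\<close>.\<close>

lemma element3_ex:
  assumes x: "x3 \<in> Tset (Tset (Tset X))" "x2 \<in> Tset (Tset X)" "x1 \<in> Tset X" "x0 \<in> X"
    and f: "arr f" "arr g" "arr h" "dom f = dom h" "dom g = dom h"
      "cod f = a1 x1 x0" "cod g = a2 x2 x1" "cod h = a3 x3 x2"
  obtains k where "element3 x3 x2 x1 x0 f g h k" "dom k = dom h"
proof -
  note [simp] = Tset_typed[OF x(2)]
  note f2 = fibA[OF x(2,3)] and f3 = fibTbar[OF x(1,2)] and J = fibs[OF vma]
  have gg: "arr (fib_in a (x2, x1)\<cdot>g)" "dom (fib_in a (x2, x1)\<cdot>g) = dom h" "cod (fib_in a (x2, x1)\<cdot>g) = FO T (tot a)"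
    using f f2 by simp_all
  have hh: "arr (fib_in (Tbar a) (x3, x2)\<cdot>h)" "dom (fib_in (Tbar a) (x3, x2)\<cdot>h) = dom h" "cod (fib_in (Tbar a) (x3, x2)\<cdot>h) = FO T (tot (Tbar a))"
    using f f3 by simp_all
  have "FA T (D1 E)\<cdot>(fib_in a (x2, x1)\<cdot>g) = FA T (epsT X)\<cdot>(x2\<cdot>bang V (dom h))"
    unfolding E_simps using fib_comp(1)[OF vma, of x2 x1 g] x f f2 by simp
  also have "\<dots> = FA T (epsT X)\<cdot>(FA T (tot_tgt (Tbar a))\<cdot>(fib_in (Tbar a) (x3, x2)\<cdot>h))"
    using fib_comp(2)[of "Tbar a" x3 x2 h] x f by simp
  also have "\<dots> = FA T (FA T (D0 E))\<cdot>(FA T (fibs a)\<cdot>(fib_in (Tbar a) (x3, x2)\<cdot>h))"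
    unfolding E_simps using comp_cong[OF T_cong2[OF J(6)], of "fib_in (Tbar a) (x3, x2)\<cdot>h"] hh J(1-3) by simp
  finally have c: "FA T (D1 E)\<cdot>(fib_in a (x2, x1)\<cdot>g) = FA T (FA T (D0 E))\<cdot>(FA T (fibs a)\<cdot>(fib_in (Tbar a) (x3, x2)\<cdot>h))" .
  obtain t where t: "arr t" "dom t = dom h" "cod t = FO T (chain_ob E)"
    "FA T (chain_fst E)\<cdot>t = fib_in a (x2, x1)\<cdot>g" "FA T (chain_snd E)\<cdot>t = FA T (fibs a)\<cdot>(fib_in (Tbar a) (x3, x2)\<cdot>h)"
    by (rule pullback_ex[OF T_pullback[OF chain_pullback[OF E_graph]] _ _ _ _ _ c]) (use gg hh J(1-3) E_typed in \<open>simp_all add: E_simps(4)\<close>)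
  note l = element[OF x(2-4) f(1,2) _ f(6,7)]
  obtain k where k: "arr k" "dom k = dom h" "cod k = dom (chain3_fst E)"
    "chain3_fst E\<cdot>k = chain_lift E (tot_in a (x1, x0)\<cdot>f) (fib_in a (x2, x1)\<cdot>g)" "chain3_snd E\<cdot>k = t"
    by (rule pullback_ex[OF chain3_pullback[OF E_graph], of "chain_lift E (tot_in a (x1, x0)\<cdot>f) (fib_in a (x2, x1)\<cdot>g)" t])
      (use l t f(4,5) in simp_all)
  show thesis by (rule that[of k]) (use k x f t(5) in \<open>simp_all add: element3_def\<close>)
qed

text \<open>To apply \<open>cov_fib\<close> to \<open>Tbar a\<close>, an arrow into
  \<open>T (tot (Tbar a))\<close> is needed, whereas 3-chains only come with one into
  \<open>T (T (tot a))\<close>. The arrow \<open>\<kappa>\<close> lifts the second projection of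
  chains to the coproduct of the fibres.\<close>

lemma chain_snd_factor:
  obtains \<kappa> where "arr \<kappa>" "dom \<kappa> = chain_ob E" "cod \<kappa> = tot (Tbar a)"
    "fibs a\<cdot>\<kappa> = chain_snd E" "tot_tgt (Tbar a)\<cdot>\<kappa> = tot_src a\<cdot>chain_fst E"
proof -
  note J = fibs[OF vma]
  let ?g = "\<lambda>(x2, x1, x0). tot_in (Tbar a) (x2, x1)\<cdot>pr2 x2 x1 x0"
  have g: "arr (?g i)" "dom (?g i) = chain_family A i" "cod (?g i) = tot (Tbar a)" if "i \<in> chain_index A" for i
    using that by (auto simp: chain_index_def chain_family_def)
  obtain \<kappa> where k: "arr \<kappa>" "dom \<kappa> = chain_ob E" "cod \<kappa> = tot (Tbar a)" and
    ki: "\<And>i. i \<in> chain_index A \<Longrightarrow> \<kappa>\<cdot>(case i of (x2, x1, x0) \<Rightarrow> chain_in x2 x1 x0) = ?g i"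
    by (rule coproduct_ex[OF chain_coproduct tot_typed(1) g]) simp_all
  have f: "fibs a\<cdot>\<kappa> = chain_snd E"
  proof (rule chain_ext')
    fix x2 x1 x0 assume x: "x2 \<in> Tset (Tset X)" "x1 \<in> Tset X" "x0 \<in> X"
    have "\<kappa>\<cdot>chain_in x2 x1 x0 = tot_in (Tbar a) (x2, x1)\<cdot>pr2 x2 x1 x0"
      using ki[of "(x2, x1, x0)"] x by (simp add: chain_index_def)
    then show "(fibs a\<cdot>\<kappa>)\<cdot>chain_in x2 x1 x0 = chain_snd E\<cdot>chain_in x2 x1 x0"
      using comp_cong[OF J(4)[of x2 x1], of "pr2 x2 x1 x0"] chain_in[OF x] k J(1-3) ob_typed[OF x] x by simp
  qed (use k J(1-3) E_typed in simp_all)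
  \<comment> \<open>The required equation is known only after the counit, which is monic.\<close>
  have "epsT X\<cdot>(tot_tgt (Tbar a)\<cdot>\<kappa>) = epsT X\<cdot>(tot_src a\<cdot>chain_fst E)"
    using comp_cong[OF J(6), of \<kappa>] chain_comm(1)[OF E_graph] k J(1-3) f E_typed unfolding E_simps by simp
  then have "tot_tgt (Tbar a)\<cdot>\<kappa> = tot_src a\<cdot>chain_fst E"
    by (rule epsT_mono[OF small_Car, rotated -1]) (use k E_typed in simp_all)
  then show thesis using that k f by blast
qed

text \<open>The first two arrows are localized by \<open>cov_chain\<close>, which yields
  \<open>f\<close>, \<open>g\<close> and the point \<open>x2\<close>. Along \<open>\<kappa>\<close>
  the remaining arrow has constant target \<open>x2\<close>, so it lies locally in a fibre of
  \<open>Tbar a\<close>.\<close>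

lemma cov_chain3:
  "cov (dom (chain3_fst E)) (\<lambda>k. \<exists>x3 x2 x1 x0 f g h. element3 x3 x2 x1 x0 f g h k)"
proof -
  note c3 = chain3_typed[OF E_graph] and J = fibs[OF vma]
  obtain \<kappa> where k: "arr \<kappa>" "dom \<kappa> = chain_ob E" "cod \<kappa> = tot (Tbar a)"
    "fibs a\<cdot>\<kappa> = chain_snd E" "tot_tgt (Tbar a)\<cdot>\<kappa> = tot_src a\<cdot>chain_fst E" by (rule chain_snd_factor)
  show ?thesis
  proof (rule cov_trans[OF cov_chain[OF c3(1,4)]])
    fix v assume v: "arr v" "cod v = dom (chain3_fst E)" "\<exists>x2\<in>Tset (Tset X). \<exists>x1\<in>Tset X. \<exists>x0\<in>X. \<exists>f g. arr f \<and> arr g \<and> dom f = dom v \<and> dom g = dom v \<and>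
      cod f = a1 x1 x0 \<and> cod g = a2 x2 x1 \<and> chain3_fst E\<cdot>v = chain_lift E (tot_in a (x1, x0)\<cdot>f) (fib_in a (x2, x1)\<cdot>g)"
    then obtain x2 x1 x0 f g where x: "x2 \<in> Tset (Tset X)" "x1 \<in> Tset X" "x0 \<in> X" and f: "arr f" "arr g" "dom f = dom v" "dom g = dom v"
      "cod f = a1 x1 x0" "cod g = a2 x2 x1" and e: "chain3_fst E\<cdot>v = chain_lift E (tot_in a (x1, x0)\<cdot>f) (fib_in a (x2, x1)\<cdot>g)" by blast
    note l = element[OF x f(1,2) _ f(5,6)] and f2 = fibA[OF x(1,2)]
    have cs: "chain_snd E\<cdot>(chain3_fst E\<cdot>v) = fib_in a (x2, x1)\<cdot>g" unfolding e using l(5) f by simp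
    have cf: "FA T (chain_fst E)\<cdot>(chain3_snd E\<cdot>v) = fib_in a (x2, x1)\<cdot>g"
      using comp_cong[OF chain3_comm[OF E_graph], of v] cs v(1,2) by simp
    let ?s = "FA T \<kappa>\<cdot>(chain3_snd E\<cdot>v)"
    have s: "arr ?s" "cod ?s = FO T (tot (Tbar a))" "dom ?s = dom v" using k v(1,2) by simp_all
    have "FA T (tot_tgt (Tbar a))\<cdot>?s = FA T (tot_src a)\<cdot>(FA T (chain_fst E)\<cdot>(chain3_snd E\<cdot>v))"
      using comp_cong[OF T_cong2[OF k(5)], of "chain3_snd E\<cdot>v"] k(1-3) v(1,2) E_typed by simp
    also have "\<dots> = x2\<cdot>bang V (dom ?s)" unfolding cf s(3) using fib_comp(1)[OF vma, of x2 x1 g] x f by simp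
    finally have st: "FA T (tot_tgt (Tbar a))\<cdot>?s = x2\<cdot>bang V (dom ?s)" .
    have x2: "x2 \<in> Tset (tgt (Tbar a))" "vmatrix (Tbar a)" using x by simp_all
    show "cov (dom v) (\<lambda>k. \<exists>x3 x2 x1 x0 f g h. element3 x3 x2 x1 x0 f g h (v\<cdot>k))"
    proof (rule cov_mono[OF cov_fib[OF x2(2,1) s(1,2) st, unfolded s(3)]])
      fix w assume w: "arr w" "cod w = dom v" "\<exists>\<xi>\<in>Tset (src (Tbar a)). \<exists>c. arr c \<and> dom c = dom w \<and> cod c = a3 \<xi> x2 \<and> ?s\<cdot>w = fib_in (Tbar a) (\<xi>, x2)\<cdot>c"
      then obtain x3 h where h: "x3 \<in> Tset (Tset (Tset X))" "arr h" "dom h = dom w" "cod h = a3 x3 x2" "?s\<cdot>w = fib_in (Tbar a) (x3, x2)\<cdot>h" by auto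
      have "chain3_fst E\<cdot>(v\<cdot>w) = chain_lift E (tot_in a (x1, x0)\<cdot>f) (fib_in a (x2, x1)\<cdot>g)\<cdot>w"
        using comp_cong[OF e, of w] w(1,2) v(1,2) by simp
      also have "\<dots> = chain_lift E (tot_in a (x1, x0)\<cdot>(f\<cdot>w)) (fib_in a (x2, x1)\<cdot>(g\<cdot>w))"
        by (rule chain_lift_eqI[OF E_graph, symmetric])
          (use l f w(1,2) x f2 comp_cong[OF l(4), of w] comp_cong[OF l(5), of w] in simp_all)
      finally have 1: "chain3_fst E\<cdot>(v\<cdot>w) = chain_lift E (tot_in a (x1, x0)\<cdot>(f\<cdot>w)) (fib_in a (x2, x1)\<cdot>(g\<cdot>w))" .
      have "FA T (chain_snd E) = FA T (fibs a)\<cdot>FA T \<kappa>" using T_comp[of \<kappa> "fibs a"] k J(1-3) by simp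
      then have "FA T (chain_snd E)\<cdot>(chain3_snd E\<cdot>(v\<cdot>w)) = FA T (fibs a)\<cdot>(?s\<cdot>w)"
        using k(1-3) J(1-3) v(1,2) w(1,2) c3 by simp
      then have 2: "FA T (chain_snd E)\<cdot>(chain3_snd E\<cdot>(v\<cdot>w)) = FA T (fibs a)\<cdot>(fib_in (Tbar a) (x3, x2)\<cdot>h)" unfolding h(5) .
      have "element3 x3 x2 x1 x0 (f\<cdot>w) (g\<cdot>w) h (v\<cdot>w)"
        unfolding element3_def using 1 2 x f h(1-4) v(1,2) w(1,2) by simp
      then show "\<exists>x3 x2 x1 x0 f g h. element3 x3 x2 x1 x0 f g h (v\<cdot>w)" by blast
    qed
  qed
qed

lemma assoc_str:
  assumes x: "x3 \<in> Tset (Tset (Tset X))" "x2 \<in> Tset (Tset X)" "x1 \<in> Tset X"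
  defines "y \<equiv> Tfun (Tset (Tset X)) (mbar X) (Tset X) x3"
  shows "arr (T_Mu A (x3, x1)\<cdot>m_str a (Tbar a) (x3, x2, x1))"
    "dom (T_Mu A (x3, x1)\<cdot>m_str a (Tbar a) (x3, x2, x1)) = prod_ob V (a2 x2 x1) (a3 x3 x2)"
    "cod (T_Mu A (x3, x1)\<cdot>m_str a (Tbar a) (x3, x2, x1)) = a2 y x1"
    "dom (T_Mu A (x3, x1)) = cod (m_str a (Tbar a) (x3, x2, x1))" "arr (T_Mu A (x3, x1))" "arr (m_str a (Tbar a) (x3, x2, x1))"
    "dom (m_str a (Tbar a) (x3, x2, x1)) = prod_ob V (a2 x2 x1) (a3 x3 x2)"
    "arr (m_mat a (x3, x2))" "dom (m_mat a (x3, x2)) = a3 x3 x2" "cod (m_mat a (x3, x2)) = a2 (mbar (Tset X) x3) (mbar X x2)"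
proof -
  have x': "x3 \<in> Tset (src (Tbar a))" "x2 \<in> Tset (tgt (Tbar a))" "x1 \<in> Tset (tgt a)" "x3 \<in> Tset (src mc)" "x1 \<in> Tset (tgt mc)" using x by simp_all
  note m = m_str[OF composable_a x'(1-3)] and b = Tbar_map[OF Mu_map x'(4,5)]
  note b = b[folded T_Mu_def, unfolded mat_comp_simps Tbar_simps src_Mat tgt_Mat Tfun_id[OF small_Car x(3)], folded y_def]
  show T: "arr (T_Mu A (x3, x1))" "arr (m_str a (Tbar a) (x3, x2, x1))"
    "dom (T_Mu A (x3, x1)) = cod (m_str a (Tbar a) (x3, x2, x1))" "dom (m_str a (Tbar a) (x3, x2, x1)) = prod_ob V (a2 x2 x1) (a3 x3 x2)"
    unfolding T_Mu_def using b[unfolded T_Mu_def] m by simp_all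
  show "arr (T_Mu A (x3, x1)\<cdot>m_str a (Tbar a) (x3, x2, x1))"
    "dom (T_Mu A (x3, x1)\<cdot>m_str a (Tbar a) (x3, x2, x1)) = prod_ob V (a2 x2 x1) (a3 x3 x2)"
    using T by simp_all
  show "cod (T_Mu A (x3, x1)\<cdot>m_str a (Tbar a) (x3, x2, x1)) = a2 y x1"
    unfolding T_Mu_def using b[unfolded T_Mu_def] m by simp
  show "arr (m_mat a (x3, x2))" "dom (m_mat a (x3, x2)) = a3 x3 x2" "cod (m_mat a (x3, x2)) = a2 (mbar (Tset X) x3) (mbar X x2)"
    using m_mat[OF vma, of x3 x2] x(1,2) by simp_all
qed

text \<open>The enriched law is the equation at the generic element, given by the projections of the
  triple product. Substitution carries it to every element, and the elements cover the object of
  3-chains.\<close>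

lemma assoc_iff: "tv_assoc_law A \<longleftrightarrow>
  Cm E\<cdot>chain_lift E (chain_fst E\<cdot>chain3_fst E) (FA T (Cm E)\<cdot>chain3_snd E) =
  Cm E\<cdot>chain_lift E (Cm E\<cdot>chain3_fst E) (Mult T (I1 E)\<cdot>(FA T (chain_snd E)\<cdot>chain3_snd E))" (is "_ \<longleftrightarrow> ?L = ?R")
proof -
  \<comment> \<open>\<open>l\<close> and \<open>r\<close> are the two sides of the enriched law with
    arbitrary arrows in place of the projections; \<open>nat\<close> states that they commute with
    substitution.\<close>
  define l where "l x3 x2 x1 x0 f q = Mu A (Tfun (Tset (Tset X)) (mbar X) (Tset X) x3, x1, x0)\<cdot>pairing V f (T_Mu A (x3, x1)\<cdot>(m_str a (Tbar a) (x3, x2, x1)\<cdot>q))" for x3 x2 x1 x0 f q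
  define r where "r x3 x2 x1 x0 f g h = Mu A (mbar (Tset X) x3, mbar X x2, x0)\<cdot>pairing V (Mu A (x2, x1, x0)\<cdot>pairing V f g) (m_mat a (x3, x2)\<cdot>h)" for x3 x2 x1 x0 f g h
  have ty: "arr (l x3 x2 x1 x0 f q)" "arr (r x3 x2 x1 x0 f g h)" "dom (l x3 x2 x1 x0 f q) = Z" "dom (r x3 x2 x1 x0 f g h) = Z"
    "cod (l x3 x2 x1 x0 f q) = a1 (mbar X (mbar (Tset X) x3)) x0" "cod (r x3 x2 x1 x0 f g h) = a1 (mbar X (mbar (Tset X) x3)) x0"
    and nat: "\<And>t. \<lbrakk>arr t; cod t = Z\<rbrakk> \<Longrightarrow> l x3 x2 x1 x0 f q\<cdot>t = l x3 x2 x1 x0 (f\<cdot>t) (q\<cdot>t)"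
    "\<And>t. \<lbrakk>arr t; cod t = Z\<rbrakk> \<Longrightarrow> r x3 x2 x1 x0 f g h\<cdot>t = r x3 x2 x1 x0 (f\<cdot>t) (g\<cdot>t) (h\<cdot>t)"
    if x: "x3 \<in> Tset (Tset (Tset X))" "x2 \<in> Tset (Tset X)" "x1 \<in> Tset X" "x0 \<in> X"
      and f: "arr f" "arr g" "arr h" "arr q" "dom f = Z" "dom g = Z" "dom h = Z" "dom q = Z"
      "cod f = a1 x1 x0" "cod g = a2 x2 x1" "cod h = a3 x3 x2" "cod q = prod_ob V (a2 x2 x1) (a3 x3 x2)" for x3 x2 x1 x0 f g h q Z
  proof -
    let ?y = "Tfun (Tset (Tset X)) (mbar X) (Tset X) x3"
    have y: "?y \<in> Tset (Tset X)" "mbar (Tset X) x3 \<in> Tset (Tset X)" "mbar X x2 \<in> Tset X" using x by simp_all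
    note s = assoc_str[OF x(1-3)] and m1 = Mu_typed[OF y(1) x(3,4)] and m2 = Mu_typed[OF y(2,3) x(4)] and m3 = Mu_typed[OF x(2-4)]
    have c: "cod (T_Mu A (x3, x1)) = a2 ?y x1" using s(3-6) by simp
    show "arr (l x3 x2 x1 x0 f q)" "arr (r x3 x2 x1 x0 f g h)" "dom (l x3 x2 x1 x0 f q) = Z" "dom (r x3 x2 x1 x0 f g h) = Z"
      "cod (l x3 x2 x1 x0 f q) = a1 (mbar X (mbar (Tset X) x3)) x0" "cod (r x3 x2 x1 x0 f g h) = a1 (mbar X (mbar (Tset X) x3)) x0"
      unfolding l_def r_def using s(4-10) c m1 m2 m3 f mbar_mbar[OF small_Car x(1)] by simp_all
    fix t assume t: "arr t" "cod t = Z"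
    show "l x3 x2 x1 x0 f q\<cdot>t = l x3 x2 x1 x0 (f\<cdot>t) (q\<cdot>t)"
      unfolding l_def using s(4-10) c m1 f t by (simp add: pairing_comp)
    show "r x3 x2 x1 x0 f g h\<cdot>t = r x3 x2 x1 x0 (f\<cdot>t) (g\<cdot>t) (h\<cdot>t)"
      unfolding r_def using s(4-10) m2 m3 f t by (simp add: pairing_comp)
  qed
  have el: "?L\<cdot>k = ?R\<cdot>k \<longleftrightarrow> l x3 x2 x1 x0 f (pairing V g h) = r x3 x2 x1 x0 f g h" if e: "element3 x3 x2 x1 x0 f g h k" for x3 x2 x1 x0 f g h k
  proof -
    note d = element3D[OF e]
    have p: "arr (pairing V g h)" "dom (pairing V g h) = dom k" "cod (pairing V g h) = prod_ob V (a2 x2 x1) (a3 x3 x2)" using d by simp_all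
    note t = ty[OF d(1-7) p(1) d(9-11) p(2) d(12-14) p(3)]
    have m: "mbar X (mbar (Tset X) x3) \<in> Tset X" using d by simp
    show ?thesis
      unfolding assoc_left[OF e] assoc_right[OF e] l_def[symmetric] r_def[symmetric]
      using tot_mono[OF vma, of "mbar X (mbar (Tset X) x3)" x0, OF _ _ t(1,2) _ t(5,6)] m t d(4) by auto
  qed
  have gen: "tv_assoc_law A \<longleftrightarrow> (\<forall>x3\<in>Tset (Tset (Tset X)). \<forall>x2\<in>Tset (Tset X). \<forall>x1\<in>Tset X. \<forall>x0\<in>X.
    l x3 x2 x1 x0 (prod_fst V (a1 x1 x0) (prod_ob V (a2 x2 x1) (a3 x3 x2))) (prod_snd V (a1 x1 x0) (prod_ob V (a2 x2 x1) (a3 x3 x2))) =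
    r x3 x2 x1 x0 (prod_fst V (a1 x1 x0) (prod_ob V (a2 x2 x1) (a3 x3 x2)))
      (prod_fst V (a2 x2 x1) (a3 x3 x2)\<cdot>prod_snd V (a1 x1 x0) (prod_ob V (a2 x2 x1) (a3 x3 x2)))
      (prod_snd V (a2 x2 x1) (a3 x3 x2)\<cdot>prod_snd V (a1 x1 x0) (prod_ob V (a2 x2 x1) (a3 x3 x2))))"
    unfolding tv_assoc_law_def Let_def l_def r_def by (rule refl)
  show ?thesis
  proof
    assume h: "tv_assoc_law A"
    have lr: "arr ?L \<and> arr ?R \<and> dom ?L = dom (chain3_fst E) \<and> dom ?R = dom (chain3_fst E) \<and> cod ?L = cod ?R"
      using chain_lift(1-3)[OF E_graph _ _ _ _ _ chain_lift_conditions(3)[OF E_precategory]] chain_lift(1-3)[OF E_graph _ _ _ _ _ chain_lift_conditions(4)[OF E_precategory]] E_Cm(1-3) by (simp add: E_simps(2))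
    show "?L = ?R"
    proof (rule cov_eq[OF cov_chain3])
      fix k assume "\<exists>x3 x2 x1 x0 f g h. element3 x3 x2 x1 x0 f g h k"
      then obtain x3 x2 x1 x0 f g h where e: "element3 x3 x2 x1 x0 f g h k" by blast
      note d = element3D[OF e] and o = ob_typed[OF element3D(2-4)[OF e]] fibTbar(4)[OF element3D(1,2)[OF e]]
      let ?P = "prod_ob V (a2 x2 x1) (a3 x3 x2)"
      let ?p = "prod_fst V (a1 x1 x0) ?P" and ?q = "prod_snd V (a1 x1 x0) ?P" and ?t = "pairing V f (pairing V g h)"
      have t: "arr ?t" "cod ?t = prod_ob V (a1 x1 x0) ?P" "?p\<cdot>?t = f" "?q\<cdot>?t = pairing V g h" using d by simp_all
      have t': "(prod_fst V (a2 x2 x1) (a3 x3 x2)\<cdot>?q)\<cdot>?t = g" "(prod_snd V (a2 x2 x1) (a3 x3 x2)\<cdot>?q)\<cdot>?t = h"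
        using d by simp_all
      have "l x3 x2 x1 x0 ?p ?q\<cdot>?t = r x3 x2 x1 x0 ?p (prod_fst V (a2 x2 x1) (a3 x3 x2)\<cdot>?q) (prod_snd V (a2 x2 x1) (a3 x3 x2)\<cdot>?q)\<cdot>?t"
        using h d(1-4) unfolding gen by simp
      then have "l x3 x2 x1 x0 f (pairing V g h) = r x3 x2 x1 x0 f g h"
        using nat[OF d(1-4), of ?p "prod_fst V (a2 x2 x1) (a3 x3 x2)\<cdot>?q" "prod_snd V (a2 x2 x1) (a3 x3 x2)\<cdot>?q" ?q "prod_ob V (a1 x1 x0) ?P" ?t] t t' o by simp
      then show "?L\<cdot>k = ?R\<cdot>k" unfolding el[OF e] .
    qed (use lr in simp_all)
  next
    assume h: "?L = ?R"
    show "tv_assoc_law A"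
      unfolding gen
    proof (intro ballI)
      fix x3 x2 x1 x0 assume x: "x3 \<in> Tset (Tset (Tset X))" "x2 \<in> Tset (Tset X)" "x1 \<in> Tset X" "x0 \<in> X"
      note o = ob_typed[OF x(2-4)] fibTbar(4)[OF x(1,2)]
      let ?P = "prod_ob V (a2 x2 x1) (a3 x3 x2)"
      let ?p = "prod_fst V (a1 x1 x0) ?P" and ?q = "prod_snd V (a1 x1 x0) ?P"
      let ?g = "prod_fst V (a2 x2 x1) (a3 x3 x2)\<cdot>?q" and ?h = "prod_snd V (a2 x2 x1) (a3 x3 x2)\<cdot>?q"
      obtain k where k: "element3 x3 x2 x1 x0 ?p ?g ?h k"
        by (rule element3_ex[OF x, of ?p ?g ?h]) (use o in simp_all)
      have "pairing V ?g ?h = ?q"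
        by (rule prod_ext[of "a2 x2 x1" "a3 x3 x2"]) (use o in simp_all)
      then show "l x3 x2 x1 x0 ?p ?q = r x3 x2 x1 x0 ?p ?g ?h" using el[OF k] h by simp
    qed
  qed
qed

theorem icat_emb_iff: "is_icat E \<longleftrightarrow> tv_unit_laws A \<and> tv_assoc_law A"
  unfolding is_icat_iff unit_laws_iff assoc_iff using E_precategory by blast

end

context embedding_setting
begin

text \<open>Trades the enriched laws for the statement that the image is an internal category. Apart
  from typing and extensionality, nothing else is used of an enriched category from here on.\<close>

lemma tvcat_iff: "is_tvcat small A \<longleftrightarrow> pre_tvcat small V T A \<and> ent (Mat A) \<in> extensional (Tset (Car A) \<times> Car A) \<and>
    Ups A \<in> extensional (Car A) \<and> Mu A \<in> extensional (Tset (Tset (Car A)) \<times> Tset (Car A) \<times> Car A) \<and> is_icat (emb_ob A)"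
proof -
  have p: "pre_tvcat small V T A \<longleftrightarrow> small (Car A) \<and> src (Mat A) = Tset (Car A) \<and> tgt (Mat A) = Car A \<and>
    (\<forall>\<xi>\<in>Tset (Car A). \<forall>x\<in>Car A. ent (Mat A) (\<xi>, x) \<in> Obj V) \<and> (\<forall>x\<in>Car A. Ups A x \<in> hom V (one V) (ent (Mat A) (ebar (Car A) x, x))) \<and>
    (\<forall>x2\<in>Tset (Tset (Car A)). \<forall>x1\<in>Tset (Car A). \<forall>x0\<in>Car A.
      Mu A (x2, x1, x0) \<in> hom V (prod_ob V (ent (Mat A) (x1, x0)) (ent (Tbar (Mat A)) (x2, x1))) (ent (Mat A) (mbar (Car A) x2, x0)))"
    using embedding_setting_axioms by (auto simp: pre_tvcat_def pre_tvcat_axioms_def)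
  have "is_icat (emb_ob A) \<longleftrightarrow> tv_unit_laws A \<and> tv_assoc_law A" if "pre_tvcat small V T A"
    using pre_tvcat.icat_emb_iff[OF that] .
  moreover have "ent (Mat A) \<in> Tset (Car A) \<times> Car A \<rightarrow>\<^sub>E Obj V \<longleftrightarrow>
    ent (Mat A) \<in> extensional (Tset (Car A) \<times> Car A) \<and> (\<forall>\<xi>\<in>Tset (Car A). \<forall>x\<in>Car A. ent (Mat A) (\<xi>, x) \<in> Obj V)"
    by (auto simp: PiE_iff)
  ultimately show ?thesis unfolding is_tvcat_def p by blast
qed

end

section \<open>Enriched functors as internal functors\<close>

text \<open>The typed data of an enriched functor, without compatibility with \<open>Ups\<close> and
  \<open>Mu\<close>, so that this can be compared with preservation of the internal
  structure.\<close>

locale tv_map = embedding_setting small V T + A: pre_tvcat small V T A + B: pre_tvcat small V T B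
  for small :: "'u set \<Rightarrow> bool" and V :: "('o, 'u) cat" (structure) and T :: "('o, 'u) monad" and A B :: "('o, 'u) tvcat" +
  fixes f :: "'u \<Rightarrow> 'u" and \<phi> :: "'u \<times> 'u \<Rightarrow> 'u"
  assumes f_in [simp]: "x \<in> Car A \<Longrightarrow> f x \<in> Car B"
    and phi_hom: "\<lbrakk>x1 \<in> Tset (Car A); x0 \<in> Car A\<rbrakk> \<Longrightarrow>
      \<phi> (x1, x0) \<in> hom V (ent (Mat A) (x1, x0)) (ent (Mat B) (Tfun (Car A) f (Car B) x1, f x0))"
begin

abbreviation "F0 \<equiv> copow_map V (Car A) f (Car B)"
abbreviation "Tf \<equiv> Tfun (Car A) f (Car B)"
abbreviation "TTf \<equiv> Tfun (Tset (Car A)) Tf (Tset (Car B))"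
abbreviation "F1 \<equiv> tot_map (Mat A) (Mat B) Tf f \<phi>"

lemma phi_typed:
  assumes "x1 \<in> Tset A.X" "x0 \<in> A.X"
  shows "arr (\<phi> (x1, x0))" "dom (\<phi> (x1, x0)) = A.a1 x1 x0" "cod (\<phi> (x1, x0)) = B.a1 (Tf x1) (f x0)"
  using phi_hom[OF assms] by (auto simp: hom_iff)

lemma phi_map: "matrix_map A.a B.a Tf f \<phi>"
  by (simp add: matrix_map_def phi_typed)

lemma F1_typed [simp]: "arr F1" "dom F1 = tot A.a" "cod F1 = tot B.a"
  using tot_map(1-3)[OF phi_map] .

lemma F1_in:
  assumes "x1 \<in> Tset A.X" "x0 \<in> A.X"
  shows "F1\<cdot>tot_in A.a (x1, x0) = tot_in B.a (Tf x1, f x0)\<cdot>\<phi> (x1, x0)"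
  using tot_map(4)[OF phi_map] assms by simp

lemma F1_D0: "D0 B.E\<cdot>F1 = F0\<cdot>D0 A.E"
  using tot_map(6)[OF phi_map] by (simp add: A.E_simps B.E_simps)

lemma epsT_nat: "epsT B.X\<cdot>copow_map V (Tset A.X) Tf (Tset B.X) = FA T F0\<cdot>epsT A.X"
  using pullback_typed[OF epsT_pullback[of A.X B.X f]] by simp

lemma F1_D1: "D1 B.E\<cdot>F1 = FA T F0\<cdot>D1 A.E"
proof -
  have "epsT B.X\<cdot>(tot_src B.a\<cdot>F1) = epsT B.X\<cdot>(copow_map V (Tset A.X) Tf (Tset B.X)\<cdot>tot_src A.a)"
    using tot_map(5)[OF phi_map] by simp
  then show ?thesis
    using comp_cong[OF epsT_nat, of "tot_src A.a"] by (simp add: A.E_simps B.E_simps)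
qed

lemma Tf_ebar: "x \<in> A.X \<Longrightarrow> Tf (ebar A.X x) = ebar B.X (f x)"
  using comp_cong[OF Unit_nat[of F0], of "pt V A.X x"] by (simp add: Tfun_app, simp add: ebar_def)

text \<open>Follows from naturality of the counit and of \<open>Mult\<close>; it aligns the indices
  on the two sides of compatibility with \<open>Mu\<close>.\<close>

lemma Tf_mbar:
  assumes x: "x2 \<in> Tset (Tset A.X)"
  shows "Tf (mbar A.X x2) = mbar B.X (TTf x2)"
proof -
  note [simp] = Tset_typed[OF x]
  have c: "arr (copow_map V (Tset A.X) Tf (Tset B.X))" "dom (copow_map V (Tset A.X) Tf (Tset B.X)) = copow V (Tset A.X)"
    "cod (copow_map V (Tset A.X) Tf (Tset B.X)) = copow V (Tset B.X)" by simp_all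
  have y: "TTf x2 \<in> Tset (Tset B.X)" "mbar A.X x2 \<in> Tset A.X" using x by simp_all
  have "FA T (epsT B.X)\<cdot>FA T (copow_map V (Tset A.X) Tf (Tset B.X)) = FA T (FA T F0)\<cdot>FA T (epsT A.X)"
    by (rule T_cong2[OF epsT_nat]) (simp_all)
  from comp_cong[OF this, of x2]
  have 1: "FA T (epsT B.X)\<cdot>TTf x2 = FA T (FA T F0)\<cdot>(FA T (epsT A.X)\<cdot>x2)"
    unfolding Tfun_app[OF x] using c by simp
  show ?thesis
    unfolding mbar_eq[OF B.small_Car y(1)] 1 Tfun_app[OF y(2)]
    unfolding mbar_eq[OF A.small_Car x]
    using comp_cong[OF Mult_nat[of F0], of "FA T (epsT A.X)\<cdot>x2"] by simp
qed

lemma S0_iff: "F1\<cdot>S0 A.E = S0 B.E\<cdot>F0 \<longleftrightarrow> (\<forall>x\<in>A.X. \<phi> (ebar A.X x, x)\<cdot>Ups A x = Ups B (f x))"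
proof -
  have e: "(F1\<cdot>S0 A.E)\<cdot>pt V A.X x = tot_in B.a (ebar B.X (f x), f x)\<cdot>(\<phi> (ebar A.X x, x)\<cdot>Ups A x)"
    "(S0 B.E\<cdot>F0)\<cdot>pt V A.X x = tot_in B.a (ebar B.X (f x), f x)\<cdot>Ups B (f x)" if x: "x \<in> A.X" for x
    using comp_cong[OF F1_in[of "ebar A.X x" x], of "Ups A x"] A.E_S0(1-3) A.E_S0(4)[OF x] B.E_S0(1-3) B.E_S0(4)[of "f x"] A.Ups_typed[OF x] x phi_typed[of "ebar A.X x" x] Tf_ebar[OF x] by simp_all
  show ?thesis
  proof (intro iffI ballI)
    fix x assume h: "F1\<cdot>S0 A.E = S0 B.E\<cdot>F0" and x: "x \<in> A.X"
    show "\<phi> (ebar A.X x, x)\<cdot>Ups A x = Ups B (f x)"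
      by (rule tot_mono[OF B.vma, of "ebar B.X (f x)" "f x"])
        (use x e[OF x, unfolded h] A.Ups_typed[OF x] B.Ups_typed[of "f x"] phi_typed[of "ebar A.X x" x] Tf_ebar[OF x] in simp_all)
  next
    assume h: "\<forall>x\<in>A.X. \<phi> (ebar A.X x, x)\<cdot>Ups A x = Ups B (f x)"
    show "F1\<cdot>S0 A.E = S0 B.E\<cdot>F0"
      by (rule copow_ext[OF A.small_Car]) (use e h A.E_S0 B.E_S0 in simp_all)
  qed
qed

text \<open>On each summand of the object of chains both sides become the corresponding side of the
  enriched condition followed by an injection of the codomain. Injections into \<open>tot\<close>
  are monic and those into chains jointly epic.\<close>

lemma Cm_iff: "F1\<cdot>Cm A.E = Cm B.E\<cdot>chain_lift B.E (F1\<cdot>chain_fst A.E) (FA T F1\<cdot>chain_snd A.E) \<longleftrightarrow>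
  (\<forall>x2\<in>Tset (Tset A.X). \<forall>x1\<in>Tset A.X. \<forall>x0\<in>A.X.
    \<phi> (mbar A.X x2, x0)\<cdot>Mu A (x2, x1, x0) = Mu B (TTf x2, Tf x1, f x0) \<cdot>
      pairing V (\<phi> (x1, x0)\<cdot>A.pr1 x2 x1 x0)
        (Tbar_map A.a B.a Tf f \<phi> (x2, x1)\<cdot>A.pr2 x2 x1 x0))"
  (is "?L = ?R \<longleftrightarrow> _")
proof -
  let ?l = "chain_lift B.E (F1\<cdot>chain_fst A.E) (FA T F1\<cdot>chain_snd A.E)"
  define R where "R x2 x1 x0 = Mu B (TTf x2, Tf x1, f x0) \<cdot>
      pairing V (\<phi> (x1, x0)\<cdot>A.pr1 x2 x1 x0)
        (Tbar_map A.a B.a Tf f \<phi> (x2, x1)\<cdot>A.pr2 x2 x1 x0)" for x2 x1 x0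
  have cond: "D1 B.E\<cdot>(F1\<cdot>chain_fst A.E) = FA T (D0 B.E)\<cdot>(FA T F1\<cdot>chain_snd A.E)"
    by (rule ifun_chain_condition[OF A.E_graph B.E_graph, of F0]) (use F1_D0 F1_D1 in \<open>simp_all add: A.E_simps B.E_simps\<close>)
  have tt: "arr (F1\<cdot>chain_fst A.E)" "arr (FA T F1\<cdot>chain_snd A.E)" "dom (F1\<cdot>chain_fst A.E) = dom (FA T F1\<cdot>chain_snd A.E)"
    "cod (F1\<cdot>chain_fst A.E) = I1 B.E" "cod (FA T F1\<cdot>chain_snd A.E) = FO T (I1 B.E)" "dom (FA T F1\<cdot>chain_snd A.E) = chain_ob A.E"
    using A.E_typed by (simp_all add: B.E_simps)
  note l = chain_lift(1-3)[OF B.E_graph tt(1-5) cond, unfolded tt(6)] and cA = A.E_Cm(1-3) and cB = B.E_Cm(1-3)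
  have e: "?L\<cdot>A.chain_in x2 x1 x0 = tot_in B.a (mbar B.X (TTf x2), f x0)\<cdot>(\<phi> (mbar A.X x2, x0)\<cdot>Mu A (x2, x1, x0))"
    "?R\<cdot>A.chain_in x2 x1 x0 = tot_in B.a (mbar B.X (TTf x2), f x0)\<cdot>R x2 x1 x0"
    "arr (\<phi> (mbar A.X x2, x0)\<cdot>Mu A (x2, x1, x0))" "dom (\<phi> (mbar A.X x2, x0)\<cdot>Mu A (x2, x1, x0)) = dom (R x2 x1 x0)"
    "cod (\<phi> (mbar A.X x2, x0)\<cdot>Mu A (x2, x1, x0)) = B.a1 (mbar B.X (TTf x2)) (f x0)"
    "arr (R x2 x1 x0)" "cod (R x2 x1 x0) = B.a1 (mbar B.X (TTf x2)) (f x0)"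
    if x: "x2 \<in> Tset (Tset A.X)" "x1 \<in> Tset A.X" "x0 \<in> A.X" for x2 x1 x0
  proof -
    let ?p = "A.pr1 x2 x1 x0" and ?q = "A.pr2 x2 x1 x0"
    note o = A.ob_typed[OF x] and ci = A.chain_in[OF x] and mA = A.Mu_typed[OF x]
    have m: "mbar A.X x2 \<in> Tset A.X" using x by simp
    note pm = phi_typed[OF m x(3)] and p = phi_typed[OF x(2,3)]
    have y: "TTf x2 \<in> Tset (Tset B.X)" "Tf x1 \<in> Tset B.X" "f x0 \<in> B.X" using x by simp_all
    note mB = B.Mu_typed[OF y]
    note b = Tbar_map[OF phi_map, of x2 x1, unfolded A.src_Mat A.tgt_Mat B.src_Mat B.tgt_Mat, OF x(1,2)]
    note fA = A.fibA[OF x(1,2)] and fB = B.fibA[OF y(1,2)]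
    show "arr (\<phi> (mbar A.X x2, x0)\<cdot>Mu A (x2, x1, x0))" "dom (\<phi> (mbar A.X x2, x0)\<cdot>Mu A (x2, x1, x0)) = dom (R x2 x1 x0)"
      "cod (\<phi> (mbar A.X x2, x0)\<cdot>Mu A (x2, x1, x0)) = B.a1 (mbar B.X (TTf x2)) (f x0)"
      "arr (R x2 x1 x0)" "cod (R x2 x1 x0) = B.a1 (mbar B.X (TTf x2)) (f x0)"
      using mA pm Tf_mbar[OF x(1)] mB b p o by (simp_all add: R_def)
    show "?L\<cdot>A.chain_in x2 x1 x0 = tot_in B.a (mbar B.X (TTf x2), f x0)\<cdot>(\<phi> (mbar A.X x2, x0)\<cdot>Mu A (x2, x1, x0))"
    proof -
      have "F1\<cdot>(tot_in A.a (mbar A.X x2, x0)\<cdot>Mu A (x2, x1, x0)) = tot_in B.a (Tf (mbar A.X x2), f x0)\<cdot>(\<phi> (mbar A.X x2, x0)\<cdot>Mu A (x2, x1, x0))"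
        using comp_cong[OF F1_in[OF m x(3)], of "Mu A (x2, x1, x0)"] mA pm m x(3) by simp
      then show ?thesis unfolding A.E_Cm(4)[OF x, symmetric] Tf_mbar[OF x(1)] using ci cA by simp
    qed
    have 1: "(F1\<cdot>chain_fst A.E)\<cdot>A.chain_in x2 x1 x0 = tot_in B.a (Tf x1, f x0)\<cdot>(\<phi> (x1, x0)\<cdot>?p)"
      using comp_cong[OF F1_in[OF x(2,3)], of ?p] ci A.E_typed p x by simp
    have 2: "(FA T F1\<cdot>chain_snd A.E)\<cdot>A.chain_in x2 x1 x0 = fib_in B.a (TTf x2, Tf x1)\<cdot>(Tbar_map A.a B.a Tf f \<phi> (x2, x1)\<cdot>?q)"
    proof -
      have "FA T F1\<cdot>(fib_in A.a (x2, x1)\<cdot>?q) = fib_in B.a (TTf x2, Tf x1)\<cdot>(Tbar_map A.a B.a Tf f \<phi> (x2, x1)\<cdot>?q)"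
        using comp_cong[OF b(4), of ?q] b(1-3) o fA fB(1-3) by simp
      then show ?thesis unfolding ci(5)[symmetric] using ci A.E_typed by simp
    qed
    have "?l\<cdot>A.chain_in x2 x1 x0 = chain_lift B.E (tot_in B.a (Tf x1, f x0)\<cdot>(\<phi> (x1, x0)\<cdot>?p)) (fib_in B.a (TTf x2, Tf x1)\<cdot>(Tbar_map A.a B.a Tf f \<phi> (x2, x1)\<cdot>?q))"
      unfolding 1[symmetric] 2[symmetric]
      by (rule chain_lift_comp[OF B.E_graph tt(1-5) cond ci(1)]) (use ci tt(6) in simp)
    then show "?R\<cdot>A.chain_in x2 x1 x0 = tot_in B.a (mbar B.X (TTf x2), f x0)\<cdot>R x2 x1 x0"
      using B.Cm_element[OF y, of "\<phi> (x1, x0)\<cdot>?p" "Tbar_map A.a B.a Tf f \<phi> (x2, x1)\<cdot>?q"] b p o cB l ci unfolding R_def by simp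
  qed
  show ?thesis
    unfolding R_def[symmetric]
  proof (intro iffI ballI)
    fix x2 x1 x0 assume h: "?L = ?R" and x: "x2 \<in> Tset (Tset A.X)" "x1 \<in> Tset A.X" "x0 \<in> A.X"
    show "\<phi> (mbar A.X x2, x0)\<cdot>Mu A (x2, x1, x0) = R x2 x1 x0"
      by (rule tot_mono[OF B.vma _ _ e(3)[OF x] e(6)[OF x] e(4)[OF x] e(5)[OF x] e(7)[OF x]]) (use x e(1,2)[OF x] h in simp_all)
  next
    assume h: "\<forall>x2\<in>Tset (Tset A.X). \<forall>x1\<in>Tset A.X. \<forall>x0\<in>A.X. \<phi> (mbar A.X x2, x0)\<cdot>Mu A (x2, x1, x0) = R x2 x1 x0"
    have t: "arr ?L \<and> arr ?R \<and> dom ?L = chain_ob A.E \<and> dom ?R = chain_ob A.E \<and> cod ?L = cod ?R"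
      using l cA cB by simp
    show "?L = ?R"
      by (rule A.chain_ext') (use t e(1,2) h in simp_all)
  qed
qed

lemma ifun_iff:
  assumes "is_icat A.E" "is_icat B.E"
  shows "is_ifun (A.E, F0, F1, B.E) \<longleftrightarrow> (\<forall>x\<in>A.X. \<phi> (ebar A.X x, x)\<cdot>Ups A x = Ups B (f x)) \<and>
    (\<forall>x2\<in>Tset (Tset A.X). \<forall>x1\<in>Tset A.X. \<forall>x0\<in>A.X.
      \<phi> (mbar A.X x2, x0)\<cdot>Mu A (x2, x1, x0) = Mu B (TTf x2, Tf x1, f x0) \<cdot>
        pairing V (\<phi> (x1, x0)\<cdot>A.pr1 x2 x1 x0)
          (Tbar_map A.a B.a Tf f \<phi> (x2, x1)\<cdot>A.pr2 x2 x1 x0))"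
  unfolding S0_iff[symmetric] Cm_iff[symmetric] is_ifun_iff
  using assms F1_D0 F1_D1 by (simp add: A.E_simps(1,2) B.E_simps(1,2))

text \<open>The function is recovered by faithfulness of copowers, the family by monicity of the
  injections of entries; extensionality fixes the values elsewhere.\<close>

lemma tv_map_unique:
  assumes g: "tv_map small V T A B g \<psi>" and e: "copow_map V A.X g B.X = F0" "tot_map A.a B.a (Tfun A.X g B.X) g \<psi> = F1"
    and ext: "f \<in> extensional A.X" "g \<in> extensional A.X" "\<phi> \<in> extensional (Tset A.X \<times> A.X)" "\<psi> \<in> extensional (Tset A.X \<times> A.X)"
  shows "f = g" "\<phi> = \<psi>"
proof -
  interpret G: tv_map small V T A B g \<psi> by (rule g)
  show fg: "f = g"
    by (rule copow_faithful[OF A.small_Car B.small_Car]) (use e ext in \<open>auto simp: PiE_iff\<close>)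
  show "\<phi> = \<psi>"
  proof (rule extensionalityI[OF ext(3,4)])
    fix i assume "i \<in> Tset A.X \<times> A.X"
    then obtain x1 x0 where i: "i = (x1, x0)" and x: "x1 \<in> Tset A.X" "x0 \<in> A.X" by auto
    have "tot_in B.a (Tf x1, f x0)\<cdot>\<phi> (x1, x0) = tot_in B.a (Tf x1, f x0)\<cdot>\<psi> (x1, x0)"
      using F1_in[OF x] G.F1_in[OF x] unfolding e(2) fg by simp
    then show "\<phi> i = \<psi> i" unfolding i
      by (rule tot_mono[OF B.vma, rotated -1]) (use phi_typed[OF x] G.phi_typed[OF x] x in \<open>simp_all add: fg\<close>)
  qed
qed

end

section \<open>The embedding as a fully faithful functor\<close>

context embedding_setting
begin

lemma tvfun_iff: "is_tvfun small (A, f, \<phi>, B) \<longleftrightarrow> is_tvcat small A \<and> is_tvcat small B \<and>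
    f \<in> extensional (Car A) \<and> \<phi> \<in> extensional (Tset (Car A) \<times> Car A) \<and> tv_map small V T A B f \<phi> \<and>
    is_ifun (emb_ob A, copow_map V (Car A) f (Car B), tot_map (Mat A) (Mat B) (Tfun (Car A) f (Car B)) f \<phi>, emb_ob B)"
proof (cases "is_tvcat small A \<and> is_tvcat small B")
  case True
  then have AB: "is_tvcat small A" "is_tvcat small B" by auto
  note A = AB(1)[unfolded tvcat_iff] and B = AB(2)[unfolded tvcat_iff]
  have m: "tv_map small V T A B f \<phi> \<longleftrightarrow> (\<forall>x\<in>Car A. f x \<in> Car B) \<and> (\<forall>x1\<in>Tset (Car A). \<forall>x0\<in>Car A.
      \<phi> (x1, x0) \<in> hom V (ent (Mat A) (x1, x0)) (ent (Mat B) (Tfun (Car A) f (Car B) x1, f x0)))"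
    using A B embedding_setting_axioms by (auto simp: tv_map_def tv_map_axioms_def)
  have f: "f \<in> Car A \<rightarrow>\<^sub>E Car B \<longleftrightarrow> f \<in> extensional (Car A) \<and> (\<forall>x\<in>Car A. f x \<in> Car B)" by (auto simp: PiE_iff)
  have i: "tv_map small V T A B f \<phi> \<Longrightarrow> ?thesis"
    unfolding is_tvfun_def case_prod_conv Let_def using tv_map.ifun_iff[of small V T A B f \<phi>] A B m f by blast
  show ?thesis
  proof (cases "tv_map small V T A B f \<phi>")
    case True then show ?thesis by (rule i)
  next
    case False then show ?thesis unfolding is_tvfun_def case_prod_conv using m f by blast
  qed
qed (auto simp: is_tvfun_def)

abbreviation "K \<equiv> emb_functor"

lemma TVCat_simps [simp]:
  "A \<in> Obj (TVCat small) \<longleftrightarrow> is_tvcat small A" "p \<in> Arr (TVCat small) \<longleftrightarrow> is_tvfun small p"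
  "Dom (TVCat small) (A, f, \<phi>, B) = A" "Cod (TVCat small) (A, f, \<phi>, B) = B"
  "FO K A = emb_ob A"
  "FA K (A, f, \<phi>, B) = (emb_ob A, copow_map V (Car A) f (Car B), tot_map (Mat A) (Mat B) (Tfun (Car A) f (Car B)) f \<phi>, emb_ob B)"
  by (simp_all add: TVCat_def emb_functor_def)

lemma TVCat_hom: "p \<in> hom (TVCat small) A B \<longleftrightarrow> (\<exists>f \<phi>. p = (A, f, \<phi>, B) \<and> is_tvfun small (A, f, \<phi>, B))"
  by (cases p) (auto simp: hom_def)

lemma K_hom: "p \<in> hom (TVCat small) A B \<Longrightarrow> FA K p \<in> hom ICat (emb_ob A) (emb_ob B)"
  unfolding TVCat_hom by (auto simp: ICat_hom tvfun_iff)

lemma K_inj: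
  assumes "p \<in> hom (TVCat small) A B" "q \<in> hom (TVCat small) A B" "FA K p = FA K q"
  shows "p = q"
proof -
  obtain f \<phi> g \<psi> where p: "p = (A, f, \<phi>, B)" "is_tvfun small (A, f, \<phi>, B)" and q: "q = (A, g, \<psi>, B)" "is_tvfun small (A, g, \<psi>, B)"
    using assms(1,2) unfolding TVCat_hom by blast
  show ?thesis
    using tv_map.tv_map_unique[of small V T A B f \<phi> g \<psi>] p q assms(3) unfolding tvfun_iff by simp
qed

text \<open>The function comes from fullness of copowers. Restricted to an entry, \<open>p1\<close>
  has constant target, and constant source once the monic counit is cancelled, so by
  \<open>tot_factor\<close> it takes values in a single entry of the codomain.\<close>

lemma K_full:
  assumes A: "is_tvcat small A" and B: "is_tvcat small B" and p: "is_ifun (emb_ob A, p0, p1, emb_ob B)"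
  obtains q where "q \<in> hom (TVCat small) A B" "FA K q = (emb_ob A, p0, p1, emb_ob B)"
proof -
  interpret A: pre_tvcat small V T A using A by (simp add: tvcat_iff)
  interpret B: pre_tvcat small V T B using B by (simp add: tvcat_iff)
  note d = ifunD[OF p, unfolded A.E_simps B.E_simps]
  obtain f where f: "f \<in> A.X \<rightarrow>\<^sub>E B.X" "p0 = copow_map V A.X f B.X"
    by (rule copow_full[OF A.small_Car B.small_Car d(3-5)])
  then have fi: "\<And>x. x \<in> A.X \<Longrightarrow> f x \<in> B.X" by auto
  let ?Tf = "Tfun A.X f B.X"
  have "\<exists>h. h \<in> hom V (A.a1 x1 x0) (B.a1 (?Tf x1) (f x0)) \<and> tot_in B.a (?Tf x1, f x0)\<cdot>h = p1\<cdot>tot_in A.a (x1, x0)"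
    if x: "x1 \<in> Tset A.X" "x0 \<in> A.X" for x1 x0
  proof -
    note [simp] = Tset_typed[OF x(1)]
    have ti: "arr (tot_in A.a (x1, x0))" "dom (tot_in A.a (x1, x0)) = A.a1 x1 x0" "cod (tot_in A.a (x1, x0)) = tot A.a" "A.a1 x1 x0 \<in> Obj V"
      using x by simp_all
    have y: "?Tf x1 \<in> Tset B.X" "f x0 \<in> B.X" using x fi by simp_all
    have g: "arr (p1\<cdot>tot_in A.a (x1, x0))" "dom (p1\<cdot>tot_in A.a (x1, x0)) = A.a1 x1 x0" "cod (p1\<cdot>tot_in A.a (x1, x0)) = tot B.a"
      using ti d(6-8) by simp_all
    have "epsT B.X\<cdot>(tot_src B.a\<cdot>(p1\<cdot>tot_in A.a (x1, x0))) = FA T p0\<cdot>(D1 A.E\<cdot>(tot_in A.a (x1, x0)\<cdot>Ident V (A.a1 x1 x0)))"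
      using comp_cong[OF d(9), of "tot_in A.a (x1, x0)"] ti d(3-8) by (simp add: A.E_simps)
    also have "\<dots> = epsT B.X\<cdot>(pt V (Tset B.X) (?Tf x1)\<cdot>bang V (A.a1 x1 x0))"
      using A.D1_tot_in[OF x, of "Ident V (A.a1 x1 x0)"] y d(3-5) x by (simp add: Tfun_app f(2)[symmetric])
    finally have "tot_src B.a\<cdot>(p1\<cdot>tot_in A.a (x1, x0)) = pt V (Tset B.X) (?Tf x1)\<cdot>bang V (A.a1 x1 x0)"
      by (rule epsT_mono[OF B.small_Car, rotated -1]) (use g ti y in simp_all)
    moreover have "tot_tgt B.a\<cdot>(p1\<cdot>tot_in A.a (x1, x0)) = pt V B.X (f x0)\<cdot>bang V (A.a1 x1 x0)"
      using comp_cong[OF d(10), of "tot_in A.a (x1, x0)"] d(3-8) x fi f(2) by simp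
    ultimately obtain h where "arr h" "dom h = A.a1 x1 x0" "cod h = B.a1 (?Tf x1) (f x0)" "tot_in B.a (?Tf x1, f x0)\<cdot>h = p1\<cdot>tot_in A.a (x1, x0)"
      using tot_factor[OF B.vma, of "?Tf x1" "f x0" "p1\<cdot>tot_in A.a (x1, x0)"] y g by auto
    then show ?thesis by (auto simp: hom_iff)
  qed
  then obtain h where h: "\<And>x1 x0. \<lbrakk>x1 \<in> Tset A.X; x0 \<in> A.X\<rbrakk> \<Longrightarrow> h x1 x0 \<in> hom V (A.a1 x1 x0) (B.a1 (?Tf x1) (f x0)) \<and>
      tot_in B.a (?Tf x1, f x0)\<cdot>h x1 x0 = p1\<cdot>tot_in A.a (x1, x0)"
    by metis
  define \<phi> where "\<phi> = restrict (\<lambda>(x1, x0). h x1 x0) (Tset A.X \<times> A.X)"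
  have \<phi>: "\<phi> (x1, x0) = h x1 x0" if "x1 \<in> Tset A.X" "x0 \<in> A.X" for x1 x0 using that by (simp add: \<phi>_def)
  interpret M: tv_map small V T A B f \<phi>
    by unfold_locales (use h fi in \<open>simp_all add: \<phi>\<close>)
  have "M.F1 = p1"
    by (rule tot_ext[OF A.vma]) (use M.F1_in h \<phi> d in simp_all)
  then have "is_tvfun small (A, f, \<phi>, B)" "FA K (A, f, \<phi>, B) = (emb_ob A, p0, p1, emb_ob B)"
    using A B f p M.tv_map_axioms by (simp_all add: tvfun_iff PiE_iff \<phi>_def)
  then show thesis using that[of "(A, f, \<phi>, B)"] by (simp add: TVCat_hom)
qed

lemma K_Ident:
  assumes A: "is_tvcat small A"
  shows "Ident (TVCat small) A \<in> hom (TVCat small) A A" "FA K (Ident (TVCat small) A) = Ident ICat (emb_ob A)"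
proof -
  interpret A: pre_tvcat small V T A using A by (simp add: tvcat_iff)
  interpret I: category ICat by (rule category_ICat)
  define i where "i = (\<lambda>x\<in>A.X. x)"
  have i: "\<And>x. x \<in> A.X \<Longrightarrow> i x = x" by (simp add: i_def)
  define \<iota> where "\<iota> = (\<lambda>x\<in>Tset A.X \<times> A.X. Ident V (ent A.a x))"
  have \<iota>: "\<And>x1 x0. \<lbrakk>x1 \<in> Tset A.X; x0 \<in> A.X\<rbrakk> \<Longrightarrow> \<iota> (x1, x0) = Ident V (A.a1 x1 x0)" by (simp add: \<iota>_def)
  have c: "copow_map V A.X i A.X = Ident V (copow V A.X)" by (rule copow_map_id) (simp_all add: i_def)
  have T: "Tfun A.X i A.X x1 = x1" if "x1 \<in> Tset A.X" for x1 using that Tset_typed[OF that] by (simp add: Tfun_app c)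
  interpret M: tv_map small V T A A i \<iota>
    by unfold_locales (use T in \<open>simp_all add: i \<iota>_def hom_iff\<close>)
  have 1: "M.F1 = Ident V (tot A.a)"
    by (rule tot_ext[OF A.vma]) (use M.F1_in T \<iota> in \<open>simp_all add: i\<close>)
  have e: "Ident (TVCat small) A = (A, i, \<iota>, A)" by (simp add: TVCat_def i_def \<iota>_def)
  show 2: "FA K (Ident (TVCat small) A) = Ident ICat (emb_ob A)" unfolding e using 1 c by (simp add: A.E_simps)
  have "is_ifun (Ident ICat (emb_ob A))" using I.Ident_in_hom[of "emb_ob A"] A by (simp add: tvcat_iff I.hom_iff)
  then have "is_tvfun small (A, i, \<iota>, A)"
    using A M.tv_map_axioms 2 unfolding e tvfun_iff by (simp add: i_def \<iota>_def)
  then show "Ident (TVCat small) A \<in> hom (TVCat small) A A" unfolding e TVCat_hom by blast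
qed

lemma K_Comp:
  assumes p: "p \<in> hom (TVCat small) A B" and q: "q \<in> hom (TVCat small) B D"
  shows "q \<cdot>\<^bsub>TVCat small\<^esub> p \<in> hom (TVCat small) A D" "FA K (q \<cdot>\<^bsub>TVCat small\<^esub> p) = FA K q \<cdot>\<^bsub>ICat\<^esub> FA K p"
proof -
  obtain f \<phi> g \<psi> where pe: "p = (A, f, \<phi>, B)" "is_tvfun small (A, f, \<phi>, B)" and qe: "q = (B, g, \<psi>, D)" "is_tvfun small (B, g, \<psi>, D)"
    using p q unfolding TVCat_hom by blast
  interpret P: tv_map small V T A B f \<phi> using pe(2) by (simp add: tvfun_iff)
  interpret Q: tv_map small V T B D g \<psi> using qe(2) by (simp add: tvfun_iff)
  interpret I: category ICat by (rule category_ICat)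
  define h where "h = compose P.A.X g f"
  define \<chi> where "\<chi> = restrict (\<lambda>(x1, x0). \<psi> (P.Tf x1, f x0)\<cdot>\<phi> (x1, x0)) (Tset P.A.X \<times> P.A.X)"
  have c: "copow_map V P.A.X h Q.B.X = Q.F0\<cdot>P.F0"
    using copow_map_comp[of P.A.X P.B.X Q.B.X f g] copow_map_cong[of P.A.X Q.B.X h "\<lambda>x. g (f x)"] by (simp add: h_def compose_eq)
  have T: "Tfun P.A.X h Q.B.X x1 = Q.Tf (P.Tf x1)" if x: "x1 \<in> Tset P.A.X" for x1
  proof -
    have "P.Tf x1 \<in> Tset P.B.X" using x by simp
    then show ?thesis using x Tset_typed[OF x] by (simp add: Tfun_app c)
  qed
  interpret M: tv_map small V T A D h \<chi>
  proof unfold_locales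
    fix x assume "x \<in> P.A.X" then show "h x \<in> Q.B.X" by (simp add: h_def compose_eq)
  next
    fix x1 x0 assume x: "x1 \<in> Tset P.A.X" "x0 \<in> P.A.X"
    then show "\<chi> (x1, x0) \<in> hom V (ent P.A.a (x1, x0)) (ent Q.B.a (Tfun P.A.X h Q.B.X x1, h x0))"
      using P.phi_typed[OF x] Q.phi_typed[of "P.Tf x1" "f x0"] T[OF x(1)] by (simp add: \<chi>_def hom_iff) (simp add: h_def compose_eq)
  qed
  have 1: "M.F1 = Q.F1\<cdot>P.F1"
  proof (rule tot_ext[OF P.A.vma])
    fix x1 x0 assume "x1 \<in> src P.A.a" "x0 \<in> tgt P.A.a"
    then have x: "x1 \<in> Tset P.A.X" "x0 \<in> P.A.X" by simp_all
    then have y: "P.Tf x1 \<in> Tset P.B.X" "f x0 \<in> P.B.X" by simp_all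
    then have "Q.Tf (P.Tf x1) \<in> Tset Q.B.X" "g (f x0) \<in> Q.B.X" by simp_all
    have hx: "h x0 = g (f x0)" "\<chi> (x1, x0) = \<psi> (P.Tf x1, f x0)\<cdot>\<phi> (x1, x0)" using x by (simp_all add: h_def compose_eq \<chi>_def)
    have "(Q.F1\<cdot>P.F1)\<cdot>tot_in P.A.a (x1, x0) = Q.F1\<cdot>(tot_in P.B.a (P.Tf x1, f x0)\<cdot>\<phi> (x1, x0))"
      using P.F1_in[OF x] x by simp
    also have "\<dots> = tot_in Q.B.a (Q.Tf (P.Tf x1), g (f x0))\<cdot>(\<psi> (P.Tf x1, f x0)\<cdot>\<phi> (x1, x0))"
      using comp_cong[OF Q.F1_in[OF y], of "\<phi> (x1, x0)"] P.phi_typed[OF x] Q.phi_typed[OF y] y by simp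
    also have "\<dots> = M.F1\<cdot>tot_in P.A.a (x1, x0)" using M.F1_in[OF x] unfolding hx T[OF x(1)] by simp
    finally show "M.F1\<cdot>tot_in P.A.a (x1, x0) = (Q.F1\<cdot>P.F1)\<cdot>tot_in P.A.a (x1, x0)" by simp
  qed simp_all
  have e: "q \<cdot>\<^bsub>TVCat small\<^esub> p = (A, h, \<chi>, D)" by (simp add: pe qe TVCat_def h_def \<chi>_def)
  show 2: "FA K (q \<cdot>\<^bsub>TVCat small\<^esub> p) = FA K q \<cdot>\<^bsub>ICat\<^esub> FA K p" unfolding e using 1 c by (simp add: pe(1) qe(1))
  have "is_ifun (FA K q \<cdot>\<^bsub>ICat\<^esub> FA K p)" using I.Comp_in_hom[OF K_hom[OF p] K_hom[OF q]] by (simp add: I.hom_iff)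
  then have "is_tvfun small (A, h, \<chi>, D)"
    using pe(2) qe(2) M.tv_map_axioms 2 unfolding e tvfun_iff by (simp add: h_def \<chi>_def)
  then show "q \<cdot>\<^bsub>TVCat small\<^esub> p \<in> hom (TVCat small) A D" unfolding e TVCat_hom by blast
qed

text \<open>The axioms are reflected from \<open>ICat\<close> along the injective action of
  \<open>K\<close> on hom-sets, so no computation with enriched functors is needed.\<close>

lemma category_TVCat: "category (TVCat small)"
proof -
  interpret I: category ICat by (rule category_ICat)
  have ob: "is_tvcat small A" "is_tvcat small B" if "p \<in> hom (TVCat small) A B" for p A B
    using that unfolding TVCat_hom by (auto simp: is_tvfun_def)
  show ?thesis
  proof
    fix p assume "p \<in> Arr (TVCat small)"
    then show "Dom (TVCat small) p \<in> Obj (TVCat small)" "Cod (TVCat small) p \<in> Obj (TVCat small)"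
      by (cases p; simp add: is_tvfun_def)+
  next
    fix A assume "A \<in> Obj (TVCat small)"
    then show "Ident (TVCat small) A \<in> hom (TVCat small) A A" using K_Ident(1) by simp
  next
    fix p A B assume p: "p \<in> hom (TVCat small) A B"
    note i = K_Ident[OF ob(1)[OF p]] and j = K_Ident[OF ob(2)[OF p]]
    show "p \<cdot>\<^bsub>TVCat small\<^esub> Ident (TVCat small) A = p"
      by (rule K_inj[OF K_Comp(1)[OF i(1) p] p]) (use K_Comp(2)[OF i(1) p] i I.Comp_Ident[OF K_hom[OF p]] in simp)
    show "Ident (TVCat small) B \<cdot>\<^bsub>TVCat small\<^esub> p = p"
      by (rule K_inj[OF K_Comp(1)[OF p j(1)] p]) (use K_Comp(2)[OF p j(1)] j I.Ident_Comp[OF K_hom[OF p]] in simp)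
  next
    fix p q r A B D E assume p: "p \<in> hom (TVCat small) A B" and q: "q \<in> hom (TVCat small) B D" and r: "r \<in> hom (TVCat small) D E"
    note pq = K_Comp[OF p q] and qr = K_Comp[OF q r]
    show "r \<cdot>\<^bsub>TVCat small\<^esub> (q \<cdot>\<^bsub>TVCat small\<^esub> p) = (r \<cdot>\<^bsub>TVCat small\<^esub> q) \<cdot>\<^bsub>TVCat small\<^esub> p"
      by (rule K_inj[OF K_Comp(1)[OF pq(1) r] K_Comp(1)[OF p qr(1)]])
        (use K_Comp(2)[OF pq(1) r] K_Comp(2)[OF p qr(1)] pq qr I.Comp_assoc[OF K_hom[OF p] K_hom[OF q] K_hom[OF r]] in simp)
  qed (use K_Comp(1) in blast)
qed

lemma fully_faithful_K: "fully_faithful (TVCat small) ICat K"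
  unfolding fully_faithful_def
proof (intro conjI ballI)
  interpret C: category "TVCat small" by (rule category_TVCat)
  have h: "p \<in> hom (TVCat small) (Dom (TVCat small) p) (Cod (TVCat small) p)" if "is_tvfun small p" for p
    using that by (cases p) (auto simp: TVCat_hom)
  have c: "FA K (q \<cdot>\<^bsub>TVCat small\<^esub> p) = FA K q \<cdot>\<^bsub>ICat\<^esub> FA K p"
    if "is_tvfun small p" "is_tvfun small q" "Cod (TVCat small) p = Dom (TVCat small) q" for p q
    using K_Comp(2)[of p "Dom (TVCat small) p" "Dom (TVCat small) q" q "Cod (TVCat small) q"] h[OF that(1)] h[OF that(2)] that(3) by simp
  show "is_functor (TVCat small) ICat K"
    unfolding is_functor_def using K_hom[OF h] K_Ident(2) c by (auto simp: tvcat_iff)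
  fix A B assume "A \<in> Obj (TVCat small)" "B \<in> Obj (TVCat small)"
  then have AB: "is_tvcat small A" "is_tvcat small B" by simp_all
  have "P \<in> FA K ` hom (TVCat small) A B" if P: "P \<in> hom ICat (emb_ob A) (emb_ob B)" for P
  proof -
    obtain p0 p1 where p: "P = (emb_ob A, p0, p1, emb_ob B)" "is_ifun (emb_ob A, p0, p1, emb_ob B)" using P unfolding ICat_hom by blast
    show ?thesis using K_full[OF AB p(2)] p(1) by (metis imageI)
  qed
  then show "bij_betw (FA K) (hom (TVCat small) A B) (hom ICat (FO K A) (FO K B))"
    unfolding bij_betw_def inj_on_def using K_inj K_hom by auto
qed

section \<open>The essential image\<close>

text \<open>An internal functor between data whose laws are not yet known. It serves to carry the
  laws from \<open>y\<close> back to \<open>x\<close> before \<open>x\<close> is known to be an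
  internal category.\<close>

definition pre_ifun where
  "pre_ifun x p0 p1 y \<longleftrightarrow> precategory x \<and> precategory y \<and>
    arr p0 \<and> dom p0 = I0 x \<and> cod p0 = I0 y \<and> arr p1 \<and> dom p1 = I1 x \<and> cod p1 = I1 y \<and>
    D1 y\<cdot>p1 = FA T p0\<cdot>D1 x \<and> D0 y\<cdot>p1 = p0\<cdot>D0 x \<and> p1\<cdot>S0 x = S0 y\<cdot>p0 \<and>
    p1\<cdot>Cm x = Cm y\<cdot>chain_lift y (p1\<cdot>chain_fst x) (FA T p1\<cdot>chain_snd x)"

lemma pre_ifunD:
  assumes "pre_ifun x p0 p1 y"
  shows "precategory x" "precategory y" "arr p0" "dom p0 = I0 x" "cod p0 = I0 y" "arr p1" "dom p1 = I1 x" "cod p1 = I1 y"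
    "D1 y\<cdot>p1 = FA T p0\<cdot>D1 x" "D0 y\<cdot>p1 = p0\<cdot>D0 x" "p1\<cdot>S0 x = S0 y\<cdot>p0"
    "p1\<cdot>Cm x = Cm y\<cdot>chain_lift y (p1\<cdot>chain_fst x) (FA T p1\<cdot>chain_snd x)" "graph x" "graph y"
  using assms precategoryD(1) by (simp_all add: pre_ifun_def)

lemma pre_ifun_chain:
  assumes p: "pre_ifun x p0 p1 y"
    and f: "arr f" "arr g" "dom f = dom g" "cod f = I1 x" "cod g = FO T (I1 x)" "D1 x\<cdot>f = FA T (D0 x)\<cdot>g"
  shows "D1 y\<cdot>(p1\<cdot>f) = FA T (D0 y)\<cdot>(FA T p1\<cdot>g)"
    "chain_lift y (p1\<cdot>chain_fst x) (FA T p1\<cdot>chain_snd x)\<cdot>chain_lift x f g = chain_lift y (p1\<cdot>f) (FA T p1\<cdot>g)"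
    "p1\<cdot>(Cm x\<cdot>chain_lift x f g) = Cm y\<cdot>chain_lift y (p1\<cdot>f) (FA T p1\<cdot>g)"
proof -
  note d = pre_ifunD[OF p]
  note xt = precategoryD(1-7)[OF d(1)] and yt = precategoryD(1-7)[OF d(2)]
  note c = ifun_chain_condition[OF d(13,14,3-10)]
  have t: "arr (p1\<cdot>chain_fst x)" "arr (FA T p1\<cdot>chain_snd x)" "dom (p1\<cdot>chain_fst x) = dom (FA T p1\<cdot>chain_snd x)"
    "cod (p1\<cdot>chain_fst x) = I1 y" "cod (FA T p1\<cdot>chain_snd x) = FO T (I1 y)" "dom (FA T p1\<cdot>chain_snd x) = chain_ob x"
    using d(3-8) xt by simp_all
  note lx = chain_lift[OF d(13) f] and ly = chain_lift(1-3)[OF d(14) t(1-5) c, unfolded t(6)]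
  show "D1 y\<cdot>(p1\<cdot>f) = FA T (D0 y)\<cdot>(FA T p1\<cdot>g)"
    using comp_cong[OF d(9), of f] comp_cong[OF T_cong2[OF d(10)], of g] f d(3-8) xt yt by simp
  show e: "chain_lift y (p1\<cdot>chain_fst x) (FA T p1\<cdot>chain_snd x)\<cdot>chain_lift x f g = chain_lift y (p1\<cdot>f) (FA T p1\<cdot>g)"
    using chain_lift_comp[OF d(14) t(1-5) c lx(1)] lx d(3-8) xt by simp
  show "p1\<cdot>(Cm x\<cdot>chain_lift x f g) = Cm y\<cdot>chain_lift y (p1\<cdot>f) (FA T p1\<cdot>g)"
    unfolding e[symmetric] using comp_cong[OF d(12), of "chain_lift x f g"] lx ly d(3-8) xt yt by simp
qed

lemma pre_ifun_unit_laws: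
  assumes p: "pre_ifun x p0 p1 y"
  shows "p1\<cdot>(Cm x\<cdot>chain_lift x (S0 x\<cdot>D0 x) (Unit T (I1 x))) = (Cm y\<cdot>chain_lift y (S0 y\<cdot>D0 y) (Unit T (I1 y)))\<cdot>p1"
    "p1\<cdot>(Cm x\<cdot>chain_lift x (Ident V (I1 x)) (FA T (S0 x)\<cdot>D1 x)) = (Cm y\<cdot>chain_lift y (Ident V (I1 y)) (FA T (S0 y)\<cdot>D1 y))\<cdot>p1"
proof -
  note d = pre_ifunD[OF p] and cx = chain_lift_conditions[OF pre_ifunD(1)[OF p]] and cy = chain_lift_conditions[OF pre_ifunD(2)[OF p]]
  note xt = precategoryD(1-7)[OF d(1)] and yt = precategoryD(1-7)[OF d(2)]
  note ly = chain_lift(1-3)[OF d(14) _ _ _ _ _ cy(1)] chain_lift(1-3)[OF d(14) _ _ _ _ _ cy(2)]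
  have "p1\<cdot>(Cm x\<cdot>chain_lift x (S0 x\<cdot>D0 x) (Unit T (I1 x))) = Cm y\<cdot>chain_lift y (p1\<cdot>(S0 x\<cdot>D0 x)) (FA T p1\<cdot>Unit T (I1 x))"
    by (rule pre_ifun_chain(3)[OF p]) (use cx xt in simp_all)
  also have "p1\<cdot>(S0 x\<cdot>D0 x) = (S0 y\<cdot>D0 y)\<cdot>p1" using comp_cong[OF d(11), of "D0 x"] d(3-10) xt yt by simp
  also have "FA T p1\<cdot>Unit T (I1 x) = Unit T (I1 y)\<cdot>p1" using Unit_nat[of p1] d(3-8) by simp
  also have "chain_lift y ((S0 y\<cdot>D0 y)\<cdot>p1) (Unit T (I1 y)\<cdot>p1) = chain_lift y (S0 y\<cdot>D0 y) (Unit T (I1 y))\<cdot>p1"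
    using chain_lift_comp[OF d(14) _ _ _ _ _ cy(1), of p1] d(3-8) yt by simp
  finally show "p1\<cdot>(Cm x\<cdot>chain_lift x (S0 x\<cdot>D0 x) (Unit T (I1 x))) = (Cm y\<cdot>chain_lift y (S0 y\<cdot>D0 y) (Unit T (I1 y)))\<cdot>p1"
    using ly d(3-8) yt by simp
  have "p1\<cdot>(Cm x\<cdot>chain_lift x (Ident V (I1 x)) (FA T (S0 x)\<cdot>D1 x)) = Cm y\<cdot>chain_lift y (p1\<cdot>Ident V (I1 x)) (FA T p1\<cdot>(FA T (S0 x)\<cdot>D1 x))"
    by (rule pre_ifun_chain(3)[OF p]) (use cx xt in simp_all)
  also have "p1\<cdot>Ident V (I1 x) = Ident V (I1 y)\<cdot>p1" using d(3-8) by simp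
  also have "FA T p1\<cdot>(FA T (S0 x)\<cdot>D1 x) = (FA T (S0 y)\<cdot>D1 y)\<cdot>p1"
    using comp_cong[OF T_cong2[OF d(11)], of "D1 x"] d(3-9) xt yt by simp
  also have "chain_lift y (Ident V (I1 y)\<cdot>p1) ((FA T (S0 y)\<cdot>D1 y)\<cdot>p1) = chain_lift y (Ident V (I1 y)) (FA T (S0 y)\<cdot>D1 y)\<cdot>p1"
    using chain_lift_comp[OF d(14) _ _ _ _ _ cy(2), of p1] d(3-8) yt by simp
  finally show "p1\<cdot>(Cm x\<cdot>chain_lift x (Ident V (I1 x)) (FA T (S0 x)\<cdot>D1 x)) = (Cm y\<cdot>chain_lift y (Ident V (I1 y)) (FA T (S0 y)\<cdot>D1 y))\<cdot>p1"
    using ly d(3-8) yt by simp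
qed

lemma pre_ifun_assoc_law:
  assumes p: "pre_ifun x p0 p1 y"
    and y: "Cm y\<cdot>chain_lift y (chain_fst y\<cdot>chain3_fst y) (FA T (Cm y)\<cdot>chain3_snd y) =
      Cm y\<cdot>chain_lift y (Cm y\<cdot>chain3_fst y) (Mult T (I1 y)\<cdot>(FA T (chain_snd y)\<cdot>chain3_snd y))"
  shows "p1\<cdot>(Cm x\<cdot>chain_lift x (chain_fst x\<cdot>chain3_fst x) (FA T (Cm x)\<cdot>chain3_snd x)) =
    p1\<cdot>(Cm x\<cdot>chain_lift x (Cm x\<cdot>chain3_fst x) (Mult T (I1 x)\<cdot>(FA T (chain_snd x)\<cdot>chain3_snd x)))"
proof -
  note d = pre_ifunD[OF p] and cx = chain_lift_conditions[OF pre_ifunD(1)[OF p]] and cy = chain_lift_conditions[OF pre_ifunD(2)[OF p]]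
  note xt = precategoryD(1-7)[OF d(1)] and yt = precategoryD(1-7)[OF d(2)]
  let ?u = "chain_lift y (p1\<cdot>chain_fst x) (FA T p1\<cdot>chain_snd x)"
  have u: "arr ?u" "dom ?u = chain_ob x" "cod ?u = chain_ob y" "chain_fst y\<cdot>?u = p1\<cdot>chain_fst x" "chain_snd y\<cdot>?u = FA T p1\<cdot>chain_snd x"
    using chain_lift[OF d(14) _ _ _ _ _ ifun_chain_condition[OF d(13,14,3-10)]] d(3-8) xt by simp_all
  have "chain_snd y\<cdot>(?u\<cdot>chain3_fst x) = FA T p1\<cdot>(FA T (chain_fst x)\<cdot>chain3_snd x)"
    using comp_cong[OF u(5), of "chain3_fst x"] chain3_comm[OF d(13)] u(1-3) d(3-8) xt yt by simp
  also have "\<dots> = FA T (chain_fst y)\<cdot>(FA T ?u\<cdot>chain3_snd x)"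
    using comp_cong[OF T_cong2[OF u(4)], of "chain3_snd x"] u(1-3) d(3-8) xt yt by simp
  finally have c: "chain_snd y\<cdot>(?u\<cdot>chain3_fst x) = FA T (chain_fst y)\<cdot>(FA T ?u\<cdot>chain3_snd x)" .
  \<comment> \<open>The arrow induced between the objects of 3-chains; along it, the two sides of
    associativity for \<open>y\<close> restrict to the images of those for \<open>x\<close>.\<close>
  obtain w where w: "arr w" "dom w = dom (chain3_fst x)" "cod w = dom (chain3_fst y)"
    "chain3_fst y\<cdot>w = ?u\<cdot>chain3_fst x" "chain3_snd y\<cdot>w = FA T ?u\<cdot>chain3_snd x"
    by (rule pullback_ex[OF chain3_pullback[OF d(14)] _ _ _ _ _ c]) (use u xt yt in simp_all)
  have C: "p1\<cdot>Cm x = Cm y\<cdot>?u" by (rule d(12))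
  have Ceq: "FA T p1\<cdot>(FA T (Cm x)\<cdot>chain3_snd x) = FA T (Cm y)\<cdot>(FA T ?u\<cdot>chain3_snd x)"
    using comp_cong[OF T_cong2[OF C], of "chain3_snd x"] u(1-3) d(3-8) xt yt by simp
  have "p1\<cdot>(Cm x\<cdot>chain_lift x (chain_fst x\<cdot>chain3_fst x) (FA T (Cm x)\<cdot>chain3_snd x)) =
    Cm y\<cdot>chain_lift y (p1\<cdot>(chain_fst x\<cdot>chain3_fst x)) (FA T p1\<cdot>(FA T (Cm x)\<cdot>chain3_snd x))"
    by (rule pre_ifun_chain(3)[OF p]) (use cx xt in simp_all)
  also have "p1\<cdot>(chain_fst x\<cdot>chain3_fst x) = (chain_fst y\<cdot>chain3_fst y)\<cdot>w"
    using comp_cong[OF u(4), of "chain3_fst x"] u(1-3) w d(3-8) xt yt by simp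
  also have "FA T p1\<cdot>(FA T (Cm x)\<cdot>chain3_snd x) = (FA T (Cm y)\<cdot>chain3_snd y)\<cdot>w"
    unfolding Ceq using w yt by simp
  also have "chain_lift y ((chain_fst y\<cdot>chain3_fst y)\<cdot>w) ((FA T (Cm y)\<cdot>chain3_snd y)\<cdot>w) =
    chain_lift y (chain_fst y\<cdot>chain3_fst y) (FA T (Cm y)\<cdot>chain3_snd y)\<cdot>w"
    using chain_lift_comp[OF d(14) _ _ _ _ _ cy(3), of w] w yt by simp
  finally have L: "p1\<cdot>(Cm x\<cdot>chain_lift x (chain_fst x\<cdot>chain3_fst x) (FA T (Cm x)\<cdot>chain3_snd x)) =
    (Cm y\<cdot>chain_lift y (chain_fst y\<cdot>chain3_fst y) (FA T (Cm y)\<cdot>chain3_snd y))\<cdot>w"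
    using chain_lift(1-3)[OF d(14) _ _ _ _ _ cy(3)] w yt by simp
  have "p1\<cdot>(Cm x\<cdot>chain_lift x (Cm x\<cdot>chain3_fst x) (Mult T (I1 x)\<cdot>(FA T (chain_snd x)\<cdot>chain3_snd x))) =
    Cm y\<cdot>chain_lift y (p1\<cdot>(Cm x\<cdot>chain3_fst x)) (FA T p1\<cdot>(Mult T (I1 x)\<cdot>(FA T (chain_snd x)\<cdot>chain3_snd x)))"
    by (rule pre_ifun_chain(3)[OF p]) (use cx xt in simp_all)
  also have "p1\<cdot>(Cm x\<cdot>chain3_fst x) = (Cm y\<cdot>chain3_fst y)\<cdot>w"
    using comp_cong[OF C, of "chain3_fst x"] u(1-3) w d(3-8) xt yt by simp
  also have "FA T p1\<cdot>(Mult T (I1 x)\<cdot>(FA T (chain_snd x)\<cdot>chain3_snd x)) = (Mult T (I1 y)\<cdot>(FA T (chain_snd y)\<cdot>chain3_snd y))\<cdot>w"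
    using comp_cong[OF Mult_nat[of p1], of "FA T (chain_snd x)\<cdot>chain3_snd x"] comp_cong[OF T_cong2[OF u(5)], of "chain3_snd x"] u(1-3) w d(3-8) xt yt by simp
  also have "chain_lift y ((Cm y\<cdot>chain3_fst y)\<cdot>w) ((Mult T (I1 y)\<cdot>(FA T (chain_snd y)\<cdot>chain3_snd y))\<cdot>w) =
    chain_lift y (Cm y\<cdot>chain3_fst y) (Mult T (I1 y)\<cdot>(FA T (chain_snd y)\<cdot>chain3_snd y))\<cdot>w"
    using chain_lift_comp[OF d(14) _ _ _ _ _ cy(4), of w] w yt by simp
  finally show ?thesis
    unfolding L y using chain_lift(1-3)[OF d(14) _ _ _ _ _ cy(4)] w yt by simp
qed

text \<open>After composition with \<open>p1\<close>, the laws of \<open>x\<close> become those of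
  \<open>y\<close> restricted along the functor, and an invertible \<open>p1\<close> can be
  cancelled. The inverse arrows preserve the structure for the same reason.\<close>

lemma pre_ifun_icat:
  assumes p: "pre_ifun x p0 p1 y" and y: "is_icat y" and i: "is_iso V p0" "is_iso V p1"
  shows "is_icat x" "is_iso ICat (x, p0, p1, y)"
proof -
  note d = pre_ifunD[OF p] and cx = chain_lift_conditions[OF pre_ifunD(1)[OF p]]
  note xt = precategoryD(1-7)[OF d(1)] and yt = precategoryD(1-7)[OF d(2)]
  note law = y[unfolded is_icat_iff, THEN conjunct2]
  note l = chain_lift(1-3)[OF d(13) _ _ _ _ _ cx(1)] chain_lift(1-3)[OF d(13) _ _ _ _ _ cx(2)]
    chain_lift(1-3)[OF d(13) _ _ _ _ _ cx(3)] chain_lift(1-3)[OF d(13) _ _ _ _ _ cx(4)]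
  have "Cm x\<cdot>chain_lift x (S0 x\<cdot>D0 x) (Unit T (I1 x)) = Ident V (I1 x)"
    by (rule iso_cancel_left[OF i(2)]) (use pre_ifun_unit_laws(1)[OF p] law l d(3-8) xt in simp_all)
  moreover have "Cm x\<cdot>chain_lift x (Ident V (I1 x)) (FA T (S0 x)\<cdot>D1 x) = Ident V (I1 x)"
    by (rule iso_cancel_left[OF i(2)]) (use pre_ifun_unit_laws(2)[OF p] law l d(3-8) xt in simp_all)
  moreover have "Cm x\<cdot>chain_lift x (chain_fst x\<cdot>chain3_fst x) (FA T (Cm x)\<cdot>chain3_snd x) =
    Cm x\<cdot>chain_lift x (Cm x\<cdot>chain3_fst x) (Mult T (I1 x)\<cdot>(FA T (chain_snd x)\<cdot>chain3_snd x))"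
    by (rule iso_cancel_left[OF i(2)]) (use pre_ifun_assoc_law[OF p] law l d(3-8) xt in simp_all)
  ultimately show x: "is_icat x" using d(1) by (simp add: is_icat_iff)
  obtain j0 where j0: "arr j0" "dom j0 = I0 y" "cod j0 = I0 x" "j0\<cdot>p0 = Ident V (I0 x)" "p0\<cdot>j0 = Ident V (I0 y)"
    using isoE[OF i(1)] d(4,5) by metis
  obtain j1 where j1: "arr j1" "dom j1 = I1 y" "cod j1 = I1 x" "j1\<cdot>p1 = Ident V (I1 x)" "p1\<cdot>j1 = Ident V (I1 y)"
    using isoE[OF i(2)] d(7,8) by metis
  have T0: "FA T j0\<cdot>FA T p0 = Ident V (FO T (I0 x))" "FA T p1\<cdot>FA T j1 = Ident V (FO T (I1 y))"
    using T_cong[OF j0(4)] T_cong[OF j1(5)] j0(1-3) j1(1-3) d(3-8) xt yt by simp_all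
  have e1: "D1 x\<cdot>j1 = FA T j0\<cdot>D1 y"
  proof -
    have "D1 x\<cdot>j1 = FA T j0\<cdot>((FA T p0\<cdot>D1 x)\<cdot>j1)" using comp_cong[OF T0(1), of "D1 x\<cdot>j1"] j0(1-3) j1(1-3) d(3-8) xt by simp
    then show ?thesis unfolding d(9)[symmetric] using j0(1-3) j1 d(3-8) yt by simp
  qed
  have e0: "D0 x\<cdot>j1 = j0\<cdot>D0 y"
  proof -
    have "D0 x\<cdot>j1 = j0\<cdot>((p0\<cdot>D0 x)\<cdot>j1)" using comp_cong[OF j0(4), of "D0 x\<cdot>j1"] j0(1-3) j1(1-3) d(3-8) xt by simp
    then show ?thesis unfolding d(10)[symmetric] using j0(1-3) j1 d(3-8) yt by simp
  qed
  have es: "j1\<cdot>S0 y = S0 x\<cdot>j0"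
  proof -
    have "S0 x\<cdot>j0 = j1\<cdot>((p1\<cdot>S0 x)\<cdot>j0)" using comp_cong[OF j1(4), of "S0 x\<cdot>j0"] j0(1-3) j1(1-3) d(3-8) xt by simp
    then show ?thesis unfolding d(11) using j0 j1(1-3) d(3-8) yt by simp
  qed
  have c: "D1 x\<cdot>(j1\<cdot>chain_fst y) = FA T (D0 x)\<cdot>(FA T j1\<cdot>chain_snd y)"
    by (rule ifun_chain_condition[OF d(14,13) j0(1-3) j1(1-3) e1 e0])
  have ec: "j1\<cdot>Cm y = Cm x\<cdot>chain_lift x (j1\<cdot>chain_fst y) (FA T j1\<cdot>chain_snd y)"
  proof (rule iso_cancel_left[OF i(2)])
    have "p1\<cdot>(Cm x\<cdot>chain_lift x (j1\<cdot>chain_fst y) (FA T j1\<cdot>chain_snd y)) =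
      Cm y\<cdot>chain_lift y (p1\<cdot>(j1\<cdot>chain_fst y)) (FA T p1\<cdot>(FA T j1\<cdot>chain_snd y))"
      by (rule pre_ifun_chain(3)[OF p]) (use c j1(1-3) yt in simp_all)
    also have "p1\<cdot>(j1\<cdot>chain_fst y) = chain_fst y" using comp_cong[OF j1(5), of "chain_fst y"] j1(1-3) d(3-8) yt by simp
    also have "FA T p1\<cdot>(FA T j1\<cdot>chain_snd y) = chain_snd y" using comp_cong[OF T0(2), of "chain_snd y"] j1(1-3) d(3-8) yt by simp
    also have "chain_lift y (chain_fst y) (chain_snd y) = Ident V (chain_ob y)"
      by (rule chain_lift_eqI[OF d(14)]) (use yt in simp_all)
    finally show "p1\<cdot>(j1\<cdot>Cm y) = p1\<cdot>(Cm x\<cdot>chain_lift x (j1\<cdot>chain_fst y) (FA T j1\<cdot>chain_snd y))"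
      using comp_cong[OF j1(5), of "Cm y"] j1(1-3) d(3-8) yt by simp
  qed (use chain_lift(1-3)[OF d(13) _ _ _ _ _ c] j1(1-3) d(3-8) xt yt in simp_all)
  have q: "is_ifun (x, p0, p1, y)" using x y d by (simp add: is_ifun_iff)
  have q': "is_ifun (y, j0, j1, x)" using x y j0(1-3) j1(1-3) e1 e0 es ec by (simp add: is_ifun_iff)
  interpret I: category ICat by (rule category_ICat)
  show "is_iso ICat (x, p0, p1, y)"
    by (rule I.isoI[of _ "(y, j0, j1, x)"]) (use q q' j0 j1 in simp_all)
qed

text \<open>Universality is applied twice: the domain of the span is decomposed along
  \<open>s\<close>, and then each piece along \<open>t\<close>.\<close>

lemma span_coproduct:
  assumes S: "small S" and Y: "small Y"
    and s: "arr s" "cod s = copow V S" and t: "arr t" "dom t = dom s" "cod t = copow V Y"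
  obtains W \<iota> where "is_coproduct V (S \<times> Y) W (dom s) \<iota>"
    "\<And>x y. \<lbrakk>x \<in> S; y \<in> Y\<rbrakk> \<Longrightarrow> s\<cdot>\<iota> (x, y) = pt V S x\<cdot>bang V (W (x, y))"
    "\<And>x y. \<lbrakk>x \<in> S; y \<in> Y\<rbrakk> \<Longrightarrow> t\<cdot>\<iota> (x, y) = pt V Y y\<cdot>bang V (W (x, y))"
proof -
  have dec: "\<exists>p. is_coproduct V Z (\<lambda>z. dom (p z)) (dom g) p \<and> (\<forall>z\<in>Z. g\<cdot>p z = pt V Z z\<cdot>bang V (dom (p z)))"
    if Z: "small Z" and g: "arr g" "cod g = copow V Z" for Z g
  proof -
    have "\<forall>z\<in>Z. \<exists>p q. is_pullback V g (pt V Z z) p q" using has_pb Z g by (simp add: has_pullbacks_def)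
    then obtain p q where pq: "\<And>z. z \<in> Z \<Longrightarrow> is_pullback V g (pt V Z z) (p z) (q z)" by metis
    have "is_coproduct V Z (\<lambda>z. dom (p z)) (dom g) p"
      using small_coproduct(2)[OF Z copow_coproduct[OF Z]] pq g unfolding universal_coproduct_def by blast
    moreover have "g\<cdot>p z = pt V Z z\<cdot>bang V (dom (p z))" if "z \<in> Z" for z
      using pullback_typed[OF pq[OF that]] bang_eq[of "q z"] Z that by simp
    ultimately show ?thesis by blast
  qed
  obtain p where p: "is_coproduct V S (\<lambda>x. dom (p x)) (dom s) p" "\<And>x. x \<in> S \<Longrightarrow> s\<cdot>p x = pt V S x\<cdot>bang V (dom (p x))"
    using dec[OF S s] by blast
  note pt = coproduct_typed[OF p(1)]
  have "\<forall>x\<in>S. \<exists>q. is_coproduct V Y (\<lambda>y. dom (q y)) (dom (p x)) q \<and> (\<forall>y\<in>Y. (t\<cdot>p x)\<cdot>q y = pt V Y y\<cdot>bang V (dom (q y)))"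
  proof
    fix x assume x: "x \<in> S"
    have "arr (t\<cdot>p x)" "cod (t\<cdot>p x) = copow V Y" "dom (t\<cdot>p x) = dom (p x)" using pt x t by simp_all
    then show "\<exists>q. is_coproduct V Y (\<lambda>y. dom (q y)) (dom (p x)) q \<and> (\<forall>y\<in>Y. (t\<cdot>p x)\<cdot>q y = pt V Y y\<cdot>bang V (dom (q y)))"
      using dec[OF Y, of "t\<cdot>p x"] by simp
  qed
  then obtain q where q: "\<And>x. x \<in> S \<Longrightarrow> is_coproduct V Y (\<lambda>y. dom (q x y)) (dom (p x)) (q x)"
    "\<And>x y. \<lbrakk>x \<in> S; y \<in> Y\<rbrakk> \<Longrightarrow> (t\<cdot>p x)\<cdot>q x y = pt V Y y\<cdot>bang V (dom (q x y))" by metis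
  have qt: "arr (q x y)" "cod (q x y) = dom (p x)" if "x \<in> S" "y \<in> Y" for x y
    using coproduct_typed[OF q(1)[OF that(1)]] that by simp_all
  show thesis
  proof (rule that[OF coproduct_Sigma[OF p(1) q(1)]])
    fix x y assume x: "x \<in> S" "y \<in> Y"
    show "s\<cdot>(case (x, y) of (x, y) \<Rightarrow> p x\<cdot>q x y) = pt V S x\<cdot>bang V (case (x, y) of (x, y) \<Rightarrow> dom (q x y))"
      using comp_cong[OF p(2)[OF x(1)], of "q x y"] pt x qt[OF x] s S by simp
    show "t\<cdot>(case (x, y) of (x, y) \<Rightarrow> p x\<cdot>q x y) = pt V Y y\<cdot>bang V (case (x, y) of (x, y) \<Rightarrow> dom (q x y))"
      using q(2)[OF x] pt x qt[OF x] t by simp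
  qed
qed

text \<open>The functor to \<open>emb_ob B\<close> supplies the source of arrows: the domain map of
  \<open>emb_ob B\<close> passes through the counit at \<open>Car B\<close>, and cartesianness at
  the function underlying \<open>q0\<close> lifts this factorization to the counit at
  \<open>X\<close>. The resulting span over copowers is a matrix.\<close>

lemma matrix_of_icat:
  assumes y: "is_icat y" and disc: "discrete (I0 y)" and B: "is_tvcat small B" and q: "is_ifun (y, q0, q1, emb_ob B)"
  obtains X a i0 i1 where "small X" "src a = Tset X" "tgt a = X" "ent a \<in> extensional (Tset X \<times> X)" "vmatrix a"
    "is_iso V i0" "arr i0" "dom i0 = copow V X" "cod i0 = I0 y"
    "is_iso V i1" "arr i1" "dom i1 = tot a" "cod i1 = I1 y"
    "D1 y\<cdot>i1 = FA T i0\<cdot>(epsT X\<cdot>tot_src a)" "D0 y\<cdot>i1 = i0\<cdot>tot_tgt a"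
proof -
  interpret B: pre_tvcat small V T B using B by (simp add: tvcat_iff)
  note g = graphD[OF precategoryD(1)[OF icat_precategory[OF y]]] and d = ifunD[OF q, unfolded B.E_simps]
  \<comment> \<open>The points of the object of objects; they form a small set by local
    smallness.\<close>
  define X where "X = hom V (one V) (I0 y)"
  have X: "small X" unfolding X_def using g by simp
  obtain i0 where i0: "is_iso V i0" "arr i0" "dom i0 = copow V X" "cod i0 = I0 y"
    using discrete_iso[OF disc] X unfolding X_def by blast
  obtain j0 where j0: "arr j0" "dom j0 = I0 y" "cod j0 = copow V X" "i0\<cdot>j0 = Ident V (I0 y)"
    using isoE[OF i0(1)] i0(3,4) by metis
  have Tj: "FA T i0\<cdot>FA T j0 = Ident V (FO T (I0 y))" using T_cong[OF j0(4)] i0 j0 g by simp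
  obtain f where f: "f \<in> X \<rightarrow>\<^sub>E B.X" "q0\<cdot>i0 = copow_map V X f B.X"
    by (rule copow_full[OF X B.small_Car, of "q0\<cdot>i0"]) (use i0 d(3-5) in simp_all)
  have fin: "\<And>x. x \<in> X \<Longrightarrow> f x \<in> B.X" using f by auto
  have "FA T (copow_map V X f B.X)\<cdot>(FA T j0\<cdot>D1 y) = FA T q0\<cdot>D1 y"
    unfolding f(2)[symmetric] using comp_cong[OF Tj, of "D1 y"] i0 j0 d(3-5) g by simp
  then have e: "epsT B.X\<cdot>(tot_src B.a\<cdot>q1) = FA T (copow_map V X f B.X)\<cdot>(FA T j0\<cdot>D1 y)"
    using d(6-9) by simp
  obtain s where s: "arr s" "dom s = I1 y" "cod s = copow V (Tset X)" "epsT X\<cdot>s = FA T j0\<cdot>D1 y"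
    using epsT_factor[OF X B.small_Car fin _ _ _ _ _ e] j0 d(6-8) g by auto
  define t where "t = j0\<cdot>D0 y"
  have t: "arr t" "dom t = dom s" "cod t = copow V X" unfolding t_def using j0 g s by simp_all
  obtain W \<iota> where W: "is_coproduct V (Tset X \<times> X) W (dom s) \<iota>"
    "\<And>x1 x0. \<lbrakk>x1 \<in> Tset X; x0 \<in> X\<rbrakk> \<Longrightarrow> s\<cdot>\<iota> (x1, x0) = pt V (Tset X) x1\<cdot>bang V (W (x1, x0))"
    "\<And>x1 x0. \<lbrakk>x1 \<in> Tset X; x0 \<in> X\<rbrakk> \<Longrightarrow> t\<cdot>\<iota> (x1, x0) = pt V X x0\<cdot>bang V (W (x1, x0))"
    by (rule span_coproduct[OF Tset_small[OF X] X s(1,3) t], rule that)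
  note w = coproduct_typed[OF W(1)]
  define a :: "('o, 'u) vmat" where "a = \<lparr>src = Tset X, tgt = X, ent = restrict W (Tset X \<times> X)\<rparr>"
  have a: "src a = Tset X" "tgt a = X" "ent a \<in> extensional (Tset X \<times> X)" by (simp_all add: a_def)
  have aW: "ent a i = W i" if "i \<in> Tset X \<times> X" for i using that by (simp add: a_def)
  have WO: "W i \<in> Obj V" if "i \<in> Tset X \<times> X" for i using w(2,3)[OF that] Obj_typed(1) by metis
  have vma: "vmatrix a" using X WO aW by (simp add: vmatrix_def a)
  have "is_coproduct V (src a \<times> tgt a) (ent a) (I1 y) \<iota>"
    using W(1) aW s(2) by (simp add: is_coproduct_def a)
  from coproduct_iso[OF tot_coproduct[OF vma] this]
  obtain i1 where i1: "is_iso V i1" "arr i1" "dom i1 = tot a" "cod i1 = I1 y" "\<And>i. i \<in> Tset X \<times> X \<Longrightarrow> i1\<cdot>tot_in a i = \<iota> i"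
    by (metis a(1,2))
  have ti: "arr (tot_in a (x1, x0))" "dom (tot_in a (x1, x0)) = W (x1, x0)" "cod (tot_in a (x1, x0)) = tot a"
      "tot_src a\<cdot>tot_in a (x1, x0) = pt V (Tset X) x1\<cdot>bang V (W (x1, x0))" "tot_tgt a\<cdot>tot_in a (x1, x0) = pt V X x0\<cdot>bang V (W (x1, x0))"
      "i1\<cdot>tot_in a (x1, x0) = \<iota> (x1, x0)" "arr (\<iota> (x1, x0))" "cod (\<iota> (x1, x0)) = I1 y" "dom (\<iota> (x1, x0)) = W (x1, x0)" "W (x1, x0) \<in> Obj V"
    if "x1 \<in> Tset X" "x0 \<in> X" for x1 x0
    using vma a aW[of "(x1, x0)"] i1(5)[of "(x1, x0)"] w(2-4)[of "(x1, x0)"] WO[of "(x1, x0)"] that s(2) by simp_all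
  have st: "arr (tot_src a)" "dom (tot_src a) = tot a" "cod (tot_src a) = copow V (Tset X)"
    "arr (tot_tgt a)" "dom (tot_tgt a) = tot a" "cod (tot_tgt a) = copow V X" using vma a by simp_all
  have D: "D1 y = FA T i0\<cdot>(epsT X\<cdot>s)" "D0 y = i0\<cdot>t"
    unfolding s(4) t_def using comp_cong[OF Tj, of "D1 y"] comp_cong[OF j0(4), of "D0 y"] i0 j0 g by simp_all
  have "D1 y\<cdot>i1 = FA T i0\<cdot>(epsT X\<cdot>tot_src a)"
  proof (rule tot_ext[OF vma])
    fix x1 x0 assume "x1 \<in> src a" "x0 \<in> tgt a"
    then have x: "x1 \<in> Tset X" "x0 \<in> X" by (simp_all add: a)
    show "(D1 y\<cdot>i1)\<cdot>tot_in a (x1, x0) = (FA T i0\<cdot>(epsT X\<cdot>tot_src a))\<cdot>tot_in a (x1, x0)"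
      unfolding D(1) using ti[OF x] W(2)[OF x] i1(2-4) s(1-3) i0 X st x by simp
  qed (use i1(2-4) i0 g X st in simp_all)
  moreover have "D0 y\<cdot>i1 = i0\<cdot>tot_tgt a"
  proof (rule tot_ext[OF vma])
    fix x1 x0 assume "x1 \<in> src a" "x0 \<in> tgt a"
    then have x: "x1 \<in> Tset X" "x0 \<in> X" by (simp_all add: a)
    show "(D0 y\<cdot>i1)\<cdot>tot_in a (x1, x0) = (i0\<cdot>tot_tgt a)\<cdot>tot_in a (x1, x0)"
      unfolding D(2) using ti[OF x] W(3)[OF x] i1(2-4) s(1-3) t i0 X st x by simp
  qed (use i1(2-4) i0 g X st in simp_all)
  ultimately show thesis using that[OF X a vma i0 i1(1-4)] by blast
qed

text \<open>\<open>Ups\<close> and \<open>Mu\<close> are read off from \<open>S0 y\<close> and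
  \<open>Cm y\<close>. By construction \<open>i0\<close> and \<open>i1\<close> preserve the
  structure, so the laws are inherited from \<open>y\<close> through \<open>pre_ifun_icat\<close>
  and become the enriched laws by \<open>tvcat_iff\<close>.\<close>

lemma tvcat_of_icat:
  assumes y: "is_icat y" and X: "small X" and a: "src a = Tset X" "tgt a = X" "ent a \<in> extensional (Tset X \<times> X)" "vmatrix a"
    and i0: "is_iso V i0" "arr i0" "dom i0 = copow V X" "cod i0 = I0 y"
    and i1: "is_iso V i1" "arr i1" "dom i1 = tot a" "cod i1 = I1 y"
    and D: "D1 y\<cdot>i1 = FA T i0\<cdot>(epsT X\<cdot>tot_src a)" "D0 y\<cdot>i1 = i0\<cdot>tot_tgt a"
  obtains A where "is_tvcat small A" "is_iso ICat (emb_ob A, i0, i1, y)"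
proof -
  note p = precategoryD[OF icat_precategory[OF y]]
  note g = graphD[OF p(1)]
  note [simp] = i0(2-4) i1(2-4) X a(1,2,4)
  have Ti0: "is_iso V (FA T i0)" using functor_iso[OF _ _ _ i0(1)] cartesian_monad category_axioms
    by (auto simp: is_cartesian_monad_def is_monad_def)
  have entO: "ent a (x1, x0) \<in> Obj V" if "x1 \<in> Tset X" "x0 \<in> X" for x1 x0 using a(4) that by (simp add: vmatrix_def)
  \<comment> \<open>An arrow into the object of arrows whose ends are constant lies in one entry.
    The domain end is compared after the counit, whose monicity turns it into a condition on
    \<open>tot_src a\<close>.\<close>
  have fac: "\<exists>h. h \<in> hom V (dom v) (ent a (x1, x0)) \<and> i1\<cdot>(tot_in a (x1, x0)\<cdot>h) = v"
    if x: "x1 \<in> Tset X" "x0 \<in> X" and v: "arr v" "cod v = I1 y"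
      and e: "D1 y\<cdot>v = FA T i0\<cdot>(x1\<cdot>bang V (dom v))" "D0 y\<cdot>v = i0\<cdot>(pt V X x0\<cdot>bang V (dom v))" for x1 x0 v
  proof -
    note [simp] = Tset_typed[OF x(1)]
    obtain j where j: "arr j" "dom j = I1 y" "cod j = tot a" "i1\<cdot>j = Ident V (I1 y)" using isoE[OF i1(1)] i1(3,4) by metis
    have jv: "arr (j\<cdot>v)" "dom (j\<cdot>v) = dom v" "cod (j\<cdot>v) = tot a" "i1\<cdot>(j\<cdot>v) = v"
      using comp_cong[OF j(4), of v] j(1-3) v by simp_all
    have "FA T i0\<cdot>(epsT X\<cdot>(tot_src a\<cdot>(j\<cdot>v))) = FA T i0\<cdot>(x1\<cdot>bang V (dom v))"
      using comp_cong[OF D(1), of "j\<cdot>v"] jv e(1) g by simp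
    then have "epsT X\<cdot>(tot_src a\<cdot>(j\<cdot>v)) = x1\<cdot>bang V (dom v)"
      by (rule iso_cancel_left[OF Ti0, rotated -1]) (use jv x v in simp_all)
    then have "epsT X\<cdot>(tot_src a\<cdot>(j\<cdot>v)) = epsT X\<cdot>(pt V (Tset X) x1\<cdot>bang V (dom v))" using x v by simp
    then have 1: "tot_src a\<cdot>(j\<cdot>v) = pt V (src a) x1\<cdot>bang V (dom (j\<cdot>v))"
      unfolding jv(2) a(1) by (rule epsT_mono[OF X, rotated -1]) (use jv(1-3) x v in simp_all)
    have "i0\<cdot>(tot_tgt a\<cdot>(j\<cdot>v)) = i0\<cdot>(pt V X x0\<cdot>bang V (dom v))"
      using comp_cong[OF D(2), of "j\<cdot>v"] jv e(2) g by simp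
    then have 2: "tot_tgt a\<cdot>(j\<cdot>v) = pt V (tgt a) x0\<cdot>bang V (dom (j\<cdot>v))"
      unfolding jv(2) a(2) by (rule iso_cancel_left[OF i0(1), rotated -1]) (use jv(1-3) x v in simp_all)
    obtain h where "arr h" "dom h = dom v" "cod h = ent a (x1, x0)" "tot_in a (x1, x0)\<cdot>h = j\<cdot>v"
      using tot_factor[OF a(4) _ _ jv(1,3) 1 2] x jv(2) by auto
    then show ?thesis using jv(4) by (auto simp: hom_iff)
  qed
  have "\<exists>h. h \<in> hom V (one V) (ent a (ebar X x, x)) \<and> i1\<cdot>(tot_in a (ebar X x, x)\<cdot>h) = S0 y\<cdot>(i0\<cdot>pt V X x)" if x: "x \<in> X" for x
  proof -
    have v: "arr (S0 y\<cdot>(i0\<cdot>pt V X x))" "cod (S0 y\<cdot>(i0\<cdot>pt V X x)) = I1 y" "dom (S0 y\<cdot>(i0\<cdot>pt V X x)) = one V"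
      using p(1-4) x by simp_all
    have "Unit T (I0 y)\<cdot>(i0\<cdot>pt V X x) = FA T i0\<cdot>ebar X x"
      unfolding ebar_def using comp_cong[OF Unit_nat[of i0], of "pt V X x"] x g by simp
    then have e: "D1 y\<cdot>(S0 y\<cdot>(i0\<cdot>pt V X x)) = FA T i0\<cdot>ebar X x" "D0 y\<cdot>(S0 y\<cdot>(i0\<cdot>pt V X x)) = i0\<cdot>pt V X x"
      using comp_cong[OF p(9), of "i0\<cdot>pt V X x"] comp_cong[OF p(8), of "i0\<cdot>pt V X x"] p(1-4) x g by simp_all
    note te = Tset_typed[OF ebar_in[OF X x]]
    show ?thesis using fac[of "ebar X x" x "S0 y\<cdot>(i0\<cdot>pt V X x)"] v e x te by simp
  qed
  then obtain u where u: "\<And>x. x \<in> X \<Longrightarrow> u x \<in> hom V (one V) (ent a (ebar X x, x)) \<and> i1\<cdot>(tot_in a (ebar X x, x)\<cdot>u x) = S0 y\<cdot>(i0\<cdot>pt V X x)" by metis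
  \<comment> \<open>\<open>f\<close> and \<open>k\<close> are the components of the generic chain on
    a summand, before transport along \<open>i1\<close>.\<close>
  define f where "f x2 x1 x0 = tot_in a (x1, x0)\<cdot>prod_fst V (ent a (x1, x0)) (ent (Tbar a) (x2, x1))" for x2 x1 x0
  define k where "k x2 x1 x0 = fib_in a (x2, x1)\<cdot>prod_snd V (ent a (x1, x0)) (ent (Tbar a) (x2, x1))" for x2 x1 x0
  have "\<exists>h. h \<in> hom V (prod_ob V (ent a (x1, x0)) (ent (Tbar a) (x2, x1))) (ent a (mbar X x2, x0)) \<and>
      i1\<cdot>(tot_in a (mbar X x2, x0)\<cdot>h) = Cm y\<cdot>chain_lift y (i1\<cdot>f x2 x1 x0) (FA T i1\<cdot>k x2 x1 x0)"
    if x: "x2 \<in> Tset (Tset X)" "x1 \<in> Tset X" "x0 \<in> X" for x2 x1 x0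
  proof -
    let ?Z = "prod_ob V (ent a (x1, x0)) (ent (Tbar a) (x2, x1))"
    note [simp] = Tset_typed[OF x(1)] Tset_typed[OF x(2)]
    have o: "ent a (x1, x0) \<in> Obj V" "ent (Tbar a) (x2, x1) \<in> Obj V" using entO x fib(4)[OF a(4), of x2 x1] by simp_all
    have ft: "arr (f x2 x1 x0)" "dom (f x2 x1 x0) = ?Z" "cod (f x2 x1 x0) = tot a" unfolding f_def using o x by simp_all
    have kt: "arr (k x2 x1 x0)" "dom (k x2 x1 x0) = ?Z" "cod (k x2 x1 x0) = FO T (tot a)"
      unfolding k_def using o x fib(1-3)[OF a(4), of x2 x1] by simp_all
    have fe: "tot_src a\<cdot>f x2 x1 x0 = pt V (Tset X) x1\<cdot>bang V ?Z" "tot_tgt a\<cdot>f x2 x1 x0 = pt V X x0\<cdot>bang V ?Z"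
      unfolding f_def using o x by simp_all
    have ke: "FA T (tot_src a)\<cdot>k x2 x1 x0 = x2\<cdot>bang V ?Z" "FA T (tot_tgt a)\<cdot>k x2 x1 x0 = x1\<cdot>bang V ?Z"
      unfolding k_def using fib_comp[OF a(4), of x2 x1 "prod_snd V (ent a (x1, x0)) (ent (Tbar a) (x2, x1))"] o x by simp_all
    have Z: "?Z \<in> Obj V" using o by simp
    have 1: "D1 y\<cdot>(i1\<cdot>f x2 x1 x0) = FA T i0\<cdot>(x1\<cdot>bang V ?Z)"
      using comp_cong[OF D(1), of "f x2 x1 x0"] ft fe Z x g by simp
    have 2: "FA T (D0 y)\<cdot>(FA T i1\<cdot>k x2 x1 x0) = FA T i0\<cdot>(x1\<cdot>bang V ?Z)"
      using comp_cong[OF T_cong2[OF D(2)], of "k x2 x1 x0"] kt ke g by simp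
    have c: "D1 y\<cdot>(i1\<cdot>f x2 x1 x0) = FA T (D0 y)\<cdot>(FA T i1\<cdot>k x2 x1 x0)" unfolding 1 2 ..
    let ?l = "chain_lift y (i1\<cdot>f x2 x1 x0) (FA T i1\<cdot>k x2 x1 x0)"
    have l: "arr ?l" "dom ?l = ?Z" "cod ?l = chain_ob y" "chain_fst y\<cdot>?l = i1\<cdot>f x2 x1 x0" "chain_snd y\<cdot>?l = FA T i1\<cdot>k x2 x1 x0"
      using chain_lift[OF p(1) _ _ _ _ _ c] ft kt by simp_all
    have v: "arr (Cm y\<cdot>?l)" "cod (Cm y\<cdot>?l) = I1 y" "dom (Cm y\<cdot>?l) = ?Z" using l p(5-7) by simp_all
    have "FA T (D1 y)\<cdot>(FA T i1\<cdot>k x2 x1 x0) = FA T (FA T i0)\<cdot>(FA T (epsT X)\<cdot>(x2\<cdot>bang V ?Z))"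
    proof -
      have "FA T (D1 y)\<cdot>FA T i1 = FA T (FA T i0)\<cdot>FA T (epsT X\<cdot>tot_src a)"
        by (rule T_cong2[OF D(1)]) (use g in simp_all)
      from comp_cong[OF this, of "k x2 x1 x0"] show ?thesis using kt ke g by simp
    qed
    then have "Mult T (I0 y)\<cdot>(FA T (D1 y)\<cdot>(FA T i1\<cdot>k x2 x1 x0)) = FA T i0\<cdot>(mbar X x2\<cdot>bang V ?Z)"
      using comp_cong[OF Mult_nat[of i0], of "FA T (epsT X)\<cdot>(x2\<cdot>bang V ?Z)"] x Z g by (simp add: mbar_eq)
    then have e1: "D1 y\<cdot>(Cm y\<cdot>?l) = FA T i0\<cdot>(mbar X x2\<cdot>bang V ?Z)"
      using comp_cong[OF p(11), of ?l] l p(1,5-7) g by simp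
    have e0: "D0 y\<cdot>(Cm y\<cdot>?l) = i0\<cdot>(pt V X x0\<cdot>bang V ?Z)"
      using comp_cong[OF p(10), of ?l] comp_cong[OF D(2), of "f x2 x1 x0"] l p(1,5-7) ft fe g by simp
    show ?thesis using fac[of "mbar X x2" x0 "Cm y\<cdot>?l", unfolded v(3), OF _ x(3) v(1,2) e1 e0] x by simp
  qed
  then obtain m where m: "\<And>x2 x1 x0. \<lbrakk>x2 \<in> Tset (Tset X); x1 \<in> Tset X; x0 \<in> X\<rbrakk> \<Longrightarrow>
      m x2 x1 x0 \<in> hom V (prod_ob V (ent a (x1, x0)) (ent (Tbar a) (x2, x1))) (ent a (mbar X x2, x0)) \<and>
      i1\<cdot>(tot_in a (mbar X x2, x0)\<cdot>m x2 x1 x0) = Cm y\<cdot>chain_lift y (i1\<cdot>f x2 x1 x0) (FA T i1\<cdot>k x2 x1 x0)" by metis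
  define A where "A = \<lparr>Car = X, Mat = a, Ups = restrict u X, Mu = restrict (\<lambda>(x2, x1, x0). m x2 x1 x0) (Tset (Tset X) \<times> Tset X \<times> X)\<rparr>"
  have As: "Car A = X" "Mat A = a" "\<And>x. x \<in> X \<Longrightarrow> Ups A x = u x"
    "\<And>x2 x1 x0. \<lbrakk>x2 \<in> Tset (Tset X); x1 \<in> Tset X; x0 \<in> X\<rbrakk> \<Longrightarrow> Mu A (x2, x1, x0) = m x2 x1 x0" by (simp_all add: A_def)
  interpret A: pre_tvcat small V T A
    by unfold_locales (use u m entO in \<open>simp_all add: As\<close>)
  note E = A.E_simps[unfolded As(1,2)] and s = A.E_S0[unfolded As(1,2)] and Cm = A.E_Cm[unfolded As(1,2)]
  note ty = A.E_typed[unfolded As(1,2)] and ci = A.chain_in[unfolded As(1,2)] and o = A.ob_typed[unfolded As(1,2)]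
  have c: "D1 y\<cdot>(i1\<cdot>chain_fst A.E) = FA T (D0 y)\<cdot>(FA T i1\<cdot>chain_snd A.E)"
    by (rule ifun_chain_condition[OF A.E_graph p(1), of i0]) (use D in \<open>simp_all add: E\<close>)
  have tt: "arr (i1\<cdot>chain_fst A.E)" "arr (FA T i1\<cdot>chain_snd A.E)" "dom (i1\<cdot>chain_fst A.E) = dom (FA T i1\<cdot>chain_snd A.E)"
    "cod (i1\<cdot>chain_fst A.E) = I1 y" "cod (FA T i1\<cdot>chain_snd A.E) = FO T (I1 y)" "dom (FA T i1\<cdot>chain_snd A.E) = chain_ob A.E"
    using ty by simp_all
  note l = chain_lift(1-3)[OF p(1) tt(1-5) c, unfolded tt(6)]
  have "i1\<cdot>S0 A.E = S0 y\<cdot>i0"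
  proof (rule copow_ext[OF X])
    fix x assume x: "x \<in> X"
    have "arr (u x)" "dom (u x) = one V" "cod (u x) = ent a (ebar X x, x)" using u[OF x] by (simp_all add: hom_iff)
    then show "(i1\<cdot>S0 A.E)\<cdot>pt V X x = (S0 y\<cdot>i0)\<cdot>pt V X x"
      using s(1-3) s(4)[OF x] u[OF x] p(1-4) x by (simp add: As(3))
  qed (use s p(1-4) in simp_all)
  moreover have "i1\<cdot>Cm A.E = Cm y\<cdot>chain_lift y (i1\<cdot>chain_fst A.E) (FA T i1\<cdot>chain_snd A.E)"
  proof (rule A.chain_ext'[unfolded As(1)])
    fix x2 x1 x0 assume x: "x2 \<in> Tset (Tset X)" "x1 \<in> Tset X" "x0 \<in> X"
    note c' = ci[OF x]
    have "chain_lift y (i1\<cdot>chain_fst A.E) (FA T i1\<cdot>chain_snd A.E)\<cdot>A.chain_in x2 x1 x0 =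
      chain_lift y ((i1\<cdot>chain_fst A.E)\<cdot>A.chain_in x2 x1 x0) ((FA T i1\<cdot>chain_snd A.E)\<cdot>A.chain_in x2 x1 x0)"
      by (rule chain_lift_comp[OF p(1) tt(1-5) c c'(1)]) (use c' tt(6) in simp)
    also have "(i1\<cdot>chain_fst A.E)\<cdot>A.chain_in x2 x1 x0 = i1\<cdot>f x2 x1 x0" unfolding f_def using c' ty by simp
    also have "(FA T i1\<cdot>chain_snd A.E)\<cdot>A.chain_in x2 x1 x0 = FA T i1\<cdot>k x2 x1 x0" unfolding k_def using c' ty by simp
    finally have L: "chain_lift y (i1\<cdot>chain_fst A.E) (FA T i1\<cdot>chain_snd A.E)\<cdot>A.chain_in x2 x1 x0 =
      chain_lift y (i1\<cdot>f x2 x1 x0) (FA T i1\<cdot>k x2 x1 x0)" .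
    have "(Cm y\<cdot>chain_lift y (i1\<cdot>chain_fst A.E) (FA T i1\<cdot>chain_snd A.E))\<cdot>A.chain_in x2 x1 x0 = i1\<cdot>(tot_in a (mbar X x2, x0)\<cdot>m x2 x1 x0)"
      unfolding m[OF x, THEN conjunct2] L[symmetric] using l c' p(5-7) by simp
    then show "(i1\<cdot>Cm A.E)\<cdot>A.chain_in x2 x1 x0 = (Cm y\<cdot>chain_lift y (i1\<cdot>chain_fst A.E) (FA T i1\<cdot>chain_snd A.E))\<cdot>A.chain_in x2 x1 x0"
      using Cm(1-3) Cm(4)[OF x] c' by (simp add: As(4)[OF x])
  qed (use Cm l p(5-7) in simp_all)
  ultimately have "pre_ifun A.E i0 i1 y"
    unfolding pre_ifun_def using A.E_precategory icat_precategory[OF y] D by (simp add: E)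
  note r = pre_ifun_icat[OF this y i0(1) i1(1)]
  have "is_tvcat small A" unfolding tvcat_iff using A.pre_tvcat_axioms r(1) a(3) by (simp add: A_def)
  then show thesis using that r(2) by blast
qed

lemma essential_image:
  assumes "is_icat y" "discrete (I0 y)" "is_tvcat small B" "is_ifun (y, q0, q1, emb_ob B)"
  shows "\<exists>A\<in>Obj (TVCat small). \<exists>i. is_iso ICat i \<and> i \<in> hom ICat (FO K A) y"
proof -
  obtain X a i0 i1 where "small X" "src a = Tset X" "tgt a = X" "ent a \<in> extensional (Tset X \<times> X)" "vmatrix a"
    "is_iso V i0" "arr i0" "dom i0 = copow V X" "cod i0 = I0 y"
    "is_iso V i1" "arr i1" "dom i1 = tot a" "cod i1 = I1 y"
    "D1 y\<cdot>i1 = FA T i0\<cdot>(epsT X\<cdot>tot_src a)" "D0 y\<cdot>i1 = i0\<cdot>tot_tgt a"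
    by (rule matrix_of_icat[OF assms])
  from tvcat_of_icat[OF assms(1) this] obtain A where A: "is_tvcat small A" "is_iso ICat (emb_ob A, i0, i1, y)" .
  interpret I: category ICat by (rule category_ICat)
  have "is_ifun (emb_ob A, i0, i1, y)" using I.isoE[OF A(2)] by auto
  then have "(emb_ob A, i0, i1, y) \<in> hom ICat (FO K A) y" by (simp add: ICat_hom)
  then show ?thesis using A by (metis TVCat_simps(1))
qed

section \<open>Reflection of effective descent\<close>

text \<open>A descent morphism does not factor through a proper subobject on objects.\<close>

lemma descent_surjective:
  assumes p: "is_tvfun small (A, f, \<phi>, B)" and dm: "category.descent_morphism ICat (FA K (A, f, \<phi>, B))" and pbs: "has_pullbacks ICat"
  shows "f ` Car A = Car B"
proof
  interpret tv_map small V T A B f \<phi> using p by (simp add: tvfun_iff)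
  show "f ` Car A \<subseteq> Car B" by auto
  \<comment> \<open>The image factorization of \<open>f\<close>, carried to copowers; the inclusion
    remains monic because it comes from an injective function.\<close>
  let ?i = "copow_map V (f ` A.X) (\<lambda>y. y) B.X" and ?j = "copow_map V A.X f (f ` A.X)"
  have S: "small (f ` A.X)" by (rule small_image) simp
  have sub: "\<And>y. y \<in> f ` A.X \<Longrightarrow> y \<in> B.X" by auto
  have it: "arr ?i" "dom ?i = copow V (f ` A.X)" "cod ?i = copow V B.X" using S sub by simp_all
  have jt: "arr ?j" "dom ?j = copow V A.X" "cod ?j = copow V (f ` A.X)" using S by simp_all
  have ij: "?i\<cdot>?j = F0" using copow_map_comp[OF A.small_Car S B.small_Car _ sub, of f] by simp
  have I: "is_ifun (emb_ob A, F0, F1, emb_ob B)" using p by (simp add: tvfun_iff)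
  obtain s where s: "arr s" "dom s = copow V B.X" "cod s = copow V (f ` A.X)" "?i\<cdot>s = Ident V (copow V B.X)"
  proof (rule descent_ob_extremal[OF dm[unfolded TVCat_simps] pbs I it(1) _ jt(1) _ _ ij])
    fix a b assume ab: "arr a" "arr b" "dom a = dom b" "cod a = dom ?i" "cod b = dom ?i" "?i\<cdot>a = ?i\<cdot>b"
    show "a = b"
      by (rule copow_map_inj_mono[OF S B.small_Car sub, rotated -1, OF ab(6)]) (use ab it in simp_all)
  qed (use it jt in \<open>simp_all add: A.E_simps B.E_simps\<close>)
  show "Car B \<subseteq> f ` Car A"
  proof
    fix y assume y: "y \<in> B.X"
    have "arr (s\<cdot>pt V B.X y)" "dom (s\<cdot>pt V B.X y) = one V" "cod (s\<cdot>pt V B.X y) = copow V (f ` A.X)" using s y by simp_all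
    \<comment> \<open>A point of the copower of the image is one of its elements, so the section
      \<open>s\<close> carries \<open>y\<close> to an element of the image.\<close>
    then obtain z where z: "z \<in> f ` A.X" "s\<cdot>pt V B.X y = pt V (f ` A.X) z" using point_cases[OF S] by metis
    have "pt V B.X y = ?i\<cdot>pt V (f ` A.X) z" unfolding z(2)[symmetric] using comp_cong[OF s(4), of "pt V B.X y"] s it y by simp
    then have "pt V B.X y = pt V B.X z" using copow_map_pt(1)[OF S B.small_Car sub z(1)] by simp
    then show "y \<in> f ` Car A" using pt_inj[OF B.small_Car y sub[OF z(1)]] z(1) by simp
  qed
qed

text \<open>On objects a pullback of internal categories is a pullback of copowers, hence discrete.
  One of its projections is the functor into an embedded category that
  \<open>essential_image\<close> asks for.\<close>

lemma K_reflection: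
  assumes pbs: "has_pullbacks ICat"
  shows "reflection (TVCat small) ICat K"
proof (intro reflection.intro reflection_axioms.intro category_TVCat category_ICat fully_faithful_K pbs)
  interpret I: category ICat by (rule category_ICat)
  fix F G p q assume F: "F \<in> Arr (TVCat small)" "G \<in> Arr (TVCat small)" "Cod (TVCat small) F = Cod (TVCat small) G"
    and pb: "is_pullback ICat (FA K F) (FA K G) p q"
  obtain A f \<phi> D where Fe: "F = (A, f, \<phi>, D)" by (cases F)
  obtain B g \<psi> D' where Ge: "G = (B, g, \<psi>, D')" by (cases G)
  obtain w p0 p1 x where pe: "p = (w, p0, p1, x)" by (cases p)
  obtain w' q0 q1 y where qe: "q = (w', q0, q1, y)" by (cases q)
  have D: "D' = D" using F(3) by (simp add: Fe Ge)
  interpret P: tv_map small V T A D f \<phi> using F(1) by (simp add: Fe tvfun_iff)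
  interpret Q: tv_map small V T B D g \<psi> using F(2) by (simp add: Ge D tvfun_iff)
  note t = I.pullback_typed[OF pb, unfolded pe qe Fe Ge TVCat_simps ICat_simps]
  have pi: "is_ifun (w, p0, p1, emb_ob A)" and x: "x = emb_ob A" and y: "y = emb_ob B" and w: "w' = w" using t by simp_all
  have "is_pullback V P.F0 Q.F0 p0 q0"
    by (rule ob_pullback) (use pb in \<open>simp add: pe qe Fe Ge D x y w\<close>)
  then have "discrete (dom p0)"
    by (rule discrete_pullback) (use discrete_copow[OF P.A.small_Car] discrete_copow[OF Q.A.small_Car] discrete_copow[OF P.B.small_Car] in \<open>simp_all add: discrete_def\<close>)
  then show "\<exists>W\<in>Obj (TVCat small). \<exists>i. is_iso ICat i \<and> i \<in> hom ICat (FO K W) (Dom ICat p)"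
    using essential_image[OF ifunD(1)[OF pi] _ _ pi] ifunD(4)[OF pi] F(1) by (simp add: pe Fe tvfun_iff)
qed

text \<open>An object \<open>r\<close> over the codomain whose pullback is embedded has a discrete
  object of objects, since points of the base lift along the surjective \<open>f\<close>. The
  functor \<open>r\<close> itself, with values in \<open>emb_ob B\<close>, then places its domain in
  the essential image.\<close>

theorem K_reflects_effective_descent:
  assumes P: "P \<in> Arr (TVCat small)" and ed: "effective_descent ICat (FA K P)"
  shows "effective_descent (TVCat small) P"
proof -
  interpret I: category ICat by (rule category_ICat)
  have pbs: "has_pullbacks ICat" and dm: "category.descent_morphism ICat (FA K P)" using ed unfolding I.effective_descent_iff by blast+
  interpret reflection "TVCat small" ICat K by (rule K_reflection[OF pbs])
  obtain A f \<phi> B where Pe: "P = (A, f, \<phi>, B)" by (cases P)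
  have Pf: "is_tvfun small (A, f, \<phi>, B)" using P by (simp add: Pe)
  interpret tv_map small V T A B f \<phi> using Pf by (simp add: tvfun_iff)
  have surj: "f ` A.X = B.X" by (rule descent_surjective[OF Pf dm[unfolded Pe] pbs])
  show ?thesis
  proof (rule reflects_effective_descent[OF P ed])
    fix r g k W assume pb: "is_pullback ICat (FA K P) r g k" and W: "W \<in> Obj (TVCat small)" "Dom ICat g = FO K W"
    obtain y r0 r1 b where re: "r = (y, r0, r1, b)" by (cases r)
    obtain w g0 g1 x where ge: "g = (w, g0, g1, x)" by (cases g)
    obtain w' k0 k1 z where ke: "k = (w', k0, k1, z)" by (cases k)
    note t = I.pullback_typed[OF pb, unfolded re ge ke Pe TVCat_simps ICat_simps]
    have ri: "is_ifun (y, r0, r1, emb_ob B)" and gi: "is_ifun (emb_ob W, g0, g1, emb_ob A)"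
      and e: "b = emb_ob B" "w = emb_ob W" "x = emb_ob A" "w' = emb_ob W" "z = y" using t W(2) by (simp_all add: ge)
    interpret W: pre_tvcat small V T W using W(1) by (simp add: tvcat_iff)
    have "is_pullback V F0 r0 g0 k0"
      by (rule ob_pullback) (use pb in \<open>simp add: re ge ke Pe e\<close>)
    then have "discrete (dom r0)"
    proof (rule discrete_descends)
      show "discrete (dom g0)" "discrete (cod F0)"
        using discrete_copow[OF W.small_Car] discrete_copow[OF B.small_Car] ifunD(4)[OF gi] by (simp_all add: W.E_simps)
      fix b assume "arr b" "dom b = one V" "cod b = cod F0"
      then obtain y where y: "y \<in> B.X" "b = pt V B.X y" using point_cases[OF B.small_Car, of b] by auto
      then obtain x where "x \<in> A.X" "y = f x" using surj by auto
      then show "\<exists>a. arr a \<and> dom a = one V \<and> cod a = dom F0 \<and> F0\<cdot>a = b"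
        using y by (intro exI[of _ "pt V A.X x"]) simp
    qed
    then show "\<exists>Y\<in>Obj (TVCat small). \<exists>i. is_iso ICat i \<and> i \<in> hom ICat (FO K Y) (Dom ICat r)"
      using essential_image[OF ifunD(1)[OF ri] _ _ ri] ifunD(4)[OF ri] Pf by (simp add: re tvfun_iff)
  qed
qed

end

theorem lemma5p3p3:
  fixes small :: "'u set \<Rightarrow> bool"
    and V :: "('o, 'u) cat"
    and T :: "('o, 'u) monad"
  assumes "set_universe small"
    and "category V"
    and "locally_small small V"
    and "lextensive small V"
    and "fully_faithful (Sets small) V (copow_functor V)"
    and "is_cartesian_monad V T"
    and "is_cartesian_trans (Sets small) V
      (comp_functor (copow_functor V) (monad_setting.Tset_functor V T))
      (comp_functor T (copow_functor V))
      (\<lambda>X. eps_hat V (FO T (copow V X)))"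
    and "is_mono V (eps_hat V (FO T (one V)))"
  shows "\<forall>p \<in> Arr (monad_setting.TVCat V T small).
    effective_descent (monad_setting.ICat V T) (FA (monad_setting.emb_functor V T) p) \<longrightarrow>
    effective_descent (monad_setting.TVCat V T small) p"
proof -
  interpret embedding_setting small V T
    using assms by (simp add: embedding_setting_def embedding_setting_axioms_def lextensive_category_def lextensive_category_axioms_def)
  show ?thesis using K_reflects_effective_descent by blast
qed

end
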